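(* Let $A$ be a regular weak multiplier bialgebra over a field $k$ with left and right full comultiplication, possessing an antipode $S$. Then for any finite dimensional full right $A$-comodule $(V,\lambda,\varrho)$, the right $A$-comodule $(V^*,\lambda^{*S},\varrho^{*S})$ on the dual vector space $V^*=\mathsf{Lin}(V,k)$, where, identifying $V^*\otimes A\cong\mathsf{Lin}(V,A)$, $$\lambda^{*S}(\varphi\otimes S(b)a)=\big[v\mapsto ((\varphi\otimes S)\varrho(v\otimes b))\,a\big],\qquad \varrho^{*S}(\varphi\otimes aS(b))=\big[v\mapsto a\,((\varphi\otimes S)\lambda(v\otimes b))\big],$$ is the dual of $V$ in the monoidal category $M^{(A)}$ of full right $A$-comodules.
   Context: Conventions. All vector spaces are over a field $k$; $\otimes$ is $\otimes_k$; the identity map of a space $V$ is also denoted by $V$; composition is juxtaposition; $\mathsf{Lin}(V,W)$ is the space of linear maps; $\mathsf{tw}$ is the flip; $\langle\ldots\rangle$ denotes linear span. For a linear map $f:V\otimes W\to V'\otimes W'$ put $f^{13}=(V'\otimes\mathsf{tw})(f\otimes Z)(V\otimes\mathsf{tw}):V\otimes Z\otimes W\to V'\otimes Z\otimes W'$ for any space $Z$. An associative, possibly non-unital algebra $A$ with multiplication $\mu$ is idempotent if $\mu:A\otimes A\to A$ is surjective, and non-degenerate if each of ($ab=0\ \forall b\in A$) and ($ba=0\ \forall b\in A$) implies $a=0$. For such $A$, $\mathbb M(A)$ is the multiplier algebra of pairs $(\lambda,\varrho)$ of linear maps $A\to A$ with $a\lambda(b)=\varrho(a)b$; it is unital and contains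 $A$ as a two-sided ideal via $(\lambda,\varrho)a=\lambda(a)$, $a(\lambda,\varrho)=\varrho(a)$. A regular weak multiplier bialgebra is an idempotent non-degenerate $k$-algebra $A$ with linear maps $E_1,E_2,T_1,T_2,T_3,T_4:A\otimes A\to A\otimes A$ and $\epsilon:A\to k$ such that for all $a,b,c,d\in A$: (i) $(a\otimes b)E_1(c\otimes d)=E_2(a\otimes b)(c\otimes d)$; (ii) $E_1^2=E_1$; (iii) $(T_2\otimes A)(A\otimes T_1)=(A\otimes T_1)(T_2\otimes A)$; (iv) $(\epsilon\otimes A)T_1=\mu=(A\otimes\epsilon)T_2$; (v) $(\mu\otimes A)T_1^{13}(A\otimes T_1)=T_1(\mu\otimes A)$; (vi) $\langle T_1(a\otimes c)(b\otimes 1)\mid a,b,c\in A\rangle=\langle E_1(b\otimes c)\mid b,c\in A\rangle$ and $\langle(1\otimes c)T_2(b\otimes a)\mid a,b,c\in A\rangle=\langle E_2(b\otimes c)\mid b,c\in A\rangle$; (vii) $(E_1\otimes A)(A\otimes T_1)=(A\otimes T_1)(E_1\otimes A)$ and $(E_2\otimes A)(A\otimes T_2)=(A\otimes T_2)E_2^{13}$; (viii) $(\epsilon\otimes A)((1\otimes a)E_1(b\otimes c))=(\epsilon\otimes A)(T_1(a\otimes c)(b\otimes1))$ and $(\epsilon\otimes A)(E_2(a\otimes b)(1\otimes c))=(\epsilon\otimes A)((1\otimes b)T_2(a\otimes c))$; (ix) $(1\otimes a)T_1(c\otimes b)=T_3(c\otimes a)(1\otimes b)$ and $T_2(a\otimes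 c)(b\otimes1)=(a\otimes1)T_4(b\otimes c)$. Then $E=(E_1,E_2)$ is an idempotent element of $\mathbb M(A\otimes A)$. Maps $A\to\mathbb M(A)$: $\overline\sqcap^L(a)b=(\epsilon\otimes A)T_2(a\otimes b)$, $b\overline\sqcap^L(a)=(\epsilon\otimes A)E_2(a\otimes b)$; $\overline\sqcap^R(a)b=(A\otimes\epsilon)E_1(b\otimes a)$, $b\overline\sqcap^R(a)=(A\otimes\epsilon)T_1(b\otimes a)$; $\sqcap^R(a)b=(A\otimes\epsilon)T_3(b\otimes a)$, $b\sqcap^R(a)=(A\otimes\epsilon)E_2(b\otimes a)$. The comultiplication is right full if $A=\langle(A\otimes\omega)T_1(a\otimes b)\mid a,b\in A,\ \omega\in\mathsf{Lin}(A,k)\rangle$ and left full if $A=\langle(\omega\otimes A)T_2(a\otimes b)\mid a,b\in A,\ \omega\in\mathsf{Lin}(A,k)\rangle$. If it is right full, the ranges of $\sqcap^R$ and $\overline\sqcap^R$ coincide; this common range $R\subseteq\mathbb M(A)$ is a (non-unital) subalgebra with local units, the base algebra. Antipode. Let $G_1,G_2:A\otimes A\to A\otimes A$ be the (well-defined, idempotent) linear maps $G_1(a\otimes bc)=(a\otimes1)((\overline\sqcap^R\otimes A)\mathsf{tw}T_4(c\otimes b))$ and $G_2(ab\otimes c)=((A\otimes\overline\sqcap^L)\mathsf{tw}T_3(b\otimes a))(1\otimes c)$. $A$ possesses an antipode if there are linear maps $R_1,R_2:A\otimes A\to A\otimes A$ with $R_iT_i=G_i$, $T_iR_i=E_i$,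 $R_iT_iR_i=R_i$ for $i=1,2$; these are unique, and the antipode is the linear map $S:A\to\mathbb M(A)$ with $S(a)b=(\epsilon\otimes A)R_1(a\otimes b)$ and $bS(a)=(A\otimes\epsilon)R_2(b\otimes a)$. For left and right full comultiplication, $A$ is spanned by the elements $S(b)a$, and also by the elements $aS(b)$. A right $A$-comodule is a vector space $V$ with linear maps $\lambda,\varrho:V\otimes A\to V\otimes A$ such that $(1\otimes a)\lambda(v\otimes b)=\varrho(v\otimes a)(1\otimes b)$ for all $v\in V$, $a,b\in A$, $(\lambda\otimes A)\lambda^{13}(V\otimes E_1)=(\lambda\otimes A)\lambda^{13}$ and $(\lambda\otimes A)\lambda^{13}(V\otimes T_1)=(V\otimes T_1)(\lambda\otimes A)$. A morphism $f:V\to V'$ is a linear map with $\lambda'(f\otimes A)=(f\otimes A)\lambda$. The comodule is full if $V=\langle(V\otimes\omega)\lambda(v\otimes a)\mid v\in V,a\in A,\omega\in\mathsf{Lin}(A,k)\rangle$ (equivalently, the same with $\varrho$). $M^{(A)}$ is the category of full right comodules. A full right comodule $V$ is a firm $R$-bimodule via $v\,\overline\sqcap^R(a)=(V\otimes\epsilon)\lambda(v\otimes a)$, $\sqcap^R(a)\,v=(V\otimes\epsilon)\varrho(v\otimes a)$. $M^{(A)}$ is monoidal: the unit is $R$ with $\lambda_R(r\otimes a)=E(1\otimes ra)$, $\varrho_R(r\otimes a)=(1\otimes ar)E$ (elements of $R\otimes A$); the product is $V\otimes_RW$ with the unique comodule structure for which $V\otimes W\to V\otimes_RW$ is a morphism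 of comodules, where $V\otimes W$ has structure maps $\lambda_V^{13}(V\otimes\lambda_W)$, $(V\otimes\varrho_W)\varrho_V^{13}$; associator and unitors are those of the module tensor product over $R$. The maps $\lambda^{*S},\varrho^{*S}$ are well-defined and make $V^*$ a full right comodule. That $V^*$ is the dual of $V$ means: there are morphisms $\mathsf{ev}:V^*\otimes_RV\to R$ and $\mathsf{coev}:R\to V\otimes_RV^*$ in $M^{(A)}$ satisfying the two triangle (zig-zag) identities. *)

theory Defs
  imports Complex_Main "HOL-Library.Function_Algebras" "HOL-Library.Product_Plus"
begin

section \<open>Vector spaces and tensor products\<close>

text \<open>The scalars form a type of class \<open>field\<close>. A vector space is a subspace \<open>carr X\<close> of
  the vector space that the scalar multiplication \<open>scal X\<close> defines on the whole ambient type.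
  Maps between spaces are HOL functions; only their values on the carrier are relevant.\<close>

record ('k, 'v) space =
  carr :: "'v set"
  scal :: "'k \<Rightarrow> 'v \<Rightarrow> 'v"

definition vspace :: "('k::field, 'v::ab_group_add) space \<Rightarrow> bool" where
  "vspace X \<longleftrightarrow> vector_space (scal X) \<and> module.subspace (scal X) (carr X)"

definition lin :: "('k, 'v::plus) space \<Rightarrow> ('k, 'w::plus) space \<Rightarrow> ('v \<Rightarrow> 'w) \<Rightarrow> bool" where
  "lin X Y f \<longleftrightarrow>
     (\<forall>x\<in>carr X. f x \<in> carr Y) \<and>
     (\<forall>x\<in>carr X. \<forall>y\<in>carr X. f (x + y) = f x + f y) \<and>
     (\<forall>c. \<forall>x\<in>carr X. f (scal X c x) = scal Y c (f x))"

definition bilin ::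
  "('k, 'v::plus) space \<Rightarrow> ('k, 'w::plus) space \<Rightarrow> ('k, 'z::plus) space \<Rightarrow> ('v \<Rightarrow> 'w \<Rightarrow> 'z) \<Rightarrow> bool" where
  "bilin X Y Z b \<longleftrightarrow>
     (\<forall>x\<in>carr X. lin Y Z (b x)) \<and> (\<forall>y\<in>carr Y. lin X Z (\<lambda>x. b x y))"

definition finite_dim :: "('k::field, 'v::ab_group_add) space \<Rightarrow> bool" where
  "finite_dim X \<longleftrightarrow> (\<exists>B. finite B \<and> B \<subseteq> carr X \<and> module.span (scal X) B = carr X)"

definition scalars :: "('k::field, 'k) space" where
  "scalars = \<lparr>carr = UNIV, scal = (*)\<rparr>"

definition fscal :: "'k::times \<Rightarrow> ('b \<Rightarrow> 'k) \<Rightarrow> 'b \<Rightarrow> 'k" where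
  "fscal c f = (\<lambda>x. c * f x)"

text \<open>The dual space. Functionals are normalised to vanish outside the carrier, so that equal
  functionals are equal functions.\<close>

definition dual :: "('k::field, 'v::ab_group_add) space \<Rightarrow> ('k, 'v \<Rightarrow> 'k) space" where
  "dual X = \<lparr>carr = {\<phi>. lin X scalars \<phi> \<and> (\<forall>x. x \<notin> carr X \<longrightarrow> \<phi> x = 0)}, scal = fscal\<rparr>"

text \<open>Tensor products are realised inside the dual of a space of bilinear forms: the pure tensor of
  \<open>x\<close> and \<open>y\<close> is the evaluation of forms at \<open>(x, y)\<close>, and the tensor product is the span of the
  pure tensors. Letting \<open>\<Phi>\<close> be all bilinear forms gives the tensor product over the field,
  letting \<open>\<Phi>\<close> be the balanced ones gives the tensor product over an algebra. The universal
  property, which determines the tensor product up to unique isomorphism, is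
  \<open>tensor_universal\<close> and \<open>tensor_unique\<close> below.\<close>

type_synonym ('k, 'v, 'w) tens = "('v \<Rightarrow> 'w \<Rightarrow> 'k) \<Rightarrow> 'k"

definition ptensor :: "('v \<Rightarrow> 'w \<Rightarrow> 'k::field) set \<Rightarrow> 'v \<Rightarrow> 'w \<Rightarrow> ('k, 'v, 'w) tens" where
  "ptensor \<Phi> x y = (\<lambda>\<beta>. if \<beta> \<in> \<Phi> then \<beta> x y else 0)"

definition tspace ::
  "('v \<Rightarrow> 'w \<Rightarrow> 'k::field) set \<Rightarrow> ('k, 'v) space \<Rightarrow> ('k, 'w) space \<Rightarrow> ('k, ('k, 'v, 'w) tens) space" where
  "tspace \<Phi> X Y =
     \<lparr>carr = module.span fscal {ptensor \<Phi> x y | x y. x \<in> carr X \<and> y \<in> carr Y}, scal = fscal\<rparr>"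

definition tlift ::
  "('v \<Rightarrow> 'w \<Rightarrow> 'k::field) set \<Rightarrow> ('k, 'v::plus) space \<Rightarrow> ('k, 'w::plus) space \<Rightarrow> ('k, 'z::plus) space
     \<Rightarrow> ('v \<Rightarrow> 'w \<Rightarrow> 'z) \<Rightarrow> ('k, 'v, 'w) tens \<Rightarrow> 'z" where
  "tlift \<Phi> X Y Z b =
     (SOME f. lin (tspace \<Phi> X Y) Z f \<and> (\<forall>x\<in>carr X. \<forall>y\<in>carr Y. f (ptensor \<Phi> x y) = b x y))"

lemma vector_space_fscal: "vector_space (fscal :: 'k::field \<Rightarrow> ('b \<Rightarrow> 'k) \<Rightarrow> _)"
  by unfold_locales (auto simp: fscal_def fun_eq_iff algebra_simps)

lemma vspace_tspace: "vspace (tspace \<Phi> X Y)"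
proof -
  interpret F: vector_space "fscal :: 'k::field \<Rightarrow> (('v \<Rightarrow> 'w \<Rightarrow> 'k) \<Rightarrow> 'k) \<Rightarrow> _"
    by (rule vector_space_fscal)
  show ?thesis
    by (simp add: vspace_def tspace_def vector_space_fscal)
qed

lemma tensor_universal:
  fixes X :: "('k::field, 'v::ab_group_add) space" and Y :: "('k, 'w::ab_group_add) space"
    and Z :: "('k, 'z::ab_group_add) space"
  assumes Z: "vspace Z"
    and b: "\<And>x y. x \<in> carr X \<Longrightarrow> y \<in> carr Y \<Longrightarrow> b x y \<in> carr Z"
    and bal: "\<And>\<omega>. lin Z scalars \<omega> \<Longrightarrow> (\<lambda>x y. \<omega> (b x y)) \<in> \<Phi>"
  shows "\<exists>f. lin (tspace \<Phi> X Y) Z f \<and>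
             (\<forall>x\<in>carr X. \<forall>y\<in>carr Y. f (ptensor \<Phi> x y) = b x y)"
proof -
  define P where "P = {ptensor \<Phi> x y | x y. x \<in> carr X \<and> y \<in> carr Y}"
  interpret F: vector_space "fscal :: 'k \<Rightarrow> (('v \<Rightarrow> 'w \<Rightarrow> 'k) \<Rightarrow> 'k) \<Rightarrow> _"
    by (rule vector_space_fscal)
  interpret Z: vector_space "scal Z" using Z by (simp add: vspace_def)
  have subZ: "Z.subspace (carr Z)" using Z by (simp add: vspace_def)
  interpret K: vector_space "(*) :: 'k \<Rightarrow> 'k \<Rightarrow> 'k"
    by unfold_locales (auto simp: algebra_simps)
  interpret FZ: vector_space_pair "fscal :: 'k \<Rightarrow> (('v \<Rightarrow> 'w \<Rightarrow> 'k) \<Rightarrow> 'k) \<Rightarrow> _" "scal Z" ..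
  interpret ZK: vector_space_pair "scal Z" "(*) :: 'k \<Rightarrow> 'k \<Rightarrow> 'k" ..
  obtain B where BP: "B \<subseteq> P" and Bi: "F.independent B" and Bs: "P \<subseteq> F.span B"
    using F.maximal_independent_subset by blast
  have "\<forall>u\<in>B. \<exists>p. u = ptensor \<Phi> (fst p) (snd p) \<and> fst p \<in> carr X \<and> snd p \<in> carr Y"
    using BP by (fastforce simp: P_def)
  then obtain p where p: "\<And>u. u \<in> B \<Longrightarrow> u = ptensor \<Phi> (fst (p u)) (snd (p u))"
      "\<And>u. u \<in> B \<Longrightarrow> fst (p u) \<in> carr X" "\<And>u. u \<in> B \<Longrightarrow> snd (p u) \<in> carr Y"
    by metis
  define g where "g u = b (fst (p u)) (snd (p u))" for u
  define f where "f = FZ.construct B g"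
  have linf: "Vector_Spaces.linear fscal (scal Z) f"
    unfolding f_def by (rule FZ.linear_construct[OF Bi])
  interpret f: Vector_Spaces.linear "fscal :: 'k \<Rightarrow> (('v \<Rightarrow> 'w \<Rightarrow> 'k) \<Rightarrow> 'k) \<Rightarrow> _" "scal Z" f
    by (rule linf)
  have fB: "f u = g u" if "u \<in> B" for u
    unfolding f_def using FZ.construct_basis[OF Bi that] .
  have "Z.span (g ` B) \<subseteq> carr Z"
    by (rule Z.span_minimal[OF _ subZ]) (use p b in \<open>auto simp: g_def\<close>)
  then have fZ: "f u \<in> carr Z" for u
    unfolding f_def using FZ.construct_in_span[OF Bi, of g u] by blast
  have eval: "\<omega> (f u) = u (\<lambda>x y. \<omega> (b x y))"
    if om: "Vector_Spaces.linear (scal Z) (*) \<omega>" and u: "u \<in> F.span B" for \<omega> u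
  proof -
    interpret \<omega>: Vector_Spaces.linear "scal Z" "(*)" \<omega> by (rule om)
    have "lin Z scalars \<omega>"
      by (auto simp: lin_def scalars_def \<omega>.add \<omega>.scale)
    then have mem: "(\<lambda>x y. \<omega> (b x y)) \<in> \<Phi>" by (rule bal)
    show ?thesis using u
    proof (induction rule: F.span_induct_alt)
      case base
      have "\<omega> (f 0) = 0" by (simp only: f.zero \<omega>.zero)
      then show ?case by (simp add: zero_fun_def)
    next
      case (step c x y)
      have "x (\<lambda>x y. \<omega> (b x y)) = \<omega> (f x)"
      proof -
        have "x (\<lambda>x y. \<omega> (b x y)) = ptensor \<Phi> (fst (p x)) (snd (p x)) (\<lambda>x y. \<omega> (b x y))"
          using p(1)[OF step(1)] by (rule arg_cong)
        then show ?thesis using mem by (simp add: fB[OF step(1)] g_def ptensor_def)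
      qed
      moreover have "\<omega> (f (fscal c x + y)) = c * \<omega> (f x) + \<omega> (f y)"
        by (simp only: f.add f.scale \<omega>.add \<omega>.scale)
      ultimately show ?case
        using step(2) by (simp add: fscal_def plus_fun_def)
    qed
  qed
  have sep: "z = 0" if "\<And>\<omega>. Vector_Spaces.linear (scal Z) (*) \<omega> \<Longrightarrow> \<omega> z = 0" for z
  proof (rule ccontr)
    assume "z \<noteq> 0"
    then have ind: "Z.independent {z}" by simp
    have "ZK.construct {z} (\<lambda>_. 1) z = 1"
      by (rule ZK.construct_basis[OF ind]) simp
    then show False using that[OF ZK.linear_construct[OF ind]] by simp
  qed
  have "f (ptensor \<Phi> x y) = b x y" if "x \<in> carr X" "y \<in> carr Y" for x y
  proof -
    have u: "ptensor \<Phi> x y \<in> F.span B" using Bs that by (auto simp: P_def)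
    have "f (ptensor \<Phi> x y) - b x y = 0"
    proof (rule sep)
      fix \<omega> assume om: "Vector_Spaces.linear (scal Z) (*) \<omega>"
      interpret \<omega>: Vector_Spaces.linear "scal Z" "(*)" \<omega> by (rule om)
      have "lin Z scalars \<omega>"
        by (auto simp: lin_def scalars_def \<omega>.add \<omega>.scale)
      then have mem: "(\<lambda>x y. \<omega> (b x y)) \<in> \<Phi>" by (rule bal)
      show "\<omega> (f (ptensor \<Phi> x y) - b x y) = 0"
        using eval[OF om u] mem by (simp add: \<omega>.diff ptensor_def)
    qed
    then show ?thesis by simp
  qed
  moreover have "lin (tspace \<Phi> X Y) Z f"
    using fZ by (auto simp: lin_def tspace_def f.add f.scale)
  ultimately show ?thesis by blast
qed

lemma tensor_unique:
  fixes X :: "('k::field, 'v::ab_group_add) space" and Y :: "('k, 'w::ab_group_add) space"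
    and Z :: "('k, 'z::ab_group_add) space"
  assumes Z: "vspace Z"
    and f: "lin (tspace \<Phi> X Y) Z f" and g: "lin (tspace \<Phi> X Y) Z g"
    and eq: "\<And>x y. x \<in> carr X \<Longrightarrow> y \<in> carr Y \<Longrightarrow> f (ptensor \<Phi> x y) = g (ptensor \<Phi> x y)"
    and t: "t \<in> carr (tspace \<Phi> X Y)"
  shows "f t = g t"
proof -
  interpret F: vector_space "fscal :: 'k \<Rightarrow> (('v \<Rightarrow> 'w \<Rightarrow> 'k) \<Rightarrow> 'k) \<Rightarrow> _"
    by (rule vector_space_fscal)
  interpret Z: vector_space "scal Z" using Z by (simp add: vspace_def)
  define P where "P = {ptensor \<Phi> x y | x y. x \<in> carr X \<and> y \<in> carr Y}"
  have carr: "carr (tspace \<Phi> X Y) = F.span P" and sc: "scal (tspace \<Phi> X Y) = fscal"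
    by (simp_all add: tspace_def P_def)
  have zero: "h 0 = 0" if "lin (tspace \<Phi> X Y) Z h" for h
  proof -
    have "0 \<in> carr (tspace \<Phi> X Y)" by (simp add: carr F.span_zero)
    then have "h (fscal 0 0) = scal Z 0 (h 0)" using that unfolding lin_def sc by blast
    then show ?thesis by (simp only: F.scale_zero_left Z.scale_zero_left)
  qed
  from t have "t \<in> F.span P" by (simp add: carr)
  then have "t \<in> F.span P \<and> f t = g t"
  proof (induction rule: F.span_induct_alt)
    case base show ?case by (simp only: zero[OF f] zero[OF g] F.span_zero simp_thms)
  next
    case (step c x y)
    have x: "x \<in> F.span P" and cx: "fscal c x \<in> F.span P" and y: "y \<in> F.span P"
      using step by (auto intro: F.span_base F.span_scale)
    have "f x = g x" using step(1) eq by (auto simp: P_def)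
    moreover have "f (fscal c x + y) = scal Z c (f x) + f y" "g (fscal c x + y) = scal Z c (g x) + g y"
      using f g x cx y by (auto simp: lin_def carr sc)
    ultimately have "f (fscal c x + y) = g (fscal c x + y)" using step(2) by (simp only:)
    then show ?case using F.span_add[OF cx y] by blast
  qed
  then show ?thesis ..
qed

subsection \<open>Tensor products over the field\<close>

definition forms :: "('k::field, 'v::plus) space \<Rightarrow> ('k, 'w::plus) space \<Rightarrow> ('v \<Rightarrow> 'w \<Rightarrow> 'k) set" where
  "forms X Y = {\<beta>. bilin X Y scalars \<beta>}"

definition tprod ::
  "('k::field, 'v::plus) space \<Rightarrow> ('k, 'w::plus) space \<Rightarrow> ('k, ('k, 'v, 'w) tens) space"
    (infixl "\<otimes>" 70) where
  "X \<otimes> Y = tspace (forms X Y) X Y"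

definition pure ::
  "('k::field, 'v::plus) space \<Rightarrow> ('k, 'w::plus) space \<Rightarrow> 'v \<Rightarrow> 'w \<Rightarrow> ('k, 'v, 'w) tens" where
  "pure X Y = ptensor (forms X Y)"

definition lift ::
  "('k::field, 'v::plus) space \<Rightarrow> ('k, 'w::plus) space \<Rightarrow> ('k, 'z::plus) space
     \<Rightarrow> ('v \<Rightarrow> 'w \<Rightarrow> 'z) \<Rightarrow> ('k, 'v, 'w) tens \<Rightarrow> 'z" where
  "lift X Y = tlift (forms X Y) X Y"

lemma lift_exists:
  fixes X :: "('k::field, 'v::ab_group_add) space" and Y :: "('k, 'w::ab_group_add) space"
    and Z :: "('k, 'z::ab_group_add) space"
  assumes Z: "vspace Z" and b: "bilin X Y Z b"
  shows lift_lin: "lin (X \<otimes> Y) Z (lift X Y Z b)"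
    and lift_pure: "x \<in> carr X \<Longrightarrow> y \<in> carr Y \<Longrightarrow> lift X Y Z b (pure X Y x y) = b x y"
proof -
  have "\<exists>f. lin (tspace (forms X Y) X Y) Z f \<and>
             (\<forall>x\<in>carr X. \<forall>y\<in>carr Y. f (ptensor (forms X Y) x y) = b x y)"
  proof (rule tensor_universal[OF Z])
    show "b x y \<in> carr Z" if "x \<in> carr X" "y \<in> carr Y" for x y
      using b that by (auto simp: bilin_def lin_def)
    show "(\<lambda>x y. \<omega> (b x y)) \<in> forms X Y" if "lin Z scalars \<omega>" for \<omega>
      using b that by (auto simp: forms_def bilin_def lin_def)
  qed
  from someI_ex[OF this]
  show "lin (X \<otimes> Y) Z (lift X Y Z b)"
    and "x \<in> carr X \<Longrightarrow> y \<in> carr Y \<Longrightarrow> lift X Y Z b (pure X Y x y) = b x y"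
    by (auto simp: tprod_def lift_def tlift_def pure_def)
qed

definition tmap ::
  "('k::field, 'v::plus) space \<Rightarrow> ('k, 'w::plus) space \<Rightarrow> ('k, 'v2::plus) space \<Rightarrow> ('k, 'w2::plus) space
     \<Rightarrow> ('v \<Rightarrow> 'v2) \<Rightarrow> ('w \<Rightarrow> 'w2) \<Rightarrow> ('k, 'v, 'w) tens \<Rightarrow> ('k, 'v2, 'w2) tens" where
  "tmap X Y X' Y' f g = lift X Y (X' \<otimes> Y') (\<lambda>x y. pure X' Y' (f x) (g y))"

definition tw ::
  "('k::field, 'v::plus) space \<Rightarrow> ('k, 'w::plus) space \<Rightarrow> ('k, 'v, 'w) tens \<Rightarrow> ('k, 'w, 'v) tens" where
  "tw X Y = lift X Y (Y \<otimes> X) (\<lambda>x y. pure Y X y x)"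

definition assoc ::
  "('k::field, 'u::plus) space \<Rightarrow> ('k, 'v::plus) space \<Rightarrow> ('k, 'w::plus) space
     \<Rightarrow> ('k, ('k, 'u, 'v) tens, 'w) tens \<Rightarrow> ('k, 'u, ('k, 'v, 'w) tens) tens" where
  "assoc X Y Z = lift (X \<otimes> Y) Z (X \<otimes> (Y \<otimes> Z))
     (\<lambda>t z. lift X Y (X \<otimes> (Y \<otimes> Z)) (\<lambda>x y. pure X (Y \<otimes> Z) x (pure Y Z y z)) t)"

definition assoc_inv ::
  "('k::field, 'u::plus) space \<Rightarrow> ('k, 'v::plus) space \<Rightarrow> ('k, 'w::plus) space
     \<Rightarrow> ('k, 'u, ('k, 'v, 'w) tens) tens \<Rightarrow> ('k, ('k, 'u, 'v) tens, 'w) tens" where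
  "assoc_inv X Y Z = lift X (Y \<otimes> Z) ((X \<otimes> Y) \<otimes> Z)
     (\<lambda>x t. lift Y Z ((X \<otimes> Y) \<otimes> Z) (\<lambda>y z. pure (X \<otimes> Y) Z (pure X Y x y) z) t)"

text \<open>The maps \<open>X \<otimes> \<omega>\<close> and \<open>\<omega> \<otimes> Y\<close> for a functional \<open>\<omega>\<close>, where \<open>X \<otimes> k\<close> and \<open>k \<otimes> Y\<close> are
  identified with \<open>X\<close> and \<open>Y\<close>.\<close>

definition slice_right ::
  "('k::field, 'v::plus) space \<Rightarrow> ('k, 'w::plus) space \<Rightarrow> ('w \<Rightarrow> 'k) \<Rightarrow> ('k, 'v, 'w) tens \<Rightarrow> 'v" where
  "slice_right X Y \<omega> = lift X Y X (\<lambda>x y. scal X (\<omega> y) x)"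

definition slice_left ::
  "('k::field, 'v::plus) space \<Rightarrow> ('k, 'w::plus) space \<Rightarrow> ('v \<Rightarrow> 'k) \<Rightarrow> ('k, 'v, 'w) tens \<Rightarrow> 'w" where
  "slice_left X Y \<omega> = lift X Y Y (\<lambda>x y. scal Y (\<omega> x) y)"

text \<open>Threefold tensor products are bracketed to the left. \<open>leg12 X Y Z f\<close> is \<open>f \<otimes> Z\<close> for
  \<open>f : X \<otimes> Y \<rightarrow> X \<otimes> Y\<close>; \<open>leg23 X Y Z Y' Z' g\<close> is \<open>X \<otimes> g\<close> for \<open>g : Y \<otimes> Z \<rightarrow> Y' \<otimes> Z'\<close>; and
  \<open>leg13 X Y Z f\<close> is \<open>f\<close> acting in the outer two factors of \<open>X \<otimes> Y \<otimes> Z\<close>,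
  for \<open>f : X \<otimes> Z \<rightarrow> X \<otimes> Z\<close>.\<close>

definition leg12 where
  "leg12 X Y Z f = tmap (X \<otimes> Y) Z (X \<otimes> Y) Z f id"

definition leg23 where
  "leg23 X Y Z Y' Z' g =
     assoc_inv X Y' Z' \<circ> tmap X (Y \<otimes> Z) X (Y' \<otimes> Z') id g \<circ> assoc X Y Z"

definition leg13 where
  "leg13 X Y Z f = leg23 X Z Y Y Z (tw Z Y) \<circ> leg12 X Z Y f \<circ> leg23 X Y Z Z Y (tw Y Z)"

section \<open>Regular weak multiplier bialgebras\<close>

text \<open>The underlying ring is a type of class \<open>ring\<close>, hence associative and not necessarily
  unital; the record adds the action of the scalars and the remaining structure maps.\<close>

record ('k, 'a) wmb =
  asc :: "'k \<Rightarrow> 'a \<Rightarrow> 'a"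
  E1 :: "('k, 'a, 'a) tens \<Rightarrow> ('k, 'a, 'a) tens"
  E2 :: "('k, 'a, 'a) tens \<Rightarrow> ('k, 'a, 'a) tens"
  T1 :: "('k, 'a, 'a) tens \<Rightarrow> ('k, 'a, 'a) tens"
  T2 :: "('k, 'a, 'a) tens \<Rightarrow> ('k, 'a, 'a) tens"
  T3 :: "('k, 'a, 'a) tens \<Rightarrow> ('k, 'a, 'a) tens"
  T4 :: "('k, 'a, 'a) tens \<Rightarrow> ('k, 'a, 'a) tens"
  eps :: "'a \<Rightarrow> 'k"

definition alg :: "('k, 'a) wmb \<Rightarrow> ('k, 'a) space" where
  "alg H = \<lparr>carr = UNIV, scal = asc H\<rparr>"

definition algsq :: "('k::field, 'a::ring) wmb \<Rightarrow> ('k, ('k, 'a, 'a) tens) space" where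
  "algsq H = alg H \<otimes> alg H"

definition ap :: "('k::field, 'a::ring) wmb \<Rightarrow> 'a \<Rightarrow> 'a \<Rightarrow> ('k, 'a, 'a) tens" where
  "ap H = pure (alg H) (alg H)"

definition amap :: "('k::field, 'a::ring) wmb \<Rightarrow> ('a \<Rightarrow> 'a) \<Rightarrow> ('a \<Rightarrow> 'a)
    \<Rightarrow> ('k, 'a, 'a) tens \<Rightarrow> ('k, 'a, 'a) tens" where
  "amap H = tmap (alg H) (alg H) (alg H) (alg H)"

definition mu :: "('k::field, 'a::ring) wmb \<Rightarrow> ('k, 'a, 'a) tens \<Rightarrow> 'a" where
  "mu H = lift (alg H) (alg H) (alg H) (*)"

definition mu2 :: "('k::field, 'a::ring) wmb
    \<Rightarrow> ('k, 'a, 'a) tens \<Rightarrow> ('k, 'a, 'a) tens \<Rightarrow> ('k, 'a, 'a) tens" where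
  "mu2 H t u = lift (alg H) (alg H) (algsq H) (\<lambda>a b. amap H (\<lambda>x. a * x) (\<lambda>y. b * y) u) t"

definition eps_left :: "('k::field, 'a::ring) wmb \<Rightarrow> ('k, 'a, 'a) tens \<Rightarrow> 'a" where
  "eps_left H = slice_left (alg H) (alg H) (eps H)"

definition eps_right :: "('k::field, 'a::ring) wmb \<Rightarrow> ('k, 'a, 'a) tens \<Rightarrow> 'a" where
  "eps_right H = slice_right (alg H) (alg H) (eps H)"

definition algebra :: "('k::field, 'a::ring) wmb \<Rightarrow> bool" where
  "algebra H \<longleftrightarrow> vector_space (asc H) \<and>
     (\<forall>c a b. asc H c a * b = asc H c (a * b) \<and> a * asc H c b = asc H c (a * b))"

definition idempotent_alg :: "('k::field, 'a::ring) wmb \<Rightarrow> bool" where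
  "idempotent_alg H \<longleftrightarrow> mu H ` carr (algsq H) = UNIV"

definition nondegenerate_alg :: "('k::field, 'a::ring) wmb \<Rightarrow> bool" where
  "nondegenerate_alg H \<longleftrightarrow>
     (\<forall>a::'a. (\<forall>b. a * b = 0) \<longrightarrow> a = 0) \<and> (\<forall>a::'a. (\<forall>b. b * a = 0) \<longrightarrow> a = 0)"

definition regular_wmb :: "('k::field, 'a::ring) wmb \<Rightarrow> bool" where
  "regular_wmb H \<longleftrightarrow>
    (let A = alg H; AA = algsq H; AAA = AA \<otimes> A;
         f12 = leg12 A A A; f23 = leg23 A A A A A; f13 = leg13 A A A in
     algebra H \<and> idempotent_alg H \<and> nondegenerate_alg H \<and>
     (\<forall>f \<in> {E1 H, E2 H, T1 H, T2 H, T3 H, T4 H}. lin AA AA f) \<and> lin A scalars (eps H) \<and>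
     (\<forall>a b c d. mu2 H (ap H a b) (E1 H (ap H c d)) = mu2 H (E2 H (ap H a b)) (ap H c d)) \<and>
     (\<forall>t\<in>carr AA. E1 H (E1 H t) = E1 H t) \<and>
     (\<forall>t\<in>carr AAA. f12 (T2 H) (f23 (T1 H) t) = f23 (T1 H) (f12 (T2 H) t)) \<and>
     (\<forall>t\<in>carr AA. eps_left H (T1 H t) = mu H t \<and> mu H t = eps_right H (T2 H t)) \<and>
     (\<forall>t\<in>carr AAA. tmap AA A A A (mu H) id (f13 (T1 H) (f23 (T1 H) t))
                    = T1 H (tmap AA A A A (mu H) id t)) \<and>
     module.span fscal {amap H (\<lambda>x. x * b) id (T1 H (ap H a c)) | a b c. True}
       = module.span fscal {E1 H (ap H b c) | b c. True} \<and>
     module.span fscal {amap H id (\<lambda>y. c * y) (T2 H (ap H b a)) | a b c. True}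
       = module.span fscal {E2 H (ap H b c) | b c. True} \<and>
     (\<forall>t\<in>carr AAA. f12 (E1 H) (f23 (T1 H) t) = f23 (T1 H) (f12 (E1 H) t)) \<and>
     (\<forall>t\<in>carr AAA. f12 (E2 H) (f23 (T2 H) t) = f23 (T2 H) (f13 (E2 H) t)) \<and>
     (\<forall>a b c. eps_left H (amap H id (\<lambda>y. a * y) (E1 H (ap H b c)))
                = eps_left H (amap H (\<lambda>x. x * b) id (T1 H (ap H a c)))) \<and>
     (\<forall>a b c. eps_left H (amap H id (\<lambda>y. y * c) (E2 H (ap H a b)))
                = eps_left H (amap H id (\<lambda>y. b * y) (T2 H (ap H a c)))) \<and>
     (\<forall>a b c. amap H id (\<lambda>y. a * y) (T1 H (ap H c b))
                = amap H id (\<lambda>y. y * b) (T3 H (ap H c a))) \<and>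
     (\<forall>a b c. amap H (\<lambda>x. x * b) id (T2 H (ap H a c))
                = amap H (\<lambda>x. a * x) id (T4 H (ap H b c))))"

definition right_full :: "('k::field, 'a::ring) wmb \<Rightarrow> bool" where
  "right_full H \<longleftrightarrow> module.span (asc H)
     {slice_right (alg H) (alg H) \<omega> (T1 H (ap H a b)) | a b \<omega>. lin (alg H) scalars \<omega>} = UNIV"

definition left_full :: "('k::field, 'a::ring) wmb \<Rightarrow> bool" where
  "left_full H \<longleftrightarrow> module.span (asc H)
     {slice_left (alg H) (alg H) \<omega> (T2 H (ap H a b)) | a b \<omega>. lin (alg H) scalars \<omega>} = UNIV"

subsection \<open>Multipliers and the base algebra\<close>

text \<open>A multiplier \<open>m = (l, r)\<close> acts by \<open>m a = l a\<close> and \<open>a m = r a\<close>.\<close>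

type_synonym 'a mult = "('a \<Rightarrow> 'a) \<times> ('a \<Rightarrow> 'a)"

abbreviation mult_left :: "'a mult \<Rightarrow> 'a \<Rightarrow> 'a" (infixr "\<rhd>" 75) where
  "m \<rhd> a \<equiv> fst m a"

abbreviation mult_right :: "'a \<Rightarrow> 'a mult \<Rightarrow> 'a" (infixl "\<lhd>" 75) where
  "a \<lhd> m \<equiv> snd m a"

definition multipliers :: "('k::field, 'a::ring) wmb \<Rightarrow> ('k, 'a mult) space" where
  "multipliers H =
     \<lparr>carr = {m. lin (alg H) (alg H) (fst m) \<and> lin (alg H) (alg H) (snd m) \<and>
                 (\<forall>a b. a * (m \<rhd> b) = (a \<lhd> m) * b)},
      scal = (\<lambda>c m. (\<lambda>a. asc H c (m \<rhd> a), \<lambda>a. asc H c (a \<lhd> m)))\<rparr>"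

definition pi_bar_L :: "('k::field, 'a::ring) wmb \<Rightarrow> 'a \<Rightarrow> 'a mult" where
  "pi_bar_L H a = (\<lambda>b. eps_left H (T2 H (ap H a b)), \<lambda>b. eps_left H (E2 H (ap H a b)))"

definition pi_bar_R :: "('k::field, 'a::ring) wmb \<Rightarrow> 'a \<Rightarrow> 'a mult" where
  "pi_bar_R H a = (\<lambda>b. eps_right H (E1 H (ap H b a)), \<lambda>b. eps_right H (T1 H (ap H b a)))"

definition pi_R :: "('k::field, 'a::ring) wmb \<Rightarrow> 'a \<Rightarrow> 'a mult" where
  "pi_R H a = (\<lambda>b. eps_right H (T3 H (ap H b a)), \<lambda>b. eps_right H (E2 H (ap H b a)))"

text \<open>In the right full case \<open>range (pi_R H)\<close> is the same set.\<close>

definition base :: "('k::field, 'a::ring) wmb \<Rightarrow> ('k, 'a mult) space" where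
  "base H = \<lparr>carr = range (pi_bar_R H), scal = scal (multipliers H)\<rparr>"

subsection \<open>The antipode\<close>

definition is_G1 :: "('k::field, 'a::ring) wmb \<Rightarrow> (('k, 'a, 'a) tens \<Rightarrow> ('k, 'a, 'a) tens) \<Rightarrow> bool" where
  "is_G1 H G \<longleftrightarrow>
    (let A = alg H; M = multipliers H in
     lin (algsq H) (algsq H) G \<and>
     (\<forall>a b c. G (ap H a (b * c)) =
        tmap M A A A (\<lambda>m. a \<lhd> m) id
          (tmap A A M A (pi_bar_R H) id (tw A A (T4 H (ap H c b))))))"

definition is_G2 :: "('k::field, 'a::ring) wmb \<Rightarrow> (('k, 'a, 'a) tens \<Rightarrow> ('k, 'a, 'a) tens) \<Rightarrow> bool" where
  "is_G2 H G \<longleftrightarrow>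
    (let A = alg H; M = multipliers H in
     lin (algsq H) (algsq H) G \<and>
     (\<forall>a b c. G (ap H (a * b) c) =
        tmap A M A A id (\<lambda>m. m \<rhd> c)
          (tmap A A A M id (pi_bar_L H) (tw A A (T3 H (ap H b a))))))"

text \<open>Since the algebra is idempotent, \<open>is_G1 H\<close> and \<open>is_G2 H\<close> each determine a map on the carrier.\<close>

definition antipode :: "('k::field, 'a::ring) wmb \<Rightarrow> ('a \<Rightarrow> 'a mult) \<Rightarrow> bool" where
  "antipode H S \<longleftrightarrow>
    (\<exists>G1 G2 R1 R2. is_G1 H G1 \<and> is_G2 H G2 \<and>
       lin (algsq H) (algsq H) R1 \<and> lin (algsq H) (algsq H) R2 \<and>
       (\<forall>t\<in>carr (algsq H). R1 (T1 H t) = G1 t \<and> T1 H (R1 t) = E1 H t \<and> R1 (T1 H (R1 t)) = R1 t) \<and>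
       (\<forall>t\<in>carr (algsq H). R2 (T2 H t) = G2 t \<and> T2 H (R2 t) = E2 H t \<and> R2 (T2 H (R2 t)) = R2 t) \<and>
       lin (alg H) (multipliers H) S \<and>
       (\<forall>a b. S a \<rhd> b = eps_left H (R1 (ap H a b)) \<and> b \<lhd> S a = eps_right H (R2 (ap H b a))))"

section \<open>Comodules\<close>

record ('k, 'v, 'a) comod =
  sp :: "('k, 'v) space"
  lam :: "('k, 'v, 'a) tens \<Rightarrow> ('k, 'v, 'a) tens"
  rho :: "('k, 'v, 'a) tens \<Rightarrow> ('k, 'v, 'a) tens"

definition comodule :: "('k::field, 'a::ring) wmb \<Rightarrow> ('k, 'v::ab_group_add, 'a) comod \<Rightarrow> bool" where
  "comodule H V \<longleftrightarrow>
    (let A = alg H; X = sp V; XAA = (X \<otimes> A) \<otimes> A; l12 = leg12 X A A (lam V); l13 = leg13 X A A (lam V) in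
     vspace X \<and> lin (X \<otimes> A) (X \<otimes> A) (lam V) \<and> lin (X \<otimes> A) (X \<otimes> A) (rho V) \<and>
     (\<forall>v\<in>carr X. \<forall>a b. tmap X A X A id (\<lambda>y. a * y) (lam V (pure X A v b))
                      = tmap X A X A id (\<lambda>y. y * b) (rho V (pure X A v a))) \<and>
     (\<forall>t\<in>carr XAA. l12 (l13 (leg23 X A A A A (E1 H) t)) = l12 (l13 t)) \<and>
     (\<forall>t\<in>carr XAA. l12 (l13 (leg23 X A A A A (T1 H) t)) = leg23 X A A A A (T1 H) (l12 t)))"

definition comod_mor :: "('k::field, 'a::ring) wmb \<Rightarrow> ('k, 'v::ab_group_add, 'a) comod
    \<Rightarrow> ('k, 'w::ab_group_add, 'a) comod \<Rightarrow> ('v \<Rightarrow> 'w) \<Rightarrow> bool" where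
  "comod_mor H V W f \<longleftrightarrow>
    (let A = alg H; fA = tmap (sp V) A (sp W) A f id in
     lin (sp V) (sp W) f \<and> (\<forall>t\<in>carr (sp V \<otimes> A). lam W (fA t) = fA (lam V t)))"

definition full_comodule :: "('k::field, 'a::ring) wmb \<Rightarrow> ('k, 'v::ab_group_add, 'a) comod \<Rightarrow> bool" where
  "full_comodule H V \<longleftrightarrow> comodule H V \<and>
     module.span (scal (sp V))
       {slice_right (sp V) (alg H) \<omega> (lam V (pure (sp V) (alg H) v a)) | v a \<omega>.
          v \<in> carr (sp V) \<and> lin (alg H) scalars \<omega>} = carr (sp V)"

text \<open>The actions of the base algebra on a full comodule; they do not depend on the chosen
  preimage of the base element.\<close>

definition ract :: "('k::field, 'a::ring) wmb \<Rightarrow> ('k, 'v::ab_group_add, 'a) comod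
    \<Rightarrow> 'v \<Rightarrow> 'a mult \<Rightarrow> 'v" where
  "ract H V v r = slice_right (sp V) (alg H) (eps H)
     (lam V (pure (sp V) (alg H) v (SOME a. pi_bar_R H a = r)))"

definition lact :: "('k::field, 'a::ring) wmb \<Rightarrow> ('k, 'v::ab_group_add, 'a) comod
    \<Rightarrow> 'a mult \<Rightarrow> 'v \<Rightarrow> 'v" where
  "lact H V r v = slice_right (sp V) (alg H) (eps H)
     (rho V (pure (sp V) (alg H) v (SOME a. pi_R H a = r)))"

subsection \<open>The monoidal unit\<close>

text \<open>An element \<open>t\<close> of \<open>R \<otimes> A\<close> is a multiplier of \<open>A \<otimes> A\<close>: the following are \<open>t u\<close> and \<open>u t\<close> for \<open>u\<close>
  in \<open>A \<otimes> A\<close>.\<close>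

definition RA_left :: "('k::field, 'a::ring) wmb
    \<Rightarrow> ('k, 'a mult, 'a) tens \<Rightarrow> ('k, 'a, 'a) tens \<Rightarrow> ('k, 'a, 'a) tens" where
  "RA_left H t u =
     lift (base H) (alg H) (algsq H) (\<lambda>r a. amap H (\<lambda>x. r \<rhd> x) (\<lambda>y. a * y) u) t"

definition RA_right :: "('k::field, 'a::ring) wmb
    \<Rightarrow> ('k, 'a, 'a) tens \<Rightarrow> ('k, 'a mult, 'a) tens \<Rightarrow> ('k, 'a, 'a) tens" where
  "RA_right H u t =
     lift (base H) (alg H) (algsq H) (\<lambda>r a. amap H (\<lambda>x. x \<lhd> r) (\<lambda>y. y * a) u) t"

text \<open>\<open>E (1 \<otimes> b)\<close> and \<open>(1 \<otimes> b) E\<close> as elements of \<open>R \<otimes> A\<close>, for \<open>b = r a\<close> and \<open>b = a r\<close> respectively.\<close>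

definition is_E_times :: "('k::field, 'a::ring) wmb \<Rightarrow> 'a \<Rightarrow> ('k, 'a mult, 'a) tens \<Rightarrow> bool" where
  "is_E_times H b t \<longleftrightarrow> t \<in> carr (base H \<otimes> alg H) \<and>
     (\<forall>u\<in>carr (algsq H). RA_left H t u = E1 H (amap H id (\<lambda>y. b * y) u) \<and>
                         RA_right H u t = amap H id (\<lambda>y. y * b) (E2 H u))"

definition is_times_E :: "('k::field, 'a::ring) wmb \<Rightarrow> 'a \<Rightarrow> ('k, 'a mult, 'a) tens \<Rightarrow> bool" where
  "is_times_E H b t \<longleftrightarrow> t \<in> carr (base H \<otimes> alg H) \<and>
     (\<forall>u\<in>carr (algsq H). RA_left H t u = amap H id (\<lambda>y. b * y) (E1 H u) \<and>
                         RA_right H u t = E2 H (amap H id (\<lambda>y. y * b) u))"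

definition unit_comod :: "('k::field, 'a::ring) wmb \<Rightarrow> ('k, 'a mult, 'a) comod" where
  "unit_comod H =
    (let A = alg H; R = base H in
     \<lparr>sp = R,
      lam = lift R A (R \<otimes> A) (\<lambda>r a. THE t. is_E_times H (r \<rhd> a) t),
      rho = lift R A (R \<otimes> A) (\<lambda>r a. THE t. is_times_E H (a \<lhd> r) t)\<rparr>)"

subsection \<open>The monoidal product\<close>

definition rforms :: "('k::field, 'a::ring) wmb \<Rightarrow> ('k, 'v::ab_group_add, 'a) comod
    \<Rightarrow> ('k, 'w::ab_group_add, 'a) comod \<Rightarrow> ('v \<Rightarrow> 'w \<Rightarrow> 'k) set" where
  "rforms H V W = {\<beta> \<in> forms (sp V) (sp W).
     \<forall>v\<in>carr (sp V). \<forall>r\<in>carr (base H). \<forall>w\<in>carr (sp W). \<beta> (ract H V v r) w = \<beta> v (lact H W r w)}"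

definition rtens :: "('k::field, 'a::ring) wmb \<Rightarrow> ('k, 'v::ab_group_add, 'a) comod
    \<Rightarrow> ('k, 'w::ab_group_add, 'a) comod \<Rightarrow> ('k, ('k, 'v, 'w) tens) space" where
  "rtens H V W = tspace (rforms H V W) (sp V) (sp W)"

definition rpure :: "('k::field, 'a::ring) wmb \<Rightarrow> ('k, 'v::ab_group_add, 'a) comod
    \<Rightarrow> ('k, 'w::ab_group_add, 'a) comod \<Rightarrow> 'v \<Rightarrow> 'w \<Rightarrow> ('k, 'v, 'w) tens" where
  "rpure H V W = ptensor (rforms H V W)"

definition rlift :: "('k::field, 'a::ring) wmb \<Rightarrow> ('k, 'v::ab_group_add, 'a) comod
    \<Rightarrow> ('k, 'w::ab_group_add, 'a) comod \<Rightarrow> ('k, 'z::ab_group_add) space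
    \<Rightarrow> ('v \<Rightarrow> 'w \<Rightarrow> 'z) \<Rightarrow> ('k, 'v, 'w) tens \<Rightarrow> 'z" where
  "rlift H V W = tlift (rforms H V W) (sp V) (sp W)"

definition tens_comod :: "('k::field, 'a::ring) wmb \<Rightarrow> ('k, 'v::ab_group_add, 'a) comod
    \<Rightarrow> ('k, 'w::ab_group_add, 'a) comod \<Rightarrow> ('k, ('k, 'v, 'w) tens, 'a) comod" where
  "tens_comod H V W =
    (let A = alg H; X = sp V; Y = sp W in
     \<lparr>sp = X \<otimes> Y,
      lam = leg13 X Y A (lam V) \<circ> leg23 X Y A Y A (lam W),
      rho = leg23 X Y A Y A (rho W) \<circ> leg13 X Y A (rho V)\<rparr>)"

definition rproj :: "('k::field, 'a::ring) wmb \<Rightarrow> ('k, 'v::ab_group_add, 'a) comod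
    \<Rightarrow> ('k, 'w::ab_group_add, 'a) comod \<Rightarrow> ('k, 'v, 'w) tens \<Rightarrow> ('k, 'v, 'w) tens" where
  "rproj H V W = lift (sp V) (sp W) (rtens H V W) (rpure H V W)"

text \<open>The comodule structure is unique on the carrier; the choice operator only fixes the
  irrelevant values elsewhere.\<close>

definition rprod :: "('k::field, 'a::ring) wmb \<Rightarrow> ('k, 'v::ab_group_add, 'a) comod
    \<Rightarrow> ('k, 'w::ab_group_add, 'a) comod \<Rightarrow> ('k, ('k, 'v, 'w) tens, 'a) comod" where
  "rprod H V W = (SOME P. sp P = rtens H V W \<and> comodule H P \<and>
                          comod_mor H (tens_comod H V W) P (rproj H V W))"

definition rmap where
  "rmap H V W V' W' f g = rlift H V W (rtens H V' W') (\<lambda>v w. rpure H V' W' (f v) (g w))"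

definition rassoc where
  "rassoc H U V W = rlift H (rprod H U V) W (rtens H U (rprod H V W))
     (\<lambda>t w. rlift H U V (rtens H U (rprod H V W))
        (\<lambda>u v. rpure H U (rprod H V W) u (rpure H V W v w)) t)"

definition rassoc_inv where
  "rassoc_inv H U V W = rlift H U (rprod H V W) (rtens H (rprod H U V) W)
     (\<lambda>u t. rlift H V W (rtens H (rprod H U V) W)
        (\<lambda>v w. rpure H (rprod H U V) W (rpure H U V u v) w) t)"

definition lunitor where
  "lunitor H V = rlift H (unit_comod H) V (sp V) (\<lambda>r v. lact H V r v)"

definition runitor where
  "runitor H V = rlift H V (unit_comod H) (sp V) (\<lambda>v r. ract H V v r)"

subsection \<open>Duals\<close>

text \<open>\<open>W\<close> is the dual of \<open>V\<close>. The triangle identities are written with the unitors on both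
  sides instead of an inverse unitor on one of them.\<close>

definition is_dual :: "('k::field, 'a::ring) wmb \<Rightarrow> ('k, 'v::ab_group_add, 'a) comod
    \<Rightarrow> ('k, 'w::ab_group_add, 'a) comod \<Rightarrow> bool" where
  "is_dual H V W \<longleftrightarrow>
    (let R = unit_comod H; VW = rprod H V W; WV = rprod H W V in
     \<exists>ev coev. comod_mor H WV R ev \<and> comod_mor H R VW coev \<and>
       (\<forall>t\<in>carr (rtens H R V).
          runitor H V (rmap H V WV V R id ev (rassoc H V W V (rmap H R V VW V coev id t)))
            = lunitor H V t) \<and>
       (\<forall>t\<in>carr (rtens H W R).
          lunitor H W (rmap H WV W R W ev id (rassoc_inv H W V W (rmap H W R W VW id coev t)))
            = runitor H W t))"

text \<open>The identification of \<open>V\<^sup>* \<otimes> A\<close> with maps from \<open>V\<close> to \<open>A\<close>, and the map \<open>\<phi> \<otimes> S\<close> from \<open>V \<otimes> A\<close> to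
  the multiplier algebra.\<close>

definition dual_eval :: "('k::field, 'a::ring) wmb \<Rightarrow> ('k, 'v::ab_group_add) space
    \<Rightarrow> ('k, 'v \<Rightarrow> 'k, 'a) tens \<Rightarrow> 'v \<Rightarrow> 'a" where
  "dual_eval H X t v = lift (dual X) (alg H) (alg H) (\<lambda>\<phi> a. asc H (\<phi> v) a) t"

definition phi_S :: "('k::field, 'a::ring) wmb \<Rightarrow> ('k, 'v::ab_group_add) space
    \<Rightarrow> ('v \<Rightarrow> 'k) \<Rightarrow> ('a \<Rightarrow> 'a mult) \<Rightarrow> ('k, 'v, 'a) tens \<Rightarrow> 'a mult" where
  "phi_S H X \<phi> S =
     lift X (alg H) (multipliers H) (\<lambda>v a. scal (multipliers H) (\<phi> v) (S a))"

definition dual_structure :: "('k::field, 'a::ring) wmb \<Rightarrow> ('a \<Rightarrow> 'a mult)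
    \<Rightarrow> ('k, 'v::ab_group_add, 'a) comod
    \<Rightarrow> (('k, 'v \<Rightarrow> 'k, 'a) tens \<Rightarrow> ('k, 'v \<Rightarrow> 'k, 'a) tens)
    \<Rightarrow> (('k, 'v \<Rightarrow> 'k, 'a) tens \<Rightarrow> ('k, 'v \<Rightarrow> 'k, 'a) tens) \<Rightarrow> bool" where
  "dual_structure H S V lamS rhoS \<longleftrightarrow>
    (let A = alg H; X = sp V; D = dual X in
     lin (D \<otimes> A) (D \<otimes> A) lamS \<and> lin (D \<otimes> A) (D \<otimes> A) rhoS \<and>
     (\<forall>\<phi>\<in>carr D. \<forall>a b. \<forall>v\<in>carr X.
        dual_eval H X (lamS (pure D A \<phi> (S b \<rhd> a))) v = phi_S H X \<phi> S (rho V (pure X A v b)) \<rhd> a \<and>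
        dual_eval H X (rhoS (pure D A \<phi> (a \<lhd> S b))) v = a \<lhd> phi_S H X \<phi> S (lam V (pure X A v b))))"

end

theory Submission
  imports Defs
begin

text \<open>The proof is a computation with matrices of multipliers. Let \<open>g i\<close>, \<open>f i\<close> be a basis of the comodule
\<open>V\<close> and its coordinate functionals. The two structure maps amount to multipliers \<open>mc \<phi> v\<close> of the algebra,
depending linearly on a functional \<open>\<phi>\<close> and a vector \<open>v\<close>: \<open>v \<otimes> a\<close> is sent to the sum of the
\<open>g i \<otimes> mc (f i) v a\<close>. The comodule axioms become identities for
\<open>X = \<Sum>i. mc \<phi> (g i) \<otimes> mc (f i) v\<close>, namely \<open>X E = X = E X\<close>, \<open>\<Delta>(mc \<phi> v a) = X \<Delta>(a)\<close> and
\<open>\<Delta>(a mc \<phi> v) = \<Delta>(a) X\<close> (\<open>XL_E1\<close>, \<open>E1_XL\<close>, \<open>XL_DL\<close>, \<open>DL_XL\<close>), and \<open>comodI\<close> goes back from such a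
matrix to a comodule.

The products \<open>S b a\<close> span the algebra, and so do the \<open>a S b\<close>; hence \<open>S\<close> extends to an antihomomorphism
\<open>Sb\<close> of the multiplier algebra (\<open>Sb_mp\<close>). The maps that define the dual comodule have the matrix
\<open>Sb (mc \<phi> (g k))\<close>, which gives their existence, and the comodule axioms for them follow by applying \<open>S \<otimes> S\<close>
with a flip to those of \<open>V\<close>. This uses that \<open>S\<close> is anticomultiplicative (\<open>S2_DL\<close>, \<open>E1_S2\<close>), which in
turn is the usual Hopf algebra computation with the unit replaced by the base algebra \<open>R\<close> and by \<open>E\<close>.

The evaluation of \<open>\<phi> \<otimes> v\<close> is \<open>evm \<phi> v\<close>, the sum of the \<open>Sb (mc \<phi> (g i)) mc (f i) v\<close>, and the opposite product
\<open>Nm \<phi> v\<close>, the sum of the \<open>mc \<phi> (g i) Sb (mc (f i) v)\<close>, describes the coaction on the coevaluation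
\<open>r \<mapsto> \<Sum>i. g i \<otimes> f i r\<close>. In a Hopf algebra both would be \<open>\<phi> v\<close> times the unit. Here the first one lies in
\<open>R\<close> (\<open>evm_slice\<close>, \<open>evm_base\<close>), and the second one is obtained from \<open>E\<close> by letting its first leg act on \<open>V\<close>
(\<open>Nm_E\<close>). Both facts are identities for the functionals \<open>y \<mapsto> \<epsilon>(mc \<phi> v y)\<close> and \<open>y \<mapsto> \<epsilon>(y mc \<phi> v)\<close>,
whereas the axioms only give them for \<open>y \<mapsto> \<epsilon>(x y)\<close> and \<open>y \<mapsto> \<epsilon>(y x)\<close>. The passage is a matter of linear
algebra (\<open>transfer_r\<close>, \<open>transfer_l\<close>): the former functionals vanish wherever all of the latter do.

Finally, fullness of \<open>V\<close> implies that a vector is determined by its coefficient multipliers (\<open>mc_inj\<close>, from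
\<open>coord_expansion\<close>). So the \<open>R\<close>-module laws, the linearity of the two morphisms and the triangle identities may be
checked on coefficients. The triangle identities then say that the products of three matrices \<open>m S(m) m\<close> and
\<open>S(m) m S(m)\<close> are \<open>m\<close> and \<open>S(m)\<close> (\<open>triangle_mc\<close>, \<open>triangle_Sb\<close>).\<close>

section \<open>Linear maps and tensor products\<close>

text \<open>The identity on spaces; writing \<open>AG X\<close> in a statement pins the vector type of \<open>X\<close> to an abelian group.\<close>
abbreviation (input) AG :: "('k::field, 'v::ab_group_add) space \<Rightarrow> ('k, 'v) space" where "AG X \<equiv> X"

lemma vspaceD:
 assumes "vspace X"
 shows vspace_vs: "vector_space (scal X)" and vspace_0: "0 \<in> carr X"
  and vspace_add: "x \<in> carr X ==> y \<in> carr X ==> x + y \<in> carr X"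
  and vspace_scal: "x \<in> carr X ==> scal X c x \<in> carr X"
proof -
 show v: "vector_space (scal X)" using assms by (simp add: vspace_def)
 interpret vector_space "scal X" by (rule v)
 have s: "subspace (carr X)" using assms by (simp add: vspace_def)
 show "0 \<in> carr X" using s by (rule subspace_0)
 show "x \<in> carr X ==> y \<in> carr X ==> x + y \<in> carr X" using s by (rule subspace_add)
 show "x \<in> carr X ==> scal X c x \<in> carr X" using s by (rule subspace_scale)
qed

lemma vspace_neg: assumes "vspace X" "x \<in> carr X" shows "- x \<in> carr X"
proof -
 interpret vector_space "scal X" using assms(1) by (rule vspace_vs)
 show ?thesis using vspace_scal[OF assms, of "-1"] by simp
qed

lemma vspace_diff: "vspace X ==> x \<in> carr X ==> y \<in> carr X ==> x - y \<in> carr X"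
 by (metis vspace_add vspace_neg diff_conv_add_uminus)

lemma vspace_sum: "vspace X ==> (\<And>i. i \<in> I ==> f i \<in> carr X) ==> sum f I \<in> carr X"
 by (induction I rule: infinite_finite_induct) (auto simp: vspace_0 vspace_add)

lemma vspace_sum_list: "vspace X ==> (\<And>i. i \<in> set l ==> f i \<in> carr X) ==> sum_list (map f l) \<in> carr X"
 by (induction l) (auto simp: vspace_0 vspace_add)

lemma linD:
 assumes "lin X Y f"
 shows lin_carr: "x \<in> carr X ==> f x \<in> carr Y"
  and lin_add: "x \<in> carr X ==> y \<in> carr X ==> f (x + y) = f x + f y"
  and lin_scal: "x \<in> carr X ==> f (scal X c x) = scal Y c (f x)"
 using assms by (auto simp: lin_def)

lemma lin_0: "vspace X ==> lin X Y f ==> f (0::'v::ab_group_add) = (0::'w::ab_group_add)"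
 using lin_add[of X Y f 0 0] vspace_0[of X] by simp

lemma lin_diff: "vspace X ==> lin X Y f ==> x \<in> carr X ==> y \<in> carr X
  ==> f (x - y :: 'v::ab_group_add) = (f x - f y :: 'w::ab_group_add)"
 using lin_add[of X Y f "x - y" y] vspace_diff[of X x y] by simp

lemma lin_sum: "vspace X ==> lin X Y f ==> (\<And>i. i \<in> I ==> g i \<in> carr X)
  ==> f (sum g I :: 'v::ab_group_add) = (\<Sum>i\<in>I. (f (g i) :: 'w::ab_group_add))"
 by (induction I rule: infinite_finite_induct) (auto simp: lin_0 lin_add vspace_sum)

lemma lin_sum_list: "vspace X ==> lin X Y f ==> (\<And>i. i \<in> set l ==> g i \<in> carr X)
  ==> f (sum_list (map g l) :: 'v::ab_group_add) = sum_list (map (\<lambda>i. (f (g i) :: 'w::ab_group_add)) l)"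
 by (induction l) (auto simp: lin_0 lin_add vspace_sum_list)

lemma lin_cong: "(\<And>x. x \<in> carr X ==> f x = g x) ==> vspace X ==> lin X Y f ==> lin X Y g"
 by (simp add: lin_def vspace_add vspace_scal)

text \<open>Linearity in a parameter of an expression: a goal \<open>lin W Z (\<lambda>w. ...)\<close> is solved by descending the expression
with these rules.\<close>
named_theorems lins

lemma lin_id[lins]: "lin X X (\<lambda>x. x)" by (simp add: lin_def)

lemma lin_comp: "lin Y Z g ==> lin X Y f ==> lin X Z (\<lambda>x. g (f x))"
 by (simp add: lin_def)

lemma lin_addI: "vspace (Y::('k::field,'v::ab_group_add) space) ==> lin X Y f ==> lin X Y g ==> lin X Y (\<lambda>x. f x + g x)"
 by (auto simp: lin_def vspace_add vector_space.vector_space_assms(1)[OF vspace_vs] ac_simps)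

lemma lin_sumI[lins]:
 assumes Y: "vspace (Y::('k::field,'v::ab_group_add) space)" and "\<And>i. i \<in> I ==> lin X Y (\<lambda>x. f x i)"
 shows "lin X Y (\<lambda>x. \<Sum>i\<in>I. f x i)"
proof -
 interpret vector_space "scal Y" using Y by (rule vspace_vs)
 show ?thesis using assms by (auto simp: lin_def vspace_sum sum.distrib scale_sum_right)
qed

lemma lin_sum_listI:
 assumes Y: "vspace (Y::('k::field,'v::ab_group_add) space)" and "\<And>i. i \<in> set l ==> lin X Y (\<lambda>x. f x i)"
 shows "lin X Y (\<lambda>x. sum_list (map (f x) l))"
 using assms(2)
proof (induction l)
 interpret vector_space "scal Y" using Y by (rule vspace_vs)
 case Nil show ?case using Y by (auto simp: lin_def vspace_0)
next
 case (Cons a l) then show ?case by (auto intro!: lin_addI Y)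
qed

lemma lin_scalI[lins]:
 assumes Y: "vspace (Y::('k::field,'v::ab_group_add) space)" and f: "lin X Y f"
 shows "lin X Y (\<lambda>x. scal Y c (f x))"
proof -
 interpret vector_space "scal Y" using Y by (rule vspace_vs)
 show ?thesis using f Y by (auto simp: lin_def vspace_scal scale_right_distrib scale_left_commute)
qed

lemma vspace_scalars[lins]: "vspace (scalars :: ('k::field, 'k) space)"
proof -
 interpret vector_space "(*) :: 'k \<Rightarrow> 'k \<Rightarrow> 'k" by unfold_locales (auto simp: algebra_simps)
 show ?thesis by (simp add: vspace_def scalars_def subspace_UNIV vector_space_axioms)
qed

lemma carr_scalars[simp, lins]: "x \<in> carr scalars" by (simp add: scalars_def)
lemma scal_scalars[simp]: "scal scalars = (*)" by (simp add: scalars_def)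

lemma lin_scal2[lins]:
 assumes Y: "vspace (Y::('k::field,'v::ab_group_add) space)" and f: "lin X scalars f" and y: "y \<in> carr Y"
 shows "lin X Y (\<lambda>x. scal Y (f x) y)"
proof -
 interpret vector_space "scal Y" using Y by (rule vspace_vs)
 show ?thesis using f Y y by (auto simp: lin_def vspace_scal scale_left_distrib)
qed

lemma lin_times_scalars[lins]: "lin X scalars f ==> lin X scalars (\<lambda>x. c * f x)"
 "lin X scalars f ==> lin X scalars (\<lambda>x. f x * c)"
 by (auto simp: lin_def algebra_simps)

lemma bilinI[lins]: "(\<And>x. x \<in> carr X ==> lin Y Z (b x)) ==> (\<And>y. y \<in> carr Y ==> lin X Z (\<lambda>x. b x y)) ==> bilin X Y Z b"
 by (simp add: bilin_def)

lemma bilinD: "bilin X Y Z b ==> x \<in> carr X ==> lin Y Z (b x)"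
 "bilin X Y Z b ==> y \<in> carr Y ==> lin X Z (\<lambda>x. b x y)"
 by (simp_all add: bilin_def)

lemma vspace_tprod[lins]: "vspace (X \<otimes> Y)" by (simp add: tprod_def vspace_tspace)

lemma scal_tprod: "scal (X \<otimes> Y) = fscal" by (simp add: tprod_def tspace_def)

lemma pure_carr: "x \<in> carr X ==> y \<in> carr Y ==> pure X Y x y \<in> carr (X \<otimes> Y)"
proof -
 interpret F: vector_space "fscal :: 'k::field \<Rightarrow> (('v \<Rightarrow> 'w \<Rightarrow> 'k) \<Rightarrow> 'k) \<Rightarrow> _"
  by (rule vector_space_fscal)
 show "x \<in> carr X ==> y \<in> carr Y ==> pure X Y x y \<in> carr (X \<otimes> Y)"
  by (auto simp: tprod_def tspace_def pure_def intro!: F.span_base)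
qed

lemma bilin_pure: "bilin X Y (X \<otimes> Y) (pure X Y)"
 using pure_carr[of _ X _ Y]
 by (auto simp: bilin_def lin_def pure_def ptensor_def forms_def scal_tprod fscal_def fun_eq_iff scalars_def)

lemma lin_pure1[lins]: "lin W X f ==> y \<in> carr Y ==> lin W (X \<otimes> Y) (\<lambda>w. pure X Y (f w) y)"
 using lin_comp[OF bilinD(2)[OF bilin_pure]] by blast
lemma lin_pure2[lins]: "lin W Y f ==> x \<in> carr X ==> lin W (X \<otimes> Y) (\<lambda>w. pure X Y x (f w))"
 using lin_comp[OF bilinD(1)[OF bilin_pure]] by blast

lemma tens_rep:
 assumes X: "vspace X" and t: "t \<in> carr (X \<otimes> Y)"
 shows "\<exists>l. set l \<subseteq> carr X \<times> carr Y \<and> t = (\<Sum>(x,y)\<leftarrow>l. pure X Y x y)"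
proof -
 interpret F: vector_space "fscal :: 'k::field \<Rightarrow> (('v \<Rightarrow> 'w \<Rightarrow> 'k) \<Rightarrow> 'k) \<Rightarrow> _"
  by (rule vector_space_fscal)
 have "t \<in> F.span {ptensor (forms X Y) x y | x y. x \<in> carr X \<and> y \<in> carr Y}"
  using t by (simp add: tprod_def tspace_def)
 then show ?thesis
 proof (induction rule: F.span_induct_alt)
  case base show ?case by (rule exI[of _ "[]"]) simp
 next
  case (step c u s)
  then obtain x y l where xy: "u = pure X Y x y" "x \<in> carr X" "y \<in> carr Y"
   and l: "set l \<subseteq> carr X \<times> carr Y" "s = (\<Sum>(x,y)\<leftarrow>l. pure X Y x y)" by (auto simp: pure_def)
  have "fscal c u = pure X Y (scal X c x) y"
   using lin_scal[OF bilinD(2)[OF bilin_pure xy(3)] xy(2)] xy by (simp add: scal_tprod)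
  then show ?case using xy l vspace_scal[OF X]
   by (intro exI[of _ "(scal X c x, y) # l"]) auto
 qed
qed

definition trep where
 "trep X Y t = (if t \<in> carr (X \<otimes> Y) then (SOME l. set l \<subseteq> carr X \<times> carr Y \<and> t = (\<Sum>(x,y)\<leftarrow>l. pure X Y x y)) else [])"

text \<open>Sweedler notation: \<open>tsum X Y t b\<close> stands for the sum of the \<open>b t' t''\<close> over the pure summands \<open>t' \<otimes> t''\<close> of
\<open>t\<close>. A decomposition is fixed once and for all, so that the sum makes sense for every \<open>b\<close>; it has a meaning
independent of that choice when \<open>b\<close> is bilinear (\<open>tsum_lift\<close>).\<close>
definition tsum :: "('k::field, 'v::ab_group_add) space \<Rightarrow> ('k, 'w::ab_group_add) space \<Rightarrow> ('k, 'v, 'w) tens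
  \<Rightarrow> ('v \<Rightarrow> 'w \<Rightarrow> 'z::ab_group_add) \<Rightarrow> 'z" where
 "tsum X Y t b = (\<Sum>(x,y)\<leftarrow>trep X Y t. b x y)"

lemma trep_eq: assumes "vspace X" and "t \<in> carr (X \<otimes> Y)"
 shows "t = (\<Sum>(x,y)\<leftarrow>trep X Y t. pure X Y x y)"
 using someI_ex[OF tens_rep[OF assms]] assms(2) by (simp add: trep_def)

lemma trep_set: assumes "vspace X" shows "set (trep X Y t) \<subseteq> carr X \<times> carr Y"
 using someI_ex[OF tens_rep[OF assms]] by (auto simp: trep_def)

lemma tsum_cong: assumes "vspace X" "\<And>x y. x \<in> carr X ==> y \<in> carr Y ==> b x y = c x y"
 shows "tsum X Y t b = tsum X Y t c"
 unfolding tsum_def using trep_set[OF assms(1), of Y t] assms(2)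
 by (intro arg_cong[of _ _ sum_list] map_cong) auto

lemma sum_list_sum_swap: "(\<Sum>p\<leftarrow>l. \<Sum>i\<in>I. (f p i :: 'a::comm_monoid_add)) = (\<Sum>i\<in>I. \<Sum>p\<leftarrow>l. f p i)"
 by (induction l) (auto simp: sum.distrib)

lemma tsum_sum: "tsum X Y t (\<lambda>x y. \<Sum>i\<in>I. b i x y) = (\<Sum>i\<in>I. tsum X Y t (b i))"
proof -
 have "(\<Sum>(x,y)\<leftarrow>l. \<Sum>i\<in>I. b i x y) = (\<Sum>i\<in>I. \<Sum>(x,y)\<leftarrow>l. b i x y)" for l
  by (induction l) (auto simp: sum.distrib)
 then show ?thesis by (simp add: tsum_def)
qed

lemma sum_list_swap: "(\<Sum>x\<leftarrow>l. \<Sum>y\<leftarrow>m. (f x y :: 'a::comm_monoid_add)) = (\<Sum>y\<leftarrow>m. \<Sum>x\<leftarrow>l. f x y)"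
 by (induction l) (simp_all add: sum_list_addf)

lemma tsum_swap: "tsum X Y t (\<lambda>x y. tsum U W s (\<lambda>u w. b x y u w)) = tsum U W s (\<lambda>u w. tsum X Y t (\<lambda>x y. b x y u w))"
 unfolding tsum_def split_def by (rule sum_list_swap)

lemma tsum_carr: "vspace X ==> vspace Z ==> (\<And>x y. x \<in> carr X ==> y \<in> carr Y ==> b x y \<in> carr Z) ==> tsum X Y t b \<in> carr Z"
 unfolding tsum_def using trep_set[of X Y t] by (intro vspace_sum_list) auto

lemma tsum_push:
 assumes "vspace X" "vspace Z" "lin Z Z' f" "\<And>x y. x \<in> carr X ==> y \<in> carr Y ==> b x y \<in> carr Z"
 shows "f (tsum X Y t b) = tsum X Y t (\<lambda>x y. f (b x y))"
 unfolding tsum_def split_def using trep_set[OF assms(1), of Y t] assms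
 by (subst lin_sum_list[OF assms(2,3)]) auto

lemma tsum_self: "vspace X ==> t \<in> carr (X \<otimes> Y) ==> tsum X Y t (pure X Y) = t"
 using trep_eq[of X t Y] by (simp add: tsum_def)

lemma tsum_lift:
 assumes X: "vspace X" and Z: "vspace Z" and b: "bilin X Y Z b" and t: "t \<in> carr (X \<otimes> Y)"
 shows "lift X Y Z b t = tsum X Y t b"
proof -
 have "lift X Y Z b t = lift X Y Z b (tsum X Y t (pure X Y))"
  by (simp only: tsum_self[OF X t])
 also have "\<dots> = tsum X Y t (\<lambda>x y. lift X Y Z b (pure X Y x y))"
  by (rule tsum_push[OF X vspace_tprod lift_lin[OF Z b] pure_carr])
 also have "\<dots> = tsum X Y t b" by (rule tsum_cong[OF X]) (rule lift_pure[OF Z b])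
 finally show ?thesis .
qed

lemma lin_tsum_op: "vspace X ==> vspace Z ==> bilin X Y Z b ==> lin (X \<otimes> Y) Z (\<lambda>t. tsum X Y t b)"
 by (rule lin_cong[OF _ vspace_tprod lift_lin]) (auto intro: tsum_lift)

lemma lin_tsum[lins]: "lin W (X \<otimes> Y) f ==> vspace X ==> vspace Z ==> bilin X Y Z b ==> lin W Z (\<lambda>w. tsum X Y (f w) b)"
 by (rule lin_comp[OF lin_tsum_op])

lemma lin_tsum_c[lins]:
 assumes "vspace X" "vspace Z" "\<And>p q. p \<in> carr X ==> q \<in> carr Y ==> lin W Z (\<lambda>w. F w p q)"
 shows "lin W Z (\<lambda>w. tsum X Y t (F w))"
 unfolding tsum_def split_def using trep_set[OF assms(1), of Y t] assms
 by (intro lin_sum_listI) auto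

lemma tsum_pure: "vspace X ==> vspace Z ==> bilin X Y Z b ==> x \<in> carr X ==> y \<in> carr Y ==> tsum X Y (pure X Y x y) b = b x y"
 by (metis tsum_lift lift_pure pure_carr)

lemma tsum_lin:
 assumes X: "vspace X" and f: "lin (X \<otimes> Y) Z f" and t: "t \<in> carr (X \<otimes> Y)"
 shows "tsum X Y t (\<lambda>x y. f (pure X Y x y)) = f t"
 using tsum_push[OF X vspace_tprod f, of Y "pure X Y" t] tsum_self[OF X t] pure_carr[of _ X _ Y] by simp

lemma tsum_tsum:
 assumes "vspace U" "vspace X" "vspace Z" "bilin X Y Z b"
  "\<And>u w. u \<in> carr U ==> w \<in> carr W ==> F u w \<in> carr (X \<otimes> Y)"
 shows "tsum X Y (tsum U W t F) b = tsum U W t (\<lambda>u w. tsum X Y (F u w) b)"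
 using tsum_push[OF assms(1) vspace_tprod lin_tsum_op[OF assms(2-4)], of W F t] assms(5) by simp

lemma lin_tens_eq:
 assumes "vspace X" "lin (X \<otimes> AG Y) (AG Z) f" "lin (X \<otimes> Y) Z g" "t \<in> carr (X \<otimes> Y)"
  "\<And>x y. x \<in> carr X ==> y \<in> carr Y ==> f (pure X Y x y) = g (pure X Y x y)"
 shows "f t = g t"
proof -
 have "tsum X Y t (\<lambda>x y. f (pure X Y x y)) = tsum X Y t (\<lambda>x y. g (pure X Y x y))"
  by (rule tsum_cong[OF assms(1,5)])
 then show ?thesis by (simp only: tsum_lin[OF assms(1,2,4)] tsum_lin[OF assms(1,3,4)])
qed

section \<open>Expansion and separation of tensors\<close>

text \<open>The coefficients in an expansion with linearly independent first factors are slices of the tensor by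
functionals. So what is known about all slices can be read off from the expansion.\<close>
lemma tens_expand_left:
 assumes X: "vspace X" and Y: "vspace Y" and t: "t \<in> carr (X \<otimes> Y)"
 shows "\<exists>B y. finite B \<and> B \<subseteq> carr X \<and> \<not> module.dependent (scal X) B \<and>
   t = (\<Sum>e\<in>B. pure X Y e (y e)) \<and>
   (\<forall>e\<in>B. y e \<in> carr Y \<and> (\<exists>\<phi>. lin X scalars \<phi> \<and> y e = tsum X Y t (\<lambda>x z. scal Y (\<phi> x) z)))"
proof -
 interpret X: vector_space "scal X" using X by (rule vspace_vs)
 obtain B0 where B0: "B0 \<subseteq> carr X" "X.independent B0" "carr X \<subseteq> X.span B0"
  using X.maximal_independent_subset by blast
 define \<phi> where "\<phi> e x = X.representation B0 x e" for e x
 have lin\<phi>: "lin X scalars (\<phi> e)" for e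
  using B0 by (auto simp: lin_def \<phi>_def X.representation_add[OF B0(2)] X.representation_scale[OF B0(2)] subset_iff)
 define B where "B = (\<Union>p\<in>set (trep X Y t). {e. \<phi> e (fst p) \<noteq> 0})"
 have "finite {e. \<phi> e x \<noteq> 0}" for x unfolding \<phi>_def by (rule X.finite_representation)
 then have fin: "finite B" by (auto simp: B_def)
 have BB0: "B \<subseteq> B0" unfolding B_def \<phi>_def using X.representation_ne_zero by blast
 define y where "y e = tsum X Y t (\<lambda>x z. scal Y (\<phi> e x) z)" for e
 have yc: "y e \<in> carr Y" for e unfolding y_def
  by (rule tsum_carr[OF X Y]) (rule vspace_scal[OF Y])
 have rs: "fst p \<in> carr X" "snd p \<in> carr Y" if "p \<in> set (trep X Y t)" for p
  using trep_set[OF X, of Y t] that by auto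
 have ex: "pure X Y (fst p) (snd p) = (\<Sum>e\<in>B. pure X Y e (scal Y (\<phi> e (fst p)) (snd p)))"
  if p: "p \<in> set (trep X Y t)" for p
 proof -
  have "fst p = (\<Sum>e | \<phi> e (fst p) \<noteq> 0. scal X (\<phi> e (fst p)) e)"
   using X.sum_nonzero_representation_eq[OF B0(2), of "fst p"] rs[OF p] B0(3) by (auto simp: \<phi>_def)
  also have "\<dots> = (\<Sum>e\<in>B. scal X (\<phi> e (fst p)) e)"
   by (rule sum.mono_neutral_left[OF fin]) (use p in \<open>auto simp: B_def\<close>)
  finally have e: "fst p = (\<Sum>e\<in>B. scal X (\<phi> e (fst p)) e)" .
  have "pure X Y (fst p) (snd p) = (\<Sum>e\<in>B. pure X Y (scal X (\<phi> e (fst p)) e) (snd p))"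
   by (subst e, rule lin_sum[OF X bilinD(2)[OF bilin_pure rs(2)[OF p]]])
    (use BB0 B0(1) vspace_scal[OF X] in auto)
  also have "\<dots> = (\<Sum>e\<in>B. pure X Y e (scal Y (\<phi> e (fst p)) (snd p)))"
  proof (rule sum.cong[OF refl])
   fix e assume "e \<in> B" then have ec: "e \<in> carr X" using BB0 B0(1) by auto
   show "pure X Y (scal X (\<phi> e (fst p)) e) (snd p) = pure X Y e (scal Y (\<phi> e (fst p)) (snd p))"
    using lin_scal[OF bilinD(2)[OF bilin_pure rs(2)[OF p]] ec]
     lin_scal[OF bilinD(1)[OF bilin_pure ec] rs(2)[OF p]] by simp
  qed
  finally show ?thesis .
 qed
 have "t = (\<Sum>p\<leftarrow>trep X Y t. pure X Y (fst p) (snd p))"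
  using trep_eq[OF X t] by (simp add: split_def)
 also have "\<dots> = (\<Sum>p\<leftarrow>trep X Y t. \<Sum>e\<in>B. pure X Y e (scal Y (\<phi> e (fst p)) (snd p)))"
  using ex by (intro arg_cong[of _ _ sum_list] map_cong) auto
 also have "\<dots> = (\<Sum>e\<in>B. \<Sum>p\<leftarrow>trep X Y t. pure X Y e (scal Y (\<phi> e (fst p)) (snd p)))"
  unfolding sum_list_sum_swap ..
 also have "\<dots> = (\<Sum>e\<in>B. pure X Y e (y e))"
 proof (rule sum.cong[OF refl])
  fix e assume "e \<in> B" then have ec: "e \<in> carr X" using BB0 B0(1) by auto
  show "(\<Sum>p\<leftarrow>trep X Y t. pure X Y e (scal Y (\<phi> e (fst p)) (snd p))) = pure X Y e (y e)"
  proof -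
   have "pure X Y e (tsum X Y t (\<lambda>x z. scal Y (\<phi> e x) z)) = tsum X Y t (\<lambda>x z. pure X Y e (scal Y (\<phi> e x) z))"
    by (rule tsum_push[OF X Y bilinD(1)[OF bilin_pure ec]]) (rule vspace_scal[OF Y])
   then show ?thesis by (simp add: y_def tsum_def split_def)
  qed
 qed
 finally have "t = (\<Sum>e\<in>B. pure X Y e (y e))" .
 moreover have "\<not> X.dependent B" using X.dependent_mono BB0 B0(2) by blast
 moreover have "B \<subseteq> carr X" using BB0 B0(1) by auto
 moreover have "\<forall>e\<in>B. y e \<in> carr Y \<and> (\<exists>\<phi>. lin X scalars \<phi> \<and> y e = tsum X Y t (\<lambda>x z. scal Y (\<phi> x) z))"
  using yc lin\<phi> y_def by blast
 ultimately show ?thesis using fin by (intro exI[of _ B] exI[of _ y]) blast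
qed

lemma tw_pure: "x \<in> carr (AG X) ==> y \<in> carr (AG Y) ==> tw X Y (pure X Y x y) = pure Y X y x"
 unfolding tw_def by (rule lift_pure[OF vspace_tprod]) (intro lins)
lemma lin_tw: "lin (AG X \<otimes> AG Y) (Y \<otimes> X) (tw X Y)"
 unfolding tw_def by (rule lift_lin[OF vspace_tprod]) (intro lins)
lemma tw_tsum: "vspace X ==> t \<in> carr (X \<otimes> Y) ==> tw X Y t = tsum X Y t (\<lambda>x y. pure Y X y x)"
 unfolding tw_def by (rule tsum_lift[OF _ vspace_tprod]) (assumption | intro lins)+

lemma tens_expand_right:
 assumes X: "vspace X" and Y: "vspace Y" and t: "t \<in> carr (X \<otimes> Y)"
 shows "\<exists>B x. finite B \<and> B \<subseteq> carr Y \<and> \<not> module.dependent (scal Y) B \<and>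
   t = (\<Sum>e\<in>B. pure X Y (x e) e) \<and>
   (\<forall>e\<in>B. x e \<in> carr X \<and> (\<exists>\<phi>. lin Y scalars \<phi> \<and> x e = tsum X Y t (\<lambda>z y. scal X (\<phi> y) z)))"
proof -
 have tt: "tw X Y t \<in> carr (Y \<otimes> X)" by (rule lin_carr[OF lin_tw t])
 obtain B x where B: "finite B" "B \<subseteq> carr Y" "\<not> module.dependent (scal Y) B"
  "tw X Y t = (\<Sum>e\<in>B. pure Y X e (x e))"
  "\<forall>e\<in>B. x e \<in> carr X \<and> (\<exists>\<phi>. lin Y scalars \<phi> \<and> x e = tsum Y X (tw X Y t) (\<lambda>x z. scal X (\<phi> x) z))"
  using tens_expand_left[OF Y X tt] by blast
 have "tw Y X (tw X Y t) = t"
  by (rule lin_tens_eq[OF X lin_comp[OF lin_tw lin_tw] lin_id t]) (simp add: tw_pure)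
 moreover have "tw Y X (\<Sum>e\<in>B. pure Y X e (x e)) = (\<Sum>e\<in>B. pure X Y (x e) e)"
  using B(2,5) by (subst lin_sum[OF vspace_tprod lin_tw]) (auto intro!: pure_carr sum.cong tw_pure)
 ultimately have "t = (\<Sum>e\<in>B. pure X Y (x e) e)" using B(4) by simp
 moreover have "tsum Y X (tw X Y t) (\<lambda>y z. scal X (\<phi> y) z) = tsum X Y t (\<lambda>z y. scal X (\<phi> y) z)"
  if "lin Y scalars \<phi>" for \<phi>
 proof -
  have "tsum Y X (tw X Y t) (\<lambda>y z. scal X (\<phi> y) z)
    = tsum X Y t (\<lambda>x y. tsum Y X (pure Y X y x) (\<lambda>y z. scal X (\<phi> y) z))"
   unfolding tw_tsum[OF X t] by (rule tsum_tsum[OF X Y X]) (intro lins that X pure_carr; assumption)+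
  also have "\<dots> = tsum X Y t (\<lambda>z y. scal X (\<phi> y) z)"
   by (rule tsum_cong[OF X], rule tsum_pure[OF Y X]) (intro lins that X; assumption)+
  finally show ?thesis .
 qed
 ultimately show ?thesis using B by (intro exI[of _ B] exI[of _ x]) metis
qed

text \<open>Slices by functionals detect tensors, since the coefficients of an expansion with independent factors are slices.\<close>
lemma tens_sep_left:
 assumes X: "vspace X" and Y: "vspace Y" and t: "t \<in> carr (X \<otimes> Y)"
  and z: "\<And>\<phi>. lin X scalars \<phi> ==> tsum X Y t (\<lambda>x y. scal Y (\<phi> x) y) = 0"
 shows "t = 0"
proof -
 obtain B y where t': "t = (\<Sum>e\<in>B. pure X Y e (y e))" and B: "B \<subseteq> carr X"
   and "\<forall>e\<in>B. y e \<in> carr Y \<and> (\<exists>\<phi>. lin X scalars \<phi> \<and> y e = tsum X Y t (\<lambda>x z. scal Y (\<phi> x) z))"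
  using tens_expand_left[OF X Y t] by blast
 then have "y e = 0" if "e \<in> B" for e using z that by auto
 then show ?thesis unfolding t' using B lin_0[OF Y bilinD(1)[OF bilin_pure]]
  by (auto intro!: sum.neutral)
qed

lemma tens_sep_right:
 assumes X: "vspace X" and Y: "vspace Y" and t: "t \<in> carr (X \<otimes> Y)"
  and z: "\<And>\<phi>. lin Y scalars \<phi> ==> tsum X Y t (\<lambda>x y. scal X (\<phi> y) x) = 0"
 shows "t = 0"
proof -
 obtain B y where t': "t = (\<Sum>e\<in>B. pure X Y (y e) e)" and B: "B \<subseteq> carr Y"
   and "\<forall>e\<in>B. y e \<in> carr X \<and> (\<exists>\<phi>. lin Y scalars \<phi> \<and> y e = tsum X Y t (\<lambda>z x. scal X (\<phi> x) z))"
  using tens_expand_right[OF X Y t] by blast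
 then have "y e = 0" if "e \<in> B" for e using z that by auto
 then show ?thesis unfolding t' using B lin_0[OF X bilinD(2)[OF bilin_pure]]
  by (auto intro!: sum.neutral)
qed

section \<open>Maps between tensor products\<close>

lemma tmap_tsum: "vspace X ==> lin X (AG X') f ==> lin Y (AG Y') g ==> t \<in> carr (X \<otimes> Y)
  ==> tmap X Y X' Y' f g t = tsum X Y t (\<lambda>x y. pure X' Y' (f x) (g y))"
 unfolding tmap_def by (rule tsum_lift[OF _ vspace_tprod]) (auto intro!: lins lin_carr[of X X' f] lin_carr[of Y Y' g])

lemma tmap_pure: "lin (AG X) (AG X') f ==> lin (AG Y) (AG Y') g ==> x \<in> carr X ==> y \<in> carr Y
  ==> tmap X Y X' Y' f g (pure X Y x y) = pure X' Y' (f x) (g y)"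
 unfolding tmap_def by (rule lift_pure[OF vspace_tprod]) (auto intro!: lins lin_carr[of X X' f] lin_carr[of Y Y' g])

lemma lin_tmap: "lin (AG X) (AG X') f ==> lin (AG Y) (AG Y') g ==> lin (X \<otimes> Y) (X' \<otimes> Y') (tmap X Y X' Y' f g)"
 unfolding tmap_def by (rule lift_lin[OF vspace_tprod]) (auto intro!: lins lin_carr[of X X' f] lin_carr[of Y Y' g])

lemma lin_idc: "lin X X id" by (simp add: lin_def)

lemma bilin_assoc_aux: "z \<in> carr (AG Z) ==> bilin (AG X) (AG Y) (X \<otimes> (Y \<otimes> Z)) (\<lambda>x y. pure X (Y \<otimes> Z) x (pure Y Z y z))"
 by (intro lins pure_carr)
lemma assoc_lin2: "vspace X ==> bilin (X \<otimes> AG Y) Z (X \<otimes> (Y \<otimes> Z))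
  (\<lambda>t z. tsum X Y t (\<lambda>x y. pure X (Y \<otimes> Z) x (pure Y Z y z)))"
 by (intro lins pure_carr)

lemma bilin_cong: "(\<And>x y. x \<in> carr X ==> y \<in> carr Y ==> b x y = c x y) ==> vspace X ==> vspace Y ==> bilin X Y Z b ==> bilin X Y Z c"
proof (unfold bilin_def, intro conjI ballI)
 assume a: "\<And>x y. x \<in> carr X ==> y \<in> carr Y ==> b x y = c x y" "vspace X" "vspace Y"
  "(\<forall>x\<in>carr X. lin Y Z (b x)) \<and> (\<forall>y\<in>carr Y. lin X Z (\<lambda>x. b x y))"
 show "lin Y Z (c x)" if "x \<in> carr X" for x
  by (rule lin_cong[of Y "b x"]) (use a that in auto)
 show "lin X Z (\<lambda>x. c x y)" if "y \<in> carr Y" for y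
  by (rule lin_cong[of X "\<lambda>x. b x y"]) (use a that in auto)
qed

lemma bilin_assoc: "vspace X ==> vspace Z ==> bilin (X \<otimes> AG Y) Z (X \<otimes> (Y \<otimes> Z))
   (\<lambda>t z. lift X Y (X \<otimes> (Y \<otimes> Z)) (\<lambda>x y. pure X (Y \<otimes> Z) x (pure Y Z y z)) t)"
 by (rule bilin_cong[OF tsum_lift[symmetric] _ _ assoc_lin2]) (auto intro!: bilin_assoc_aux vspace_tprod)

lemma assoc_pure: "vspace X ==> vspace Z ==> x \<in> carr X ==> y \<in> carr (AG Y) ==> z \<in> carr Z
 ==> assoc X Y Z (pure (X \<otimes> Y) Z (pure X Y x y) z) = pure X (Y \<otimes> Z) x (pure Y Z y z)"
 unfolding assoc_def
 by (subst lift_pure[OF vspace_tprod bilin_assoc]) (auto intro!: pure_carr lift_pure vspace_tprod bilin_assoc_aux)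

lemma lin_assoc: "vspace X ==> vspace Z ==> lin ((X \<otimes> AG Y) \<otimes> Z) (X \<otimes> (Y \<otimes> Z)) (assoc X Y Z)"
 unfolding assoc_def by (rule lift_lin[OF vspace_tprod bilin_assoc])

lemma bilin_assoc_inv: "vspace X ==> vspace Y ==> bilin X (Y \<otimes> AG Z) ((X \<otimes> Y) \<otimes> Z)
   (\<lambda>x t. lift Y Z ((X \<otimes> Y) \<otimes> Z) (\<lambda>y z. pure (X \<otimes> Y) Z (pure X Y x y) z) t)"
proof (rule bilin_cong[OF tsum_lift[symmetric]])
 assume v: "vspace X" "vspace Y"
 show "bilin X (Y \<otimes> Z) ((X \<otimes> Y) \<otimes> Z) (\<lambda>x t. tsum Y Z t (\<lambda>y z. pure (X \<otimes> Y) Z (pure X Y x y) z))"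
  by (intro lins pure_carr v)
 show "\<And>x t. x \<in> carr X ==> bilin Y Z ((X \<otimes> Y) \<otimes> Z) (\<lambda>y z. pure (X \<otimes> Y) Z (pure X Y x y) z)"
  by (intro lins pure_carr)
qed (auto intro: lins)

lemma assoc_inv_tsum: "vspace X ==> vspace Y ==> x \<in> carr X ==> t \<in> carr (Y \<otimes> Z)
 ==> assoc_inv X Y Z (pure X (Y \<otimes> Z) x t) = tsum Y Z t (\<lambda>y z. pure (X \<otimes> Y) Z (pure X Y x y) z)"
 unfolding assoc_inv_def
 by (subst lift_pure[OF vspace_tprod bilin_assoc_inv]) (auto intro!: tsum_lift lins pure_carr)

lemma lin_assoc_inv: "vspace X ==> vspace Y ==> lin (X \<otimes> (Y \<otimes> AG Z)) ((X \<otimes> Y) \<otimes> Z) (assoc_inv X Y Z)"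
 unfolding assoc_inv_def by (rule lift_lin[OF vspace_tprod bilin_assoc_inv])

lemma leg12_pure: "lin (AG X \<otimes> AG Y) (X \<otimes> Y) f ==> t \<in> carr (X \<otimes> Y) ==> z \<in> carr (AG Z)
 ==> leg12 X Y Z f (pure (X \<otimes> Y) Z t z) = pure (X \<otimes> Y) Z (f t) z"
 unfolding leg12_def by (simp add: tmap_pure lin_idc)
lemma lin_leg12: "lin (AG X \<otimes> AG Y) (X \<otimes> Y) f ==> lin ((X \<otimes> Y) \<otimes> AG Z) ((X \<otimes> Y) \<otimes> Z) (leg12 X Y Z f)"
 unfolding leg12_def by (rule lin_tmap[OF _ lin_idc])

lemma leg23_pure: "vspace X ==> vspace Z ==> vspace Y' ==> lin (AG Y \<otimes> Z) (Y' \<otimes> AG Z') g ==> x \<in> carr X ==> y \<in> carr Y ==> z \<in> carr Z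
 ==> leg23 X Y Z Y' Z' g (pure (X \<otimes> Y) Z (pure X Y x y) z)
   = tsum Y' Z' (g (pure Y Z y z)) (\<lambda>y z. pure (X \<otimes> Y') Z' (pure X Y' x y) z)"
 unfolding leg23_def
 by (simp add: assoc_pure tmap_pure lin_idc pure_carr assoc_inv_tsum lin_carr)
lemma lin_leg23: "vspace X ==> vspace Z ==> vspace Y' ==> lin (AG Y \<otimes> Z) (Y' \<otimes> AG Z') g
 ==> lin ((X \<otimes> Y) \<otimes> Z) ((X \<otimes> Y') \<otimes> Z') (leg23 X Y Z Y' Z' g)"
 unfolding leg23_def comp_def
 by (rule lin_comp[OF lin_assoc_inv lin_comp[OF lin_tmap[OF lin_idc] lin_assoc]])

lemma leg13_pure:
 assumes v: "vspace X" "vspace Z" "vspace Y" and f: "lin (X \<otimes> Z) (X \<otimes> Z) f" and c: "x \<in> carr X" "y \<in> carr Y" "z \<in> carr Z"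
 shows "leg13 X Y Z f (pure (X \<otimes> Y) Z (pure X Y x y) z)
   = tsum X Z (f (pure X Z x z)) (\<lambda>x z. pure (X \<otimes> Y) Z (pure X Y x y) z)"
proof -
 have 1: "leg23 X Y Z Z Y (tw Y Z) (pure (X \<otimes> Y) Z (pure X Y x y) z) = pure (X \<otimes> Z) Y (pure X Z x z) y"
  using c v by (subst leg23_pure[OF v(1,2,2) lin_tw]) (auto simp: tw_pure intro!: tsum_pure lins pure_carr)
 have fx: "f (pure X Z x z) \<in> carr (X \<otimes> Z)" by (rule lin_carr[OF f]) (intro pure_carr c)
 have 2: "pure (X \<otimes> Z) Y (f (pure X Z x z)) y = tsum X Z (f (pure X Z x z)) (\<lambda>x z. pure (X \<otimes> Z) Y (pure X Z x z) y)"
  by (rule sym, rule tsum_lin[OF v(1) _ fx, where f="\<lambda>t. pure (X \<otimes> Z) Y t y" and Z="(X \<otimes> Z) \<otimes> Y"]) (intro lins c)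
 have "leg23 X Z Y Y Z (tw Z Y) (tsum X Z (f (pure X Z x z)) (\<lambda>x z. pure (X \<otimes> Z) Y (pure X Z x z) y))
   = tsum X Z (f (pure X Z x z)) (\<lambda>x z. leg23 X Z Y Y Z (tw Z Y) (pure (X \<otimes> Z) Y (pure X Z x z) y))"
  using v c by (intro tsum_push[OF v(1) vspace_tprod lin_leg23]) (auto intro!: lin_tw pure_carr)
 also have "\<dots> = tsum X Z (f (pure X Z x z)) (\<lambda>x z. pure (X \<otimes> Y) Z (pure X Y x y) z)"
 proof (rule tsum_cong[OF v(1)])
  fix x z assume "x \<in> carr X" "z \<in> carr Z"
  then show "leg23 X Z Y Y Z (tw Z Y) (pure (X \<otimes> Z) Y (pure X Z x z) y) = pure (X \<otimes> Y) Z (pure X Y x y) z"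
   using c v by (subst leg23_pure[OF v(1,3,3) lin_tw]) (auto simp: tw_pure intro!: tsum_pure lins pure_carr)
 qed
 finally show ?thesis unfolding leg13_def using 1 2
  by (simp add: leg12_pure[OF f] pure_carr c)
qed
lemma lin_leg13: "vspace X ==> vspace Z ==> vspace Y ==> lin (X \<otimes> Z) (X \<otimes> Z) f
 ==> lin ((X \<otimes> Y) \<otimes> Z) ((X \<otimes> Y) \<otimes> Z) (leg13 X Y Z f)"
 unfolding leg13_def comp_def
 by (rule lin_comp[OF lin_leg23 lin_comp[OF lin_leg12 lin_leg23]]) (auto intro: lin_tw)

section \<open>Trilinear maps\<close>

definition tril where
 "tril X Y U Z g \<longleftrightarrow> (\<forall>u\<in>carr U. bilin X Y Z (\<lambda>x y. g x y u)) \<and> (\<forall>x\<in>carr X. \<forall>y\<in>carr Y. lin U Z (g x y))"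

lemma trilI[lins]: "(\<And>y u. y \<in> carr Y ==> u \<in> carr U ==> lin X Z (\<lambda>x. g x y u)) ==>
  (\<And>x u. x \<in> carr X ==> u \<in> carr U ==> lin Y Z (\<lambda>y. g x y u)) ==>
  (\<And>x y. x \<in> carr X ==> y \<in> carr Y ==> lin U Z (\<lambda>u. g x y u)) ==> tril X Y U Z g"
 by (auto simp: tril_def bilin_def)

lemma trilD: "tril X Y U Z g ==> y \<in> carr Y ==> u \<in> carr U ==> lin X Z (\<lambda>x. g x y u)"
 "tril X Y U Z g ==> x \<in> carr X ==> u \<in> carr U ==> lin Y Z (\<lambda>y. g x y u)"
 "tril X Y U Z g ==> x \<in> carr X ==> y \<in> carr Y ==> lin U Z (\<lambda>u. g x y u)"
 by (auto simp: tril_def bilin_def)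

definition tsum3 where "tsum3 X Y U t g = tsum (X \<otimes> Y) U t (\<lambda>s u. tsum X Y s (\<lambda>x y. g x y u))"

lemma bilin_tsum3: "vspace X ==> vspace Z ==> tril X Y U Z g ==> bilin (X \<otimes> Y) U Z (\<lambda>s u. tsum X Y s (\<lambda>x y. g x y u))"
 by (intro lins) (auto intro: trilD)

lemma tsum3_lin: "vspace X ==> vspace Z ==> tril X Y U Z g ==> lin ((X \<otimes> Y) \<otimes> U) Z (\<lambda>t. tsum3 X Y U t g)"
 unfolding tsum3_def by (rule lin_tsum_op[OF vspace_tprod _ bilin_tsum3])

lemma tsum3_pure: "vspace X ==> vspace Z ==> tril X Y U Z g ==> s \<in> carr (X \<otimes> Y) ==> u \<in> carr U
  ==> tsum3 X Y U (pure (X \<otimes> Y) U s u) g = tsum X Y s (\<lambda>x y. g x y u)"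
 unfolding tsum3_def by (rule tsum_pure[OF vspace_tprod _ bilin_tsum3])

lemma tsum3_pure2: assumes "vspace X" "vspace Z" "tril X Y U Z g" "x \<in> carr X" "y \<in> carr Y" "u \<in> carr U"
  shows "tsum3 X Y U (pure (X \<otimes> Y) U (pure X Y x y) u) g = g x y u"
proof -
 have b: "bilin X Y Z (\<lambda>x y. g x y u)" using assms(3,6) by (simp add: tril_def)
 show ?thesis by (simp add: tsum3_pure[OF assms(1-3)] pure_carr assms(4-6) tsum_pure[OF assms(1,2) b])
qed

section \<open>Functionals and spans\<close>

text \<open>A vector outside the span of \<open>P\<close> could be completed, together with a basis of that span, to a basis, and its coordinate
functional would vanish on \<open>P\<close>.\<close>
lemma span_UNIV_by_functionals:
 assumes V: "vector_space s" and h: "\<And>\<psi>. lin \<lparr>carr = UNIV, scal = s\<rparr> scalars \<psi> ==> (\<And>x. x \<in> P ==> \<psi> x = 0) ==> (\<And>x. \<psi> x = 0)"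
 shows "module.span s P = UNIV"
proof (rule ccontr)
 interpret vector_space s by (rule V)
 interpret K: vector_space "(*) :: 'a \<Rightarrow> 'a \<Rightarrow> 'a" by unfold_locales (auto simp: algebra_simps)
 interpret VK: vector_space_pair s "(*) :: 'a \<Rightarrow> 'a \<Rightarrow> 'a" ..
 assume "span P \<noteq> UNIV"
 then obtain x where x: "x \<notin> span P" by auto
 obtain B where B: "B \<subseteq> P" "independent B" "P \<subseteq> span B" using maximal_independent_subset by blast
 have sp: "span B = span P" using B span_mono[OF B(1)] span_minimal[OF B(3)] by auto
 have ind: "independent (insert x B)" using x B(2) sp by (simp add: independent_insert)
 define \<psi> where "\<psi> = VK.construct (insert x B) (\<lambda>y. if y = x then 1 else 0)"
 have l: "Vector_Spaces.linear s (*) \<psi>" unfolding \<psi>_def by (rule VK.linear_construct[OF ind])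
 interpret l: Vector_Spaces.linear s "(*)" \<psi> by (rule l)
 have xB: "x \<notin> B" using x span_superset[of B] sp by auto
 have "\<psi> b = 0" if "b \<in> B" for b
  unfolding \<psi>_def using VK.construct_basis[OF ind, of b] that xB by auto
 note b0 = this
 have "\<psi> y = 0" if "y \<in> span B" for y
  using that by (induction rule: span_induct_alt) (simp_all add: l.add l.scale b0)
 then have "\<psi> y = 0" if "y \<in> P" for y using B that by auto
 moreover have "lin \<lparr>carr = UNIV, scal = s\<rparr> scalars \<psi>" by (simp add: lin_def l.add l.scale)
 ultimately have "\<psi> x = 0" using h by blast
 moreover have "\<psi> x = 1" unfolding \<psi>_def using VK.construct_basis[OF ind, of x] by simp
 ultimately show False by simp
qed

text \<open>The common principle behind extending an identity from a spanning set to the span.\<close>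
lemma lin_span_eq:
 fixes X :: "('k::field, 'v::ab_group_add) space" and Z :: "('k, 'z::ab_group_add) space"
 assumes X: "vspace X" and f: "lin X Z f" and g: "lin X Z g" and P: "P \<subseteq> carr X"
  and e: "\<And>x. x \<in> P ==> f x = g x" and x: "x \<in> module.span (scal X) P"
 shows "f x = g x"
proof -
 interpret vector_space "scal X" by (rule vspace_vs[OF X])
 from x have "x \<in> carr X \<and> f x = g x"
 proof (induction rule: span_induct_alt)
  case base show ?case by (simp only: vspace_0[OF X] lin_0[OF X f] lin_0[OF X g] simp_thms)
 next
  case (step c x y)
  have x: "x \<in> carr X" "f x = g x" using step P e by auto
  have y: "y \<in> carr X" "f y = g y" using step by auto
  have cx: "scal X c x \<in> carr X" by (rule vspace_scal[OF X x(1)])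
  have "f (scal X c x + y) = g (scal X c x + y)"
   by (simp only: lin_add[OF f cx y(1)] lin_add[OF g cx y(1)] lin_scal[OF f x(1)] lin_scal[OF g x(1)] x y)
  then show ?case using vspace_add[OF X cx y(1)] by blast
 qed
 then show ?thesis ..
qed

lemma lin_tens3_eq:
 assumes X: "vspace X" and f: "lin ((X \<otimes> AG Y) \<otimes> AG U) (AG Z) f" and g: "lin ((X \<otimes> Y) \<otimes> U) Z g"
  and t: "t \<in> carr ((X \<otimes> Y) \<otimes> U)"
  and e: "\<And>x y u. x \<in> carr X ==> y \<in> carr Y ==> u \<in> carr U ==>
    f (pure (X \<otimes> Y) U (pure X Y x y) u) = g (pure (X \<otimes> Y) U (pure X Y x y) u)"
 shows "f t = g t"
proof (rule lin_tens_eq[OF vspace_tprod f g t])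
 fix s u assume s: "s \<in> carr (X \<otimes> Y)" and u: "u \<in> carr U"
 show "f (pure (X \<otimes> Y) U s u) = g (pure (X \<otimes> Y) U s u)"
  by (rule lin_tens_eq[OF X lin_comp[OF f] lin_comp[OF g] s]) (intro lins u, intro lins u, rule e[OF _ _ u])
qed

text \<open>The maps that act on two of three legs become iterated Sweedler sums. This is how the axioms, stated as equations
between maps, are turned into equations between elements.\<close>
lemma tsum3_leg12:
 assumes X: "vspace X" and Z: "vspace Z" and f: "lin (X \<otimes> Y) (X \<otimes> Y) f"
  and g: "tril X Y U Z g" and t: "t \<in> carr ((X \<otimes> Y) \<otimes> U)"
 shows "tsum3 X Y U (leg12 X Y U f t) g = tsum3 X Y U t (\<lambda>x y u. tsum X Y (f (pure X Y x y)) (\<lambda>p q. g p q u))"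
proof (rule lin_tens3_eq[OF X lin_comp[OF tsum3_lin[OF X Z g] lin_leg12[OF f]] tsum3_lin[OF X Z] t])
 show g': "tril X Y U Z (\<lambda>x y u. tsum X Y (f (pure X Y x y)) (\<lambda>p q. g p q u))"
  by (intro lins X Z lin_comp[OF f] trilD[OF g]; assumption)
 show "tsum3 X Y U (leg12 X Y U f (pure (X \<otimes> Y) U (pure X Y x y) u)) g
   = tsum3 X Y U (pure (X \<otimes> Y) U (pure X Y x y) u) (\<lambda>x y u. tsum X Y (f (pure X Y x y)) (\<lambda>p q. g p q u))"
  if c: "x \<in> carr X" "y \<in> carr Y" "u \<in> carr U" for x y u
  by (simp add: tsum3_pure2[OF X Z g' c] leg12_pure[OF f pure_carr] c tsum3_pure[OF X Z g] lin_carr[OF f] pure_carr)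
qed

lemma tsum3_leg23:
 assumes X: "vspace X" and U: "vspace U" and Z: "vspace Z" and Y': "vspace Y'" and f: "lin (Y \<otimes> U) (Y' \<otimes> U') f"
  and g: "tril X Y' U' Z g" and t: "t \<in> carr ((X \<otimes> Y) \<otimes> U)"
 shows "tsum3 X Y' U' (leg23 X Y U Y' U' f t) g = tsum3 X Y U t (\<lambda>x y u. tsum Y' U' (f (pure Y U y u)) (\<lambda>p q. g x p q))"
proof (rule lin_tens3_eq[OF X lin_comp[OF tsum3_lin[OF X Z g] lin_leg23[OF X U Y' f]] tsum3_lin[OF X Z] t])
 show g': "tril X Y U Z (\<lambda>x y u. tsum Y' U' (f (pure Y U y u)) (\<lambda>p q. g x p q))"
  by (intro lins X Z Y' lin_comp[OF f] trilD[OF g]; assumption)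
 show "tsum3 X Y' U' (leg23 X Y U Y' U' f (pure (X \<otimes> Y) U (pure X Y x y) u)) g
   = tsum3 X Y U (pure (X \<otimes> Y) U (pure X Y x y) u) (\<lambda>x y u. tsum Y' U' (f (pure Y U y u)) (\<lambda>p q. g x p q))"
  if c: "x \<in> carr X" "y \<in> carr Y" "u \<in> carr U" for x y u
 proof -
  have "tsum3 X Y' U' (tsum Y' U' (f (pure Y U y u)) (\<lambda>p q. pure (X \<otimes> Y') U' (pure X Y' x p) q)) g
   = tsum Y' U' (f (pure Y U y u)) (\<lambda>p q. tsum3 X Y' U' (pure (X \<otimes> Y') U' (pure X Y' x p) q) g)"
   by (rule tsum_push[OF Y' vspace_tprod tsum3_lin[OF X Z g]]) (intro pure_carr c)
  also have "\<dots> = tsum Y' U' (f (pure Y U y u)) (\<lambda>p q. g x p q)"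
   by (rule tsum_cong[OF Y']) (simp add: tsum3_pure2[OF X Z g] c)
  finally show ?thesis
   by (simp add: tsum3_pure2[OF X Z g' c] leg23_pure[OF X U Y' f] c)
 qed
qed

lemma tsum3_leg13:
 assumes X: "vspace X" and U: "vspace U" and Z: "vspace Z" and Y: "vspace Y" and f: "lin (X \<otimes> U) (X \<otimes> U) f"
  and g: "tril X Y U Z g" and t: "t \<in> carr ((X \<otimes> Y) \<otimes> U)"
 shows "tsum3 X Y U (leg13 X Y U f t) g = tsum3 X Y U t (\<lambda>x y u. tsum X U (f (pure X U x u)) (\<lambda>p q. g p y q))"
proof (rule lin_tens3_eq[OF X lin_comp[OF tsum3_lin[OF X Z g] lin_leg13[OF X U Y f]] tsum3_lin[OF X Z] t])
 show g': "tril X Y U Z (\<lambda>x y u. tsum X U (f (pure X U x u)) (\<lambda>p q. g p y q))"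
  by (intro lins X Z Y lin_comp[OF f] trilD[OF g]; assumption)
 show "tsum3 X Y U (leg13 X Y U f (pure (X \<otimes> Y) U (pure X Y x y) u)) g
   = tsum3 X Y U (pure (X \<otimes> Y) U (pure X Y x y) u) (\<lambda>x y u. tsum X U (f (pure X U x u)) (\<lambda>p q. g p y q))"
  if c: "x \<in> carr X" "y \<in> carr Y" "u \<in> carr U" for x y u
 proof -
  have "tsum3 X Y U (tsum X U (f (pure X U x u)) (\<lambda>p q. pure (X \<otimes> Y) U (pure X Y p y) q)) g
   = tsum X U (f (pure X U x u)) (\<lambda>p q. tsum3 X Y U (pure (X \<otimes> Y) U (pure X Y p y) q) g)"
   by (rule tsum_push[OF X vspace_tprod tsum3_lin[OF X Z g]]) (intro pure_carr c)
  also have "\<dots> = tsum X U (f (pure X U x u)) (\<lambda>p q. g p y q)"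
   by (rule tsum_cong[OF X]) (simp add: tsum3_pure2[OF X Z g] c)
  finally show ?thesis
   by (simp add: tsum3_pure2[OF X Z g' c] leg13_pure[OF X U Y f] c)
 qed
qed

section \<open>Tensor squares of the algebra in Sweedler form\<close>

locale wmba =
 fixes H :: "('k::field, 'a::ring) wmb"
 assumes reg: "regular_wmb H"
begin

abbreviation A where "A \<equiv> alg H"
abbreviation AA where "AA \<equiv> alg H \<otimes> alg H"
abbreviation tp (infix "\<odot>" 72) where "x \<odot> y \<equiv> pure (alg H) (alg H) x y"
abbreviation ts :: "('k,'a,'a) tens \<Rightarrow> ('a \<Rightarrow> 'a \<Rightarrow> 'z::ab_group_add) \<Rightarrow> 'z" where "ts \<equiv> tsum (alg H) (alg H)"
abbreviation t1 where "t1 a b \<equiv> T1 H (a \<odot> b)"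
abbreviation t2 where "t2 a b \<equiv> T2 H (a \<odot> b)"
abbreviation t3 where "t3 a b \<equiv> T3 H (a \<odot> b)"
abbreviation t4 where "t4 a b \<equiv> T4 H (a \<odot> b)"
abbreviation e1 where "e1 a b \<equiv> E1 H (a \<odot> b)"
abbreviation e2 where "e2 a b \<equiv> E2 H (a \<odot> b)"

lemma carr_A[simp, lins]: "x \<in> carr (alg H)" by (simp add: alg_def)
lemma scal_A[simp]: "scal (alg H) = asc H" by (simp add: alg_def)
lemma algebra_H: "algebra H" using reg by (simp add: regular_wmb_def Let_def)
lemma vs_A: "vector_space (asc H)" using algebra_H by (simp add: algebra_def)
lemma vspace_A[simp, lins]: "vspace (alg H)"
proof -
 interpret vector_space "asc H" by (rule vs_A)
 show ?thesis by (simp add: vspace_def alg_def vector_space_axioms subspace_UNIV)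
qed
lemma asc_mul: "asc H c a * b = asc H c (a * b)" "a * asc H c b = asc H c (a * b)"
 using algebra_H by (auto simp: algebra_def)

lemma lin_mulL[lins]: "lin W A f ==> lin W A (\<lambda>w. f w * b)"
 by (auto simp: lin_def asc_mul algebra_simps)
lemma lin_mulR[lins]: "lin W A f ==> lin W A (\<lambda>w. b * f w)"
 by (auto simp: lin_def asc_mul algebra_simps)
lemma lin_asc1[lins]: "lin W A f ==> lin W A (\<lambda>w. asc H c (f w))"
 using lin_scalI[OF vspace_A, of W f c] by simp
lemma lin_asc2[lins]: "lin W scalars f ==> lin W A (\<lambda>w. asc H (f w) y)"
 using lin_scal2[OF vspace_A, of W f y] by simp

lemma algsq_eq: "algsq H = AA" by (simp add: algsq_def)
lemma ap_eq: "ap H a b = a \<odot> b" by (simp add: ap_def)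

lemma lin_F: "lin AA AA (E1 H)" "lin AA AA (E2 H)" "lin AA AA (T1 H)" "lin AA AA (T2 H)" "lin AA AA (T3 H)" "lin AA AA (T4 H)"
 using reg by (auto simp: regular_wmb_def Let_def algsq_eq)
lemma lin_eps: "lin A scalars (eps H)" using reg by (auto simp: regular_wmb_def Let_def)

lemma lin_Fs[lins]:
 "lin W AA f ==> lin W AA (\<lambda>w. E1 H (f w))" "lin W AA f ==> lin W AA (\<lambda>w. E2 H (f w))"
 "lin W AA f ==> lin W AA (\<lambda>w. T1 H (f w))" "lin W AA f ==> lin W AA (\<lambda>w. T2 H (f w))"
 "lin W AA f ==> lin W AA (\<lambda>w. T3 H (f w))" "lin W AA f ==> lin W AA (\<lambda>w. T4 H (f w))"
 by (rule lin_comp[OF lin_F(1)] lin_comp[OF lin_F(2)] lin_comp[OF lin_F(3)] lin_comp[OF lin_F(4)]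
   lin_comp[OF lin_F(5)] lin_comp[OF lin_F(6)], assumption)+
lemma lin_epsI[lins]: "lin W A f ==> lin W scalars (\<lambda>w. eps H (f w))" by (rule lin_comp[OF lin_eps])

lemma pc[simp]: "x \<odot> y \<in> carr AA" by (rule pure_carr) simp_all
lemma Fc[simp]: "t \<in> carr AA ==> E1 H t \<in> carr AA" "t \<in> carr AA ==> E2 H t \<in> carr AA"
 "t \<in> carr AA ==> T1 H t \<in> carr AA" "t \<in> carr AA ==> T2 H t \<in> carr AA"
 "t \<in> carr AA ==> T3 H t \<in> carr AA" "t \<in> carr AA ==> T4 H t \<in> carr AA"
 by (rule lin_carr[OF lin_F(1)] lin_carr[OF lin_F(2)] lin_carr[OF lin_F(3)] lin_carr[OF lin_F(4)]
   lin_carr[OF lin_F(5)] lin_carr[OF lin_F(6)], assumption)+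

lemma eps_asc: "eps H (asc H c x) = c * eps H x"
 using lin_scal[OF lin_eps, of x c] by simp

abbreviation bil where "bil Z b \<equiv> bilin (alg H) (alg H) Z b"
abbreviation tri where "tri Z g \<equiv> tril (alg H) (alg H) (alg H) Z g"

lemma ts_pure: "vspace Z ==> bil Z b ==> ts (x \<odot> y) b = b x y"
 by (rule tsum_pure) simp_all
lemma ts_ts: "vspace Z ==> bil Z b ==> (\<And>u w. F u w \<in> carr AA) ==> ts (ts t F) b = ts t (\<lambda>u w. ts (F u w) b)"
 by (rule tsum_tsum) simp_all
lemma ts_carr: "vspace Z ==> (\<And>x y. b x y \<in> carr Z) ==> ts t b \<in> carr Z"
 by (rule tsum_carr) simp_all
lemma ts_carrAA[simp]: "(\<And>x y. b x y \<in> carr AA) ==> ts t b \<in> carr AA"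
 by (rule ts_carr[OF vspace_tprod])
lemma ts_push: "vspace Z ==> lin Z Z' f ==> (\<And>x y. b x y \<in> carr Z) ==> f (ts t b) = ts t (\<lambda>x y. f (b x y))"
 by (rule tsum_push) simp_all
lemma ts_pushAA: "lin AA Z' f ==> (\<And>x y. b x y \<in> carr AA) ==> f (ts t b) = ts t (\<lambda>x y. f (b x y))"
 by (rule ts_push[OF vspace_tprod])
lemma ts_pushA: "lin A Z' f ==> f (ts t b) = ts t (\<lambda>x y. f (b x y))"
 by (rule ts_push[OF vspace_A]) simp_all
lemma ts_self: "t \<in> carr AA ==> ts t (\<lambda>x y. x \<odot> y) = t" by (rule tsum_self) simp_all
lemma ts_lin: "lin AA Z f ==> t \<in> carr AA ==> f t = ts t (\<lambda>x y. f (x \<odot> y))"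
 by (rule tsum_lin[symmetric]) simp_all
lemma AA_eq: "lin AA Z f ==> lin AA Z g ==> t \<in> carr AA ==> (\<And>x y. f (x \<odot> y) = g (x \<odot> y)) ==> f t = g t"
 for Z :: "('k,'z::ab_group_add) space"
 by (rule lin_tens_eq[OF vspace_A, of "alg H" Z f g t]) simp_all
lemma ts_swap: "ts t (\<lambda>x y. ts s (\<lambda>u w. b x y u w)) = ts s (\<lambda>u w. ts t (\<lambda>x y. b x y u w))"
 by (rule tsum_swap)
lemma ts_mul: "ts t b * (c::'a) = ts t (\<lambda>x y. b x y * c)" "(c::'a) * ts t b = ts t (\<lambda>x y. c * b x y)"
 by (rule ts_pushA[of A "\<lambda>w. w * c"], intro lins) (rule ts_pushA[of A "\<lambda>w. c * w"], intro lins)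
lemma ts_asc: "asc H c (ts t b) = ts t (\<lambda>x y. asc H c (b x y))"
 by (rule ts_pushA[of A "\<lambda>w. asc H c w"], intro lins)
lemma ts_eps: "eps H (ts t b) = ts t (\<lambda>x y. eps H (b x y))"
 by (rule ts_pushA[of scalars "\<lambda>w. eps H w"], intro lins)
lemma ts_tpL: "ts t b \<odot> c = ts t (\<lambda>x y. b x y \<odot> c)" by (rule ts_pushA[of AA "\<lambda>w. w \<odot> c"], intro lins)
lemma ts_tpR: "c \<odot> ts t b = ts t (\<lambda>x y. c \<odot> b x y)" by (rule ts_pushA[of AA "\<lambda>w. c \<odot> w"], intro lins)

text \<open>The counit applied to the left and to the right leg.\<close>
definition "el t = ts t (\<lambda>x y. asc H (eps H x) y)"
definition "er t = ts t (\<lambda>x y. asc H (eps H y) x)"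
lemma eps_left_eq: "t \<in> carr AA ==> eps_left H t = el t"
 unfolding eps_left_def slice_left_def el_def scal_A by (rule tsum_lift) (simp_all, intro lins)
lemma eps_right_eq: "t \<in> carr AA ==> eps_right H t = er t"
 unfolding eps_right_def slice_right_def er_def scal_A by (rule tsum_lift) (simp_all, intro lins)
lemma lin_el[lins]: "lin W AA f ==> lin W A (\<lambda>w. el (f w))" unfolding el_def by (intro lins)
lemma lin_er[lins]: "lin W AA f ==> lin W A (\<lambda>w. er (f w))" unfolding er_def by (intro lins)
lemma el_pure: "el (x \<odot> y) = asc H (eps H x) y" unfolding el_def by (rule ts_pure[where Z=A]; intro lins)
lemma er_pure: "er (x \<odot> y) = asc H (eps H y) x" unfolding er_def by (rule ts_pure[where Z=A]; intro lins)
lemma el_ts: "(\<And>x y. b x y \<in> carr AA) ==> el (ts t b) = ts t (\<lambda>x y. el (b x y))"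
 by (rule ts_pushAA[of A el]) (intro lins, simp)
lemma er_ts: "(\<And>x y. b x y \<in> carr AA) ==> er (ts t b) = ts t (\<lambda>x y. er (b x y))"
 by (rule ts_pushAA[of A er]) (intro lins, simp)

text \<open>Multiplication of one leg by an algebra element: \<open>l\<close> and \<open>r\<close> give the side, the digit the leg.\<close>
definition "l1 a t = ts t (\<lambda>x y. (a * x) \<odot> y)"
definition "l2 a t = ts t (\<lambda>x y. x \<odot> (a * y))"
definition "r1 t a = ts t (\<lambda>x y. (x * a) \<odot> y)"
definition "r2 t a = ts t (\<lambda>x y. x \<odot> (y * a))"
lemmas lr_defs = l1_def l2_def r1_def r2_def

lemma lin_lr[lins]: "lin W AA f ==> lin W AA (\<lambda>w. l1 a (f w))" "lin W AA f ==> lin W AA (\<lambda>w. l2 a (f w))"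
 "lin W AA f ==> lin W AA (\<lambda>w. r1 (f w) a)" "lin W AA f ==> lin W AA (\<lambda>w. r2 (f w) a)"
 "lin W A g ==> lin W AA (\<lambda>w. l1 (g w) t)" "lin W A g ==> lin W AA (\<lambda>w. l2 (g w) t)"
 "lin W A g ==> lin W AA (\<lambda>w. r1 t (g w))" "lin W A g ==> lin W AA (\<lambda>w. r2 t (g w))"
 unfolding lr_defs by (intro lins; assumption)+
lemma lr_c[simp]: "l1 a t \<in> carr AA" "l2 a t \<in> carr AA" "r1 t a \<in> carr AA" "r2 t a \<in> carr AA"
 by (simp_all add: lr_defs)
lemma lr_pure[simp]: "l1 a (x \<odot> y) = (a * x) \<odot> y" "l2 a (x \<odot> y) = x \<odot> (a * y)"
  "r1 (x \<odot> y) a = (x * a) \<odot> y" "r2 (x \<odot> y) a = x \<odot> (y * a)"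
 unfolding lr_defs by (rule ts_pure[where Z=AA]; intro lins)+
lemma ts_lr: assumes "vspace Z" "bil Z b"
 shows "ts (l1 a t) b = ts t (\<lambda>x y. b (a * x) y)" "ts (l2 a t) b = ts t (\<lambda>x y. b x (a * y))"
  "ts (r1 t a) b = ts t (\<lambda>x y. b (x * a) y)" "ts (r2 t a) b = ts t (\<lambda>x y. b x (y * a))"
 unfolding lr_defs by (simp_all add: ts_ts[OF assms] ts_pure[OF assms])

lemma lr_comm:
 assumes t: "t \<in> carr AA"
 shows "l1 a (l1 b t) = l1 (a * b) t" "l2 a (l2 b t) = l2 (a * b) t" "r1 (r1 t a) b = r1 t (a * b)" "r2 (r2 t a) b = r2 t (a * b)"
  "l2 a (l1 b t) = l1 b (l2 a t)" "r1 (l1 a t) b = l1 a (r1 t b)" "r2 (l1 a t) b = l1 a (r2 t b)"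
  "r1 (l2 a t) b = l2 a (r1 t b)" "r2 (l2 a t) b = l2 a (r2 t b)" "r2 (r1 t a) b = r1 (r2 t b) a"
 by (rule AA_eq[OF _ _ t, where Z=AA], intro lins, intro lins, simp add: mult.assoc)+

lemma amap_eq: "lin A A f ==> lin A A g ==> t \<in> carr AA ==> amap H f g t = ts t (\<lambda>x y. f x \<odot> g y)"
 unfolding amap_def by (rule tmap_tsum) simp_all
lemma amap_lr: assumes "t \<in> carr AA"
 shows "amap H (\<lambda>x. a * x) id t = l1 a t" "amap H id (\<lambda>x. a * x) t = l2 a t"
 "amap H (\<lambda>x. x * a) id t = r1 t a" "amap H id (\<lambda>x. x * a) t = r2 t a"
 unfolding lr_defs by (subst amap_eq[OF _ _ assms]; auto intro!: lins lin_idc)+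

definition mm (infixl "\<cdot>" 70) where "t \<cdot> u = ts t (\<lambda>a b. ts u (\<lambda>x y. (a * x) \<odot> (b * y)))"
lemma lin_mm[lins]: "lin W AA f ==> lin W AA (\<lambda>w. f w \<cdot> u)" "lin W AA f ==> lin W AA (\<lambda>w. u \<cdot> f w)"
 unfolding mm_def by (intro lins; assumption)+
lemma mm_c[simp]: "t \<cdot> u \<in> carr AA" by (simp add: mm_def)
lemma mu2_eq: "t \<in> carr AA ==> u \<in> carr AA ==> mu2 H t u = t \<cdot> u"
proof -
 assume t: "t \<in> carr AA" and u: "u \<in> carr AA"
 have e: "(\<lambda>a b. amap H (\<lambda>x. a * x) (\<lambda>y. b * y) u) = (\<lambda>a b. ts u (\<lambda>x y. (a * x) \<odot> (b * y)))"
  by (intro ext amap_eq u lins)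
 show ?thesis unfolding mu2_def e mm_def algsq_eq by (rule tsum_lift[OF _ _ _ t]) (intro lins)+
qed
lemma mm_pureL: "(a \<odot> b) \<cdot> u = ts u (\<lambda>x y. (a * x) \<odot> (b * y))"
 unfolding mm_def by (rule ts_pure[where Z=AA]; intro lins)
lemma mm_pure[simp]: "(a \<odot> b) \<cdot> (c \<odot> d) = (a * c) \<odot> (b * d)"
 unfolding mm_pureL by (rule ts_pure[where Z=AA]; intro lins)
lemma mm_lr: assumes "t \<in> carr AA" shows "(a \<odot> b) \<cdot> t = l1 a (l2 b t)" "t \<cdot> (a \<odot> b) = r1 (r2 t b) a"
 by (rule AA_eq[OF _ _ assms, where Z=AA], intro lins, intro lins, simp)+
lemma nondegA: "(\<And>b. a * b = 0) ==> a = (0::'a)" "(\<And>b. b * a = 0) ==> a = (0::'a)"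
proof -
 have "nondegenerate_alg H" using reg by (simp add: regular_wmb_def Let_def)
 then show "(\<And>b. a * b = 0) ==> a = (0::'a)" "(\<And>b. b * a = 0) ==> a = (0::'a)"
  unfolding nondegenerate_alg_def by blast+
qed
lemma nondegA_eq: "(\<And>b. a * b = a' * b) ==> a = (a'::'a)" "(\<And>b. b * a = b * a') ==> a = (a'::'a)"
proof -
 show "(\<And>b. a * b = a' * b) ==> a = a'" using nondegA(1)[of "a - a'"] by (simp add: left_diff_distrib)
 show "(\<And>b. b * a = b * a') ==> a = a'" using nondegA(2)[of "a - a'"] by (simp add: right_diff_distrib)
qed

end

context wmba begin

section \<open>Nondegeneracy in one leg\<close>

text \<open>A family of endomorphisms that separates points of \<open>A\<close> still separates the tensors in \<open>A \<otimes> Y\<close>: slice by a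
functional of \<open>Y\<close>. The families of interest are left and right multiplications.\<close>
lemma leg1_inj: assumes Y: "vspace Y" and t: "t \<in> carr (alg H \<otimes> Y)" and h: "\<And>d. lin A A (h d)"
 and inj: "\<And>x. (\<And>d. h d x = 0) ==> x = 0" and z: "\<And>d. tsum A Y t (\<lambda>x y. pure A Y (h d x) y) = 0"
 shows "t = 0"
proof (rule tens_sep_right[OF vspace_A Y t])
 fix \<phi> assume p: "lin Y scalars \<phi>"
 have b: "bilin A Y A (\<lambda>x y. asc H (\<phi> y) x)" by (intro lins p)
 have l: "lin (A \<otimes> Y) A (\<lambda>t. tsum A Y t (\<lambda>x y. asc H (\<phi> y) x))" by (intro lins p)
 show "tsum A Y t (\<lambda>x y. scal A (\<phi> y) x) = 0"
 proof (rule inj)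
  fix d
  have "h d (tsum A Y t (\<lambda>x y. asc H (\<phi> y) x)) = tsum A Y t (\<lambda>x y. h d (asc H (\<phi> y) x))"
   by (rule tsum_push[OF vspace_A vspace_A h]) simp
  also have "\<dots> = tsum A Y t (\<lambda>x y. tsum A Y (pure A Y (h d x) y) (\<lambda>x y. asc H (\<phi> y) x))"
   by (rule tsum_cong) (simp_all add: tsum_pure[OF vspace_A vspace_A b] lin_scal[OF h, simplified])
  also have "\<dots> = tsum A Y (tsum A Y t (\<lambda>x y. pure A Y (h d x) y)) (\<lambda>x y. asc H (\<phi> y) x)"
   by (rule tsum_tsum[OF vspace_A vspace_A vspace_A b, symmetric]) (simp add: pure_carr)
  also have "\<dots> = 0" unfolding z by (rule lin_0[OF vspace_tprod l])
  finally show "h d (tsum A Y t (\<lambda>x y. scal A (\<phi> y) x)) = 0" by simp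
 qed
qed
lemma leg2_inj: assumes X: "vspace X" and t: "t \<in> carr (X \<otimes> alg H)" and h: "\<And>d. lin A A (h d)"
 and inj: "\<And>x. (\<And>d. h d x = 0) ==> x = 0" and z: "\<And>d. tsum X A t (\<lambda>x y. pure X A x (h d y)) = 0"
 shows "t = 0"
proof (rule tens_sep_left[OF X vspace_A t])
 fix \<phi> assume p: "lin X scalars \<phi>"
 have b: "bilin X A A (\<lambda>x y. asc H (\<phi> x) y)" by (intro lins p)
 have l: "lin (X \<otimes> A) A (\<lambda>t. tsum X A t (\<lambda>x y. asc H (\<phi> x) y))" by (intro lins p X)
 show "tsum X A t (\<lambda>x y. scal A (\<phi> x) y) = 0"
 proof (rule inj)
  fix d
  have "h d (tsum X A t (\<lambda>x y. asc H (\<phi> x) y)) = tsum X A t (\<lambda>x y. h d (asc H (\<phi> x) y))"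
   by (rule tsum_push[OF X vspace_A h]) simp
  also have "\<dots> = tsum X A t (\<lambda>x y. tsum X A (pure X A x (h d y)) (\<lambda>x y. asc H (\<phi> x) y))"
   by (rule tsum_cong[OF X]) (simp_all add: tsum_pure[OF X vspace_A b] lin_scal[OF h, simplified])
  also have "\<dots> = tsum X A (tsum X A t (\<lambda>x y. pure X A x (h d y))) (\<lambda>x y. asc H (\<phi> x) y)"
   by (rule tsum_tsum[OF X X vspace_A b, symmetric]) (simp add: pure_carr)
  also have "\<dots> = 0" unfolding z by (rule lin_0[OF vspace_tprod l])
  finally show "h d (tsum X A t (\<lambda>x y. scal A (\<phi> x) y)) = 0" by simp
 qed
qed
lemma lin_mul: "lin A A (\<lambda>x. d * x)" "lin A A (\<lambda>x. x * d)" by (intro lins)+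
lemma nondeg_left: assumes "vspace Y" "t \<in> carr (alg H \<otimes> Y)" "\<And>d. tsum A Y t (\<lambda>x y. pure A Y (d * x) y) = 0" shows "t = 0"
 by (rule leg1_inj[where h="\<lambda>d x. d * x", OF assms(1,2) lin_mul(1) _ assms(3)]) (rule nondegA(2), simp)
lemma nondeg_left': assumes "vspace Y" "t \<in> carr (alg H \<otimes> Y)" "\<And>d. tsum A Y t (\<lambda>x y. pure A Y (x * d) y) = 0" shows "t = 0"
 by (rule leg1_inj[where h="\<lambda>d x. x * d", OF assms(1,2) lin_mul(2) _ assms(3)]) (rule nondegA(1), simp)
lemma nondeg_right: assumes "vspace Y" "t \<in> carr (Y \<otimes> alg H)" "\<And>d. tsum Y A t (\<lambda>x y. pure Y A x (d * y)) = 0" shows "t = 0"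
 by (rule leg2_inj[where h="\<lambda>d x. d * x", OF assms(1,2) lin_mul(1) _ assms(3)]) (rule nondegA(2), simp)
lemma nondeg_right': assumes "vspace Y" "t \<in> carr (Y \<otimes> alg H)" "\<And>d. tsum Y A t (\<lambda>x y. pure Y A x (y * d)) = 0" shows "t = 0"
 by (rule leg2_inj[where h="\<lambda>d x. x * d", OF assms(1,2) lin_mul(2) _ assms(3)]) (rule nondegA(1), simp)

lemma diff_c: "t \<in> carr (X \<otimes> Y) ==> u \<in> carr (X \<otimes> Y) ==> t - u \<in> carr (X \<otimes> AG Y)" for X :: "('k,'x::ab_group_add) space"
 by (rule vspace_diff[OF vspace_tprod])

lemma nondegAA:
 assumes t: "t \<in> carr AA" and u: "u \<in> carr AA"
 shows "(\<And>d. l1 d t = l1 d u) ==> t = u" "(\<And>d. l2 d t = l2 d u) ==> t = u"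
  "(\<And>d. r1 t d = r1 u d) ==> t = u" "(\<And>d. r2 t d = r2 u d) ==> t = u"
proof -
 note d = lin_diff[OF vspace_tprod _ t u]
 show "(\<And>d. l1 d t = l1 d u) ==> t = u"
  using nondeg_left[OF vspace_A diff_c[OF t u]] d[of AA "\<lambda>t. l1 _ t", OF lin_lr(1)[OF lin_id]]
  by (simp add: l1_def)
 show "(\<And>d. l2 d t = l2 d u) ==> t = u"
  using nondeg_right[OF vspace_A diff_c[OF t u]] d[of AA "\<lambda>t. l2 _ t", OF lin_lr(2)[OF lin_id]]
  by (simp add: l2_def)
 show "(\<And>d. r1 t d = r1 u d) ==> t = u"
  using nondeg_left'[OF vspace_A diff_c[OF t u]] d[of AA "\<lambda>t. r1 t _", OF lin_lr(3)[OF lin_id]]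
  by (simp add: r1_def)
 show "(\<And>d. r2 t d = r2 u d) ==> t = u"
  using nondeg_right'[OF vspace_A diff_c[OF t u]] d[of AA "\<lambda>t. r2 t _", OF lin_lr(4)[OF lin_id]]
  by (simp add: r2_def)
qed

lemma nondeg_mm:
 assumes t: "t \<in> carr AA" and u: "u \<in> carr AA"
 shows "(\<And>a b. a \<odot> b \<cdot> t = a \<odot> b \<cdot> u) ==> t = u" "(\<And>a b. t \<cdot> a \<odot> b = u \<cdot> a \<odot> b) ==> t = u"
proof -
 assume "\<And>a b. a \<odot> b \<cdot> t = a \<odot> b \<cdot> u"
 then have "l2 b t = l2 b u" for b by - (rule nondegAA(1), simp_all add: mm_lr t u)
 then show "t = u" by (rule nondegAA(2)[OF t u])
next
 assume "\<And>a b. t \<cdot> a \<odot> b = u \<cdot> a \<odot> b"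
 then have "r2 t b = r2 u b" for b by - (rule nondegAA(3), simp_all add: mm_lr t u)
 then show "t = u" by (rule nondegAA(4)[OF t u])
qed

section \<open>The axioms on elements\<close>

lemma E_balanced: assumes "t \<in> carr AA" "u \<in> carr AA" shows "t \<cdot> E1 H u = E2 H t \<cdot> u"
proof -
 have p: "(a \<odot> b) \<cdot> e1 c d = e2 a b \<cdot> (c \<odot> d)" for a b c d
  using reg by (simp add: regular_wmb_def Let_def ap_eq mu2_eq)
 show ?thesis
 proof (rule AA_eq[OF _ _ assms(1), where Z=AA], intro lins, intro lins)
  fix a b show "a \<odot> b \<cdot> E1 H u = e2 a b \<cdot> u"
   by (rule AA_eq[OF _ _ assms(2), where Z=AA], intro lins, intro lins) (rule p)
 qed
qed

lemma E1_idem: "t \<in> carr AA ==> E1 H (E1 H t) = E1 H t"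
 using reg by (simp add: regular_wmb_def Let_def algsq_eq)

abbreviation (input) "p3 a b c \<equiv> pure (alg H \<otimes> alg H) (alg H) (pure (alg H) (alg H) a b) c"
lemma p3c: "p3 a b c \<in> carr ((alg H \<otimes> alg H) \<otimes> alg H)" by (intro pure_carr) simp_all

lemmas lin12 = lin_leg12[where X="alg H" and Y="alg H" and Z="alg H"]
lemmas lin23 = lin_leg23[where X="alg H" and Y="alg H" and Z="alg H" and Y'="alg H" and Z'="alg H"]
lemmas lin13 = lin_leg13[where X="alg H" and Y="alg H" and Z="alg H"]

lemma T1_T2_commute: assumes Z: "vspace Z" and g: "tri Z g"
 shows "ts (t1 b c) (\<lambda>p z. ts (t2 a p) (\<lambda>p q. g p q z)) = ts (t2 a b) (\<lambda>p q. ts (t1 q c) (\<lambda>q z. g p q z))"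
proof -
 have "leg12 A A A (T2 H) (leg23 A A A A A (T1 H) (p3 a b c)) = leg23 A A A A A (T1 H) (leg12 A A A (T2 H) (p3 a b c))"
  using reg p3c by (simp add: regular_wmb_def Let_def algsq_eq)
 then have "tsum3 A A A (leg12 A A A (T2 H) (leg23 A A A A A (T1 H) (p3 a b c))) g
   = tsum3 A A A (leg23 A A A A A (T1 H) (leg12 A A A (T2 H) (p3 a b c))) g" by simp
 moreover have g1: "tri Z (\<lambda>x y u. ts (t2 x y) (\<lambda>p q. g p q u))" by (intro lins trilD[OF g] Z)
 moreover have g2: "tri Z (\<lambda>x y u. ts (t1 y u) (\<lambda>y u. ts (t2 x y) (\<lambda>p q. g p q u)))" by (intro lins trilD[OF g] Z)
 moreover have g3: "tri Z (\<lambda>x y u. ts (t1 y u) (\<lambda>q z. g x q z))" by (intro lins trilD[OF g] Z)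
 moreover have g4: "tri Z (\<lambda>x y u. ts (t2 x y) (\<lambda>x y. ts (t1 y u) (\<lambda>q z. g x q z)))" by (intro lins trilD[OF g] Z)
 ultimately show ?thesis using lin_F p3c
  by (simp add: tsum3_leg12[OF vspace_A Z] tsum3_leg23[OF vspace_A vspace_A Z vspace_A] g
    lin_carr[OF lin12] lin_carr[OF lin23] tsum3_pure2[OF vspace_A Z])
qed

text \<open>Multiplicativity of the comultiplication, in the form \<open>\<Delta>(x y)(1 \<otimes> c) = \<Delta>(x) (\<Delta>(y)(1 \<otimes> c))\<close>.\<close>
lemma T1_mult: assumes Z: "vspace Z" and b: "bil Z b"
 shows "ts (t1 (x * y) c) b = ts (t1 y c) (\<lambda>p z. ts (t1 x z) (\<lambda>q w. b (q * p) w))"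
proof -
 have m: "mu H t = ts t (\<lambda>x y. x * y)" if "t \<in> carr AA" for t
  unfolding mu_def by (rule tsum_lift[OF _ _ _ that]) (intro lins)+
 have lm: "lin AA A (mu H)" unfolding mu_def by (rule lift_lin) (intro lins)+
 have "tmap AA A A A (mu H) id (leg13 A A A (T1 H) (leg23 A A A A A (T1 H) (p3 x y c))) = T1 H (tmap AA A A A (mu H) id (p3 x y c))"
  using reg p3c by (simp add: regular_wmb_def Let_def algsq_eq)
 moreover have "tmap AA A A A (mu H) id (p3 x y c) = (x * y) \<odot> c"
  using m by (subst tmap_pure[OF lm lin_idc]) (auto intro!: arg_cong[of _ _ "\<lambda>x. x \<odot> c"] ts_pure lins)
 moreover have tm: "ts (tmap AA A A A (mu H) id t) b = tsum3 A A A t (\<lambda>x y z. b (x * y) z)" if t: "t \<in> carr ((alg H \<otimes> alg H) \<otimes> alg H)" for t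
 proof (rule lin_tens3_eq[OF vspace_A _ _ t])
  have bl: "tri Z (\<lambda>x y z. b (x * y) z)" by (intro lins lin_comp[OF bilinD(2)[OF b]] bilinD(1)[OF b])
  show "lin ((alg H \<otimes> alg H) \<otimes> alg H) Z (\<lambda>t. tsum3 A A A t (\<lambda>x y z. b (x * y) z))"
   by (rule tsum3_lin[OF vspace_A Z bl])
  show "lin ((alg H \<otimes> alg H) \<otimes> alg H) Z (\<lambda>t. ts (tmap AA A A A (mu H) id t) b)"
   by (intro lins lin_tmap lin_idc lm b Z)
  show "ts (tmap AA A A A (mu H) id (p3 x y u)) b = tsum3 A A A (p3 x y u) (\<lambda>x y z. b (x * y) z)" for x y u
   by (subst tmap_pure[OF lm lin_idc]) (simp_all add: tsum3_pure2[OF vspace_A Z bl] ts_pure[OF Z b] m ts_pure[OF vspace_A, of "\<lambda>x y. x * y"] lins)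
 qed
 ultimately have "ts (t1 (x * y) c) b = tsum3 A A A (leg13 A A A (T1 H) (leg23 A A A A A (T1 H) (p3 x y c))) (\<lambda>x y z. b (x * y) z)"
  using p3c lin_F by (simp add: lin_carr[OF lin13] lin_carr[OF lin23] flip: tm)
 moreover have g1: "tri Z (\<lambda>x y z. b (x * y) z)" by (intro lins lin_comp[OF bilinD(2)[OF b]] bilinD(1)[OF b])
 moreover have g2: "tri Z (\<lambda>x y z. ts (t1 x z) (\<lambda>x z. b (x * y) z))" by (intro lins lin_comp[OF bilinD(2)[OF b]] bilinD(1)[OF b] Z)
 moreover have g3: "tri Z (\<lambda>x y z. ts (t1 y z) (\<lambda>y z. ts (t1 x z) (\<lambda>x z. b (x * y) z)))" by (intro lins lin_comp[OF bilinD(2)[OF b]] bilinD(1)[OF b] Z)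
 ultimately show ?thesis using lin_F p3c
  by (simp add: tsum3_leg13[OF vspace_A vspace_A Z vspace_A] tsum3_leg23[OF vspace_A vspace_A Z vspace_A]
    lin_carr[OF lin23] tsum3_pure2[OF vspace_A Z])
qed

lemma E1_T1_commute: assumes Z: "vspace Z" and g: "tri Z g"
 shows "ts (t1 b c) (\<lambda>p z. ts (e1 a p) (\<lambda>p q. g p q z)) = ts (e1 a b) (\<lambda>p q. ts (t1 q c) (\<lambda>q z. g p q z))"
proof -
 have "leg12 A A A (E1 H) (leg23 A A A A A (T1 H) (p3 a b c)) = leg23 A A A A A (T1 H) (leg12 A A A (E1 H) (p3 a b c))"
  using reg p3c by (simp add: regular_wmb_def Let_def algsq_eq)
 then have "tsum3 A A A (leg12 A A A (E1 H) (leg23 A A A A A (T1 H) (p3 a b c))) g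
   = tsum3 A A A (leg23 A A A A A (T1 H) (leg12 A A A (E1 H) (p3 a b c))) g" by simp
 moreover have g1: "tri Z (\<lambda>x y u. ts (e1 x y) (\<lambda>p q. g p q u))" by (intro lins trilD[OF g] Z)
 moreover have g2: "tri Z (\<lambda>x y u. ts (t1 y u) (\<lambda>y u. ts (e1 x y) (\<lambda>p q. g p q u)))" by (intro lins trilD[OF g] Z)
 moreover have g3: "tri Z (\<lambda>x y u. ts (t1 y u) (\<lambda>q z. g x q z))" by (intro lins trilD[OF g] Z)
 moreover have g4: "tri Z (\<lambda>x y u. ts (e1 x y) (\<lambda>x y. ts (t1 y u) (\<lambda>q z. g x q z)))" by (intro lins trilD[OF g] Z)
 ultimately show ?thesis using lin_F p3c
  by (simp add: tsum3_leg12[OF vspace_A Z] tsum3_leg23[OF vspace_A vspace_A Z vspace_A] g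
    lin_carr[OF lin12] lin_carr[OF lin23] tsum3_pure2[OF vspace_A Z])
qed

lemma E2_T2_commute: assumes Z: "vspace Z" and g: "tri Z g"
 shows "ts (t2 y p) (\<lambda>y z. ts (e2 x y) (\<lambda>x y. g x y z)) = ts (e2 x p) (\<lambda>x p. ts (t2 y p) (\<lambda>y z. g x y z))"
proof -
 have "leg12 A A A (E2 H) (leg23 A A A A A (T2 H) (p3 x y p)) = leg23 A A A A A (T2 H) (leg13 A A A (E2 H) (p3 x y p))"
  using reg p3c by (simp add: regular_wmb_def Let_def algsq_eq)
 then have "tsum3 A A A (leg12 A A A (E2 H) (leg23 A A A A A (T2 H) (p3 x y p))) g
   = tsum3 A A A (leg23 A A A A A (T2 H) (leg13 A A A (E2 H) (p3 x y p))) g" by simp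
 moreover have g1: "tri Z (\<lambda>x y u. ts (e2 x y) (\<lambda>p q. g p q u))" by (intro lins trilD[OF g] Z)
 moreover have g2: "tri Z (\<lambda>x y u. ts (t2 y u) (\<lambda>y u. ts (e2 x y) (\<lambda>p q. g p q u)))" by (intro lins trilD[OF g] Z)
 moreover have g3: "tri Z (\<lambda>x y u. ts (t2 y u) (\<lambda>q z. g x q z))" by (intro lins trilD[OF g] Z)
 moreover have g4: "tri Z (\<lambda>x y u. ts (e2 x u) (\<lambda>x u. ts (t2 y u) (\<lambda>q z. g x q z)))" by (intro lins trilD[OF g] Z)
 ultimately show ?thesis using lin_F p3c
  by (simp add: tsum3_leg12[OF vspace_A Z] tsum3_leg23[OF vspace_A vspace_A Z vspace_A] tsum3_leg13[OF vspace_A vspace_A Z vspace_A] g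
    lin_carr[OF lin13] lin_carr[OF lin23] tsum3_pure2[OF vspace_A Z])
qed

lemma counit_T: "el (t1 a b) = a * b" "er (t2 a b) = a * b"
proof -
 have m: "mu H (a \<odot> b) = a * b"
  unfolding mu_def by (rule lift_pure) (intro lins)+
 show "el (t1 a b) = a * b" "er (t2 a b) = a * b"
  using reg m by (simp_all add: regular_wmb_def Let_def algsq_eq eps_left_eq eps_right_eq)
qed

lemma span_E: "module.span fscal {r1 (t1 a c) b | a b c. True} = module.span fscal {e1 b c | b c. True}"
 "module.span fscal {l2 c (t2 b a) | a b c. True} = module.span fscal {e2 b c | b c. True}"
 using reg by (simp_all add: regular_wmb_def Let_def ap_eq amap_lr)

lemma counit_E: "el (l2 a (e1 b c)) = el (r1 (t1 a c) b)" "el (r2 (e2 a b) c) = el (l2 b (t2 a c))"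
 using reg by (simp_all add: regular_wmb_def Let_def ap_eq amap_lr eps_left_eq)

lemma T_compat: "l2 a (t1 c b) = r2 (t3 c a) b" "r1 (t2 a c) b = l1 a (t4 b c)"
 using reg by (simp_all add: regular_wmb_def Let_def ap_eq amap_lr)

text \<open>Idempotency: every element is a sum of products, given by a tensor.\<close>
lemma idem: obtains t where "t \<in> carr AA" "a = ts t (\<lambda>x y. x * y)"
proof -
 have "idempotent_alg H" using reg by (simp add: regular_wmb_def Let_def)
 then have "a \<in> mu H ` carr AA" by (simp add: idempotent_alg_def algsq_eq)
 then obtain t where t: "t \<in> carr AA" "a = mu H t" by auto
 have "mu H t = ts t (\<lambda>x y. x * y)" unfolding mu_def by (rule tsum_lift[OF _ _ _ t(1)]) (intro lins)+
 then show ?thesis using that t by simp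
qed

end

context wmba begin

section \<open>Compatibilities of the structure maps\<close>

text \<open>Because of idempotency it is enough to compare linear maps on products.\<close>
lemma idemE:
 fixes Z :: "('k,'z::ab_group_add) space"
 assumes "lin A Z f" "lin A Z g" "\<And>x y. f (x * y) = g (x * y)"
 shows "f a = g (a :: 'a)"
proof -
 obtain t where t: "a = ts t (\<lambda>x y. x * y)" by (rule idem)
 show ?thesis unfolding t ts_pushA[OF assms(1)] ts_pushA[OF assms(2)] assms(3) ..
qed

lemmas ts_lrA = ts_lr[OF vspace_A] and ts_lrAA = ts_lr[OF vspace_tprod[of "alg H" "alg H"]] and ts_lrS = ts_lr[OF vspace_scalars]
lemmas ts_pureA = ts_pure[OF vspace_A] and ts_pureAA = ts_pure[OF vspace_tprod[of "alg H" "alg H"]] and ts_pureS = ts_pure[OF vspace_scalars]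
lemmas ts_tsA = ts_ts[OF vspace_A] and ts_tsAA = ts_ts[OF vspace_tprod[of "alg H" "alg H"]] and ts_tsS = ts_ts[OF vspace_scalars]

lemma asc_tp: "asc H c x \<odot> y = x \<odot> asc H c y"
 using lin_scal[of A AA "\<lambda>x. x \<odot> y" x c] lin_scal[of A AA "\<lambda>y. x \<odot> y" y c] by (simp add: lins)

lemma el_lr: assumes "t \<in> carr AA" shows "el (l2 b t) = b * el t" "el (r2 t b) = el t * b"
 "er (l1 b t) = b * er t" "er (r1 t b) = er t * b"
 by (rule AA_eq[OF _ _ assms, where Z=A], intro lins, intro lins, simp add: el_pure er_pure asc_mul)+

lemma mm_leg: assumes "t \<in> carr AA" "u \<in> carr AA"
 shows "t \<cdot> r1 u a = r1 (t \<cdot> u) a" "t \<cdot> r2 u a = r2 (t \<cdot> u) a" "l1 a t \<cdot> u = l1 a (t \<cdot> u)" "l2 a t \<cdot> u = l2 a (t \<cdot> u)"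
  "r1 t a \<cdot> u = t \<cdot> l1 a u" "r2 t a \<cdot> u = t \<cdot> l2 a u"
proof -
 have "f t u = g t u" if "\<And>t. lin AA AA (f t)" "\<And>t. lin AA AA (g t)" "\<And>u. lin AA AA (\<lambda>t. f t u)" "\<And>u. lin AA AA (\<lambda>t. g t u)"
  "\<And>p q x y. f (p \<odot> q) (x \<odot> y) = g (p \<odot> q) (x \<odot> y)" for f g :: "('k,'a,'a) tens \<Rightarrow> ('k,'a,'a) tens \<Rightarrow> ('k,'a,'a) tens"
  by (rule AA_eq[OF that(3,4) assms(1)], rule AA_eq[OF that(1,2) assms(2)], rule that(5))
 note 1 = this
 show "t \<cdot> r1 u a = r1 (t \<cdot> u) a" by (rule 1, (intro lins)+) (simp add: mult.assoc)
 show "t \<cdot> r2 u a = r2 (t \<cdot> u) a" by (rule 1, (intro lins)+) (simp add: mult.assoc)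
 show "l1 a t \<cdot> u = l1 a (t \<cdot> u)" by (rule 1, (intro lins)+) (simp add: mult.assoc)
 show "l2 a t \<cdot> u = l2 a (t \<cdot> u)" by (rule 1, (intro lins)+) (simp add: mult.assoc)
 show "r1 t a \<cdot> u = t \<cdot> l1 a u" by (rule 1, (intro lins)+) (simp add: mult.assoc)
 show "r2 t a \<cdot> u = t \<cdot> l2 a u" by (rule 1, (intro lins)+) (simp add: mult.assoc)
qed

lemma E2_E2: "t \<in> carr AA ==> E2 H (E2 H t) = E2 H t"
 by (rule nondeg_mm(2)) (simp_all add: E1_idem flip: E_balanced)
lemma E1_r: assumes "t \<in> carr AA" shows "E1 H (r1 t a) = r1 (E1 H t) a" "E1 H (r2 t a) = r2 (E1 H t) a"
 by (rule nondeg_mm(1); simp add: E_balanced mm_leg assms)+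
lemma E2_l: assumes "t \<in> carr AA" shows "E2 H (l1 a t) = l1 a (E2 H t)" "E2 H (l2 a t) = l2 a (E2 H t)"
 by (rule nondeg_mm(2); simp add: mm_leg assms flip: E_balanced)+
lemma e1_r: "e1 (x * a) y = r1 (e1 x y) a" "e1 x (y * a) = r2 (e1 x y) a"
 using E1_r[of "x \<odot> y" a] by simp_all
lemma e2_l: "e2 (a * x) y = l1 a (e2 x y)" "e2 x (a * y) = l2 a (e2 x y)"
 using E2_l[of "x \<odot> y" a] by simp_all

lemma t2L: "t2 (d * a) b = l1 d (t2 a b)"
 by (rule nondegAA(3)) (simp_all add: lr_comm(6) lr_comm(1) T_compat(2))

text \<open>The four maps are the products \<open>T\<^sub>1(a \<otimes> b) = \<Delta>(a)(1 \<otimes> b)\<close>, \<open>T\<^sub>2(a \<otimes> b) = (a \<otimes> 1)\<Delta>(b)\<close>,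
\<open>T\<^sub>3(a \<otimes> b) = (1 \<otimes> b)\<Delta>(a)\<close> and \<open>T\<^sub>4(a \<otimes> b) = \<Delta>(b)(a \<otimes> 1)\<close>. This and the three similar lemmas below express that they
come from one multiplier \<open>\<Delta>\<close>.\<close>
lemma t1_t2: "l1 d (t1 a b) = r2 (t2 d a) b"
proof -
 have "ts (t1 a b) (\<lambda>p z. ts (t2 d p) (\<lambda>p q. asc H (eps H q) p \<odot> z)) = ts (t2 d a) (\<lambda>p q. ts (t1 q b) (\<lambda>q z. asc H (eps H q) p \<odot> z))"
  by (rule T1_T2_commute[where Z=AA]) (intro lins)+
 moreover have "ts (t2 d p) (\<lambda>p q. asc H (eps H q) p \<odot> z) = (d * p) \<odot> z" for p z
  using counit_T(2)[of d p] by (simp add: er_def flip: ts_tpL)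
 moreover have "ts (t1 q b) (\<lambda>q z. asc H (eps H q) p \<odot> z) = p \<odot> (q * b)" for p q
  using counit_T(1)[of q b] by (simp add: el_def asc_tp flip: ts_tpR)
 ultimately show ?thesis by (simp add: l1_def r2_def)
qed
lemma t2_t3: "l2 c (t2 d a) = l1 d (t3 a c)"
 by (rule nondegAA(4)) (simp_all add: lr_comm(9) lr_comm(7) lr_comm(5) T_compat(1)[symmetric] t1_t2[symmetric])
lemma t1_t4: "r1 (t1 a b) c = r2 (t4 c a) b"
 by (rule nondegAA(1)) (simp_all add: lr_comm(6)[symmetric] t1_t2 lr_comm(10) lr_comm(7)[symmetric] T_compat(2)[symmetric])
lemma t3_t4: "r1 (t3 c a) b = l2 a (t4 b c)"
 by (rule nondegAA(4)) (simp_all add: lr_comm(10) lr_comm(9) lr_comm(8) T_compat(1)[symmetric] t1_t4[symmetric])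

section \<open>The comultiplication as a multiplier\<close>

text \<open>Left and right multiplication of \<open>A \<otimes> A\<close> by the multiplier \<open>\<Delta>(a)\<close>.\<close>
definition "DL a t = ts t (\<lambda>x y. r1 (t1 a y) x)"
definition "DR a t = ts t (\<lambda>x y. l2 y (t2 x a))"
lemma DL_c[simp]: "DL a t \<in> carr AA" "DR a t \<in> carr AA" by (simp_all add: DL_def DR_def)
lemma lin_DL[lins]: "lin W AA f ==> lin W AA (\<lambda>w. DL a (f w))" "lin W A g ==> lin W AA (\<lambda>w. DL (g w) t)"
 "lin W AA f ==> lin W AA (\<lambda>w. DR a (f w))" "lin W A g ==> lin W AA (\<lambda>w. DR (g w) t)"
 unfolding DL_def DR_def by (intro lins; assumption)+
lemma DL_pure: "DL a (x \<odot> y) = r1 (t1 a y) x" unfolding DL_def by (rule ts_pureAA) (intro lins)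
lemma DL_pure4: "DL a (x \<odot> y) = r2 (t4 x a) y" by (simp add: DL_pure t1_t4)
lemma DR_pure: "DR a (x \<odot> y) = l2 y (t2 x a)" unfolding DR_def by (rule ts_pureAA) (intro lins)
lemma DR_pure3: "DR a (x \<odot> y) = l1 x (t3 a y)" by (simp add: DR_pure t2_t3)

lemma DL_adj: assumes t: "t \<in> carr AA" and u: "u \<in> carr AA" shows "t \<cdot> DL a u = DR a t \<cdot> u"
proof (rule AA_eq[OF _ _ t, where Z=AA], intro lins, intro lins)
 fix p q show "p \<odot> q \<cdot> DL a u = DR a (p \<odot> q) \<cdot> u"
  by (rule AA_eq[OF _ _ u, where Z=AA], intro lins, intro lins)
   (simp add: DL_pure DR_pure mm_leg mm_lr t1_t2[symmetric] lr_comm)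
qed
lemma DL_r: assumes "t \<in> carr AA" shows "DL a (r1 t x) = r1 (DL a t) x" "DL a (r2 t x) = r2 (DL a t) x"
 by (rule nondeg_mm(1); simp add: DL_adj mm_leg assms)+
lemma DR_l: assumes "t \<in> carr AA" shows "DR a (l1 x t) = l1 x (DR a t)" "DR a (l2 x t) = l2 x (DR a t)"
 by (rule nondeg_mm(2); simp add: mm_leg assms flip: DL_adj)+
lemma t1_DL: "t1 (a * b) c = DL a (t1 b c)"
proof -
 have "ts (t1 (a * b) c) (\<lambda>x y. x \<odot> y) = ts (t1 b c) (\<lambda>p z. ts (t1 a z) (\<lambda>q w. (q * p) \<odot> w))"
  by (rule T1_mult[where Z=AA]) (intro lins)+
 then show ?thesis by (simp add: ts_self DL_def r1_def)
qed
lemma DL_DL: assumes "t \<in> carr AA" shows "DL (a * b) t = DL a (DL b t)"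
 by (rule AA_eq[OF _ _ assms, where Z=AA], intro lins, intro lins) (simp_all add: DL_pure t1_DL DL_r)
lemma t4_DL: "t4 x (a * b) = DL a (t4 x b)"
 by (rule nondegAA(4)) (simp_all add: t1_t4[symmetric] t1_DL DL_r(1) DL_r(2)[symmetric])
lemma DR_DR: "t \<in> carr AA ==> DR (a * b) t = DR b (DR a t)"
 by (rule nondeg_mm(2)) (simp_all add: DL_DL flip: DL_adj)
lemma t2_DR: "t2 c (a * b) = DR b (t2 c a)"
 by (rule nondegAA(2)) (simp_all add: DR_pure[symmetric] DR_DR DR_l(2)[symmetric])
lemma t3_DR: "t3 (a * b) c = DR b (t3 a c)"
 by (rule nondegAA(1)) (simp_all add: DR_pure3[symmetric] DR_DR DR_l(1)[symmetric])

section \<open>The idempotent and the comultiplication\<close>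

lemma fscal_AA: "scal AA = fscal" by (rule scal_tprod)

lemma E1_fix_span: "u \<in> module.span fscal {e1 b c | b c. True} ==> E1 H u = u"
 by (rule lin_span_eq[OF vspace_tprod lin_F(1) lin_id, where P="{e1 b c | b c. True}"]) (auto simp: E1_idem fscal_AA)
lemma E2_fix_span: "u \<in> module.span fscal {e2 b c | b c. True} ==> E2 H u = u"
 by (rule lin_span_eq[OF vspace_tprod lin_F(2) lin_id, where P="{e2 b c | b c. True}"]) (auto simp: E2_E2 fscal_AA)

lemma E1_DL: assumes "t \<in> carr AA" shows "E1 H (DL a t) = DL a t"
proof (rule AA_eq[OF _ _ assms, where Z=AA], intro lins, intro lins)
 interpret F: vector_space "fscal :: 'k \<Rightarrow> ('k,'a,'a) tens \<Rightarrow> _" by (rule vector_space_fscal)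
 fix x y
 have "r1 (t1 a y) x \<in> F.span {r1 (t1 a c) b | a b c. True}" by (rule F.span_base) blast
 then show "E1 H (DL a (x \<odot> y)) = DL a (x \<odot> y)" unfolding span_E(1) using E1_fix_span by (simp add: DL_pure)
qed
lemma E2_DR: assumes "t \<in> carr AA" shows "E2 H (DR a t) = DR a t"
proof (rule AA_eq[OF _ _ assms, where Z=AA], intro lins, intro lins)
 interpret F: vector_space "fscal :: 'k \<Rightarrow> ('k,'a,'a) tens \<Rightarrow> _" by (rule vector_space_fscal)
 fix x y
 have "l2 y (t2 x a) \<in> F.span {l2 c (t2 b a) | a b c. True}" by (rule F.span_base) blast
 then show "E2 H (DR a (x \<odot> y)) = DR a (x \<odot> y)" unfolding span_E(2) using E2_fix_span by (simp add: DR_pure)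
qed
lemma DL_E1: "t \<in> carr AA ==> DL a (E1 H t) = DL a t"
 by (rule nondeg_mm(1)) (simp_all add: DL_adj E_balanced E2_DR)
lemma E1_t1: "E1 H (t1 a b) = t1 a b"
 by (rule nondegAA(3)) (simp_all add: E1_r[symmetric] E1_DL flip: DL_pure)
lemma E1_t4: "E1 H (t4 a b) = t4 a b"
 by (rule nondegAA(4)) (simp_all add: E1_r[symmetric] E1_DL flip: DL_pure4)
lemma E2_t3: "E2 H (t3 a b) = t3 a b"
 by (rule nondegAA(1)) (simp_all add: E2_l[symmetric] E2_DR flip: DR_pure3)
lemma E2_t2: "E2 H (t2 a b) = t2 a b"
 by (rule nondegAA(2)) (simp_all add: E2_l[symmetric] E2_DR flip: DR_pure)

text \<open>The range of \<open>E\<^sub>1\<close> is spanned by the elements \<open>\<Delta>(p)(w \<otimes> u)\<close>, by the axiom on the spans of the two ranges.\<close>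
lemma E1_ext:
 fixes Z :: "('k,'z::ab_group_add) space"
 assumes f: "lin AA Z f" and g: "lin AA Z g" and e: "\<And>p w u. f (DL p (w \<odot> u)) = g (DL p (w \<odot> u))" and t: "t \<in> carr AA"
 shows "f (E1 H t) = g (E1 H t)"
proof (rule AA_eq[OF lin_comp[OF f lin_F(1)] lin_comp[OF g lin_F(1)] t])
 interpret F: vector_space "fscal :: 'k \<Rightarrow> ('k,'a,'a) tens \<Rightarrow> _" by (rule vector_space_fscal)
 fix x y
 show "f (e1 x y) = g (e1 x y)"
 proof (rule lin_span_eq[OF vspace_tprod f g, where P="{r1 (t1 a c) b | a b c. True}"])
  show "e1 x y \<in> module.span (scal AA) {r1 (t1 a c) b | a b c. True}" unfolding fscal_AA span_E(1) by (rule F.span_base) auto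
 qed (auto simp: e simp flip: DL_pure)
qed
lemma E2_ext:
 fixes Z :: "('k,'z::ab_group_add) space"
 assumes f: "lin AA Z f" and g: "lin AA Z g" and e: "\<And>p w u. f (DR p (w \<odot> u)) = g (DR p (w \<odot> u))" and t: "t \<in> carr AA"
 shows "f (E2 H t) = g (E2 H t)"
proof (rule AA_eq[OF lin_comp[OF f lin_F(2)] lin_comp[OF g lin_F(2)] t])
 interpret F: vector_space "fscal :: 'k \<Rightarrow> ('k,'a,'a) tens \<Rightarrow> _" by (rule vector_space_fscal)
 fix x y
 show "f (e2 x y) = g (e2 x y)"
 proof (rule lin_span_eq[OF vspace_tprod f g, where P="{l2 c (t2 b a) | a b c. True}"])
  show "e2 x y \<in> module.span (scal AA) {l2 c (t2 b a) | a b c. True}" unfolding fscal_AA span_E(2) by (rule F.span_base) auto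
 qed (auto simp: e simp flip: DR_pure)
qed
text \<open>The element \<open>E\<^sub>1 t\<close> is tested by the products of \<open>t\<close> with the range of \<open>E\<^sub>2\<close>, and this range is spanned by the
\<open>(w \<otimes> u)\<Delta>(p)\<close>.\<close>
lemma E1_cancel:
 assumes t: "t \<in> carr AA" "u \<in> carr AA" and e: "\<And>d. DL d t = DL d u"
 shows "E1 H t = E1 H u"
proof (rule nondeg_mm(1))
 fix a b
 have "E2 H (a \<odot> b) \<cdot> t = E2 H (a \<odot> b) \<cdot> u"
  by (rule E2_ext[where Z=AA], intro lins, intro lins) (simp_all add: e t flip: DL_adj)
 then show "a \<odot> b \<cdot> E1 H t = a \<odot> b \<cdot> E1 H u" by (simp add: E_balanced t)
qed (simp_all add: t)

lemma el_t3: "el (t3 c a) = a * c"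
proof (rule nondegA_eq(1))
 fix b have "el (t3 c a) * b = el (r2 (t3 c a) b)" by (simp add: el_lr)
 also have "\<dots> = a * c * b" by (simp add: el_lr counit_T mult.assoc flip: T_compat(1))
 finally show "el (t3 c a) * b = a * c * b" .
qed
lemma er_t4: "er (t4 b c) = c * b"
proof (rule nondegA_eq(2))
 fix a have "a * er (t4 b c) = er (l1 a (t4 b c))" by (simp add: el_lr)
 also have "\<dots> = a * (c * b)" by (simp add: el_lr counit_T mult.assoc flip: T_compat(2))
 finally show "a * er (t4 b c) = a * (c * b)" .
qed
lemma eps_el_er: "eps H (el t) = ts t (\<lambda>x y. eps H x * eps H y)" "eps H (er t) = ts t (\<lambda>x y. eps H x * eps H y)"
 by (simp_all add: el_def er_def ts_eps eps_asc mult.commute)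

end

context wmba begin

section \<open>Coassociativity\<close>

abbreviation A3 where "A3 \<equiv> alg H \<otimes> (alg H \<otimes> alg H)"
lemma q3c[simp]: "s \<in> carr AA ==> pure A AA x s \<in> carr A3" by (intro pure_carr) simp_all

text \<open>Reduces identities between triple sums to the case where the first leg is multiplied from the left; there the
missing covering factor is available.\<close>
lemma tri_of_left:
 assumes F: "U \<in> carr A3" "V \<in> carr A3"
  and e: "\<And>d. tsum A AA U (\<lambda>x s. pure A AA (d * x) s) = tsum A AA V (\<lambda>x s. pure A AA (d * x) s)"
 shows "U = V"
proof -
 have l: "lin A3 A3 (\<lambda>U. tsum A AA U (\<lambda>x s. pure A AA (d * x) s))" for d by (intro lins)
 have "U - V = 0"
  by (rule nondeg_left[OF vspace_tprod diff_c[OF F]])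
   (simp add: lin_diff[OF vspace_tprod l F] e)
 then show ?thesis by simp
qed

lemma tsA3_pure: "vspace Z ==> bilin A AA Z b ==> s \<in> carr AA ==> tsum A AA (pure A AA x s) b = b x s"
 by (rule tsum_pure) simp_all
lemma tsA3_ts: "vspace Z ==> bilin A AA Z b ==> (\<And>u w. F u w \<in> carr A3) ==> tsum A AA (ts t F) b = ts t (\<lambda>u w. tsum A AA (F u w) b)"
 by (rule tsum_tsum) simp_all
lemma ts_carrA3[simp]: "(\<And>x y. b x y \<in> carr A3) ==> ts t b \<in> carr A3"
 by (rule ts_carr[OF vspace_tprod])

lemma bil_d: "bilin A AA A3 (\<lambda>x s. pure A AA (d * x) s)" by (intro lins)
lemma bil_g: assumes "vspace Z" "tri Z g" shows "bilin A AA Z (\<lambda>x s. ts s (\<lambda>y z. g x y z))"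
 by (intro lins assms(1) trilD[OF assms(2)]; assumption)
lemma bil_g': assumes "tri Z g" shows "bil Z (g x)"
 by (intro lins trilD[OF assms(1)] carr_A)

text \<open>Coassociativity for \<open>\<Delta>\<close> covered on the outer legs from the right. It follows from the commutation of \<open>T\<^sub>1\<close> and
\<open>T\<^sub>2\<close> after multiplying the first leg from the left.\<close>
lemma coassoc_t1_t4: assumes Z: "vspace Z" and g: "tri Z g"
 shows "ts (t1 p q) (\<lambda>p q. ts (t4 w p) (\<lambda>x y. g x y q)) = ts (t4 w p) (\<lambda>x y. ts (t1 y q) (\<lambda>y q. g x y q))"
proof -
 define U where "U = ts (t1 p q) (\<lambda>p q. ts (t4 w p) (\<lambda>x y. pure A AA x (y \<odot> q)))"
 define V where "V = ts (t4 w p) (\<lambda>x y. ts (t1 y q) (\<lambda>y q. pure A AA x (y \<odot> q)))"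
 have c: "U \<in> carr A3" "V \<in> carr A3" by (simp_all add: U_def V_def)
 have "U = V"
 proof (rule tri_of_left[OF c])
  fix d
  have "tsum A AA U (\<lambda>x s. pure A AA (d * x) s) = ts (t1 p q) (\<lambda>p q. ts (t4 w p) (\<lambda>x y. pure A AA (d * x) (y \<odot> q)))"
   by (simp add: U_def tsA3_ts[OF vspace_tprod bil_d] tsA3_pure[OF vspace_tprod bil_d])
  also have "\<dots> = ts (t1 p q) (\<lambda>p q. ts (l1 d (t4 w p)) (\<lambda>x y. pure A AA x (y \<odot> q)))"
   by (subst ts_lr(1)[where Z=A3]) (intro lins | simp)+
  also have "\<dots> = ts (t1 p q) (\<lambda>p q. ts (t2 d p) (\<lambda>x y. pure A AA (x * w) (y \<odot> q)))"
   unfolding T_compat(2)[symmetric] by (subst ts_lr(3)[where Z=A3]) (intro lins | simp)+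
  also have "\<dots> = ts (t2 d p) (\<lambda>x y. ts (t1 y q) (\<lambda>y q. pure A AA (x * w) (y \<odot> q)))"
   by (rule T1_T2_commute[where Z=A3]) (intro lins | simp)+
  also have "\<dots> = ts (r1 (t2 d p) w) (\<lambda>x y. ts (t1 y q) (\<lambda>y q. pure A AA x (y \<odot> q)))"
   by (subst ts_lr(3)[where Z=A3]) (intro lins | simp)+
  also have "\<dots> = ts (t4 w p) (\<lambda>x y. ts (t1 y q) (\<lambda>y q. pure A AA (d * x) (y \<odot> q)))"
   unfolding T_compat(2) by (subst ts_lr(1)[where Z=A3]) (intro lins | simp)+
  also have "\<dots> = tsum A AA V (\<lambda>x s. pure A AA (d * x) s)"
   by (simp add: V_def tsA3_ts[OF vspace_tprod bil_d] tsA3_pure[OF vspace_tprod bil_d])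
  finally show "tsum A AA U (\<lambda>x s. pure A AA (d * x) s) = tsum A AA V (\<lambda>x s. pure A AA (d * x) s)" .
 qed
 then have "tsum A AA U (\<lambda>x s. ts s (\<lambda>y z. g x y z)) = tsum A AA V (\<lambda>x s. ts s (\<lambda>y z. g x y z))" by simp
 then show ?thesis
  by (simp add: U_def V_def tsA3_ts[OF Z bil_g[OF Z g]] tsA3_pure[OF Z bil_g[OF Z g]] ts_pure[OF Z bil_g'[OF g]])
qed

text \<open>In Sweedler notation, \<open>p\<^sub>1 \<otimes> \<Delta>(p\<^sub>2 q) z = (p\<^sub>1 \<otimes> p\<^sub>2 \<otimes> p\<^sub>3)(1 \<otimes> \<Delta>(q) z)\<close>.\<close>
lemma coassoc_DL: assumes Z: "vspace Z" and g: "tri Z g" and z: "z \<in> carr AA"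
 shows "ts (t1 p q) (\<lambda>p q. ts (DL q z) (\<lambda>x y. g p x y)) = ts (DL q z) (\<lambda>x y. ts (t1 p y) (\<lambda>p y. ts (t1 p x) (\<lambda>p x. g p x y)))"
proof -
 define U where "U = ts (t1 p q) (\<lambda>p q. ts (DL q z) (\<lambda>x y. pure A AA p (x \<odot> y)))"
 define V where "V = ts (DL q z) (\<lambda>x y. ts (t1 p y) (\<lambda>p y. ts (t1 p x) (\<lambda>p x. pure A AA p (x \<odot> y))))"
 have c: "U \<in> carr A3" "V \<in> carr A3" by (simp_all add: U_def V_def)
 have "U = V"
 proof (rule tri_of_left[OF c])
  fix d
  have "tsum A AA U (\<lambda>x s. pure A AA (d * x) s) = ts (t1 p q) (\<lambda>p q. ts (DL q z) (\<lambda>x y. pure A AA (d * p) (x \<odot> y)))"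
   by (simp add: U_def tsA3_ts[OF vspace_tprod bil_d] tsA3_pure[OF vspace_tprod bil_d])
  also have "\<dots> = ts (l1 d (t1 p q)) (\<lambda>p q. ts (DL q z) (\<lambda>x y. pure A AA p (x \<odot> y)))"
   by (subst ts_lr(1)[where Z=A3]) (intro lins | simp)+
  also have "\<dots> = ts (t2 d p) (\<lambda>s t. ts (DL (t * q) z) (\<lambda>x y. pure A AA s (x \<odot> y)))"
   unfolding t1_t2 by (subst ts_lr(4)[where Z=A3]) (intro lins | simp)+
  also have "\<dots> = ts (t2 d p) (\<lambda>s t. ts (DL q z) (\<lambda>x y. ts (t1 t y) (\<lambda>t y. pure A AA s ((t * x) \<odot> y))))"
  proof (rule tsum_cong[OF vspace_A])
   fix s t
   have "ts (DL (t * q) z) (\<lambda>x y. pure A AA s (x \<odot> y)) = ts (ts (DL q z) (\<lambda>x y. r1 (t1 t y) x)) (\<lambda>x y. pure A AA s (x \<odot> y))"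
    by (simp add: DL_DL z flip: DL_def)
   also have "\<dots> = ts (DL q z) (\<lambda>x y. ts (r1 (t1 t y) x) (\<lambda>x y. pure A AA s (x \<odot> y)))"
    by (rule ts_ts[where Z=A3]) (intro lins | simp)+
   also have "\<dots> = ts (DL q z) (\<lambda>x y. ts (t1 t y) (\<lambda>t y. pure A AA s ((t * x) \<odot> y)))"
    by (subst ts_lr(3)[where Z=A3]) (intro lins | simp)+
   finally show "ts (DL (t * q) z) (\<lambda>x y. pure A AA s (x \<odot> y)) = ts (DL q z) (\<lambda>x y. ts (t1 t y) (\<lambda>t y. pure A AA s ((t * x) \<odot> y)))" .
  qed
  also have "\<dots> = ts (DL q z) (\<lambda>x y. ts (t2 d p) (\<lambda>s t. ts (t1 t y) (\<lambda>t y. pure A AA s ((t * x) \<odot> y))))"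
   by (rule ts_swap)
  also have "\<dots> = ts (DL q z) (\<lambda>x y. ts (t1 p y) (\<lambda>p y. ts (t2 d p) (\<lambda>s t. pure A AA s ((t * x) \<odot> y))))"
   by (subst T1_T2_commute[where Z=A3]) (intro lins | simp)+
  also have "\<dots> = ts (DL q z) (\<lambda>x y. ts (t1 p y) (\<lambda>p y. ts (r2 (t2 d p) x) (\<lambda>s t. pure A AA s (t \<odot> y))))"
   by (subst ts_lr(4)[where Z=A3]) (intro lins | simp)+
  also have "\<dots> = ts (DL q z) (\<lambda>x y. ts (t1 p y) (\<lambda>p y. ts (t1 p x) (\<lambda>p x. pure A AA (d * p) (x \<odot> y))))"
   unfolding t1_t2[symmetric] by (subst ts_lr(1)[where Z=A3]) (intro lins | simp)+
  also have "\<dots> = tsum A AA V (\<lambda>x s. pure A AA (d * x) s)"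
   by (simp add: V_def tsA3_ts[OF vspace_tprod bil_d] tsA3_pure[OF vspace_tprod bil_d])
  finally show "tsum A AA U (\<lambda>x s. pure A AA (d * x) s) = tsum A AA V (\<lambda>x s. pure A AA (d * x) s)" .
 qed
 then have "tsum A AA U (\<lambda>x s. ts s (\<lambda>y z. g x y z)) = tsum A AA V (\<lambda>x s. ts s (\<lambda>y z. g x y z))" by simp
 then show ?thesis
  by (simp add: U_def V_def tsA3_ts[OF Z bil_g[OF Z g]] tsA3_pure[OF Z bil_g[OF Z g]] ts_pure[OF Z bil_g'[OF g]])
qed

abbreviation B3 where "B3 \<equiv> (alg H \<otimes> alg H) \<otimes> alg H"
lemma q3c'[simp]: "s \<in> carr AA ==> pure AA A s x \<in> carr B3" by (intro pure_carr) simp_all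
lemma ts_carrB3[simp]: "(\<And>x y. b x y \<in> carr B3) ==> ts t b \<in> carr B3"
 by (rule ts_carr[OF vspace_tprod])
lemma tsB3_pure: "vspace Z ==> bilin AA A Z b ==> s \<in> carr AA ==> tsum AA A (pure AA A s x) b = b s x"
 by (rule tsum_pure) (simp_all add: vspace_tprod)
lemma tsB3_ts: "vspace Z ==> bilin AA A Z b ==> (\<And>u w. F u w \<in> carr B3) ==> tsum AA A (ts t F) b = ts t (\<lambda>u w. tsum AA A (F u w) b)"
 by (rule tsum_tsum) (simp_all add: vspace_tprod)
lemma bil_d3: "bilin AA A B3 (\<lambda>s x. pure AA A s (x * d))" by (intro lins)
lemma bil_g3: assumes "vspace Z" "tri Z g" shows "bilin AA A Z (\<lambda>s z. ts s (\<lambda>x y. g x y z))"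
 by (intro lins assms(1) trilD[OF assms(2)]; assumption)
lemma bil_g3': assumes "tri Z g" shows "bil Z (\<lambda>x y. g x y z)"
 by (intro lins trilD[OF assms(1)] carr_A)

lemma coassoc_t3_t4: assumes Z: "vspace Z" and g: "tri Z g"
 shows "ts (t3 d c) (\<lambda>p z. ts (t4 x p) (\<lambda>x y. g x y z)) = ts (t4 x d) (\<lambda>x y. ts (t3 y c) (\<lambda>y z. g x y z))"
proof -
 define U where "U = ts (t3 d c) (\<lambda>p z. ts (t4 x p) (\<lambda>x y. pure AA A (x \<odot> y) z))"
 define V where "V = ts (t4 x d) (\<lambda>x y. ts (t3 y c) (\<lambda>y z. pure AA A (x \<odot> y) z))"
 have c: "U \<in> carr B3" "V \<in> carr B3" by (simp_all add: U_def V_def)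
 have l: "lin B3 B3 (\<lambda>U. tsum AA A U (\<lambda>x s. pure AA A x (s * e)))" for e by (intro lins)
 have "U - V = 0"
 proof (rule nondeg_right'[OF vspace_tprod diff_c[OF c]])
  fix e
  have "tsum AA A U (\<lambda>x s. pure AA A x (s * e)) = ts (t3 d c) (\<lambda>p z. ts (t4 x p) (\<lambda>x y. pure AA A (x \<odot> y) (z * e)))"
   by (simp add: U_def tsB3_ts[OF vspace_tprod bil_d3] tsB3_pure[OF vspace_tprod bil_d3])
  also have "\<dots> = ts (r2 (t3 d c) e) (\<lambda>p z. ts (t4 x p) (\<lambda>x y. pure AA A (x \<odot> y) z))"
   by (subst ts_lr(4)[where Z=B3]) (intro lins | simp)+
  also have "\<dots> = ts (t1 d e) (\<lambda>p z. ts (t4 x p) (\<lambda>x y. pure AA A (x \<odot> y) (c * z)))"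
   unfolding T_compat(1)[symmetric] by (subst ts_lr(2)[where Z=B3]) (intro lins | simp)+
  also have "\<dots> = ts (t4 x d) (\<lambda>x y. ts (t1 y e) (\<lambda>y z. pure AA A (x \<odot> y) (c * z)))"
   by (rule coassoc_t1_t4[where Z=B3]) (intro lins | simp)+
  also have "\<dots> = ts (t4 x d) (\<lambda>x y. ts (l2 c (t1 y e)) (\<lambda>y z. pure AA A (x \<odot> y) z))"
   by (subst ts_lr(2)[where Z=B3]) (intro lins | simp)+
  also have "\<dots> = ts (t4 x d) (\<lambda>x y. ts (t3 y c) (\<lambda>y z. pure AA A (x \<odot> y) (z * e)))"
   unfolding T_compat(1) by (subst ts_lr(4)[where Z=B3]) (intro lins | simp)+
  also have "\<dots> = tsum AA A V (\<lambda>x s. pure AA A x (s * e))"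
   by (simp add: V_def tsB3_ts[OF vspace_tprod bil_d3] tsB3_pure[OF vspace_tprod bil_d3])
  finally show "tsum AA A (U - V) (\<lambda>x s. pure AA A x (s * e)) = 0"
   by (simp add: lin_diff[OF vspace_tprod l c])
 qed
 then have "tsum AA A U (\<lambda>s z. ts s (\<lambda>x y. g x y z)) = tsum AA A V (\<lambda>s z. ts s (\<lambda>x y. g x y z))" by simp
 then show ?thesis
  by (simp add: U_def V_def tsB3_ts[OF Z bil_g3[OF Z g]] tsB3_pure[OF Z bil_g3[OF Z g]] ts_pure[OF Z bil_g3'[OF g]])
qed

section \<open>Multipliers and counital maps\<close>

abbreviation "MM \<equiv> carr (multipliers H)"
lemma MM_iff: "m \<in> MM \<longleftrightarrow> lin A A (fst m) \<and> lin A A (snd m) \<and> (\<forall>a b. a * (m \<rhd> b) = (a \<lhd> m) * b)"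
 by (simp add: multipliers_def)
lemma lin_ml[lins]: "lin W A f ==> m \<in> MM ==> lin W A (\<lambda>w. m \<rhd> f w)"
 unfolding MM_iff using lin_comp by blast
lemma lin_mr[lins]: "lin W A f ==> m \<in> MM ==> lin W A (\<lambda>w. f w \<lhd> m)"
 unfolding MM_iff using lin_comp by blast
lemma MM_bal: "m \<in> MM ==> a * (m \<rhd> b) = (a \<lhd> m) * b" by (simp add: MM_iff)
lemma MM_l: assumes m: "m \<in> MM" shows "m \<rhd> (a * b) = (m \<rhd> a) * b"
 by (rule nondegA_eq(2)) (simp add: MM_bal[OF m] flip: mult.assoc)
lemma MM_r: assumes m: "m \<in> MM" shows "(a * b) \<lhd> m = a * (b \<lhd> m)"
 by (rule nondegA_eq(1)) (simp add: MM_bal[OF m, symmetric] mult.assoc)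
lemma MMI: "lin A A (fst m) ==> lin A A (snd m) ==> (\<And>a b. a * (m \<rhd> b) = (a \<lhd> m) * b) ==> m \<in> MM"
 by (simp add: MM_iff)
lemma MM_eq: assumes m: "m \<in> MM" "n \<in> MM" and e: "\<And>x. m \<rhd> x = n \<rhd> x" shows "m = n"
proof (rule prod_eqI)
 show "fst m = fst n" using e by blast
 have "a \<lhd> m = a \<lhd> n" for a by (rule nondegA_eq(1)) (simp add: MM_bal[OF m(1), symmetric] MM_bal[OF m(2), symmetric] e)
 then show "snd m = snd n" by blast
qed
lemma MM_eqr: assumes m: "m \<in> MM" "n \<in> MM" and e: "\<And>x. x \<lhd> m = x \<lhd> n" shows "m = n"
 by (rule MM_eq[OF m], rule nondegA_eq(2)) (simp add: MM_bal m e)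
lemma ts_ml: "m \<in> MM ==> m \<rhd> ts t b = ts t (\<lambda>x y. m \<rhd> b x y)" by (rule ts_pushA[of A "\<lambda>w. m \<rhd> w"]) (intro lins)
lemma ts_mr: "m \<in> MM ==> ts t b \<lhd> m = ts t (\<lambda>x y. b x y \<lhd> m)" by (rule ts_pushA[of A "\<lambda>w. w \<lhd> m"]) (intro lins)

abbreviation "Rb \<equiv> pi_bar_R H"
abbreviation "Lb \<equiv> pi_bar_L H"
abbreviation "Rr \<equiv> pi_R H"
text \<open>The fourth counital map \<open>c \<mapsto> (\<epsilon> \<otimes> A)(E(b \<otimes> c))\<close>, the companion of \<open>Rb\<close>, \<open>Rr\<close> and \<open>Lb\<close>. It is
the image of \<open>Rb\<close> under the antipode (\<open>Sb_Rb\<close>).\<close>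
definition "L b = ((\<lambda>c. el (e1 b c)), (\<lambda>a. el (t4 b a)))"

lemma Rb_l: "Rb b \<rhd> x = er (e1 x b)" and Rb_r: "x \<lhd> Rb b = er (t1 x b)"
 by (simp_all add: pi_bar_R_def ap_eq eps_right_eq)
lemma Lb_l: "Lb b \<rhd> x = el (t2 b x)" and Lb_r: "x \<lhd> Lb b = el (e2 b x)"
 by (simp_all add: pi_bar_L_def ap_eq eps_left_eq)
lemma Rr_l: "Rr b \<rhd> x = er (t3 x b)" and Rr_r: "x \<lhd> Rr b = er (e2 x b)"
 by (simp_all add: pi_R_def ap_eq eps_right_eq)
lemma L_l: "L b \<rhd> x = el (e1 b x)" and L_r: "x \<lhd> L b = el (t4 b x)"
 by (simp_all add: L_def)
lemmas RLs = Rb_l Rb_r Lb_l Lb_r Rr_l Rr_r L_l L_r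

lemma lin_RLs[lins]: 
 "lin W A f ==> lin W A (\<lambda>w. Rb (f w) \<rhd> x)" "lin W A f ==> lin W A (\<lambda>w. x \<lhd> Rb (f w))"
 "lin W A f ==> lin W A (\<lambda>w. Rr (f w) \<rhd> x)" "lin W A f ==> lin W A (\<lambda>w. x \<lhd> Rr (f w))"
 "lin W A f ==> lin W A (\<lambda>w. L (f w) \<rhd> x)" "lin W A f ==> lin W A (\<lambda>w. x \<lhd> L (f w))"
 "lin W A f ==> lin W A (\<lambda>w. Lb (f w) \<rhd> x)" "lin W A f ==> lin W A (\<lambda>w. x \<lhd> Lb (f w))"
 unfolding RLs by (intro lins; assumption)+

lemma L_MM[lins, simp]: "L b \<in> MM"
proof (rule MMI)
 show "lin A A (fst (L b))" "lin A A (snd (L b))" unfolding L_def fst_conv snd_conv by (intro lins)+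
 fix a c
 have "a * (L b \<rhd> c) = el (l2 a (e1 b c))" by (simp add: L_l el_lr)
 also have "\<dots> = el (r1 (t1 a c) b)" by (rule counit_E)
 also have "\<dots> = (a \<lhd> L b) * c" by (simp add: t1_t4 L_r el_lr)
 finally show "a * (L b \<rhd> c) = (a \<lhd> L b) * c" .
qed
lemma Lb_MM[lins, simp]: "Lb b \<in> MM"
proof (rule MMI)
 show "lin A A (fst (Lb b))" "lin A A (snd (Lb b))" unfolding Lb_l[abs_def] Lb_r[abs_def] by (intro lins)+
 fix a c
 have "a * (Lb b \<rhd> c) = el (l2 a (t2 b c))" by (simp add: Lb_l el_lr)
 also have "\<dots> = el (r2 (e2 b a) c)" by (rule counit_E(2)[symmetric])
 also have "\<dots> = (a \<lhd> Lb b) * c" by (simp add: Lb_r el_lr)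
 finally show "a * (Lb b \<rhd> c) = (a \<lhd> Lb b) * c" .
qed

text \<open>Here and in the next lemma \<open>\<epsilon>(x y b)\<close> is written as \<open>\<epsilon>(x y\<^sub>1) \<epsilon>(y\<^sub>2 b)\<close> and as \<open>\<epsilon>(x y\<^sub>2) \<epsilon>(y\<^sub>1 b)\<close>. This takes the place of
the multiplicativity of the counit.\<close>
lemma eps_weak_mult1: "eps H (x * y * b) = ts (t1 y b) (\<lambda>p q. eps H (x * p) * eps H q)"
proof -
 have "ts (t1 y b) (\<lambda>p q. eps H (x * p) * eps H q) = ts (l1 x (t1 y b)) (\<lambda>p q. eps H p * eps H q)"
  by (rule ts_lrS(1)[symmetric]) (intro lins)
 also have "\<dots> = ts (t2 x y) (\<lambda>p q. eps H p * eps H (q * b))"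
  unfolding t1_t2 by (rule ts_lrS(4)) (intro lins)
 also have "\<dots> = eps H ((Lb x \<rhd> y) * b)"
  by (simp add: Lb_l el_def ts_mul ts_eps asc_mul eps_asc)
 also have "\<dots> = eps H (el (t2 x (y * b)))" by (simp add: MM_l[symmetric]) (simp add: Lb_l)
 also have "\<dots> = eps H (er (t2 x (y * b)))" by (simp only: eps_el_er)
 finally show ?thesis by (simp add: counit_T mult.assoc)
qed
lemma eps_weak_mult2: "eps H (x * y * b) = ts (t4 b y) (\<lambda>p q. eps H (x * q) * eps H p)"
proof -
 have "ts (t4 b y) (\<lambda>p q. eps H (x * q) * eps H p) = eps H (x * (y \<lhd> L b))"
  by (simp add: L_r el_def ts_mul ts_eps asc_mul eps_asc mult.commute)
 also have "\<dots> = eps H (el (t4 b (x * y)))" by (simp add: MM_r[symmetric]) (simp add: L_r)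
 also have "\<dots> = eps H (er (t4 b (x * y)))" by (simp only: eps_el_er)
 finally show ?thesis by (simp add: er_t4)
qed

lemma Rb_mul: "(a * p) \<lhd> Rb b = a * (p \<lhd> Rb b)"
proof (rule nondegA_eq(2))
 fix q
 have "q * er (t1 (a * p) b) = ts (t2 q (a * p)) (\<lambda>s t. asc H (eps H (t * b)) s)"
  by (simp add: el_lr(3)[symmetric] t1_t2) (simp add: er_def, rule ts_lrA(4), intro lins)
 also have "\<dots> = ts (ts (t2 q a) (\<lambda>s t. l2 t (t2 s p))) (\<lambda>s t. asc H (eps H (t * b)) s)"
  by (simp add: t2_DR DR_def)
 also have "\<dots> = ts (t2 q a) (\<lambda>s t. ts (l2 t (t2 s p)) (\<lambda>s t. asc H (eps H (t * b)) s))"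
  by (rule ts_tsA) (intro lins | simp)+
 also have "\<dots> = ts (t2 q a) (\<lambda>s t. ts (t2 s p) (\<lambda>u w. asc H (eps H (t * w * b)) u))"
  by (subst ts_lrA(2)) (intro lins | simp add: mult.assoc)+
 also have "\<dots> = ts (t2 q a) (\<lambda>s t. ts (t2 s p) (\<lambda>u w. ts (t1 w b) (\<lambda>w b. asc H (eps H b) (asc H (eps H (t * w)) u))))"
 proof (intro tsum_cong vspace_A)
  fix t u w
  have "lin scalars A (\<lambda>c. asc H c u)" by (intro lins)
  then show "asc H (eps H (t * w * b)) u = ts (t1 w b) (\<lambda>w b. asc H (eps H b) (asc H (eps H (t * w)) u))"
   unfolding eps_weak_mult1 using ts_push[OF vspace_scalars, of A "\<lambda>c. asc H c u"] vector_space.vector_space_assms(3)[OF vs_A]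
   by (simp add: mult.commute)
 qed
 also have "\<dots> = ts (t2 q a) (\<lambda>s t. ts (t1 p b) (\<lambda>p b. ts (t2 s p) (\<lambda>u w. asc H (eps H b) (asc H (eps H (t * w)) u))))"
  by (subst T1_T2_commute[where Z=A]) (intro lins | simp)+
 also have "\<dots> = ts (t1 p b) (\<lambda>p b. ts (t2 q a) (\<lambda>s t. ts (t2 s p) (\<lambda>u w. asc H (eps H b) (asc H (eps H (t * w)) u))))"
  by (rule ts_swap)
 also have "\<dots> = ts (t1 p b) (\<lambda>p b. asc H (eps H b) (q * a * p))"
 proof (intro tsum_cong vspace_A)
  fix p b
  have "q * a * p = er (DR p (t2 q a))" by (simp add: mult.assoc counit_T flip: t2_DR)
  also have "\<dots> = ts (t2 q a) (\<lambda>s t. er (l2 t (t2 s p)))" unfolding DR_def by (rule er_ts) simp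
  also have "\<dots> = ts (t2 q a) (\<lambda>s t. ts (t2 s p) (\<lambda>u w. asc H (eps H (t * w)) u))"
   unfolding er_def by (subst ts_lrA(2)) (intro lins | simp)+
  finally show "ts (t2 q a) (\<lambda>s t. ts (t2 s p) (\<lambda>u w. asc H (eps H b) (asc H (eps H (t * w)) u))) = asc H (eps H b) (q * a * p)"
   by (simp add: ts_asc)
 qed
 also have "\<dots> = q * (a * er (t1 p b))" by (simp add: er_def ts_mul asc_mul mult.assoc)
 finally show "q * ((a * p) \<lhd> Rb b) = q * (a * (p \<lhd> Rb b))" by (simp add: Rb_r)
qed

lemma Rr_mul: "Rr a \<rhd> (p * c) = (Rr a \<rhd> p) * c"
proof (rule nondegA_eq(1))
 fix q
 have "er (t3 (p * c) a) * q = ts (t4 q (p * c)) (\<lambda>s t. asc H (eps H (a * t)) s)"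
  by (simp add: el_lr(4)[symmetric] t3_t4) (simp add: er_def, rule ts_lrA(2), intro lins)
 also have "\<dots> = ts (ts (t4 q c) (\<lambda>s t. r2 (t4 s p) t)) (\<lambda>s t. asc H (eps H (a * t)) s)"
  by (simp add: t4_DL DL_def t1_t4)
 also have "\<dots> = ts (t4 q c) (\<lambda>s t. ts (r2 (t4 s p) t) (\<lambda>s t. asc H (eps H (a * t)) s))"
  by (rule ts_tsA) (intro lins | simp)+
 also have "\<dots> = ts (t4 q c) (\<lambda>s t. ts (t4 s p) (\<lambda>u w. asc H (eps H (a * w * t)) u))"
  by (subst ts_lrA(4)) (intro lins | simp add: mult.assoc)+
 also have "\<dots> = ts (t4 q c) (\<lambda>s t. ts (t4 s p) (\<lambda>u w. ts (l2 a (t4 t w)) (\<lambda>w b. asc H (eps H b) (asc H (eps H w) u))))"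
 proof (intro tsum_cong vspace_A)
  fix t u w
  have "lin scalars A (\<lambda>c. asc H c u)" by (intro lins)
  moreover have "ts (l2 a (t4 t w)) (\<lambda>w b. asc H (eps H b) (asc H (eps H w) u)) = ts (t4 t w) (\<lambda>w b. asc H (eps H (a * b)) (asc H (eps H w) u))"
   by (rule ts_lrA(2)) (intro lins)
  ultimately show "asc H (eps H (a * w * t)) u = ts (l2 a (t4 t w)) (\<lambda>w b. asc H (eps H b) (asc H (eps H w) u))"
   unfolding eps_weak_mult2 using ts_push[OF vspace_scalars, of A "\<lambda>c. asc H c u"] vector_space.vector_space_assms(3)[OF vs_A]
   by simp
 qed
 also have "\<dots> = ts (t4 q c) (\<lambda>s t. ts (t4 s p) (\<lambda>u w. ts (t3 w a) (\<lambda>w b. asc H (eps H b) (asc H (eps H (w * t)) u))))"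
  unfolding t3_t4[symmetric] by (subst ts_lrA(3)) (intro lins | simp)+
 also have "\<dots> = ts (t4 q c) (\<lambda>s t. ts (t3 p a) (\<lambda>p b. ts (t4 s p) (\<lambda>u w. asc H (eps H b) (asc H (eps H (w * t)) u))))"
  by (subst coassoc_t3_t4[where Z=A]) (intro lins | simp)+
 also have "\<dots> = ts (t3 p a) (\<lambda>p b. ts (t4 q c) (\<lambda>s t. ts (t4 s p) (\<lambda>u w. asc H (eps H b) (asc H (eps H (w * t)) u))))"
  by (rule ts_swap)
 also have "\<dots> = ts (t3 p a) (\<lambda>p b. asc H (eps H b) (p * (c * q)))"
 proof (intro tsum_cong vspace_A)
  fix p b
  have "p * (c * q) = er (DL p (t4 q c))" by (simp add: mult.assoc er_t4 flip: t4_DL)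
  also have "\<dots> = ts (t4 q c) (\<lambda>s t. er (r2 (t4 s p) t))" unfolding DL_def t1_t4 by (rule er_ts) simp
  also have "\<dots> = ts (t4 q c) (\<lambda>s t. ts (t4 s p) (\<lambda>u w. asc H (eps H (w * t)) u))"
   unfolding er_def by (subst ts_lrA(4)) (intro lins | simp)+
  finally show "ts (t4 q c) (\<lambda>s t. ts (t4 s p) (\<lambda>u w. asc H (eps H b) (asc H (eps H (w * t)) u))) = asc H (eps H b) (p * (c * q))"
   by (simp add: ts_asc)
 qed
 also have "\<dots> = er (t3 p a) * c * q" by (simp add: er_def ts_mul asc_mul mult.assoc)
 finally show "(Rr a \<rhd> (p * c)) * q = (Rr a \<rhd> p) * c * q" by (simp add: Rr_l)
qed

lemma Rb_MM[lins, simp]: "Rb b \<in> MM"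
proof (rule MMI)
 show "lin A A (fst (Rb b))" "lin A A (snd (Rb b))" unfolding Rb_l[abs_def] Rb_r[abs_def] by (intro lins)+
 fix a c
 have "(a \<lhd> Rb b) * c = er (DL a (E1 H (c \<odot> b)))" by (simp add: Rb_r DL_E1 DL_pure el_lr)
 also have "\<dots> = a * er (E1 H (c \<odot> b))"
 proof (rule E1_ext[where Z=A], intro lins, intro lins)
  fix p w u
  have "er (DL a (DL p (w \<odot> u))) = er (t1 (a * p) u) * w" by (simp add: DL_DL[symmetric], simp add: DL_pure el_lr)
  also have "\<dots> = a * er (DL p (w \<odot> u))" using Rb_mul[where a=a and p=p and b=u] by (simp add: Rb_r DL_pure el_lr mult.assoc)
  finally show "er (DL a (DL p (w \<odot> u))) = a * er (DL p (w \<odot> u))" .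
 qed simp
 finally show "a * (Rb b \<rhd> c) = (a \<lhd> Rb b) * c" by (simp add: Rb_l)
qed
lemma Rr_MM[lins, simp]: "Rr b \<in> MM"
proof (rule MMI)
 show "lin A A (fst (Rr b))" "lin A A (snd (Rr b))" unfolding Rr_l[abs_def] Rr_r[abs_def] by (intro lins)+
 fix a c
 have "a * (Rr b \<rhd> c) = er (DR c (a \<odot> b))" by (simp add: Rr_l DR_pure3 el_lr)
 also have "\<dots> = er (DR c (E2 H (a \<odot> b)))"
 proof -
  have "DR c (E2 H (a \<odot> b)) = DR c (a \<odot> b)"
   by (rule nondeg_mm(2)) (simp_all add: DL_adj[symmetric] E_balanced[symmetric] E1_DL)
  then show ?thesis by simp
 qed
 also have "\<dots> = er (E2 H (a \<odot> b)) * c"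
 proof (rule E2_ext[where Z=A], intro lins, intro lins)
  fix p w u
  have "er (DR c (DR p (w \<odot> u))) = w * er (t3 (p * c) u)" by (simp add: DR_DR[symmetric], simp add: DR_pure3 el_lr)
  also have "\<dots> = er (DR p (w \<odot> u)) * c" using Rr_mul[where a=u and p=p and c=c] by (simp add: Rr_l DR_pure3 el_lr mult.assoc)
  finally show "er (DR c (DR p (w \<odot> u))) = er (DR p (w \<odot> u)) * c" .
 qed simp
 finally show "a * (Rr b \<rhd> c) = (a \<lhd> Rr b) * c" by (simp add: Rr_r)
qed
end

section \<open>Calculus of the counital maps\<close>

lemma functional_sep:
 fixes s :: "'k::field \<Rightarrow> 'v::ab_group_add \<Rightarrow> 'v"
 assumes V: "vector_space s" and W: "module.subspace s W"
  and h: "\<And>\<theta>. Vector_Spaces.linear s (*) \<theta> ==> (\<And>w. w \<in> W ==> \<theta> w = 0) ==> \<theta> x = 0"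
 shows "x \<in> W"
proof (rule ccontr)
 interpret vector_space s by (rule V)
 interpret K: vector_space "(*) :: 'k \<Rightarrow> 'k \<Rightarrow> 'k" by unfold_locales (auto simp: algebra_simps)
 interpret VK: vector_space_pair s "(*) :: 'k \<Rightarrow> 'k \<Rightarrow> 'k" ..
 assume x: "x \<notin> W"
 obtain B where B: "B \<subseteq> W" "independent B" "W \<subseteq> span B" using maximal_independent_subset by blast
 have sp: "span B = W" using B(3) span_minimal[OF B(1) W] by auto
 have ind: "independent (insert x B)" using x B(2) sp by (simp add: independent_insert)
 define \<psi> where "\<psi> = VK.construct (insert x B) (\<lambda>y. if y = x then 1 else 0)"
 have l: "Vector_Spaces.linear s (*) \<psi>" unfolding \<psi>_def by (rule VK.linear_construct[OF ind])
 interpret l: Vector_Spaces.linear s "(*)" \<psi> by (rule l)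
 have xB: "x \<notin> B" using x B(1) by auto
 have b0: "\<psi> b = 0" if "b \<in> B" for b
  unfolding \<psi>_def using VK.construct_basis[OF ind, of b] that xB by auto
 have "\<psi> y = 0" if "y \<in> span B" for y
  using that by (induction rule: span_induct_alt) (simp_all add: l.add l.scale b0)
 then have "\<psi> x = 0" using h[OF l] sp by blast
 moreover have "\<psi> x = 1" unfolding \<psi>_def using VK.construct_basis[OF ind, of x] by simp
 ultimately show False by simp
qed

lemma linear_lin: "Vector_Spaces.linear (scal X) (*) \<theta> ==> lin X scalars \<theta>"
proof -
 assume "Vector_Spaces.linear (scal X) (*) \<theta>"
 then interpret l: Vector_Spaces.linear "scal X" "(*)" \<theta> .
 show ?thesis by (simp add: lin_def l.add l.scale)
qed

lemma vspace_functionals: assumes X: "vspace X" and h: "\<And>\<omega>. lin X scalars \<omega> ==> \<omega> x = 0" shows "x = 0"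
proof -
 interpret vector_space "scal X" by (rule vspace_vs[OF X])
 have "x \<in> {0}" by (rule functional_sep[OF vspace_vs[OF X] subspace_single_0]) (rule h, rule linear_lin)
 then show ?thesis by simp
qed

context wmba begin

lemma ts_zero: "(\<And>x y. b x y = 0) ==> ts t b = 0" by (simp add: tsum_def split_def)
lemma asc_0[simp]: "asc H c 0 = 0"
proof -
 interpret vector_space "asc H" by (rule vs_A)
 show ?thesis by (rule scale_zero_right)
qed

text \<open>Multiplication of one leg by a multiplier from the left.\<close>
definition "o1 m t = ts t (\<lambda>x y. (m \<rhd> x) \<odot> y)"
definition "o2 m t = ts t (\<lambda>x y. x \<odot> (m \<rhd> y))"
lemma o_c[simp]: "o1 m t \<in> carr AA" "o2 m t \<in> carr AA" by (simp_all add: o1_def o2_def)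
lemma lin_o[lins]: "lin W AA f ==> m \<in> MM ==> lin W AA (\<lambda>w. o1 m (f w))" "lin W AA f ==> m \<in> MM ==> lin W AA (\<lambda>w. o2 m (f w))"
 unfolding o1_def o2_def by (intro lins; assumption)+
lemma o_pure: "m \<in> MM ==> o1 m (x \<odot> y) = (m \<rhd> x) \<odot> y" "m \<in> MM ==> o2 m (x \<odot> y) = x \<odot> (m \<rhd> y)"
 unfolding o1_def o2_def by (rule ts_pureAA; intro lins; assumption)+
lemma ts_o: assumes "vspace Z" "bil Z b" "m \<in> MM"
 shows "ts (o1 m t) b = ts t (\<lambda>x y. b (m \<rhd> x) y)" "ts (o2 m t) b = ts t (\<lambda>x y. b x (m \<rhd> y))"
 unfolding o1_def o2_def by (simp_all add: ts_ts[OF assms(1,2)] ts_pure[OF assms(1,2)])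
lemma o_r: assumes t: "t \<in> carr AA" and m: "m \<in> MM" shows "o1 m (r1 t a) = r1 (o1 m t) a" "o1 m (r2 t a) = r2 (o1 m t) a"
  "o2 m (r1 t a) = r1 (o2 m t) a" "o2 m (r2 t a) = r2 (o2 m t) a"
  "l1 a (o1 m t) = l1 (a \<lhd> m) t" "l2 a (o2 m t) = l2 (a \<lhd> m) t" "l1 a (o2 m t) = o2 m (l1 a t)"
 by (rule AA_eq[OF _ _ t, where Z=AA], (intro lins m)+, simp add: o_pure m MM_l MM_bal)+

lemma eps_Rb: "eps H (a \<lhd> Rb b) = eps H (a * b)"
 using counit_T(1)[of a b] by (simp add: Rb_r eps_el_er(2)) (simp flip: eps_el_er(1))
lemma eps_Rr: "eps H (Rr a \<rhd> b) = eps H (a * b)"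
 using el_t3[of b a] by (simp add: Rr_l eps_el_er(2)) (simp flip: eps_el_er(1))

lemma Rb_r_t2: "q * (a \<lhd> Rb b) = ts (t2 q a) (\<lambda>s t. asc H (eps H (t * b)) s)"
 by (simp add: Rb_r el_lr(3)[symmetric] t1_t2) (simp add: er_def, rule ts_lrA(4), intro lins)
lemma Rr_l_t4: "(Rr a \<rhd> c) * q = ts (t4 q c) (\<lambda>s t. asc H (eps H (a * t)) s)"
 by (simp add: Rr_l el_lr(4)[symmetric] t3_t4) (simp add: er_def, rule ts_lrA(2), intro lins)
lemma er_l2_t4: "er (l2 a (t4 q c)) = (Rr a \<rhd> c) * q"
 by (simp add: Rr_l_t4 er_def, rule ts_lrA(2), intro lins)

text \<open>\<open>Rb b\<close> depends only on the functional \<open>a \<mapsto> \<epsilon>(a b)\<close>, and conversely \<open>eps_Rb\<close> recovers this functional. So the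
base algebra consists of functionals of the form \<open>\<epsilon>(_ b)\<close>.\<close>
lemma Rb_eqI: assumes "\<And>a. eps H (a * b) = eps H (a * b')" shows "Rb b = Rb b'"
 by (rule MM_eqr, simp, simp, rule nondegA_eq(2)) (simp only: Rb_r_t2 assms)
lemma Rr_eqI: assumes "\<And>y. eps H (a * y) = eps H (a' * y)" shows "Rr a = Rr a'"
 by (rule MM_eq, simp, simp, rule nondegA_eq(1)) (simp only: Rr_l_t4 assms)

lemma t4_Rb: "t4 x (a \<lhd> Rb c) = ts (t4 x a) (\<lambda>p q. p \<odot> (q \<lhd> Rb c))"
proof -
 have "t4 x (a \<lhd> Rb c) = ts (t1 a c) (\<lambda>p z. t4 x (asc H (eps H z) p))"
  unfolding Rb_r er_def by (rule ts_pushA[of AA "\<lambda>w. t4 x w"]) (intro lins)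
 also have "\<dots> = ts (t1 a c) (\<lambda>p z. ts (t4 x p) (\<lambda>g h. g \<odot> asc H (eps H z) h))"
 proof (intro tsum_cong vspace_A)
  fix p z
  have "t4 x (asc H k p) = ts (t4 x p) (\<lambda>g h. g \<odot> asc H k h)" for k
  proof -
   have "t4 x (asc H k p) = scal AA k (t4 x p)"
    by (rule lin_scal[of A AA "\<lambda>p. t4 x p", simplified]) (intro lins)
   also have "\<dots> = scal AA k (ts (t4 x p) (\<lambda>g h. g \<odot> h))" by (simp add: ts_self)
   also have "\<dots> = ts (t4 x p) (\<lambda>g h. scal AA k (g \<odot> h))" by (rule ts_pushAA[where Z'=AA]) (intro lins | simp)+
   also have "\<dots> = ts (t4 x p) (\<lambda>g h. g \<odot> asc H k h)"
    using lin_scal[of A AA "\<lambda>y. _ \<odot> y" _ k] by (simp add: lins)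
   finally show ?thesis .
  qed
  then show "t4 x (asc H (eps H z) p) = ts (t4 x p) (\<lambda>g h. g \<odot> asc H (eps H z) h)" .
 qed
 also have "\<dots> = ts (t4 x a) (\<lambda>g h. ts (t1 h c) (\<lambda>h z. g \<odot> asc H (eps H z) h))"
  by (rule coassoc_t1_t4[where Z=AA]) (intro lins)+
 finally show ?thesis by (simp add: Rb_r er_def flip: ts_tpR)
qed

lemma DL_Rb: assumes t: "t \<in> carr AA" shows "DL (a \<lhd> Rb c) t = DL a (o2 (Rb c) t)"
proof (rule AA_eq[OF _ _ t, where Z=AA], (intro lins)+)
 fix x y
 have "DL (a \<lhd> Rb c) (x \<odot> y) = ts (t4 x a) (\<lambda>p q. p \<odot> ((q \<lhd> Rb c) * y))"
  unfolding DL_pure4 t4_Rb r2_def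
  by (subst ts_tsAA) (intro lins | simp add: ts_pureAA lins)+
 also have "\<dots> = DL a (x \<odot> (Rb c \<rhd> y))" by (simp add: DL_pure4 r2_def flip: MM_bal)
 finally show "DL (a \<lhd> Rb c) (x \<odot> y) = DL a (o2 (Rb c) (x \<odot> y))" by (simp add: o_pure)
qed

lemma t4_Rr: "t4 x (Rr c \<rhd> d) = o2 (Rr c) (t4 x d)"
proof -
 have k: "t4 x (asc H k p) = ts (t4 x p) (\<lambda>g h. g \<odot> asc H k h)" for k p
 proof -
  have "t4 x (asc H k p) = scal AA k (t4 x p)"
   by (rule lin_scal[of A AA "\<lambda>p. t4 x p", simplified]) (intro lins)
  also have "\<dots> = scal AA k (ts (t4 x p) (\<lambda>g h. g \<odot> h))" by (simp add: ts_self)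
  also have "\<dots> = ts (t4 x p) (\<lambda>g h. scal AA k (g \<odot> h))" by (rule ts_pushAA[where Z'=AA]) (intro lins | simp)+
  also have "\<dots> = ts (t4 x p) (\<lambda>g h. g \<odot> asc H k h)"
   using lin_scal[of A AA "\<lambda>y. _ \<odot> y" _ k] by (simp add: lins)
  finally show ?thesis .
 qed
 have "t4 x (Rr c \<rhd> d) = ts (t3 d c) (\<lambda>p z. t4 x (asc H (eps H z) p))"
  unfolding Rr_l er_def by (rule ts_pushA[of AA "\<lambda>w. t4 x w"]) (intro lins)
 also have "\<dots> = ts (t3 d c) (\<lambda>p z. ts (t4 x p) (\<lambda>g h. g \<odot> asc H (eps H z) h))" by (simp add: k)
 also have "\<dots> = ts (t4 x d) (\<lambda>g h. ts (t3 h c) (\<lambda>h z. g \<odot> asc H (eps H z) h))"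
  by (rule coassoc_t3_t4[where Z=AA]) (intro lins)+
 finally show ?thesis by (simp add: Rr_l er_def o2_def flip: ts_tpR)
qed
lemma DL_Rr: assumes t: "t \<in> carr AA" shows "DL (Rr c \<rhd> d) t = o2 (Rr c) (DL d t)"
 by (rule AA_eq[OF _ _ t, where Z=AA], (intro lins)+) (simp add: DL_pure4 t4_Rr o_r)

text \<open>The element \<open>E\<close> covered in its second leg by a product: \<open>E(1 \<otimes> p q) = (Rb \<otimes> A)(\<Delta>(p)(1 \<otimes> q))\<close>, so that \<open>E\<close> has its
first leg in the range of \<open>Rb\<close>.\<close>
lemma E1_Rb: "e1 x (p * q) = ts (t1 p q) (\<lambda>p z. (Rb p \<rhd> x) \<odot> z)"
proof -
 have "ts (t1 p q) (\<lambda>p z. ts (e1 x p) (\<lambda>u v. asc H (eps H v) u \<odot> z)) = ts (e1 x p) (\<lambda>u v. ts (t1 v q) (\<lambda>v z. asc H (eps H v) u \<odot> z))"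
  by (rule E1_T1_commute[where Z=AA]) (intro lins)+
 also have "\<dots> = r2 (e1 x p) q"
  by (simp add: asc_tp r2_def counit_T(1)[unfolded el_def] flip: ts_tpR)
 finally show ?thesis by (simp add: e1_r Rb_l er_def ts_tpL)
qed

lemma E2_Rr: "e2 x (q * p) = ts (t3 p q) (\<lambda>p z. (x \<lhd> Rr p) \<odot> z)"
proof (rule idemE[where Z=AA and f="\<lambda>p. e2 x (q * p)" and g="\<lambda>p. ts (t3 p q) (\<lambda>p z. (x \<lhd> Rr p) \<odot> z)"], (intro lins)+)
 fix p' p
 have 1: "ts (t2 y p) (\<lambda>y z. (x \<lhd> Rr y) \<odot> z) = ts (e2 x p) (\<lambda>x p. x \<odot> (Lb y \<rhd> p))" for y
 proof -
  have "ts (t2 y p) (\<lambda>y z. ts (e2 x y) (\<lambda>x y. asc H (eps H y) x \<odot> z)) = ts (e2 x p) (\<lambda>x p. ts (t2 y p) (\<lambda>y z. asc H (eps H y) x \<odot> z))"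
   by (rule E2_T2_commute[where Z=AA]) (intro lins)+
  then show ?thesis by (simp add: Rr_r er_def Lb_l el_def ts_tpL asc_tp ts_tpR)
 qed
 have "ts (t3 (p' * p) q) (\<lambda>p z. (x \<lhd> Rr p) \<odot> z) = ts (ts (t3 p' q) (\<lambda>y z0. l2 z0 (t2 y p))) (\<lambda>p z. (x \<lhd> Rr p) \<odot> z)"
  by (simp add: t3_DR DR_def)
 also have "\<dots> = ts (t3 p' q) (\<lambda>y z0. ts (l2 z0 (t2 y p)) (\<lambda>p z. (x \<lhd> Rr p) \<odot> z))"
  by (rule ts_tsAA) (intro lins | simp)+
 also have "\<dots> = ts (t3 p' q) (\<lambda>y z0. l2 z0 (ts (t2 y p) (\<lambda>p z. (x \<lhd> Rr p) \<odot> z)))"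
 proof (intro tsum_cong vspace_A)
  fix y z0
  have "ts (l2 z0 (t2 y p)) (\<lambda>p z. (x \<lhd> Rr p) \<odot> z) = ts (t2 y p) (\<lambda>p z. (x \<lhd> Rr p) \<odot> (z0 * z))"
   by (rule ts_lrAA) (intro lins)
  also have "\<dots> = l2 z0 (ts (t2 y p) (\<lambda>p z. (x \<lhd> Rr p) \<odot> z))"
   by (subst ts_pushAA[of AA "\<lambda>t. l2 z0 t"]) (intro lins | simp)+
  finally show "ts (l2 z0 (t2 y p)) (\<lambda>p z. (x \<lhd> Rr p) \<odot> z) = l2 z0 (ts (t2 y p) (\<lambda>p z. (x \<lhd> Rr p) \<odot> z))" .
 qed
 also have "\<dots> = ts (t3 p' q) (\<lambda>y z0. ts (e2 x p) (\<lambda>x p. x \<odot> ((z0 \<lhd> Lb y) * p)))"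
  unfolding 1 by (subst ts_pushAA[of AA "\<lambda>t. l2 _ t"]) (intro lins | simp add: MM_bal)+
 also have "\<dots> = ts (e2 x p) (\<lambda>x p. x \<odot> ts (t3 p' q) (\<lambda>y z0. (z0 \<lhd> Lb y) * p))"
  unfolding ts_tpR by (rule ts_swap)
 also have "\<dots> = ts (e2 x p) (\<lambda>x p. x \<odot> (q * p' * p))"
 proof -
  have "ts (t3 p' q) (\<lambda>y z0. (z0 \<lhd> Lb y)) = el (E2 H (t3 p' q))"
   unfolding Lb_r by (rule ts_lin[symmetric, where f="\<lambda>t. el (E2 H t)" and Z=A]) (intro lins | simp)+
  then have "ts (t3 p' q) (\<lambda>y z0. (z0 \<lhd> Lb y) * p) = q * p' * p" for p
   by (simp add: E2_t3 el_t3 flip: ts_mul)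
  then show ?thesis by simp
 qed
 also have "\<dots> = e2 x (q * (p' * p))" by (simp add: l2_def e2_l flip: mult.assoc)
 finally show "e2 x (q * (p' * p)) = ts (t3 (p' * p) q) (\<lambda>p z. (x \<lhd> Rr p) \<odot> z)" ..
qed

section \<open>The space of multipliers\<close>

abbreviation "M \<equiv> multipliers H"
lemma M_simps[simp]: "fst (m + n) x = fst m x + fst n (x::'a)" "snd (m + n) x = snd m x + snd n x"
 "fst (scal M c m) x = asc H c (fst m x)" "snd (scal M c m) x = asc H c (snd m x)"
 "fst (0 :: 'a mult) x = 0" "snd (0 :: 'a mult) x = 0"
 by (auto simp: multipliers_def)
lemma mult_eqI: "(\<And>x. fst m x = fst n x) ==> (\<And>x. snd m x = snd n x) ==> m = (n :: 'a mult)"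
 by (rule prod_eqI) auto
lemma vs_M: "vector_space (scal M)"
proof -
 interpret vector_space "asc H" by (rule vs_A)
 show ?thesis by unfold_locales (rule mult_eqI; simp add: scale_right_distrib scale_left_distrib)+
qed
lemma vspace_M[simp, lins]: "vspace M"
proof -
 interpret AV: vector_space "asc H" by (rule vs_A)
 interpret vector_space "scal M" by (rule vs_M)
 have "subspace MM"
 proof (rule subspaceI)
  show "0 \<in> MM" by (rule MMI) (auto simp: lin_def)
  show "m + n \<in> MM" if "m \<in> MM" "n \<in> MM" for m n
   by (rule MMI) (use that in \<open>auto simp: lin_def MM_iff AV.scale_right_distrib distrib_left distrib_right\<close>)
  show "scal M c m \<in> MM" if "m \<in> MM" for m c
   by (rule MMI) (use that in \<open>auto simp: lin_def MM_iff AV.scale_right_distrib asc_mul mult.commute\<close>)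
 qed
 then show ?thesis by (simp add: vspace_def vs_M)
qed
lemma lin_toM: assumes "\<And>w. w \<in> carr W ==> F w \<in> MM" "\<And>x. lin W A (\<lambda>w. F w \<rhd> x)" "\<And>x. lin W A (\<lambda>w. x \<lhd> F w)"
 shows "lin W M F"
 using assms by (auto simp: lin_def intro!: mult_eqI)
lemma lin_Rb[lins]: "lin W A f ==> lin W M (\<lambda>w. Rb (f w))"
 and lin_Rr[lins]: "lin W A f ==> lin W M (\<lambda>w. Rr (f w))"
 by (rule lin_toM; (intro lins)?; assumption?; simp)+
lemma lin_Mact[lins]: "lin W M f ==> lin W A (\<lambda>w. f w \<rhd> x)" "lin W M f ==> lin W A (\<lambda>w. x \<lhd> f w)"
 by (auto simp: lin_def)

definition mp (infixl "\<star>" 70) where "m \<star> n = (\<lambda>x::'a. fst m (fst n x), \<lambda>x::'a. snd n (snd m x))"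
lemma mp_s[simp]: "(m \<star> n) \<rhd> x = m \<rhd> (n \<rhd> x)" "x \<lhd> (m \<star> n) = (x \<lhd> m) \<lhd> n" by (simp_all add: mp_def)
lemma mp_MM[simp]: "m \<in> MM ==> n \<in> MM ==> m \<star> n \<in> MM"
 by (rule MMI) (auto simp: MM_bal mp_def intro!: lins)
lemma mp_assoc: "(m \<star> n) \<star> k = m \<star> (n \<star> k)" by (simp add: mp_def)

text \<open>Slices of a tensor by a functional on its right and on its left leg.\<close>
definition "slr \<omega> t = ts t (\<lambda>x z. asc H (\<omega> z) x)"
definition "sll \<omega> t = ts t (\<lambda>x z. asc H (\<omega> x) z)"
lemma lin_sl[lins]: assumes "lin A scalars \<omega>" "lin W AA f" shows "lin W A (\<lambda>w. slr \<omega> (f w))" "lin W A (\<lambda>w. sll \<omega> (f w))"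
proof -
 note c = lin_comp[OF assms(1)]
 show "lin W A (\<lambda>w. slr \<omega> (f w))" "lin W A (\<lambda>w. sll \<omega> (f w))" unfolding slr_def sll_def by (intro lins c assms(2))+
qed
lemma sl_pure: assumes "lin A scalars \<omega>" shows "slr \<omega> (x \<odot> y) = asc H (\<omega> y) x" "sll \<omega> (x \<odot> y) = asc H (\<omega> x) y"
proof -
 note c = lin_comp[OF assms(1)]
 show "slr \<omega> (x \<odot> y) = asc H (\<omega> y) x" "sll \<omega> (x \<odot> y) = asc H (\<omega> x) y"
  unfolding slr_def sll_def by (rule ts_pureA; intro lins c)+
qed
lemma slr_lr: assumes "lin A scalars \<omega>" "t \<in> carr AA" shows "slr \<omega> (l1 b t) = b * slr \<omega> t" "slr \<omega> (r1 t b) = slr \<omega> t * b"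
 "sll \<omega> (l2 b t) = b * sll \<omega> t" "sll \<omega> (r2 t b) = sll \<omega> t * b"
 by (rule AA_eq[OF _ _ assms(2), where Z=A], (intro lins assms(1))+, simp add: sl_pure assms(1) asc_mul)+
lemma slr_E1: assumes "lin A scalars \<omega>" shows "slr \<omega> (l2 d (e1 x (p * q))) = Rb (ts (t1 p q) (\<lambda>p z. asc H (\<omega> (d * z)) p)) \<rhd> x"
proof -
 note c = lin_comp[OF assms(1)]
 have "slr \<omega> (l2 d (e1 x (p * q))) = ts (t1 p q) (\<lambda>p z. asc H (\<omega> (d * z)) (Rb p \<rhd> x))"
  unfolding E1_Rb by (subst ts_pushAA[of A "\<lambda>t. slr \<omega> (l2 d t)"]) (intro lins assms | simp add: sl_pure[OF assms])+
 also have "\<dots> = ts (t1 p q) (\<lambda>p z. Rb (asc H (\<omega> (d * z)) p) \<rhd> x)"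
  using lin_scal[of A A "\<lambda>p. Rb p \<rhd> x"] by (simp add: lins)
 also have "\<dots> = Rb (ts (t1 p q) (\<lambda>p z. asc H (\<omega> (d * z)) p)) \<rhd> x"
  by (rule ts_pushA[symmetric, of A "\<lambda>w. Rb w \<rhd> x"]) (intro lins)
 finally show ?thesis .
qed
lemma slr_E2: assumes "lin A scalars \<omega>" shows "slr \<omega> (r2 (e2 x (q * p)) d) = x \<lhd> Rr (ts (t3 p q) (\<lambda>p z. asc H (\<omega> (z * d)) p))"
proof -
 note c = lin_comp[OF assms(1)]
 have "slr \<omega> (r2 (e2 x (q * p)) d) = ts (t3 p q) (\<lambda>p z. asc H (\<omega> (z * d)) (x \<lhd> Rr p))"
  unfolding E2_Rr by (subst ts_pushAA[of A "\<lambda>t. slr \<omega> (r2 t d)"]) (intro lins assms | simp add: sl_pure[OF assms])+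
 also have "\<dots> = ts (t3 p q) (\<lambda>p z. x \<lhd> Rr (asc H (\<omega> (z * d)) p))"
  using lin_scal[of A A "\<lambda>p. x \<lhd> Rr p"] by (simp add: lins)
 also have "\<dots> = x \<lhd> Rr (ts (t3 p q) (\<lambda>p z. asc H (\<omega> (z * d)) p))"
  by (rule ts_pushA[symmetric, of A "\<lambda>w. x \<lhd> Rr w"]) (intro lins)
 finally show ?thesis .
qed

section \<open>Slices and the transfer principle\<close>

text \<open>Slicing the second leg of \<open>(1 \<otimes> a b) E (1 \<otimes> p q)\<close>, once with \<open>E\<close> absorbed by the right factor and once by the left one.
Since slices of full comultiplications exhaust \<open>A\<close>, the ranges of \<open>Rb\<close> and \<open>Rr\<close> turn out to agree.\<close>
lemma Rb_Rr_slices: assumes w: "lin A scalars \<omega>"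
 shows "Rb (ts (t1 p q) (\<lambda>p z. asc H (\<omega> (a * b * z)) p)) = Rr (ts (t3 b a) (\<lambda>y z. asc H (\<omega> (z * (p * q))) y))"
proof (rule MM_eq, simp, simp, rule nondegA_eq(2))
 fix x y
 have "y * (Rb (ts (t1 p q) (\<lambda>p z. asc H (\<omega> (a * b * z)) p)) \<rhd> x) = slr \<omega> (l1 y (l2 (a * b) (e1 x (p * q))))"
  by (simp add: slr_lr[OF w] slr_E1[OF w])
 also have "l1 y (l2 (a * b) (e1 x (p * q))) = r1 (r2 (e2 y (a * b)) (p * q)) x"
  using E_balanced[of "y \<odot> (a * b)" "x \<odot> (p * q)"] by (simp add: mm_lr)
 also have "slr \<omega> \<dots> = (y \<lhd> Rr (ts (t3 b a) (\<lambda>y z. asc H (\<omega> (z * (p * q))) y))) * x"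
  by (simp add: slr_lr[OF w] slr_E2[OF w])
 finally show "y * (Rb (ts (t1 p q) (\<lambda>p z. asc H (\<omega> (a * b * z)) p)) \<rhd> x) = y * (Rr (ts (t3 b a) (\<lambda>y z. asc H (\<omega> (z * (p * q))) y)) \<rhd> x)"
  by (simp add: MM_bal)
qed

text \<open>Write \<open>t\<close> with independent first factors. The hypothesis says that the second factors are annihilated by all
functionals \<open>\<epsilon>(x _)\<close>, hence they are annihilated by \<open>\<chi>\<close>. This upgrades an identity that is known for these functionals
to one for any functional which is compatible with the map \<open>Rb\<close>.\<close>
lemma transfer_r: assumes t: "t \<in> carr AA" and c: "lin A scalars \<chi>"
 and z: "\<And>x. slr (\<lambda>y. eps H (x * y)) t = 0" and k: "\<And>y. (\<And>x. eps H (x * y) = 0) ==> \<chi> y = 0"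
 shows "slr \<chi> t = 0"
proof -
 obtain B y where B: "finite B" "\<not> module.dependent (scal A) B" and t': "t = (\<Sum>e\<in>B. e \<odot> y e)"
  using tens_expand_left[OF vspace_A vspace_A t] by blast
 interpret vector_space "asc H" by (rule vs_A)
 have s: "slr \<omega> t = (\<Sum>e\<in>B. asc H (\<omega> (y e)) e)" if "lin A scalars \<omega>" for \<omega>
  unfolding t' by (subst lin_sum[OF vspace_tprod lin_sl(1)[OF that lin_id]]) (simp_all add: sl_pure[OF that])
 have "eps H (x * y e) = 0" if e: "e \<in> B" for x e
 proof -
  have "lin A scalars (\<lambda>y. eps H (x * y))" by (intro lins)
  from z[of x, unfolded s[OF this]] show ?thesis using B e independentD[of B B "\<lambda>e. eps H (x * y e)" e] by simp
 qed
 then show ?thesis unfolding s[OF c] using k by simp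
qed
lemma transfer_l: assumes t: "t \<in> carr AA" and c: "lin A scalars \<chi>"
 and z: "\<And>x. sll (\<lambda>y. eps H (y * x)) t = 0" and k: "\<And>y. (\<And>x. eps H (y * x) = 0) ==> \<chi> y = 0"
 shows "sll \<chi> t = 0"
proof -
 obtain B y where B: "finite B" "\<not> module.dependent (scal A) B" and t': "t = (\<Sum>e\<in>B. y e \<odot> e)"
  using tens_expand_right[OF vspace_A vspace_A t] by blast
 interpret vector_space "asc H" by (rule vs_A)
 have s: "sll \<omega> t = (\<Sum>e\<in>B. asc H (\<omega> (y e)) e)" if "lin A scalars \<omega>" for \<omega>
  unfolding t' by (subst lin_sum[OF vspace_tprod lin_sl(2)[OF that lin_id]]) (simp_all add: sl_pure[OF that])
 have "eps H (y e * x) = 0" if e: "e \<in> B" for x e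
 proof -
  have "lin A scalars (\<lambda>y. eps H (y * x))" by (intro lins)
  from z[of x, unfolded s[OF this]] show ?thesis using B e independentD[of B B "\<lambda>e. eps H (y e * x)" e] by simp
 qed
 then show ?thesis unfolding s[OF c] using k by simp
qed

lemma Rb_t4: "ts (t4 c b) (\<lambda>p q. Rb q \<rhd> p) = b * c"
proof -
 have "ts (t4 c b) (\<lambda>p q. Rb q \<rhd> p) = er (E1 H (t4 c b))"
  unfolding Rb_l by (rule ts_lin[symmetric, where f="\<lambda>t. er (E1 H t)" and Z=A]) (intro lins | simp)+
 then show ?thesis by (simp add: E1_t4 er_t4)
qed
lemma L_t1: "ts (t1 p q) (\<lambda>p z. L p \<rhd> z) = p * q"
proof -
 have "ts (t1 p q) (\<lambda>p z. L p \<rhd> z) = el (E1 H (t1 p q))"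
  unfolding L_l by (rule ts_lin[symmetric, where f="\<lambda>t. el (E1 H t)" and Z=A]) (intro lins | simp)+
 then show ?thesis by (simp add: E1_t1 counit_T)
qed

text \<open>\<open>E(Rb b \<otimes> 1) = E(1 \<otimes> L b)\<close>: after multiplication by \<open>\<Delta>(d)\<close> both sides become \<open>d\<^sub>1 \<otimes> \<epsilon>(d\<^sub>2 b) d\<^sub>3\<close>.\<close>
lemma E_Rb_L: assumes t: "t \<in> carr AA" shows "E1 H (o1 (Rb b) t) = E1 H (o2 (L b) t)"
proof (rule E1_cancel)
 fix d
 show "DL d (o1 (Rb b) t) = DL d (o2 (L b) t)"
 proof (rule AA_eq[OF _ _ t, where Z=AA], (intro lins)+)
  fix x y
  have "DL d (o2 (L b) (x \<odot> y)) = ts (t4 x d) (\<lambda>g h. g \<odot> ((h \<lhd> L b) * y))"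
   by (simp add: o_pure DL_pure4 r2_def MM_bal)
  also have "\<dots> = ts (t4 x d) (\<lambda>g h. ts (t1 h y) (\<lambda>h y. g \<odot> asc H (eps H (h * b)) y))"
  proof (intro tsum_cong vspace_A)
   fix g h
   have "(h \<lhd> L b) * y = ts (r1 (t1 h y) b) (\<lambda>h y. asc H (eps H h) y)" by (simp add: L_r t1_t4 el_lr[symmetric]) (simp add: el_def)
   also have "\<dots> = ts (t1 h y) (\<lambda>h y. asc H (eps H (h * b)) y)" by (rule ts_lrA) (intro lins)
   finally show "g \<odot> ((h \<lhd> L b) * y) = ts (t1 h y) (\<lambda>h y. g \<odot> asc H (eps H (h * b)) y)" by (simp add: ts_tpR)
  qed
  also have "\<dots> = ts (t1 d y) (\<lambda>d y. ts (t4 x d) (\<lambda>g h. g \<odot> asc H (eps H (h * b)) y))"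
   by (rule coassoc_t1_t4[where Z=AA, symmetric]) (intro lins)+
  also have "\<dots> = ts (t1 d y) (\<lambda>d y. ((d \<lhd> Rb b) * x) \<odot> y)"
  proof (intro tsum_cong vspace_A)
   fix d y
   have "(d \<lhd> Rb b) * x = er (r2 (t4 x d) b)" by (simp add: Rb_r el_lr[symmetric] t1_t4)
   also have "\<dots> = ts (t4 x d) (\<lambda>g h. asc H (eps H (h * b)) g)" unfolding er_def by (rule ts_lrA) (intro lins)
   finally show "ts (t4 x d) (\<lambda>g h. g \<odot> asc H (eps H (h * b)) y) = ((d \<lhd> Rb b) * x) \<odot> y"
    by (simp add: ts_tpL flip: asc_tp)
  qed
  also have "\<dots> = DL d (o1 (Rb b) (x \<odot> y))" by (simp add: o_pure DL_pure r1_def MM_bal)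
  finally show "DL d (o1 (Rb b) (x \<odot> y)) = DL d (o2 (L b) (x \<odot> y))" ..
 qed
qed simp_all

end

section \<open>Full comultiplication and the base algebra\<close>

locale wmbf = wmba H for H :: "('k::field, 'a::ring) wmb" +
 assumes lfull: "left_full H" and rfull: "right_full H"
begin

lemma lin_span0: assumes "lin A scalars \<psi>" "\<And>x. x \<in> P ==> \<psi> x = 0" "module.span (asc H) P = UNIV" shows "\<psi> x = 0"
proof -
 interpret vector_space "asc H" by (rule vs_A)
 have "x \<in> span P" using assms(3) by simp
 then show ?thesis
 proof (induction rule: span_induct_alt)
  case base show ?case by (rule lin_0[OF vspace_A assms(1)])
 next
  case (step c x y) then show ?case using lin_add[OF assms(1), of "asc H c x" y] lin_scal[OF assms(1), of x c] assms(2) by simp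
 qed
qed
text \<open>The form in which fullness is used: a functional killing all slices is zero.\<close>
lemma rfullD: assumes p: "lin A scalars \<psi>" and z: "\<And>a b. sll \<psi> (t1 a b) = 0" shows "\<psi> x = 0"
proof (rule lin_span0[OF p _ rfull[unfolded right_full_def]])
 fix y assume "y \<in> {slice_right (alg H) (alg H) \<omega> (T1 H (ap H a b)) | a b \<omega>. lin (alg H) scalars \<omega>}"
 then obtain a b \<omega> where y: "y = slice_right (alg H) (alg H) \<omega> (T1 H (ap H a b))" and w: "lin A scalars \<omega>" by blast
 note c = lin_comp[OF w] and cp = lin_comp[OF p]
 have "y = slr \<omega> (t1 a b)" unfolding y slice_right_def slr_def ap_eq scal_A
  by (rule tsum_lift) (simp_all, intro lins c)
 then have "\<psi> y = ts (t1 a b) (\<lambda>x z. \<omega> z * \<psi> x)"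
  using ts_pushA[OF p] lin_scal[OF p] by (simp add: slr_def)
 also have "\<dots> = \<omega> (sll \<psi> (t1 a b))" unfolding sll_def using ts_pushA[OF w] lin_scal[OF w] by (simp add: mult.commute)
 finally show "\<psi> y = 0" by (simp add: z lin_0[OF vspace_A w])
qed
lemma lfullD: assumes p: "lin A scalars \<psi>" and z: "\<And>a b. slr \<psi> (t2 a b) = 0" shows "\<psi> x = 0"
proof (rule lin_span0[OF p _ lfull[unfolded left_full_def]])
 fix y assume "y \<in> {slice_left (alg H) (alg H) \<omega> (T2 H (ap H a b)) | a b \<omega>. lin (alg H) scalars \<omega>}"
 then obtain a b \<omega> where y: "y = slice_left (alg H) (alg H) \<omega> (T2 H (ap H a b))" and w: "lin A scalars \<omega>" by blast
 note c = lin_comp[OF w] and cp = lin_comp[OF p]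
 have "y = sll \<omega> (t2 a b)" unfolding y slice_left_def sll_def ap_eq scal_A
  by (rule tsum_lift) (simp_all, intro lins c)
 then have "\<psi> y = ts (t2 a b) (\<lambda>x z. \<omega> x * \<psi> z)"
  using ts_pushA[OF p] lin_scal[OF p] by (simp add: sll_def)
 also have "\<dots> = \<omega> (slr \<psi> (t2 a b))" unfolding slr_def using ts_pushA[OF w] lin_scal[OF w] by (simp add: mult.commute)
 finally show "\<psi> y = 0" by (simp add: z lin_0[OF vspace_A w])
qed
lemma rfullD3: assumes p: "lin A scalars \<psi>" and z: "\<And>a b. sll \<psi> (t3 a b) = 0" shows "\<psi> x = 0"
proof (rule rfullD[OF p], rule nondegA(2))
 fix a b d
 show "d * sll \<psi> (t1 a b) = 0" by (simp add: slr_lr[OF p, symmetric] T_compat) (simp add: slr_lr[OF p] z)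
qed

lemma subspace_range: assumes "lin A M F" shows "module.subspace (scal M) (range F)"
proof -
 interpret vector_space "scal M" by (rule vs_M)
 show ?thesis
 proof (rule subspaceI)
  have "F 0 = 0" by (rule lin_0[OF vspace_A assms])
  then show "0 \<in> range F" by (rule range_eqI[OF sym])
  show "x + y \<in> range F" if xy: "x \<in> range F" "y \<in> range F" for x y
  proof -
   obtain a b where "x = F a" "y = F b" using xy by blast
   then have "x + y = F (a + b)" by (simp add: lin_add[OF assms])
   then show ?thesis by (rule range_eqI)
  qed
  show "scal M c x \<in> range F" if x: "x \<in> range F" for c x
  proof -
   obtain a where "x = F a" using x by blast
   then have "scal M c x = F (asc H c a)" using lin_scal[OF assms, of a c] by simp
   then show ?thesis by (rule range_eqI)
  qed
 qed
qed

text \<open>By \<open>Rb_Rr_slices\<close>, values of \<open>Rb\<close> on slices are values of \<open>Rr\<close>, and conversely; by fullness and idempotency these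
slices span \<open>A\<close>.\<close>
lemma range_eq: "range Rb = range Rr"
proof
 have lRb: "lin A M Rb" and lRr: "lin A M Rr" by (intro lins)+
 show "range Rb \<subseteq> range Rr"
 proof (rule image_subsetI, rule functional_sep[OF vs_M subspace_range[OF lRr]])
  fix \<theta> x assume "Vector_Spaces.linear (scal M) (*) \<theta>" and W: "\<And>w. w \<in> range Rr ==> \<theta> w = 0"
  then have th: "lin M scalars \<theta>" by (intro linear_lin)
  have p: "lin A scalars (\<lambda>x. \<theta> (Rb x))" by (rule lin_comp[OF th lRb])
  show "\<theta> (Rb x) = 0"
  proof (rule rfullD[OF p], rule nondegA(2))
   fix p' q d
   show "d * sll (\<lambda>x. \<theta> (Rb x)) (t1 p' q) = 0"
   proof (rule idemE[where Z=A and f="\<lambda>d. d * sll (\<lambda>x. \<theta> (Rb x)) (t1 p' q)" and g="\<lambda>d. 0"], intro lins)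
    show "lin A A (\<lambda>d. 0)" by (simp add: lin_def asc_0)
    fix a b
    show "a * b * sll (\<lambda>x. \<theta> (Rb x)) (t1 p' q) = 0"
    proof (rule vspace_functionals[OF vspace_A])
     fix \<omega> assume w: "lin A scalars \<omega>"
     have "\<omega> (a * b * sll (\<lambda>x. \<theta> (Rb x)) (t1 p' q)) = ts (t1 p' q) (\<lambda>x z. \<theta> (Rb x) * \<omega> (a * b * z))"
      unfolding sll_def ts_mul using ts_pushA[OF w] lin_scal[OF w] by (simp add: asc_mul)
     also have "\<dots> = \<theta> (Rb (ts (t1 p' q) (\<lambda>x z. asc H (\<omega> (a * b * z)) x)))"
      using ts_pushA[OF p] lin_scal[OF p] by (simp add: mult.commute)
     also have "\<dots> = 0" unfolding Rb_Rr_slices[OF w] by (rule W) blast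
     finally show "\<omega> (a * b * sll (\<lambda>x. \<theta> (Rb x)) (t1 p' q)) = 0" .
    qed
   qed
  qed
 qed
 show "range Rr \<subseteq> range Rb"
 proof (rule image_subsetI, rule functional_sep[OF vs_M subspace_range[OF lRb]])
  fix \<theta> x assume "Vector_Spaces.linear (scal M) (*) \<theta>" and W: "\<And>w. w \<in> range Rb ==> \<theta> w = 0"
  then have th: "lin M scalars \<theta>" by (intro linear_lin)
  have p: "lin A scalars (\<lambda>x. \<theta> (Rr x))" by (rule lin_comp[OF th lRr])
  show "\<theta> (Rr x) = 0"
  proof (rule rfullD3[OF p], rule nondegA(1))
   fix p' q d
   show "sll (\<lambda>x. \<theta> (Rr x)) (t3 p' q) * d = 0"
   proof (rule idemE[where Z=A and f="\<lambda>d. sll (\<lambda>x. \<theta> (Rr x)) (t3 p' q) * d" and g="\<lambda>d. 0"], intro lins)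
    show "lin A A (\<lambda>d. 0)" by (simp add: lin_def asc_0)
    fix a b
    show "sll (\<lambda>x. \<theta> (Rr x)) (t3 p' q) * (a * b) = 0"
    proof (rule vspace_functionals[OF vspace_A])
     fix \<omega> assume w: "lin A scalars \<omega>"
     have "\<omega> (sll (\<lambda>x. \<theta> (Rr x)) (t3 p' q) * (a * b)) = ts (t3 p' q) (\<lambda>x z. \<theta> (Rr x) * \<omega> (z * (a * b)))"
      unfolding sll_def ts_mul using ts_pushA[OF w] lin_scal[OF w] by (simp add: asc_mul)
     also have "\<dots> = \<theta> (Rr (ts (t3 p' q) (\<lambda>x z. asc H (\<omega> (z * (a * b))) x)))"
      using ts_pushA[OF p] lin_scal[OF p] by (simp add: mult.commute)
     also have "\<dots> = 0" unfolding Rb_Rr_slices[OF w, symmetric] by (rule W) blast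
     finally show "\<omega> (sll (\<lambda>x. \<theta> (Rr x)) (t3 p' q) * (a * b)) = 0" .
    qed
   qed
  qed
 qed
qed

abbreviation R where "R \<equiv> base H"
lemma R_carr: "carr R = range Rb" by (simp add: base_def)
lemma R_Rb[simp, lins]: "Rb a \<in> carr R" and R_Rr[simp, lins]: "Rr a \<in> carr R"
 by (auto simp: R_carr range_eq) (auto simp: range_eq[symmetric])
lemma R_MM: "r \<in> carr R ==> r \<in> MM" by (auto simp: R_carr)
lemma R_E: "r \<in> carr R ==> (\<And>a. r = Rb a ==> P) ==> P" "r \<in> carr R ==> (\<And>a. r = Rr a ==> P) ==> P"
 unfolding R_carr by blast (unfold range_eq, blast)

lemma rDL: "r \<in> carr R ==> t \<in> carr AA ==> DL (r \<rhd> d) t = o2 r (DL d t)"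
 by (erule R_E(2)) (simp add: DL_Rr)
lemma DLr: "r \<in> carr R ==> t \<in> carr AA ==> DL (d \<lhd> r) t = DL d (o2 r t)"
 by (erule R_E(1)) (simp add: DL_Rb)
lemma t4r: "r \<in> carr R ==> t4 x (r \<rhd> d) = o2 r (t4 x d)"
 by (erule R_E(2)) (simp add: t4_Rr)
lemma t1r: assumes r: "r \<in> carr R" shows "t1 (r \<rhd> d) y = o2 r (t1 d y)"
 by (rule nondegAA(3)) (simp_all add: DL_pure[symmetric] rDL[OF r] o_r(3)[symmetric] R_MM[OF r])
lemma t1r': assumes r: "r \<in> carr R" shows "t1 (d \<lhd> r) y = t1 d (r \<rhd> y)"
 by (rule nondegAA(3)) (simp_all add: DL_pure[symmetric] DLr[OF r] o_pure R_MM[OF r])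
lemma t3r: assumes r: "r \<in> carr R" shows "t3 d (a \<lhd> r) = t3 (r \<rhd> d) a"
 by (rule nondegAA(4)) (simp_all add: T_compat(1)[symmetric] t1r[OF r] o_r(6) R_MM[OF r])
lemma E1_o2: assumes r: "r \<in> carr R" and t: "t \<in> carr AA" shows "E1 H (o2 r t) = o2 r (E1 H t)"
proof -
 note [lins] = R_MM[OF r]
 have "E1 H (o2 r t) = E1 H (o2 r (E1 H t))"
  by (rule E1_cancel) (simp_all add: t DL_E1 flip: DLr[OF r])
 also have "\<dots> = o2 r (E1 H t)"
  by (rule E1_ext[where Z=AA, OF _ _ _ t], (intro lins)+) (simp add: E1_DL flip: rDL[OF r])
 finally show ?thesis .
qed
lemma Rb_R: "r \<in> carr R ==> Rb (r \<rhd> a) = r \<star> Rb a"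
 by (rule MM_eqr) (simp_all add: R_MM, simp add: Rb_r t1r')
lemma Rr_R: "r \<in> carr R ==> Rr (a \<lhd> r) = Rr a \<star> r"
 by (rule MM_eq) (simp_all add: R_MM, simp add: Rr_l t3r)
lemma R_mp[simp]: "r \<in> carr R ==> s \<in> carr R ==> r \<star> s \<in> carr R"
 by (erule R_E(1)[of s]) (simp flip: Rb_R)

lemma E1_L: "e1 (p * q) y = ts (t4 q p) (\<lambda>x z. x \<odot> (L z \<rhd> y))"
proof (rule idemE[where Z=AA and f="\<lambda>y. e1 (p * q) y" and g="\<lambda>y. ts (t4 q p) (\<lambda>x z. x \<odot> (L z \<rhd> y))"], (intro lins)+)
 fix a b
 have "L z \<rhd> (a * b) = ts (t1 a b) (\<lambda>r y. asc H (eps H (Rb r \<rhd> z)) y)" for z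
  unfolding L_l E1_Rb by (subst el_ts) (simp_all add: el_pure)
 then have "ts (t4 q p) (\<lambda>x z. x \<odot> (L z \<rhd> (a * b))) = ts (t1 a b) (\<lambda>r y. ts (t4 q p) (\<lambda>x z. asc H (eps H (Rb r \<rhd> z)) x \<odot> y))"
  by (simp add: ts_tpR asc_tp ts_swap[of "t4 q p"])
 also have "\<dots> = ts (t1 a b) (\<lambda>r y. er (o2 (Rb r) (t4 q p)) \<odot> y)"
  unfolding er_def by (subst ts_o(2)[where Z=A]) (intro lins | simp flip: ts_tpL)+
 also have "\<dots> = e1 (p * q) (a * b)" by (simp add: E1_Rb er_t4 MM_l flip: t4r)
 finally show "e1 (p * q) (a * b) = ts (t4 q p) (\<lambda>x z. x \<odot> (L z \<rhd> (a * b)))" ..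
qed

text \<open>\<open>R A = A\<close>, because \<open>Rb_t4\<close> writes every product as a sum of elements of \<open>R A\<close>.\<close>
lemma Rr_A_total: assumes p: "lin A scalars \<psi>" and z: "\<And>a b. \<psi> (Rr a \<rhd> b) = 0" shows "\<psi> x = 0"
proof (rule idemE[where Z=scalars and f=\<psi> and g="\<lambda>_. 0"], rule p)
 show "lin A scalars (\<lambda>_. 0)" by (simp add: lin_def)
 fix b c
 have "\<psi> (Rb q \<rhd> y) = 0" for q y
 proof -
  obtain a where "Rb q = Rr a" using R_E(2)[OF R_Rb[of q]] by metis
  then show ?thesis using z by simp
 qed
 then have "ts (t4 c b) (\<lambda>x y. \<psi> (Rb y \<rhd> x)) = 0" by (intro ts_zero)
 then show "\<psi> (b * c) = 0" by (simp only: ts_pushA[OF p, symmetric] Rb_t4)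
qed
lemma A_L_total: assumes p: "lin A scalars \<psi>" and z: "\<And>a b. \<psi> (a \<lhd> L b) = 0" shows "\<psi> x = 0"
proof (rule lfullD[OF p])
 fix p' q
 define g where "g = slr \<psi> (t2 p' q)"
 have c: "lin W scalars (\<lambda>w. \<psi> (f w))" if "lin W A f" for W :: "('k,'w::ab_group_add) space" and f
  using lin_comp[OF p that] .
 have "g \<lhd> Rb b = 0" for b
 proof (rule vspace_functionals[OF vspace_A])
  fix \<omega> assume w: "lin A scalars \<omega>"
  have cw: "lin W scalars (\<lambda>w. \<omega> (f w))" if "lin W A f" for W :: "('k,'w::ab_group_add) space" and f
   using lin_comp[OF w that] .
  have bl: "tri scalars (\<lambda>s t h. \<omega> (asc H (eps H (t * b)) s) * \<psi> h)" by (intro lins cw c)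
  have "\<omega> (g \<lhd> Rb b) = ts (t2 p' q) (\<lambda>s t. \<psi> t * \<omega> (s \<lhd> Rb b))"
   unfolding g_def slr_def using ts_pushA[of scalars "\<lambda>w. \<omega> (w \<lhd> Rb b)"] lin_scal[of A scalars "\<lambda>w. \<omega> (w \<lhd> Rb b)"]
   by (simp add: lins cw)
  also have "\<dots> = \<psi> (ts (t2 p' q) (\<lambda>s t. asc H (\<omega> (s \<lhd> Rb b)) t))"
   using ts_pushA[OF p] lin_scal[OF p] by (simp add: mult.commute)
  also have "ts (t2 p' q) (\<lambda>s t. asc H (\<omega> (s \<lhd> Rb b)) t) = (sll \<omega> (t2 p' q)) \<lhd> L b"
  proof (rule nondegA_eq(1))
   fix y
   have "(sll \<omega> (t2 p' q) \<lhd> L b) * y = ts (t2 p' q) (\<lambda>s t. asc H (\<omega> s) ((t \<lhd> L b) * y))"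
    unfolding sll_def ts_mr[OF L_MM] ts_mul using lin_scal[of A A "\<lambda>w. w \<lhd> L b"] by (simp add: asc_mul lins)
   also have "\<dots> = ts (t2 p' q) (\<lambda>s t. ts (t1 t y) (\<lambda>t y. asc H (\<omega> s * eps H (t * b)) y))"
   proof (intro tsum_cong vspace_A)
    fix s h
    have "(h \<lhd> L b) * y = ts (r1 (t1 h y) b) (\<lambda>h y. asc H (eps H h) y)" by (simp add: L_r t1_t4 el_lr[symmetric]) (simp add: el_def)
    also have "\<dots> = ts (t1 h y) (\<lambda>h y. asc H (eps H (h * b)) y)" by (rule ts_lrA) (intro lins)
    finally show "asc H (\<omega> s) ((h \<lhd> L b) * y) = ts (t1 h y) (\<lambda>h y. asc H (\<omega> s * eps H (h * b)) y)"
     using vector_space.vector_space_assms(3)[OF vs_A] by (simp add: ts_asc)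
   qed
   also have "\<dots> = ts (t1 q y) (\<lambda>q y. ts (t2 p' q) (\<lambda>s t. asc H (\<omega> s * eps H (t * b)) y))"
    by (rule T1_T2_commute[where Z=A, symmetric]) (intro lins cw)+
   also have "\<dots> = ts (t1 q y) (\<lambda>q y. asc H (\<omega> (p' * (q \<lhd> Rb b))) y)"
   proof (intro tsum_cong vspace_A)
    fix q y
    have "lin scalars A (\<lambda>k. asc H k y)" by (intro lins)
    moreover have "\<omega> (p' * (q \<lhd> Rb b)) = ts (t2 p' q) (\<lambda>s t. \<omega> s * eps H (t * b))"
     unfolding Rb_r_t2 using ts_pushA[OF w] lin_scal[OF w] by (simp add: mult.commute)
    ultimately show "ts (t2 p' q) (\<lambda>s t. asc H (\<omega> s * eps H (t * b)) y) = asc H (\<omega> (p' * (q \<lhd> Rb b))) y"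
     using ts_push[OF vspace_scalars, of A "\<lambda>k. asc H k y"] by simp
   qed
   also have "\<dots> = ts (l1 p' (t1 q y)) (\<lambda>q y. asc H (\<omega> (q \<lhd> Rb b)) y)"
    by (subst ts_lrA(1)) (intro lins cw | simp add: MM_r)+
   also have "\<dots> = ts (t2 p' q) (\<lambda>s t. asc H (\<omega> (s \<lhd> Rb b)) (t * y))"
    unfolding t1_t2 by (rule ts_lrA(4)) (intro lins cw)
   finally show "ts (t2 p' q) (\<lambda>s t. asc H (\<omega> (s \<lhd> Rb b)) t) * y = (sll \<omega> (t2 p' q) \<lhd> L b) * y"
    by (simp add: ts_mul asc_mul)
  qed
  finally show "\<omega> (g \<lhd> Rb b) = 0" by (simp add: z)
 qed
 then have "g * (Rb b \<rhd> y) = 0" for b y by (simp add: MM_bal)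
 then have "ts (t4 c b) (\<lambda>x y. g * (Rb y \<rhd> x)) = 0" for b c by (intro ts_zero)
 then have g0: "g * (b * c) = 0" for b c by (simp only: ts_mul[symmetric] Rb_t4)
 have "g * b = 0" for b
  by (rule idemE[where Z=A and f="\<lambda>b. g * b" and g="\<lambda>_. 0"]) (intro lins | simp add: lin_def g0)+
 then show "slr \<psi> (t2 p' q) = 0" using nondegA(1) g_def by blast
qed

text \<open>As long as the right leg is tested with the functionals \<open>\<epsilon>(x _)\<close> only, \<open>(1 \<otimes> r)\<Delta>(d)(e \<otimes> 1)\<close> may be replaced by the
\<open>Rb g d e \<otimes> h\<close> with \<open>g \<otimes> h = \<Delta>(p)(c \<otimes> 1)\<close>. The transfer principle then admits other functionals.\<close>
lemma base_split: assumes r: "r = Rb (p * c)"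
 shows "er (l2 x (o2 r (t4 e d))) = er (l2 x (ts (t4 c p) (\<lambda>g h. (Rb g \<rhd> (d * e)) \<odot> h)))"
proof -
 have rR: "r \<in> carr R" by (simp add: r)
 have "er (l2 x (o2 r (t4 e d))) = Rr x \<rhd> (r \<rhd> (d * e))"
  by (simp add: o_r R_MM[OF rR] er_l2_t4 Rr_R[OF rR] MM_l)
 also have "\<dots> = Rb ((Rr x \<rhd> p) * c) \<rhd> (d * e)"
  by (simp add: r MM_l[symmetric] Rb_R)
 also have "\<dots> = ts (t4 c p) (\<lambda>g h. asc H (eps H (x * h)) (Rb g \<rhd> (d * e)))"
  unfolding Rr_l_t4 using ts_pushA[of A "\<lambda>w. Rb w \<rhd> (d * e)"] lin_scal[of A A "\<lambda>w. Rb w \<rhd> (d * e)"] by (simp add: lins)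
 also have "\<dots> = er (l2 x (ts (t4 c p) (\<lambda>g h. (Rb g \<rhd> (d * e)) \<odot> h)))"
  by (subst ts_pushAA[of A "\<lambda>t. er (l2 x t)"]) (intro lins | simp add: er_pure)+
 finally show ?thesis .
qed

end

context wmbf begin
lemma E2_Lb: "e2 (q * p) b = ts (t2 q p) (\<lambda>s t. s \<odot> (b \<lhd> Lb t))"
proof (rule idemE[where Z=AA and f="\<lambda>b. e2 (q * p) b" and g="\<lambda>b. ts (t2 q p) (\<lambda>s t. s \<odot> (b \<lhd> Lb t))"], (intro lins)+)
 fix a c
 have "(a * c) \<lhd> Lb t = ts (t3 c a) (\<lambda>r z. asc H (eps H (t \<lhd> Rr r)) z)" for t
  unfolding Lb_r E2_Rr by (subst el_ts) (simp_all add: el_pure)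
 then have "ts (t2 q p) (\<lambda>s t. s \<odot> ((a * c) \<lhd> Lb t)) = ts (t3 c a) (\<lambda>r z. ts (t2 q p) (\<lambda>s t. asc H (eps H (t \<lhd> Rr r)) s \<odot> z))"
  by (simp add: ts_tpR asc_tp ts_swap[of "t2 q p"])
 also have "\<dots> = ts (t3 c a) (\<lambda>r z. ((q * p) \<lhd> Rr r) \<odot> z)"
 proof (intro tsum_cong vspace_A)
  fix r z
  obtain r' where r': "Rr r = Rb r'" using R_E(1)[OF R_Rr[of r]] by metis
  have "(q * p) \<lhd> Rr r = ts (t2 q p) (\<lambda>s t. asc H (eps H (t * r')) s)"
   unfolding r' Rb_mul by (rule Rb_r_t2)
  also have "\<dots> = ts (t2 q p) (\<lambda>s t. asc H (eps H (t \<lhd> Rr r)) s)" unfolding r' by (simp add: eps_Rb)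
  finally show "ts (t2 q p) (\<lambda>s t. asc H (eps H (t \<lhd> Rr r)) s \<odot> z) = ((q * p) \<lhd> Rr r) \<odot> z" by (simp flip: ts_tpL)
 qed
 also have "\<dots> = e2 (q * p) (a * c)" by (simp add: E2_Rr)
 finally show "e2 (q * p) (a * c) = ts (t2 q p) (\<lambda>s t. s \<odot> ((a * c) \<lhd> Lb t))" ..
qed
lemma t2r: assumes r: "r \<in> carr R" shows "t2 c (r \<rhd> a) = o2 r (t2 c a)"
 by (rule nondegAA(4)) (simp_all add: t1_t2[symmetric] t1r[OF r] o_r(7) o_r(4)[symmetric] R_MM[OF r])
definition "o2r m t = ts t (\<lambda>x y. x \<odot> (y \<lhd> m))"
lemma o2r_c[simp]: "o2r m t \<in> carr AA" by (simp add: o2r_def)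
lemma lin_o2r[lins]: "lin W AA f ==> m \<in> MM ==> lin W AA (\<lambda>w. o2r m (f w))" unfolding o2r_def by (intro lins; assumption)
lemma o2r_pure: "m \<in> MM ==> o2r m (x \<odot> y) = x \<odot> (y \<lhd> m)" unfolding o2r_def by (rule ts_pureAA; intro lins; assumption)
lemma o2r_r: "m \<in> MM ==> t \<in> carr AA ==> r2 (o2r m t) y = r2 t (m \<rhd> y)"
proof -
 assume m: "m \<in> MM" and t: "t \<in> carr AA"
 show ?thesis by (rule AA_eq[OF _ _ t, where Z=AA], (intro lins m)+) (simp add: o2r_pure m MM_bal)
qed
lemma ts_o2r: assumes "vspace Z" "bil Z b" "m \<in> MM" shows "ts (o2r m t) b = ts t (\<lambda>x y. b x (y \<lhd> m))"
 unfolding o2r_def by (simp_all add: ts_ts[OF assms(1,2)] ts_pure[OF assms(1,2)])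
lemma t2r': assumes r: "r \<in> carr R" shows "t2 c (a \<lhd> r) = o2r r (t2 c a)"
 by (rule nondegAA(4)) (simp_all add: t1_t2[symmetric] t1r'[OF r] o2r_r R_MM[OF r])
lemma MM_comm: assumes m: "m \<in> MM" "n \<in> MM" shows "(m \<rhd> x) \<lhd> n = m \<rhd> (x \<lhd> n)"
 by (rule nondegA_eq(1)) (simp add: MM_bal[OF m(2), symmetric] MM_l[OF m(1), symmetric])
end

section \<open>The antipode\<close>

text \<open>The map \<open>R1\<close> is formally \<open>a \<otimes> b \<mapsto> a\<^sub>1 \<otimes> S(a\<^sub>2) b\<close>, and \<open>G\<close> is the idempotent \<open>R1 T\<^sub>1\<close>.\<close>
locale antip = wmbf H for H :: "('k::field, 'a::ring) wmb" +
 fixes S :: "'a \<Rightarrow> 'a mult" and G R1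
 assumes G: "is_G1 H G" and lin_R1: "lin (alg H \<otimes> alg H) (alg H \<otimes> alg H) R1"
  and R1T1: "\<And>t. t \<in> carr (alg H \<otimes> alg H) ==> R1 (T1 H t) = G t"
  and T1R1: "\<And>t. t \<in> carr (alg H \<otimes> alg H) ==> T1 H (R1 t) = E1 H t"
  and RTR: "\<And>t. t \<in> carr (alg H \<otimes> alg H) ==> R1 (T1 H (R1 t)) = R1 t"
  and lin_S: "lin (alg H) (multipliers H) S"
  and S_R1: "\<And>a b. S a \<rhd> b = eps_left H (R1 (ap H a b))"
begin

lemma lin_G: "lin AA AA G" using G by (simp add: is_G1_def Let_def algsq_eq)
lemma lin_GR[lins]: "lin W AA f ==> lin W AA (\<lambda>w. G (f w))" "lin W AA f ==> lin W AA (\<lambda>w. R1 (f w))"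
 by (rule lin_comp[OF lin_G], assumption) (rule lin_comp[OF lin_R1], assumption)
lemma GR_c[simp]: "t \<in> carr AA ==> G t \<in> carr AA" "t \<in> carr AA ==> R1 t \<in> carr AA"
 by (auto intro: lin_carr[OF lin_G] lin_carr[OF lin_R1])
lemma S_MM[simp, lins]: "S a \<in> MM" by (rule lin_carr[OF lin_S]) simp
lemma lin_SI[lins]: "lin W A f ==> lin W M (\<lambda>w. S (f w))" by (rule lin_comp[OF lin_S])
lemma S_l: "S a \<rhd> b = el (R1 (a \<odot> b))" by (simp add: S_R1 ap_eq eps_left_eq)

lemma G_eq: "G (a \<odot> (b * c)) = ts (t4 c b) (\<lambda>x y. (a \<lhd> Rb y) \<odot> x)"
proof -
 have "G (a \<odot> (b * c)) = tmap M A A A (\<lambda>m. a \<lhd> m) id (tmap A A M A Rb id (tw A A (t4 c b)))"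
  using G by (simp add: is_G1_def Let_def ap_eq)
 also have "\<dots> = ts (t4 c b) (\<lambda>x y. tmap M A A A (\<lambda>m. a \<lhd> m) id (tmap A A M A Rb id (tw A A (x \<odot> y))))"
  by (rule ts_lin[where f="\<lambda>t. tmap M A A A (\<lambda>m. a \<lhd> m) id (tmap A A M A Rb id (tw A A t))" and Z=AA])
   (intro lin_comp[OF lin_tmap] lin_comp[OF lin_tw] lins lin_idc | simp)+
 also have "\<dots> = ts (t4 c b) (\<lambda>x y. (a \<lhd> Rb y) \<odot> x)"
 proof (intro tsum_cong vspace_A)
  fix x y
  have "tmap A A M A Rb id (y \<odot> x) = pure M A (Rb y) x"
   by (subst tmap_pure[OF _ lin_idc]) (intro lins | simp)+
  moreover have "tmap M A A A (\<lambda>m. a \<lhd> m) id (pure M A (Rb y) x) = (a \<lhd> Rb y) \<odot> x"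
   by (subst tmap_pure[OF _ lin_idc]) (intro lins | simp)+
  ultimately show "tmap M A A A (\<lambda>m. a \<lhd> m) id (tmap A A M A Rb id (tw A A (x \<odot> y))) = (a \<lhd> Rb y) \<odot> x"
   by (simp add: tw_pure)
 qed
 finally show ?thesis .
qed

lemma R1E1: "t \<in> carr AA ==> R1 (E1 H t) = R1 t" by (simp add: T1R1[symmetric] RTR)
lemma GR1: "t \<in> carr AA ==> G (R1 t) = R1 t" by (simp add: R1T1[symmetric] RTR)

lemma ext_pp:
 fixes Z :: "('k,'z::ab_group_add) space"
 assumes "lin AA Z f" "lin AA Z g" "t \<in> carr AA" and e: "\<And>x a b. f (x \<odot> (a * b)) = g (x \<odot> (a * b))"
 shows "f t = g t"
proof (rule AA_eq[OF assms(1-3)])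
 fix x y
 show "f (x \<odot> y) = g (x \<odot> y)"
  by (rule idemE[where f="\<lambda>y. f (x \<odot> y)" and g="\<lambda>y. g (x \<odot> y)" and Z=Z])
   (intro lins lin_comp[OF assms(1)] lin_comp[OF assms(2)] e)+
qed

lemma G_l: assumes t: "t \<in> carr AA" shows "G (l1 a t) = l1 a (G t)"
proof (rule ext_pp[OF _ _ t, where Z=AA], (intro lins)+)
 fix x b c
 show "G (l1 a (x \<odot> (b * c))) = l1 a (G (x \<odot> (b * c)))"
  by (simp add: G_eq, subst ts_pushAA[of AA "l1 a"]) (intro lins | simp add: MM_r)+
qed
lemma G_o1: assumes t: "t \<in> carr AA" and m: "m \<in> MM" shows "G (o1 m t) = o1 m (G t)"
proof (rule ext_pp[OF _ _ t, where Z=AA], (intro lins m)+)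
 fix x b c
 show "G (o1 m (x \<odot> (b * c))) = o1 m (G (x \<odot> (b * c)))"
  by (simp add: G_eq o_pure m, subst ts_pushAA[of AA "o1 m"]) (intro lins m | simp add: MM_comm m o_pure)+
qed
lemma elG: "el (G (a \<odot> b)) = Rr a \<rhd> b"
proof (rule idemE[where f="\<lambda>b. el (G (a \<odot> b))" and g="\<lambda>b. Rr a \<rhd> b" and Z=A], (intro lins)+)
 fix b c
 show "el (G (a \<odot> (b * c))) = Rr a \<rhd> (b * c)"
  by (simp add: G_eq el_ts el_pure eps_Rb Rr_l_t4 MM_l)
qed

lemma comm_E1: assumes Z: "vspace Z" and g: "tri Z g"
 shows "ts (t2 c a) (\<lambda>s t. ts (e1 t b) (\<lambda>x y. g s x y)) = ts (e1 a b) (\<lambda>a b. ts (t2 c a) (\<lambda>s t. g s t b))"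
proof (rule idemE[where f="\<lambda>b. ts (t2 c a) (\<lambda>s t. ts (e1 t b) (\<lambda>x y. g s x y))" and g="\<lambda>b. ts (e1 a b) (\<lambda>a b. ts (t2 c a) (\<lambda>s t. g s t b))" and Z=Z], (intro lins Z trilD[OF g] | simp)+)
 fix p q
 have 1: "ts (e1 x (p * q)) b = ts (t1 p q) (\<lambda>p z. b (Rb p \<rhd> x) z)" if "bil Z b" for b x
  unfolding E1_Rb by (subst ts_ts[OF Z that]) (simp_all add: ts_pure[OF Z that])
 have "ts (t2 c a) (\<lambda>s t. ts (e1 t (p * q)) (\<lambda>x y. g s x y)) = ts (t2 c a) (\<lambda>s t. ts (t1 p q) (\<lambda>p z. g s (Rb p \<rhd> t) z))"
  by (subst 1) (intro lins Z trilD[OF g] | simp)+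
 also have "\<dots> = ts (t1 p q) (\<lambda>p z. ts (t2 c a) (\<lambda>s t. g s (Rb p \<rhd> t) z))" by (rule ts_swap)
 also have "\<dots> = ts (t1 p q) (\<lambda>p z. ts (o2 (Rb p) (t2 c a)) (\<lambda>s t. g s t z))"
  by (subst ts_o(2)[OF Z]) (intro lins Z trilD[OF g] | simp)+
 also have "\<dots> = ts (e1 a (p * q)) (\<lambda>a b. ts (t2 c a) (\<lambda>s t. g s t b))"
  by (subst 1) (intro lins Z trilD[OF g] | simp add: t2r)+
 finally show "ts (t2 c a) (\<lambda>s t. ts (e1 t (p * q)) (\<lambda>x y. g s x y)) = ts (e1 a (p * q)) (\<lambda>a b. ts (t2 c a) (\<lambda>s t. g s t b))" .
qed
lemma comm_G: assumes Z: "vspace Z" and g: "tri Z g"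
 shows "ts (t2 c a) (\<lambda>s t. ts (G (t \<odot> b)) (\<lambda>x y. g s x y)) = ts (G (a \<odot> b)) (\<lambda>a b. ts (t2 c a) (\<lambda>s t. g s t b))"
proof (rule idemE[where f="\<lambda>b. ts (t2 c a) (\<lambda>s t. ts (G (t \<odot> b)) (\<lambda>x y. g s x y))" and g="\<lambda>b. ts (G (a \<odot> b)) (\<lambda>a b. ts (t2 c a) (\<lambda>s t. g s t b))" and Z=Z], (intro lins Z trilD[OF g] | simp)+)
 fix p q
 have 1: "ts (G (x \<odot> (p * q))) b = ts (t4 q p) (\<lambda>z y. b (x \<lhd> Rb y) z)" if "bil Z b" for b x
  unfolding G_eq by (subst ts_ts[OF Z that]) (simp_all add: ts_pure[OF Z that])
 have "ts (t2 c a) (\<lambda>s t. ts (G (t \<odot> (p * q))) (\<lambda>x y. g s x y)) = ts (t2 c a) (\<lambda>s t. ts (t4 q p) (\<lambda>z y. g s (t \<lhd> Rb y) z))"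
  by (subst 1) (intro lins Z trilD[OF g] | simp)+
 also have "\<dots> = ts (t4 q p) (\<lambda>z y. ts (t2 c a) (\<lambda>s t. g s (t \<lhd> Rb y) z))" by (rule ts_swap)
 also have "\<dots> = ts (t4 q p) (\<lambda>z y. ts (o2r (Rb y) (t2 c a)) (\<lambda>s t. g s t z))"
  by (subst ts_o2r[OF Z]) (intro lins Z trilD[OF g] | simp)+
 also have "\<dots> = ts (G (a \<odot> (p * q))) (\<lambda>a b. ts (t2 c a) (\<lambda>s t. g s t b))"
  by (subst 1) (intro lins Z trilD[OF g] | simp add: t2r')+
 finally show "ts (t2 c a) (\<lambda>s t. ts (G (t \<odot> (p * q))) (\<lambda>x y. g s x y)) = ts (G (a \<odot> (p * q))) (\<lambda>a b. ts (t2 c a) (\<lambda>s t. g s t b))" .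
qed

lemma ts_F: assumes "vspace Z" "lin AA AA F" "bil Z b" "t \<in> carr AA"
 shows "ts t (\<lambda>x y. ts (F (x \<odot> y)) b) = ts (F t) b"
 by (rule ts_lin[symmetric, of Z "\<lambda>t. ts (F t) b"]) (intro lins lin_comp[OF assms(2)] assms)+

text \<open>\<open>R1\<close> inherits the commutation with \<open>T\<^sub>2\<close>, since \<open>T\<^sub>1\<close>, \<open>E\<^sub>1\<close> and \<open>G\<close> have it and \<open>R1 = R1 E\<^sub>1 = G R1\<close>.\<close>
lemma comm_R1: assumes Z: "vspace Z" and g: "tri Z g"
 shows "ts (t2 c a) (\<lambda>s t. ts (R1 (t \<odot> b)) (\<lambda>x y. g s x y)) = ts (R1 (a \<odot> b)) (\<lambda>a b. ts (t2 c a) (\<lambda>s t. g s t b))"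
proof -
 note L = lins Z trilD[OF g]
 define \<beta> where "\<beta> s x y = ts (R1 (x \<odot> y)) (\<lambda>x y. g s x y)" for s x y
 have \<beta>: "tri Z \<beta>" unfolding \<beta>_def by (intro L | simp)+
 have bg: "bil Z (\<lambda>x y. g s x y)" for s by (intro L | simp)+
 have "ts (t2 c a) (\<lambda>s t. ts (R1 (t \<odot> b)) (\<lambda>x y. g s x y)) = ts (t2 c a) (\<lambda>s t. ts (R1 (e1 t b)) (\<lambda>x y. g s x y))"
  by (simp add: R1E1)
 also have "\<dots> = ts (t2 c a) (\<lambda>s t. ts (e1 t b) (\<lambda>x y. \<beta> s x y))"
  unfolding \<beta>_def by (subst ts_F[OF Z lin_R1]) (simp_all add: bg)
 also have "\<dots> = ts (e1 a b) (\<lambda>a b. ts (t2 c a) (\<lambda>s t. \<beta> s t b))" by (rule comm_E1[OF Z \<beta>])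
 also have "\<dots> = ts (T1 H (R1 (a \<odot> b))) (\<lambda>a b. ts (t2 c a) (\<lambda>s t. \<beta> s t b))" by (simp add: T1R1)
 also have "\<dots> = ts (R1 (a \<odot> b)) (\<lambda>x y. ts (t1 x y) (\<lambda>a b. ts (t2 c a) (\<lambda>s t. \<beta> s t b)))"
  by (rule ts_F[OF Z lin_F(3), symmetric]) (intro lins Z trilD[OF \<beta>] | simp)+
 also have "\<dots> = ts (R1 (a \<odot> b)) (\<lambda>x y. ts (t2 c x) (\<lambda>s t. ts (t1 t y) (\<lambda>t y. \<beta> s t y)))"
  by (subst T1_T2_commute[OF Z \<beta>]) simp
 also have "\<dots> = ts (R1 (a \<odot> b)) (\<lambda>x y. ts (t2 c x) (\<lambda>s t. ts (G (t \<odot> y)) (\<lambda>x y. g s x y)))"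
  unfolding \<beta>_def by (subst ts_F[OF Z lin_R1]) (simp_all add: bg R1T1)
 also have "\<dots> = ts (R1 (a \<odot> b)) (\<lambda>x y. ts (G (x \<odot> y)) (\<lambda>a b. ts (t2 c a) (\<lambda>s t. g s t b)))"
  by (subst comm_G[OF Z g]) simp
 also have "\<dots> = ts (G (R1 (a \<odot> b))) (\<lambda>a b. ts (t2 c a) (\<lambda>s t. g s t b))"
  by (rule ts_F[OF Z lin_G]) (intro L | simp)+
 finally show ?thesis by (simp add: GR1)
qed

text \<open>Applying the counit to the middle leg of \<open>comm_R1\<close> shows that \<open>R1\<close> is determined by \<open>S\<close>.\<close>
lemma R1_S: "l1 c (R1 (a \<odot> b)) = ts (t2 c a) (\<lambda>s t. s \<odot> (S t \<rhd> b))"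
proof -
 have "ts (t2 c a) (\<lambda>s t. ts (R1 (t \<odot> b)) (\<lambda>x y. asc H (eps H x) s \<odot> y)) = ts (R1 (a \<odot> b)) (\<lambda>a b. ts (t2 c a) (\<lambda>s t. asc H (eps H t) s \<odot> b))"
  by (rule comm_R1[OF vspace_tprod[of "alg H" "alg H"]]) (intro lins)
 moreover have "ts (t2 c a) (\<lambda>s t. asc H (eps H t) s \<odot> b) = (c * a) \<odot> b" for a b
  using counit_T(2)[of c a] by (simp add: er_def flip: ts_tpL)
 ultimately show ?thesis by (simp add: l1_def S_l el_def asc_tp ts_tpR)
qed

text \<open>The antipode axiom \<open>a\<^sub>1 S(a\<^sub>2) = L a\<close>, from \<open>T\<^sub>1 R1 = E\<^sub>1\<close>.\<close>
lemma mult_R1: "ts (R1 (a \<odot> b)) (\<lambda>x y. x * y) = L a \<rhd> b"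
proof -
 have "ts (R1 (a \<odot> b)) (\<lambda>x y. el (t1 x y)) = el (T1 H (R1 (a \<odot> b)))"
  by (rule ts_lin[symmetric, where f="\<lambda>t. el (T1 H t)" and Z=A]) (intro lins | simp)+
 then show ?thesis by (simp add: counit_T T1R1 L_l)
qed
lemma antipode_right: "x \<lhd> L a = ts (t2 x a) (\<lambda>s t. s \<lhd> S t)"
proof (rule nondegA_eq(1))
 fix b
 have "(x \<lhd> L a) * b = x * ts (R1 (a \<odot> b)) (\<lambda>x y. x * y)" by (simp add: mult_R1 MM_bal)
 also have "\<dots> = ts (l1 x (R1 (a \<odot> b))) (\<lambda>x y. x * y)"
  unfolding ts_mul by (subst ts_lrA(1)) (intro lins | simp flip: mult.assoc)+
 also have "\<dots> = ts (t2 x a) (\<lambda>s t. s * (S t \<rhd> b))"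
  unfolding R1_S by (subst ts_tsA) (intro lins | simp add: ts_pureA lins)+
 also have "\<dots> = ts (t2 x a) (\<lambda>s t. s \<lhd> S t) * b" by (simp add: ts_mul MM_bal)
 finally show "(x \<lhd> L a) * b = ts (t2 x a) (\<lambda>s t. s \<lhd> S t) * b" .
qed
text \<open>The antipode axiom \<open>S(a\<^sub>1) a\<^sub>2 = Rr a\<close>, from \<open>R1 T\<^sub>1 = G\<close>.\<close>
lemma antipode_left: "ts (t1 a b) (\<lambda>p q. S p \<rhd> q) = Rr a \<rhd> b"
proof -
 have "ts (t1 a b) (\<lambda>x y. el (R1 (x \<odot> y))) = el (R1 (t1 a b))"
  by (rule ts_lin[symmetric, where f="\<lambda>t. el (R1 t)" and Z=A]) (intro lins | simp)+
 then show ?thesis by (simp add: S_l R1T1 elG)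
qed
text \<open>\<open>S(a\<^sub>1) a\<^sub>2 S(a\<^sub>3) = S a\<close>, from \<open>G R1 = R1\<close>.\<close>
lemma Rr_R1: "ts (R1 (a \<odot> b)) (\<lambda>p q. Rr p \<rhd> q) = S a \<rhd> b"
proof -
 have "ts (R1 (a \<odot> b)) (\<lambda>x y. el (G (x \<odot> y))) = el (G (R1 (a \<odot> b)))"
  by (rule ts_lin[symmetric, where f="\<lambda>t. el (G t)" and Z=A]) (intro lins | simp)+
 then show ?thesis by (simp add: S_l GR1 elG)
qed

lemma R1_R: assumes r: "r \<in> carr R" shows "R1 (b \<odot> (r \<rhd> e)) = o1 r (R1 (b \<odot> e))"
proof -
 note rM = R_MM[OF r]
 have T: "T1 H (o1 r t) = o2 r (T1 H t)" if "t \<in> carr AA" for t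
  by (rule AA_eq[OF _ _ that, where Z=AA], (intro lins rM)+) (simp add: o_pure rM t1r[OF r])
 have "T1 H (o1 r (R1 (b \<odot> e))) = T1 H (R1 (b \<odot> (r \<rhd> e)))"
  by (simp add: T T1R1 E1_o2[OF r, symmetric] o_pure rM)
 then have "R1 (T1 H (o1 r (R1 (b \<odot> e)))) = R1 (b \<odot> (r \<rhd> e))" by (simp add: RTR)
 then show ?thesis by (simp add: R1T1 G_o1 rM GR1)
qed

lemma el_l1_R1: "el (l1 a (R1 (b \<odot> e))) = S b \<rhd> (Rr a \<rhd> e)"
proof -
 have "el (l1 a t) = el (o1 (Rr a) t)" if "t \<in> carr AA" for t
  by (rule AA_eq[OF _ _ that, where Z=A], (intro lins)+) (simp add: o_pure el_pure eps_Rr)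
 then show ?thesis by (simp add: S_l R1_R)
qed
lemma S_Lb: "S (Lb a \<rhd> b) \<rhd> e = S b \<rhd> (Rr a \<rhd> e)"
proof -
 have "S b \<rhd> (Rr a \<rhd> e) = ts (t2 a b) (\<lambda>s t. asc H (eps H s) (S t \<rhd> e))"
  unfolding el_l1_R1[symmetric] R1_S by (simp add: el_ts el_pure)
 also have "\<dots> = S (Lb a \<rhd> b) \<rhd> e"
  unfolding Lb_l el_def using ts_pushA[of A "\<lambda>t. S t \<rhd> e"] lin_scal[of A A "\<lambda>t. S t \<rhd> e"] by (simp add: lins)
 finally show ?thesis ..
qed

lemma R1_mult: "R1 ((a * b) \<odot> c) = ts (R1 (a \<odot> c)) (\<lambda>x y. l1 x (R1 (b \<odot> y)))"
proof -
 define Q where "Q = ts (R1 (a \<odot> c)) (\<lambda>x y. l1 x (R1 (b \<odot> y)))"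
 have Qc: "Q \<in> carr AA" by (simp add: Q_def)
 have T: "T1 H (l1 x t) = DL x (T1 H t)" if "t \<in> carr AA" for t x
  by (rule AA_eq[OF _ _ that, where Z=AA], (intro lins)+) (simp add: t1_DL)
 have "T1 H Q = ts (R1 (a \<odot> c)) (\<lambda>x y. r1 (t1 x y) b)"
  unfolding Q_def by (subst ts_pushAA[OF lin_F(3)]) (simp_all add: T T1R1 DL_E1 DL_pure)
 also have "\<dots> = r1 (T1 H (R1 (a \<odot> c))) b"
  by (rule ts_lin[symmetric, where f="\<lambda>t. r1 (T1 H t) b" and Z=AA]) (intro lins | simp)+
 also have "\<dots> = e1 (a * b) c" by (simp add: T1R1 e1_r)
 finally have "T1 H Q = e1 (a * b) c" .
 moreover have "G Q = Q" unfolding Q_def by (subst ts_pushAA[OF lin_G]) (simp_all add: G_l GR1)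
 ultimately have "R1 (e1 (a * b) c) = Q" using R1T1[OF Qc] by simp
 then show ?thesis by (simp add: R1E1 Q_def)
qed
text \<open>By \<open>R1_mult\<close>, \<open>S(a b)\<close> is \<open>S(b) Rr(a\<^sub>1) S(a\<^sub>2)\<close>, where \<open>Rr(a\<^sub>1) S(a\<^sub>2)\<close> is \<open>S a\<close>.\<close>
lemma S_mult: "S (a * b) = S b \<star> S a"
proof (rule MM_eq)
 fix c
 have "S (a * b) \<rhd> c = ts (R1 (a \<odot> c)) (\<lambda>x y. S b \<rhd> (Rr x \<rhd> y))"
  by (simp add: S_l[of "a * b"] R1_mult el_ts el_l1_R1)
 then show "S (a * b) \<rhd> c = (S b \<star> S a) \<rhd> c" by (simp add: Rr_R1 flip: ts_ml)
qed simp_all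

lemma S_Rb: "S (Rb a \<rhd> b) \<rhd> c = S b \<rhd> (L a \<rhd> c)"
proof -
 have "R1 ((Rb a \<rhd> b) \<odot> c) = R1 (b \<odot> (L a \<rhd> c))"
  using E_Rb_L[of "b \<odot> c" a] R1E1[of "o1 (Rb a) (b \<odot> c)"] R1E1[of "o2 (L a) (b \<odot> c)"] by (simp add: o_pure)
 then show ?thesis by (simp add: S_l)
qed

text \<open>\<open>S(A) A\<close> contains \<open>R A\<close>, by the antipode axiom, and therefore everything.\<close>
lemma S_A_total: assumes p: "lin A scalars \<psi>" and z: "\<And>a b. \<psi> (S a \<rhd> b) = 0" shows "\<psi> x = 0"
 by (rule Rr_A_total[OF p]) (simp add: ts_pushA[OF p] z ts_zero flip: antipode_left)
lemma A_S_total: assumes p: "lin A scalars \<psi>" and z: "\<And>a b. \<psi> (a \<lhd> S b) = 0" shows "\<psi> x = 0"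
 by (rule A_L_total[OF p]) (simp add: ts_pushA[OF p] z ts_zero antipode_right)
lemma SA_span: "module.span (asc H) {S b \<rhd> a | a b. True} = UNIV"
proof (rule span_UNIV_by_functionals[OF vs_A])
 fix \<psi> x assume p: "lin \<lparr>carr = UNIV, scal = asc H\<rparr> scalars \<psi>" and z: "\<And>x. x \<in> {S b \<rhd> a | a b. True} ==> \<psi> x = 0"
 show "\<psi> x = 0" by (rule S_A_total) (use p z in \<open>auto simp: alg_def\<close>)
qed
lemma AS_span: "module.span (asc H) {a \<lhd> S b | a b. True} = UNIV"
proof (rule span_UNIV_by_functionals[OF vs_A])
 fix \<psi> x assume p: "lin \<lparr>carr = UNIV, scal = asc H\<rparr> scalars \<psi>" and z: "\<And>x. x \<in> {a \<lhd> S b | a b. True} ==> \<psi> x = 0"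
 show "\<psi> x = 0" by (rule A_S_total) (use p z in \<open>auto simp: alg_def\<close>)
qed
lemma S_ext: fixes Z :: "('k,'z::ab_group_add) space" assumes f: "lin A Z f" and g: "lin A Z g" and e: "\<And>a b. f (S a \<rhd> b) = g (S a \<rhd> b)" shows "f x = g x"
proof (rule lin_span_eq[OF vspace_A f g, where P="{S b \<rhd> a | a b. True}"])
 show "x \<in> module.span (scal A) {S b \<rhd> a | a b. True}" by (simp only: scal_A SA_span UNIV_I)
qed (auto simp: e)
lemma S_extr: fixes Z :: "('k,'z::ab_group_add) space" assumes f: "lin A Z f" and g: "lin A Z g" and e: "\<And>a b. f (a \<lhd> S b) = g (a \<lhd> S b)" shows "f x = g x"
proof (rule lin_span_eq[OF vspace_A f g, where P="{a \<lhd> S b | a b. True}"])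
 show "x \<in> module.span (scal A) {a \<lhd> S b | a b. True}" by (simp only: scal_A AS_span UNIV_I)
qed (auto simp: e)
text \<open>Elements are separated by the left multiplications by \<open>S d\<close>: move \<open>S d\<close> to the other side, where the \<open>c S d\<close> span.\<close>
lemma S_cancel: assumes "\<And>d. S d \<rhd> y = S d \<rhd> y'" shows "y = y'"
proof (rule nondegA_eq(2))
 fix b show "b * y = b * y'"
  by (rule S_extr[where Z=A and f="\<lambda>b. b * y" and g="\<lambda>b. b * y'"]) (intro lins | simp add: assms flip: MM_bal)+
qed
lemma S_cancelr: assumes "\<And>a b. y * (S a \<rhd> b) = y' * (S a \<rhd> b)" shows "y = y'"
proof (rule nondegA_eq(1))
 fix b show "y * b = y' * b"
  by (rule S_ext[where Z=A and f="\<lambda>b. y * b" and g="\<lambda>b. y' * b"]) (intro lins | simp add: assms)+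
qed
lemma S_cancell: assumes "\<And>a b. (a \<lhd> S b) * y = (a \<lhd> S b) * y'" shows "y = y'"
proof (rule nondegA_eq(2))
 fix b show "b * y = b * y'"
  by (rule S_extr[where Z=A and f="\<lambda>b. b * y" and g="\<lambda>b. b * y'"]) (intro lins | simp add: assms)+
qed

lemma S_Rbr: "S (a \<lhd> Rb b) \<rhd> c = L b \<rhd> (S a \<rhd> c)"
proof (rule S_cancel)
 fix d
 have "S d \<rhd> (S (a \<lhd> Rb b) \<rhd> c) = S ((a \<lhd> Rb b) * d) \<rhd> c" by (simp add: S_mult)
 also have "\<dots> = S (a * (Rb b \<rhd> d)) \<rhd> c" by (simp add: MM_bal)
 also have "\<dots> = S d \<rhd> (L b \<rhd> (S a \<rhd> c))" by (simp add: S_mult S_Rb)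
 finally show "S d \<rhd> (S (a \<lhd> Rb b) \<rhd> c) = S d \<rhd> (L b \<rhd> (S a \<rhd> c))" .
qed
lemma S_Lbr: "S (a \<lhd> Lb b) \<rhd> c = Rr b \<rhd> (S a \<rhd> c)"
proof (rule S_cancel)
 fix d
 have "S d \<rhd> (S (a \<lhd> Lb b) \<rhd> c) = S ((a \<lhd> Lb b) * d) \<rhd> c" by (simp add: S_mult)
 also have "\<dots> = S (a * (Lb b \<rhd> d)) \<rhd> c" by (simp add: MM_bal)
 also have "\<dots> = S d \<rhd> (Rr b \<rhd> (S a \<rhd> c))" by (simp add: S_mult S_Lb)
 finally show "S d \<rhd> (S (a \<lhd> Lb b) \<rhd> c) = S d \<rhd> (Rr b \<rhd> (S a \<rhd> c))" .
qed

section \<open>Extension of the antipode to multipliers\<close>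

text \<open>Both sides are \<open>c S(b m d) a\<close>. This compatibility makes the extension of \<open>S\<close> to the multiplier \<open>m\<close> well defined.\<close>
lemma Sb_key: assumes m: "m \<in> MM" shows "(c \<lhd> S d) * (S (b \<lhd> m) \<rhd> a) = (c \<lhd> S (m \<rhd> d)) * (S b \<rhd> a)"
 by (simp add: MM_bal[OF S_MM, symmetric] mp_s(1)[symmetric] S_mult[symmetric] MM_bal[OF m] del: mp_s(1))
text \<open>The two actions of \<open>Sb m\<close> are the ones forced by \<open>S d Sb m = S (m d)\<close> and \<open>Sb m S b = S (b m)\<close>.\<close>
definition "Sb m = (\<lambda>y. THE w. \<forall>c d. (c \<lhd> S d) * w = (c \<lhd> S (m \<rhd> d)) * y, \<lambda>y. THE w. \<forall>b a. w * (S b \<rhd> a) = y * (S (b \<lhd> m) \<rhd> a))"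
text \<open>Since the \<open>S b a\<close> span, it is enough to give the solution for these, and there \<open>Sb_key\<close> exhibits it.\<close>
lemma Sb_ex: assumes m: "m \<in> MM" shows "\<exists>w. \<forall>c d. (c \<lhd> S d) * w = (c \<lhd> S (m \<rhd> d)) * y"
proof -
 interpret vector_space "asc H" by (rule vs_A)
 have "y \<in> span {S b \<rhd> a | a b. True}" by (simp only: SA_span UNIV_I)
 then show ?thesis
 proof (induction rule: span_induct_alt)
  case base show ?case by (rule exI[of _ 0]) simp
 next
  case (step k x y)
  then obtain a b w where x: "x = S b \<rhd> a" and w: "\<forall>c d. (c \<lhd> S d) * w = (c \<lhd> S (m \<rhd> d)) * y" by blast
  show ?case by (rule exI[of _ "asc H k (S (b \<lhd> m) \<rhd> a) + w"]) (simp add: distrib_left asc_mul Sb_key[OF m] x w)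
 qed
qed
lemma Sb_exr: assumes m: "m \<in> MM" shows "\<exists>w. \<forall>b a. w * (S b \<rhd> a) = y * (S (b \<lhd> m) \<rhd> a)"
proof -
 interpret vector_space "asc H" by (rule vs_A)
 have "y \<in> span {a \<lhd> S b | a b. True}" by (simp only: AS_span UNIV_I)
 then show ?thesis
 proof (induction rule: span_induct_alt)
  case base show ?case by (rule exI[of _ 0]) simp
 next
  case (step k x y)
  then obtain a b w where x: "x = a \<lhd> S b" and w: "\<forall>b a. w * (S b \<rhd> a) = y * (S (b \<lhd> m) \<rhd> a)" by blast
  show ?case by (rule exI[of _ "asc H k (a \<lhd> S (m \<rhd> b)) + w"]) (simp add: distrib_right asc_mul Sb_key[OF m] x w)
 qed
qed
lemma Sb_char: assumes m: "m \<in> MM" shows "(c \<lhd> S d) * (Sb m \<rhd> y) = (c \<lhd> S (m \<rhd> d)) * y"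
proof -
 have "\<exists>!w. \<forall>c d. (c \<lhd> S d) * w = (c \<lhd> S (m \<rhd> d)) * y"
  by (rule ex_ex1I[OF Sb_ex[OF m]]) (rule S_cancell, simp)
 from theI'[OF this] show ?thesis by (simp add: Sb_def)
qed
lemma Sb_charr: assumes m: "m \<in> MM" shows "(y \<lhd> Sb m) * (S b \<rhd> a) = y * (S (b \<lhd> m) \<rhd> a)"
proof -
 have "\<exists>!w. \<forall>b a. w * (S b \<rhd> a) = y * (S (b \<lhd> m) \<rhd> a)"
  by (rule ex_ex1I[OF Sb_exr[OF m]]) (rule S_cancelr, simp)
 from theI'[OF this] show ?thesis by (simp add: Sb_def)
qed
lemma Sb_l: "m \<in> MM ==> Sb m \<rhd> (S b \<rhd> a) = S (b \<lhd> m) \<rhd> a"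
 by (rule S_cancell) (simp add: Sb_char Sb_key)
lemma Sb_r: "m \<in> MM ==> (a \<lhd> S b) \<lhd> Sb m = a \<lhd> S (m \<rhd> b)"
 by (rule S_cancelr) (simp add: Sb_charr Sb_key)
lemma Sb_MM[simp, lins]: assumes m: "m \<in> MM" shows "Sb m \<in> MM"
proof (rule MMI)
 show l: "lin A A (fst (Sb m))"
  unfolding lin_def by (intro conjI ballI allI) (simp, (rule S_cancell, simp add: Sb_char[OF m] distrib_left asc_mul)+)
 show r: "lin A A (snd (Sb m))"
  unfolding lin_def by (intro conjI ballI allI) (simp, (rule S_cancelr, simp add: Sb_charr[OF m] distrib_right asc_mul)+)
 have ll: "lin W A (\<lambda>w. Sb m \<rhd> f w)" if "lin W A f" for W :: "('k,'w::ab_group_add) space" and f using lin_comp[OF l that] .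
 have rr: "lin W A (\<lambda>w. f w \<lhd> Sb m)" if "lin W A f" for W :: "('k,'w::ab_group_add) space" and f using lin_comp[OF r that] .
 fix a b
 show "a * (Sb m \<rhd> b) = (a \<lhd> Sb m) * b"
  by (rule S_extr[where Z=A and f="\<lambda>a. a * (Sb m \<rhd> b)" and g="\<lambda>a. (a \<lhd> Sb m) * b"])
   (intro lins ll rr | simp add: Sb_char Sb_r m)+
qed
lemma Sb_eqI: assumes m: "m \<in> MM" "n \<in> MM" and e: "\<And>a b. n \<rhd> (S b \<rhd> a) = S (b \<lhd> m) \<rhd> a" shows "Sb m = n"
proof (rule MM_eq)
 fix x show "Sb m \<rhd> x = n \<rhd> x"
  by (rule S_ext[where Z=A and f="\<lambda>x. Sb m \<rhd> x"]) (intro lins m | simp add: Sb_l e m)+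
qed (simp_all add: m)
lemma lin_Sb[lins]: assumes f: "lin W M f" and W: "vspace W" shows "lin W M (\<lambda>w. Sb (f w))"
proof -
 have c: "f w \<in> MM" if "w \<in> carr W" for w using lin_carr[OF f that] .
 show ?thesis unfolding lin_def
 proof (intro conjI ballI allI)
  fix x y k assume x: "x \<in> carr W"
  show "Sb (f x) \<in> MM" by (simp add: c x)
  show "Sb (f (scal W k x)) = scal M k (Sb (f x))"
   using lin_scal[of A A "\<lambda>b. S b \<rhd> _"]
   by (intro Sb_eqI) (auto simp: c x W vspace_scal lin_scal[OF f] Sb_l lins vspace_scal[OF vspace_M])
 next
  fix x y assume x: "x \<in> carr W" "y \<in> carr W"
  show "Sb (f (x + y)) = Sb (f x) + Sb (f y)"
   using lin_add[of A A "\<lambda>b. S b \<rhd> _"]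
   by (intro Sb_eqI) (auto simp: c x W vspace_add lin_add[OF f] Sb_l lins vspace_add[OF vspace_M])
 qed
qed
lemma Sb_mp: "m \<in> MM ==> n \<in> MM ==> Sb (m \<star> n) = Sb n \<star> Sb m"
 by (rule Sb_eqI) (simp_all add: Sb_l)
lemma Sb_Rb: "Sb (Rb p) = L p"
 by (rule Sb_eqI) (simp_all add: S_Rbr)
lemma S_act: "m \<in> MM ==> S (m \<rhd> b) = S b \<star> Sb m" "m \<in> MM ==> S (b \<lhd> m) = Sb m \<star> S b"
 by (rule MM_eqr, simp, simp, simp add: Sb_r) (rule MM_eq, simp, simp, simp add: Sb_l)

lemmas vAA = vspace_tprod[of "alg H" "alg H"]

section \<open>Anticomultiplicativity of the antipode\<close>

text \<open>The action of \<open>(S \<otimes> S)\<close> of the flip of \<open>t\<close> on \<open>z\<close> from the left.\<close>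
definition "S2 t z = ts t (\<lambda>p q. ts z (\<lambda>x y. (S q \<rhd> x) \<odot> (S p \<rhd> y)))"
lemma S2_c[simp]: "S2 t z \<in> carr AA" by (simp add: S2_def)
lemma lin_S2[lins]: "lin W AA f ==> lin W AA (\<lambda>w. S2 (f w) z)" "lin W AA f ==> lin W AA (\<lambda>w. S2 t (f w))"
 unfolding S2_def by (intro lins; assumption)+
lemma S2_pure: "S2 (p \<odot> q) (x \<odot> y) = (S q \<rhd> x) \<odot> (S p \<rhd> y)"
proof -
 have "S2 (p \<odot> q) z = ts z (\<lambda>x y. (S q \<rhd> x) \<odot> (S p \<rhd> y))" for z unfolding S2_def by (rule ts_pureAA) (intro lins)
 then show ?thesis by (simp add: ts_pureAA lins)
qed
text \<open>\<open>S A A\<close> spans \<open>A\<close> in each leg.\<close>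
lemma S2_ext: fixes Z :: "('k,'z::ab_group_add) space" 
 assumes Z: "vspace Z" and f: "lin AA Z f" and g: "lin AA Z g" and e: "\<And>c d x y. f (S2 (c \<odot> d) (x \<odot> y)) = g (S2 (c \<odot> d) (x \<odot> y))" and t: "t \<in> carr AA"
 shows "f t = g t"
proof (rule AA_eq[OF f g t])
 fix x y
 show "f (x \<odot> y) = g (x \<odot> y)"
 proof (rule S_ext[where Z=Z and f="\<lambda>x. f (x \<odot> y)" and g="\<lambda>x. g (x \<odot> y)"], (intro lins lin_comp[OF f] lin_comp[OF g])+)
  fix d a show "f ((S d \<rhd> a) \<odot> y) = g ((S d \<rhd> a) \<odot> y)"
   by (rule S_ext[where Z=Z and f="\<lambda>y. f ((S d \<rhd> a) \<odot> y)" and g="\<lambda>y. g ((S d \<rhd> a) \<odot> y)"])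
    (intro lins lin_comp[OF f] lin_comp[OF g] | simp add: e flip: S2_pure)+
 qed
qed

lemma E1_S: "e1 x (S (q * p) \<rhd> d) = ts (t2 q p) (\<lambda>s t. (Rr t \<rhd> x) \<odot> (S s \<rhd> d))"
proof (rule idemE[where f="\<lambda>x. e1 x (S (q * p) \<rhd> d)" and g="\<lambda>x. ts (t2 q p) (\<lambda>s t. (Rr t \<rhd> x) \<odot> (S s \<rhd> d))" and Z=AA], (intro lins)+)
 fix z z'
 have "e1 (z * z') (S (q * p) \<rhd> d) = ts (t4 z' z) (\<lambda>g h. g \<odot> (S (q * (p \<lhd> Rb h)) \<rhd> d))"
  by (simp add: E1_L MM_r flip: S_Rbr)
 also have "\<dots> = ts (t4 z' z) (\<lambda>g h. ts (t2 q p) (\<lambda>s t. asc H (eps H (t * h)) g \<odot> (S s \<rhd> d)))"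
  unfolding Rb_r_t2 using ts_pushA[of AA "\<lambda>s. _ \<odot> (S s \<rhd> d)"] lin_scal[of A A "\<lambda>s. S s \<rhd> d"] by (simp add: lins asc_tp)
 also have "\<dots> = ts (t2 q p) (\<lambda>s t. ts (t4 z' z) (\<lambda>g h. asc H (eps H (t * h)) g \<odot> (S s \<rhd> d)))" by (rule ts_swap)
 also have "\<dots> = ts (t2 q p) (\<lambda>s t. (Rr t \<rhd> (z * z')) \<odot> (S s \<rhd> d))"
  by (simp add: MM_l Rr_l_t4 ts_tpL)
 finally show "e1 (z * z') (S (q * p) \<rhd> d) = ts (t2 q p) (\<lambda>s t. (Rr t \<rhd> (z * z')) \<odot> (S s \<rhd> d))" .
qed
text \<open>\<open>E\<close> is fixed by \<open>S \<otimes> S\<close> with a flip, in the form \<open>E S2(t) = S2(t E)\<close>.\<close>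
lemma E1_S2: "z \<in> carr AA ==> E1 H (S2 (a \<odot> b) z) = S2 (e2 a b) z"
proof (rule AA_eq[where f="\<lambda>z. E1 H (S2 (a \<odot> b) z)" and g="\<lambda>z. S2 (e2 a b) z" and Z=AA], (intro lins)+, assumption)
 fix c d
 show "E1 H (S2 (a \<odot> b) (c \<odot> d)) = S2 (e2 a b) (c \<odot> d)"
 proof (rule idemE[where f="\<lambda>a. E1 H (S2 (a \<odot> b) (c \<odot> d))" and g="\<lambda>a. S2 (e2 a b) (c \<odot> d)" and Z=AA], (intro lins)+)
  fix q p
  have "S2 (e2 (q * p) b) (c \<odot> d) = ts (t2 q p) (\<lambda>s t. S2 (s \<odot> (b \<lhd> Lb t)) (c \<odot> d))"
   unfolding E2_Lb by (rule ts_pushAA[where f="\<lambda>w. S2 w (c \<odot> d)" and Z'=AA]) (intro lins | simp)+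
  also have "\<dots> = ts (t2 q p) (\<lambda>s t. (Rr t \<rhd> (S b \<rhd> c)) \<odot> (S s \<rhd> d))" by (simp add: S2_pure S_Lbr)
  also have "\<dots> = E1 H (S2 ((q * p) \<odot> b) (c \<odot> d))" by (simp add: S2_pure E1_S)
  finally show "E1 H (S2 ((q * p) \<odot> b) (c \<odot> d)) = S2 (e2 (q * p) b) (c \<odot> d)" ..
 qed
qed
lemma Rr_t1: "ts (t1 h y) (\<lambda>p z. (Rr p \<rhd> x) \<odot> z) = l2 h (e1 x y)"
proof (rule nondeg_mm(1))
 fix a c
 have "a \<odot> c \<cdot> ts (t1 h y) (\<lambda>p z. (Rr p \<rhd> x) \<odot> z) = ts (t1 h y) (\<lambda>p z. ((a \<lhd> Rr p) * x) \<odot> (c * z))"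
  by (subst ts_pushAA[where f="\<lambda>w. a \<odot> c \<cdot> w" and Z'=AA]) (intro lins | simp add: MM_bal)+
 also have "\<dots> = ts (l2 c (t1 h y)) (\<lambda>p z. ((a \<lhd> Rr p) * x) \<odot> z)" by (rule ts_lrAA[symmetric]) (intro lins)
 also have "\<dots> = ts (t3 h c) (\<lambda>p z. ((a \<lhd> Rr p) * x) \<odot> (z * y))" unfolding T_compat by (rule ts_lrAA) (intro lins)
 also have "\<dots> = e2 a (c * h) \<cdot> x \<odot> y"
  unfolding E2_Rr by (subst ts_pushAA[where f="\<lambda>w. w \<cdot> x \<odot> y" and Z'=AA]) (intro lins | simp)+
 also have "\<dots> = a \<odot> (c * h) \<cdot> e1 x y" using E_balanced[of "a \<odot> (c * h)" "x \<odot> y"] by simp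
 also have "\<dots> = a \<odot> c \<cdot> l2 h (e1 x y)" by (simp add: mm_lr lr_comm)
 finally show "a \<odot> c \<cdot> ts (t1 h y) (\<lambda>p z. (Rr p \<rhd> x) \<odot> z) = a \<odot> c \<cdot> l2 h (e1 x y)" .
qed simp_all

text \<open>\<open>S(h\<^sub>1) h\<^sub>2 q\<^sub>1 \<otimes> h\<^sub>3 q\<^sub>2 = (1 \<otimes> h) \<Delta>(q)\<close>: coassociativity produces \<open>Rr\<close>, which is absorbed by \<open>E\<close> and then by \<open>\<Delta>(q)\<close>.\<close>
lemma S_DL_cancel: assumes z: "z \<in> carr AA" shows "ts (t1 h q) (\<lambda>h q. o1 (S h) (DL q z)) = l2 h (DL q z)"
proof -
 have "ts (t1 h q) (\<lambda>h q. o1 (S h) (DL q z)) = ts (DL q z) (\<lambda>x y. ts (t1 h y) (\<lambda>h y. ts (t1 h x) (\<lambda>h x. (S h \<rhd> x) \<odot> y)))"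
  unfolding o1_def by (rule coassoc_DL[OF vAA _ z]) (intro lins)
 also have "\<dots> = ts (DL q z) (\<lambda>x y. l2 h (e1 x y))" by (simp add: antipode_left Rr_t1 flip: ts_tpL)
 also have "\<dots> = l2 h (E1 H (DL q z))"
  by (rule ts_lin[symmetric, where f="\<lambda>t. l2 h (E1 H t)" and Z=AA]) (intro lins | simp)+
 finally show ?thesis by (simp add: E1_DL z)
qed

lemma S_Rr_t4: "S w \<rhd> (Rr p \<rhd> y) = ts (t4 w p) (\<lambda>g h. S g \<rhd> (h * y))"
proof -
 have "S w \<rhd> (Rr p \<rhd> y) = ts (t1 p y) (\<lambda>p y. S (p * w) \<rhd> y)" by (simp add: antipode_left[symmetric] ts_ml S_mult)
 also have "\<dots> = ts (r1 (t1 p y) w) (\<lambda>p y. S p \<rhd> y)" by (rule ts_lrA[symmetric]) (intro lins)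
 also have "\<dots> = ts (t4 w p) (\<lambda>g h. S g \<rhd> (h * y))" unfolding t1_t4 by (rule ts_lrA) (intro lins)
 finally show ?thesis .
qed

lemma S2_Rr_DL: assumes z: "z \<in> carr AA"
 shows "S2 (w \<odot> u) (o2 (Rr p) (DL q z)) = ts (t1 p q) (\<lambda>p q. S2 (DL p (w \<odot> u)) (DL q z))"
proof -
 have "S2 (w \<odot> u) (o2 (Rr p) Z) = ts (t4 w p) (\<lambda>g h. o1 (S u) (o2 (S g) (l2 h Z)))" if Z: "Z \<in> carr AA" for Z
  by (rule AA_eq[OF _ _ Z, where Z=AA], (intro lins)+) (simp add: o_pure S2_pure S_Rr_t4 ts_tpR)
 then have "S2 (w \<odot> u) (o2 (Rr p) (DL q z)) = ts (t4 w p) (\<lambda>g h. o1 (S u) (o2 (S g) (ts (t1 h q) (\<lambda>h q. o1 (S h) (DL q z)))))"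
  by (simp add: S_DL_cancel z)
 also have "\<dots> = ts (t4 w p) (\<lambda>g h. ts (t1 h q) (\<lambda>h q. o1 (S u) (o2 (S g) (o1 (S h) (DL q z)))))"
  by (subst ts_pushAA[where f="\<lambda>t. o1 (S u) (o2 (S _) t)" and Z'=AA]) (intro lins | simp)+
 also have "\<dots> = ts (t4 w p) (\<lambda>g h. ts (t1 h q) (\<lambda>h q. S2 (g \<odot> (h * u)) (DL q z)))"
 proof (intro tsum_cong vspace_A)
  fix g h q
  show "o1 (S u) (o2 (S g) (o1 (S h) (DL q z))) = S2 (g \<odot> (h * u)) (DL q z)"
   by (rule AA_eq[where t="DL q z" and Z=AA], (intro lins)+) (simp_all add: o_pure S2_pure S_mult)
 qed
 also have "\<dots> = ts (t1 p q) (\<lambda>p q. ts (t4 w p) (\<lambda>g h. S2 (g \<odot> (h * u)) (DL q z)))"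
  by (rule coassoc_t1_t4[OF vAA, symmetric]) (intro lins)
 also have "\<dots> = ts (t1 p q) (\<lambda>p q. S2 (DL p (w \<odot> u)) (DL q z))"
 proof (intro tsum_cong vspace_A)
  fix p q
  show "ts (t4 w p) (\<lambda>g h. S2 (g \<odot> (h * u)) (DL q z)) = S2 (DL p (w \<odot> u)) (DL q z)"
   unfolding DL_pure4 r2_def by (rule ts_pushAA[where f="\<lambda>t. S2 t (DL q z)" and Z'=AA, symmetric]) (intro lins | simp)+
 qed
 finally show ?thesis .
qed

lemma L_DL: assumes z: "z \<in> carr AA" shows "ts (t1 p q) (\<lambda>p q. o1 (L p) (DL q z)) = DL (p * q) z"
proof -
 have "ts (t1 p q) (\<lambda>p q. o1 (L p) (DL q z)) = ts (DL q z) (\<lambda>x y. ts (t1 p y) (\<lambda>p y. ts (t1 p x) (\<lambda>p x. (L p \<rhd> x) \<odot> y)))"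
  unfolding o1_def by (rule coassoc_DL[OF vAA _ z]) (intro lins)
 also have "\<dots> = ts (DL q z) (\<lambda>x y. r1 (t1 p y) x)" by (simp add: L_t1 r1_def flip: ts_tpL)
 finally show ?thesis by (simp add: DL_DL z flip: DL_def)
qed

text \<open>Anticomultiplicativity. As in a Hopf algebra, \<open>S(d)\<close> is written as \<open>S(d\<^sub>1) d\<^sub>2 S(d\<^sub>3)\<close>; then \<open>\<Delta>(S(d) a)\<close> acquires
the factor \<open>S(d\<^sub>2) \<otimes> S(d\<^sub>1)\<close> by \<open>S2_Rr_DL\<close>, and \<open>d\<^sub>3 S(d\<^sub>4)\<close> leads back to \<open>\<Delta>(a)\<close> via \<open>L\<close>.\<close>
lemma S2_DL: assumes z: "z \<in> carr AA"
 shows "S2 (w \<odot> u) (DL (S d \<rhd> a) z) = S2 (DL d (w \<odot> u)) (DL a z)"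
proof (rule idemE[where f="\<lambda>a. S2 (w \<odot> u) (DL (S d \<rhd> a) z)" and g="\<lambda>a. S2 (DL d (w \<odot> u)) (DL a z)" and Z=AA], (intro lins)+)
 fix b c :: 'a
 let ?a = "b * c"
 have "S2 (w \<odot> u) (DL (S d \<rhd> ?a) z) = ts (R1 (d \<odot> ?a)) (\<lambda>p q. S2 (w \<odot> u) (o2 (Rr p) (DL q z)))"
  unfolding Rr_R1[symmetric] by (subst ts_pushA[where f="\<lambda>a. S2 (w \<odot> u) (DL a z)" and Z'=AA]) (intro lins | simp add: DL_Rr z)+
 also have "\<dots> = ts (R1 (d \<odot> ?a)) (\<lambda>p q. ts (t1 p q) (\<lambda>p q. S2 (DL p (w \<odot> u)) (DL q z)))"
  by (simp add: S2_Rr_DL z)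
 also have "\<dots> = ts (T1 H (R1 (d \<odot> ?a))) (\<lambda>p q. S2 (DL p (w \<odot> u)) (DL q z))"
  by (rule ts_F[OF vAA lin_F(3)]) (intro lins | simp)+
 also have "\<dots> = ts (t1 b c) (\<lambda>r y. S2 (DL (Rb r \<rhd> d) (w \<odot> u)) (DL y z))"
  by (simp add: T1R1 E1_Rb) (subst ts_tsAA, (intro lins | simp add: ts_pureAA lins)+)
 also have "\<dots> = ts (t1 b c) (\<lambda>r y. S2 (DL d (w \<odot> u)) (o1 (L r) (DL y z)))"
 proof (intro tsum_cong vspace_A)
  fix r y
  have "S2 (o2 (Rb r) t) Z = S2 t (o1 (L r) Z)" if t: "t \<in> carr AA" and Z: "Z \<in> carr AA" for t Z
  proof (rule AA_eq[OF _ _ t, where Z=AA], (intro lins)+)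
   fix p q show "S2 (o2 (Rb r) (p \<odot> q)) Z = S2 (p \<odot> q) (o1 (L r) Z)"
    by (rule AA_eq[OF _ _ Z, where Z=AA], (intro lins)+) (simp add: o_pure S2_pure S_Rb)
  qed
  then show "S2 (DL (Rb r \<rhd> d) (w \<odot> u)) (DL y z) = S2 (DL d (w \<odot> u)) (o1 (L r) (DL y z))"
   by (simp add: rDL)
 qed
 also have "\<dots> = S2 (DL d (w \<odot> u)) (DL ?a z)"
  unfolding L_DL[OF z, symmetric] by (rule ts_pushAA[where f="\<lambda>t. S2 (DL d (w \<odot> u)) t" and Z'=AA, symmetric]) (intro lins | simp)+
 finally show "S2 (w \<odot> u) (DL (S d \<rhd> ?a) z) = S2 (DL d (w \<odot> u)) (DL ?a z)" .
qed

end

section \<open>Finite frames\<close>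

text \<open>A finite family with coordinate functionals that reproduces every vector. Besides \<open>V\<close> itself, this serves the dual
space, with the roles of vectors and functionals exchanged.\<close>
locale frame =
 fixes X :: "('k::field, 'v::ab_group_add) space" and I :: "'i set" and g :: "'i \<Rightarrow> 'v" and f :: "'i \<Rightarrow> 'v \<Rightarrow> 'k"
 assumes vX[simp, lins]: "vspace X" and fin: "finite I" and gc[simp, lins]: "\<And>i. g i \<in> carr X"
  and fl: "\<And>i. lin X scalars (f i)" and exp: "\<And>v. v \<in> carr X ==> v = (\<Sum>i\<in>I. scal X (f i v) (g i))"
begin
lemma lin_f[lins]: "lin W X h ==> lin W scalars (\<lambda>w. f i (h w))" by (rule lin_comp[OF fl])
lemma exp_lin: fixes Z :: "('k,'z::ab_group_add) space" assumes "lin X Z F" "v \<in> carr X" shows "F v = (\<Sum>i\<in>I. scal Z (f i v) (F (g i)))"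
proof -
 have "F v = F (\<Sum>i\<in>I. scal X (f i v) (g i))" using exp[OF assms(2)] by simp
 also have "\<dots> = (\<Sum>i\<in>I. scal Z (f i v) (F (g i)))"
  by (subst lin_sum[OF vX assms(1)]) (auto simp: vspace_scal lin_scal[OF assms(1)])
 finally show ?thesis .
qed
lemma eqX: assumes "v \<in> carr X" "w \<in> carr X" "\<And>i. i \<in> I ==> f i v = f i w" shows "v = w"
 using exp[OF assms(1)] exp[OF assms(2)] assms(3) by simp
lemma sumX: "(\<Sum>i\<in>I. scal X (c i) (g i)) \<in> carr X" by (intro vspace_sum vX vspace_scal gc)
end

lemma fd_frame:
 assumes X: "vspace X" and fd: "finite_dim X"
 shows "\<exists>(I::'v::ab_group_add set) g f. frame (X :: ('k::field,'v) space) I g f"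
proof -
 interpret vector_space "scal X" by (rule vspace_vs[OF X])
 obtain B0 where B0: "finite B0" "B0 \<subseteq> carr X" "span B0 = carr X" using fd by (auto simp: finite_dim_def)
 obtain B where B: "B \<subseteq> B0" "independent B" "B0 \<subseteq> span B" using maximal_independent_subset by blast
 have sB: "span B = carr X" using span_mono[OF B(1)] span_minimal[OF B(3)] B0(3) by auto
 define g where "g e = (if e \<in> B then e else 0)" for e
 define f where "f e v = representation B v e" for e v
 have "frame X B g f"
 proof
  show "vspace X" by (rule X)
  show fB: "finite B" using B(1) B0(1) finite_subset by blast
  show "g i \<in> carr X" for i using B B0 vspace_0[OF X] by (auto simp: g_def)
  show "lin X scalars (f i)" for i
   by (auto simp: lin_def f_def representation_add[OF B(2)] representation_scale[OF B(2)] sB)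
  show "v = (\<Sum>i\<in>B. scal X (f i v) (g i))" if "v \<in> carr X" for v
  proof -
   have "v = (\<Sum>i\<in>B. scal X (representation B v i) i)"
    using sum_representation_eq[OF B(2) _ fB order_refl, of v] that sB by simp
   also have "\<dots> = (\<Sum>i\<in>B. scal X (f i v) (g i))" by (rule sum.cong) (simp_all add: f_def g_def)
   finally show ?thesis .
  qed
 qed
 then show ?thesis by blast
qed

context wmbf begin

section \<open>Comodules as matrices of multipliers\<close>

text \<open>Left and right multiplication of \<open>A \<otimes> A\<close> by the multiplier \<open>\<Sum>i. m i \<otimes> n i\<close>.\<close>
definition "XX K m n t = (\<Sum>i\<in>K. ts t (\<lambda>x y. (m i \<rhd> x) \<odot> (n i \<rhd> y)))"
definition "XXr K m n t = (\<Sum>i\<in>K. ts t (\<lambda>x y. (x \<lhd> m i) \<odot> (y \<lhd> n i)))"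
lemma XX_c[simp]: "XX K m n t \<in> carr AA" "XXr K m n t \<in> carr AA" unfolding XX_def XXr_def by (intro vspace_sum vspace_tprod ts_carrAA pc)+
lemma lin_XX[lins]: "lin W AA h ==> (\<And>i. i \<in> K ==> m i \<in> MM) ==> (\<And>i. i \<in> K ==> n i \<in> MM) ==> lin W AA (\<lambda>w. XX K m n (h w))"
 "lin W AA h ==> (\<And>i. i \<in> K ==> m i \<in> MM) ==> (\<And>i. i \<in> K ==> n i \<in> MM) ==> lin W AA (\<lambda>w. XXr K m n (h w))"
 unfolding XX_def XXr_def by (intro lins; assumption?; blast)+
lemma XX_pure: assumes "\<And>i. i \<in> K ==> m i \<in> MM" "\<And>i. i \<in> K ==> n i \<in> MM"
 shows "XX K m n (x \<odot> y) = (\<Sum>i\<in>K. (m i \<rhd> x) \<odot> (n i \<rhd> y))" "XXr K m n (x \<odot> y) = (\<Sum>i\<in>K. (x \<lhd> m i) \<odot> (y \<lhd> n i))"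
 unfolding XX_def XXr_def by (rule sum.cong[OF refl], rule ts_pureAA, intro lins; simp add: assms)+

lemma vR[simp, lins]: "vspace R"
 using subspace_range[of Rb] by (simp add: vspace_def base_def vs_M lins)
lemma scal_R: "scal R = scal M" by (simp add: base_def)
lemma lin_toR: "(\<And>w. w \<in> carr W ==> F w \<in> carr R) ==> lin W M F ==> lin W R F"
 by (simp add: lin_def scal_R)
lemma lin_ofR: "lin W R F ==> lin W M F" by (auto simp: lin_def scal_R R_MM)
lemma lin_R_RbRr[lins]: "lin W A h ==> lin W R (\<lambda>w. Rb (h w))" "lin W A h ==> lin W R (\<lambda>w. Rr (h w))"
 by (rule lin_toR, simp, intro lins, assumption)+
lemma lin_Ract[lins]: "lin W R h ==> lin W A (\<lambda>w. h w \<rhd> x)" "lin W R h ==> lin W A (\<lambda>w. x \<lhd> h w)"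
 using lin_Mact[OF lin_ofR] by blast+

text \<open>Every element of the base algebra is an \<open>Rr y\<close>, so a tensor over \<open>R \<otimes> A\<close> can be lifted to one over \<open>A \<otimes> A\<close>.\<close>
lemma RA_rep: assumes "t \<in> carr (R \<otimes> alg H)" shows "\<exists>t'\<in>carr AA. t = ts t' (\<lambda>y z. pure R A (Rr y) z)"
proof -
 let ?P = "\<lambda>t'. ts t' (\<lambda>y z. pure R A (Rr y) z)"
 have lP: "lin AA (R \<otimes> A) ?P" by (intro lins | simp)+
 obtain l where l: "set l \<subseteq> carr R \<times> carr A" "t = (\<Sum>(x,y)\<leftarrow>l. pure R A x y)" using tens_rep[OF vR assms] by blast
 from l have "\<exists>t'\<in>carr AA. t = ?P t'"
 proof (induction l arbitrary: t)
  case Nil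
  have "?P 0 = 0" by (rule lin_0[OF vspace_tprod lP])
  moreover have "t = 0" using Nil.prems(2) by (simp only: list.map(1) sum_list.Nil)
  ultimately have "t = ?P 0" by simp
  then show ?case using vspace_0[OF vspace_tprod] by blast
 next
  case (Cons p l)
  obtain t' where t': "t' \<in> carr AA" "(\<Sum>(x,y)\<leftarrow>l. pure R A x y) = ?P t'" using Cons.IH[OF _ refl] Cons.prems(1) by auto
  have "fst p \<in> carr R" using Cons.prems(1) by auto
  then obtain y where y: "fst p = Rr y" by (rule R_E(2))
  have 1: "t = pure R A (fst p) (snd p) + (\<Sum>(x,y)\<leftarrow>l. pure R A x y)" using Cons.prems(2) by (simp only: list.map sum_list.Cons split_def)
  have "?P (y \<odot> snd p + t') = ?P (y \<odot> snd p) + ?P t'" by (rule lin_add[OF lP]) (simp_all add: t')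
  moreover have "?P (y \<odot> snd p) = pure R A (Rr y) (snd p)" by (rule ts_pure[where Z="R \<otimes> A"]) (intro lins R_Rr)+
  ultimately have "t = ?P (y \<odot> snd p + t')" using 1 by (simp only: y t'(2))
  moreover have "y \<odot> snd p + t' \<in> carr AA" by (rule vspace_add[OF vspace_tprod]) (simp_all add: t')
  ultimately show ?case by blast
 qed
 then show ?thesis .
qed

text \<open>The tensor \<open>t\<close> over \<open>R \<otimes> A\<close> is the element \<open>E(1 \<otimes> b)\<close>.\<close>
definition "repE b t \<longleftrightarrow> t \<in> carr (R \<otimes> alg H) \<and> (\<forall>x. e1 x b = tsum R A t (\<lambda>r z. (r \<rhd> x) \<odot> z))"
lemma repE_pq: "repE (p * q) (ts (t1 p q) (\<lambda>y z. pure R A (Rb y) z))"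
proof -
 have c: "ts (t1 p q) (\<lambda>y z. pure R A (Rb y) z) \<in> carr (R \<otimes> A)" by (rule ts_carr[OF vspace_tprod]) (simp add: pure_carr)
 have "tsum R A (ts (t1 p q) (\<lambda>y z. pure R A (Rb y) z)) (\<lambda>r z. (r \<rhd> x) \<odot> z) = ts (t1 p q) (\<lambda>y z. (Rb y \<rhd> x) \<odot> z)" for x
  by (subst tsum_tsum[where Z=AA]) (intro lins R_MM | simp add: pure_carr tsum_pure[where Z=AA] lins R_MM)+
 then show ?thesis using c by (simp add: repE_def E1_Rb)
qed
lemma lin_repE_op: "lin (R \<otimes> alg H) AA (\<lambda>t. tsum R A t (\<lambda>r z. (r \<rhd> x) \<odot> z))"
 by (intro lins R_MM | simp)+
lemma repE_add: "repE b t ==> repE c u ==> repE (b + c) (t + u)"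
 using lin_add[of A AA "\<lambda>y. _ \<odot> y" b c] by (simp add: repE_def vspace_add[OF vspace_tprod] lin_add[OF lin_repE_op] lins lin_add[OF lin_F(1)])
lemma repE_ex: "\<exists>t. repE b t"
proof -
 obtain s where s: "b = ts s (\<lambda>x y. x * y)" by (rule idem)
 let ?t = "\<lambda>p q. ts (t1 p q) (\<lambda>y z. pure R A (Rb y) z)"
 have c: "?t p q \<in> carr (R \<otimes> A)" for p q using repE_pq by (simp add: repE_def)
 have "e1 x b = ts s (\<lambda>p q. e1 x (p * q))" for x
  unfolding s by (rule ts_pushA[where f="\<lambda>y. e1 x y" and Z'=AA]) (intro lins)
 moreover have "tsum R A (ts s ?t) (\<lambda>r z. (r \<rhd> x) \<odot> z) = ts s (\<lambda>p q. tsum R A (?t p q) (\<lambda>r z. (r \<rhd> x) \<odot> z))" for x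
  by (rule ts_push[OF vspace_tprod lin_repE_op c])
 ultimately have "repE b (ts s ?t)"
  using repE_pq ts_carr[OF vspace_tprod c] by (simp add: repE_def)
 then show ?thesis by blast
qed

lemma tsum_sumpure: assumes X: "vspace X" and Z: "vspace Z" and b: "bilin X Y Z b" and c: "\<And>k. k \<in> K ==> gg k \<in> carr X" "\<And>k. k \<in> K ==> a k \<in> carr Y"
 shows "tsum X Y (\<Sum>k\<in>K. pure X Y (gg k) (a k)) b = (\<Sum>k\<in>K. b (gg k) (a k))"
 by (subst lin_sum[OF vspace_tprod lin_tsum_op[OF X Z b]]) (auto intro!: sum.cong simp: pure_carr c tsum_pure[OF X Z b])

text \<open>A matrix of multipliers whose square \<open>X\<close> satisfies \<open>X E = X\<close> and \<open>\<Delta>(m a) = X \<Delta>(a)\<close> defines a comodule. The index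
points only have to span, so the criterion applies to the dual of \<open>V\<close> with a basis as well as to a quotient such as
\<open>V \<otimes>\<^sub>R W\<close> with the images of pure tensors.\<close>
lemma comodI:
 fixes V :: "('k, 'v::ab_group_add, 'a) comod" and pt :: "'q \<Rightarrow> 'v" and gg :: "'i \<Rightarrow> 'q"
 assumes vX: "vspace (sp V)" and lam: "lin (sp V \<otimes> alg H) (sp V \<otimes> alg H) (lam V)" and rho: "lin (sp V \<otimes> alg H) (sp V \<otimes> alg H) (rho V)"
  and P: "pt ` P \<subseteq> carr (sp V)" "module.span (scal (sp V)) (pt ` P) = carr (sp V)"
  and gP: "\<And>k. k \<in> K ==> gg k \<in> P" and m: "\<And>k x. k \<in> K ==> x \<in> P ==> m k x \<in> MM"
  and L: "\<And>x a. x \<in> P ==> lam V (pure (sp V) (alg H) (pt x) a) = (\<Sum>k\<in>K. pure (sp V) (alg H) (pt (gg k)) (m k x \<rhd> a))"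
  and Rh: "\<And>x a. x \<in> P ==> rho V (pure (sp V) (alg H) (pt x) a) = (\<Sum>k\<in>K. pure (sp V) (alg H) (pt (gg k)) (a \<lhd> m k x))"
  and E: "\<And>k x t. k \<in> K ==> x \<in> P ==> t \<in> carr AA ==> XX K (\<lambda>i. m k (gg i)) (\<lambda>i. m i x) (E1 H t) = XX K (\<lambda>i. m k (gg i)) (\<lambda>i. m i x) t"
  and T: "\<And>k x a t. k \<in> K ==> x \<in> P ==> t \<in> carr AA ==> DL (m k x \<rhd> a) t = XX K (\<lambda>i. m k (gg i)) (\<lambda>i. m i x) (DL a t)"
 shows "comodule H V"
proof -
 define X where "X = sp V"
 note vX' = vX[folded X_def] and lam' = lam[folded X_def] and rho' = rho[folded X_def] and P' = P[folded X_def]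
 note [simp, lins] = vX'
 have gX[simp]: "pt (gg k) \<in> carr X" if "k \<in> K" for k using gP[OF that] P' by auto
 have PX: "pt x \<in> carr X" if "x \<in> P" for x using that P' by auto
 let ?p = "\<lambda>x a b. pure (X \<otimes> A) A (pure X A (pt x) a) b"
 have XA: "pure X A x a \<in> carr (X \<otimes> A)" if "x \<in> carr X" for x a using that by (simp add: pure_carr)
 define l12 where "l12 = leg12 X A A (lam V)"
 define l13 where "l13 = leg13 X A A (lam V)"
 have ll12: "lin ((X \<otimes> A) \<otimes> A) ((X \<otimes> A) \<otimes> A) l12" unfolding l12_def by (rule lin_leg12[OF lam'])
 have ll13: "lin ((X \<otimes> A) \<otimes> A) ((X \<otimes> A) \<otimes> A) l13" unfolding l13_def by (rule lin_leg13[OF vX' vspace_A vspace_A lam'])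
 have ll23: "lin ((X \<otimes> A) \<otimes> A) ((X \<otimes> A) \<otimes> A) (leg23 X A A A A F)" if "lin AA AA F" for F
  by (rule lin_leg23[OF vX' vspace_A vspace_A that])
 define J where "J l t = ts t (\<lambda>p q. ?p (gg l) p q)" for l t
 have lJ[lins]: "lin W ((X \<otimes> A) \<otimes> A) (\<lambda>w. J l (h w))" if "l \<in> K" "lin W AA h" for l h and W :: "('k,'w::ab_group_add) space"
  unfolding J_def using that by (intro lins that(2)) (simp_all add: XA)
 have Jp: "J l (p \<odot> q) = ?p (gg l) p q" if "l \<in> K" for l p q
  unfolding J_def by (rule ts_pure[where Z="(X \<otimes> A) \<otimes> A"]) (intro lins XA gX that)+
 let ?X = "\<lambda>l x t. XX K (\<lambda>i. m l (gg i)) (\<lambda>i. m i x) t"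
 have lX: "lin W AA (\<lambda>w. ?X l x (h w))" if "l \<in> K" "x \<in> P" "lin W AA h" for l x h and W :: "('k,'w::ab_group_add) space"
  using that by (intro lins) (auto intro: m gP)
 have lJX: "lin AA ((X \<otimes> A) \<otimes> A) (\<lambda>t. \<Sum>l\<in>K. J l (?X l x t))" if "x \<in> P" for x
  by (intro lin_sumI lJ lX lin_id vspace_tprod; (assumption | rule that))
 have C: "l12 (l13 (?p x p q)) = (\<Sum>l\<in>K. J l (?X l x (p \<odot> q)))" if x: "x \<in> P" for x p q
 proof -
  have b: "bilin X A ((X \<otimes> A) \<otimes> A) (\<lambda>x z. pure (X \<otimes> A) A (pure X A x p) z)" by (intro lins pure_carr; simp)
  have "l13 (?p x p q) = (\<Sum>k\<in>K. ?p (gg k) p (m k x \<rhd> q))"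
   unfolding l13_def using x by (simp add: leg13_pure[OF vX' vspace_A vspace_A lam'] PX L[folded X_def] tsum_sumpure[OF vX' vspace_tprod b])
  then have "l12 (l13 (?p x p q)) = (\<Sum>k\<in>K. l12 (?p (gg k) p (m k x \<rhd> q)))"
   by (simp add: lin_sum[OF vspace_tprod ll12] pure_carr)
  also have "\<dots> = (\<Sum>k\<in>K. \<Sum>l\<in>K. ?p (gg l) (m l (gg k) \<rhd> p) (m k x \<rhd> q))"
  proof (rule sum.cong[OF refl])
   fix k assume k: "k \<in> K"
   have "l12 (?p (gg k) p (m k x \<rhd> q)) = pure (X \<otimes> A) A (\<Sum>l\<in>K. pure X A (pt (gg l)) (m l (gg k) \<rhd> p)) (m k x \<rhd> q)"
    unfolding l12_def using k by (simp add: leg12_pure[OF lam' pure_carr] L[folded X_def] gP)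
   also have "\<dots> = (\<Sum>l\<in>K. ?p (gg l) (m l (gg k) \<rhd> p) (m k x \<rhd> q))"
    by (rule lin_sum[where X="X \<otimes> A" and Y="(X \<otimes> A) \<otimes> A" and f="\<lambda>t. pure (X \<otimes> A) A t (m k x \<rhd> q)"]) (intro lins | simp add: pure_carr)+
   finally show "l12 (?p (gg k) p (m k x \<rhd> q)) = (\<Sum>l\<in>K. ?p (gg l) (m l (gg k) \<rhd> p) (m k x \<rhd> q))" .
  qed
  also have "\<dots> = (\<Sum>l\<in>K. \<Sum>k\<in>K. ?p (gg l) (m l (gg k) \<rhd> p) (m k x \<rhd> q))" by (rule sum.swap)
  also have "\<dots> = (\<Sum>l\<in>K. J l (?X l x (p \<odot> q)))"
  proof (rule sum.cong[OF refl])
   fix l assume l: "l \<in> K"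
   have "J l (?X l x (p \<odot> q)) = J l (\<Sum>k\<in>K. (m l (gg k) \<rhd> p) \<odot> (m k x \<rhd> q))"
    by (subst XX_pure) (auto intro: m gP l x)
   also have "\<dots> = (\<Sum>k\<in>K. J l ((m l (gg k) \<rhd> p) \<odot> (m k x \<rhd> q)))"
    by (rule lin_sum[OF vspace_tprod lJ[OF l lin_id]]) simp
   finally show "(\<Sum>k\<in>K. ?p (gg l) (m l (gg k) \<rhd> p) (m k x \<rhd> q)) = J l (?X l x (p \<odot> q))" by (simp add: Jp l)
  qed
  finally show ?thesis .
 qed
 have C23: "l12 (l13 (leg23 X A A A A F (?p x a b))) = (\<Sum>l\<in>K. J l (?X l x (F (a \<odot> b))))" if x: "x \<in> P" and F: "lin AA AA F" for x F a b
 proof -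
  have "l12 (l13 (leg23 X A A A A F (?p x a b))) = l12 (l13 (ts (F (a \<odot> b)) (\<lambda>p q. ?p x p q)))"
   using x by (simp add: leg23_pure[OF vX' vspace_A vspace_A F] PX)
  also have "\<dots> = ts (F (a \<odot> b)) (\<lambda>p q. l12 (l13 (?p x p q)))"
   by (rule ts_push[OF vspace_tprod lin_comp[OF ll12 ll13]]) (simp add: pure_carr PX x)
  also have "\<dots> = ts (F (a \<odot> b)) (\<lambda>p q. (\<Sum>l\<in>K. J l (?X l x (p \<odot> q))))" by (simp add: C x)
  also have "\<dots> = (\<Sum>l\<in>K. J l (?X l x (F (a \<odot> b))))"
   by (rule ts_lin[symmetric, OF lJX[OF x]]) (rule lin_carr[OF F pc])
  finally show ?thesis .
 qed
 have ext: "h1 t = h2 t" if "lin ((X \<otimes> A) \<otimes> A) ((X \<otimes> A) \<otimes> A) h1" "lin ((X \<otimes> A) \<otimes> A) ((X \<otimes> A) \<otimes> A) h2"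
  "\<And>x a b. x \<in> P ==> h1 (?p x a b) = h2 (?p x a b)" "t \<in> carr ((X \<otimes> A) \<otimes> A)" for h1 h2 t
 proof (rule lin_tens3_eq[OF vX' that(1,2,4)])
  fix x a b assume x: "x \<in> carr X"
  show "h1 (pure (X \<otimes> A) A (pure X A x a) b) = h2 (pure (X \<otimes> A) A (pure X A x a) b)"
   by (rule lin_span_eq[OF vX' lin_comp[OF that(1)] lin_comp[OF that(2)] P'(1), where x=x])
    (intro lins XA | auto simp: that(3) P'(2) x)+
 qed
 have 1: "tmap X A X A id (\<lambda>y. a * y) (lam V (pure X A v b)) = tmap X A X A id (\<lambda>y. y * b) (rho V (pure X A v a))" if v: "v \<in> carr X" for v a b
 proof -
  have lt: "lin (X \<otimes> A) (X \<otimes> A) (tmap X A X A id h)" if "lin A A h" for h by (rule lin_tmap[OF lin_idc that])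
  have ma: "lin A A (\<lambda>y. a * y)" "lin A A (\<lambda>y. y * b)" by (intro lins)+
  show ?thesis
  proof (rule lin_span_eq[OF vX' lin_comp[OF lt[OF ma(1)] lin_comp[OF lam']] lin_comp[OF lt[OF ma(2)] lin_comp[OF rho']] P'(1), where x=v])
   fix y assume "y \<in> pt ` P"
   then obtain x where x: "x \<in> P" and y: "y = pt x" by blast
   have "tmap X A X A id (\<lambda>y. a * y) (lam V (pure X A (pt x) b)) = (\<Sum>k\<in>K. pure X A (pt (gg k)) (a * (m k x \<rhd> b)))"
    unfolding L[OF x, folded X_def] by (subst lin_sum[OF vspace_tprod lt[OF ma(1)]]) (auto intro!: sum.cong simp: pure_carr tmap_pure[OF lin_idc ma(1)])
   also have "\<dots> = tmap X A X A id (\<lambda>y. y * b) (rho V (pure X A (pt x) a))"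
    unfolding Rh[OF x, folded X_def] by (subst lin_sum[OF vspace_tprod lt[OF ma(2)]]) (auto intro!: sum.cong simp: pure_carr tmap_pure[OF lin_idc ma(2)] MM_bal m x)
   finally show "tmap X A X A id (\<lambda>y. a * y) (lam V (pure X A y b)) = tmap X A X A id (\<lambda>y. y * b) (rho V (pure X A y a))" by (simp add: y)
  qed (intro lins XA | simp add: P'(2) v)+
 qed
 have 2: "l12 (l13 (leg23 X A A A A (E1 H) t)) = l12 (l13 t)" if t: "t \<in> carr ((X \<otimes> A) \<otimes> A)" for t
 proof (rule ext[OF lin_comp[OF ll12 lin_comp[OF ll13 ll23[OF lin_F(1)]]] lin_comp[OF ll12 ll13] _ t])
  fix x a b assume x: "x \<in> P"
  show "l12 (l13 (leg23 X A A A A (E1 H) (?p x a b))) = l12 (l13 (?p x a b))"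
   by (simp add: C23[OF x lin_F(1)] C[OF x] E x)
 qed
 have 3: "l12 (l13 (leg23 X A A A A (T1 H) t)) = leg23 X A A A A (T1 H) (l12 t)" if t: "t \<in> carr ((X \<otimes> A) \<otimes> A)" for t
 proof (rule ext[OF lin_comp[OF ll12 lin_comp[OF ll13 ll23[OF lin_F(3)]]] lin_comp[OF ll23[OF lin_F(3)] ll12] _ t])
  fix x a b assume x: "x \<in> P"
  have XT: "?X l x (t1 a b) = t1 (m l x \<rhd> a) b" if l: "l \<in> K" for l
  proof (rule nondegAA(3))
   fix d
   have "?X l x (r1 t d) = r1 (?X l x t) d" if t: "t \<in> carr AA" for t
    by (rule AA_eq[OF _ _ t, where Z=AA], (intro lX l x lins)+, simp, subst (1 2) XX_pure, (auto intro!: m gP l x)[4],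
      subst lin_sum[OF vspace_tprod lin_lr(3)[OF lin_id]], auto intro!: sum.cong simp: MM_l m gP l x)
   then show "r1 (?X l x (t1 a b)) d = r1 (t1 (m l x \<rhd> a) b) d"
    using T[OF l x, of "d \<odot> b" a] by (simp add: DL_pure)
  qed simp_all
  have "leg23 X A A A A (T1 H) (l12 (?p x a b)) = leg23 X A A A A (T1 H) (\<Sum>l\<in>K. ?p (gg l) (m l x \<rhd> a) b)"
  proof -
   have "l12 (?p x a b) = pure (X \<otimes> A) A (\<Sum>l\<in>K. pure X A (pt (gg l)) (m l x \<rhd> a)) b"
    unfolding l12_def using x by (simp add: leg12_pure[OF lam' pure_carr] L[folded X_def] PX)
   also have "\<dots> = (\<Sum>l\<in>K. ?p (gg l) (m l x \<rhd> a) b)"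
    by (rule lin_sum[where X="X \<otimes> A" and Y="(X \<otimes> A) \<otimes> A" and f="\<lambda>t. pure (X \<otimes> A) A t b"]) (intro lins | simp add: pure_carr)+
   finally show ?thesis by simp
  qed
  also have "\<dots> = (\<Sum>l\<in>K. J l (t1 (m l x \<rhd> a) b))"
   by (subst lin_sum[OF vspace_tprod ll23[OF lin_F(3)]]) (auto intro!: sum.cong simp: pure_carr J_def leg23_pure[OF vX' vspace_A vspace_A lin_F(3)])
  finally show "l12 (l13 (leg23 X A A A A (T1 H) (?p x a b))) = leg23 X A A A A (T1 H) (l12 (?p x a b))"
   by (simp add: C23[OF x lin_F(3)] XT)
 qed
 show ?thesis unfolding comodule_def Let_def using 1 2 3 vX lam rho by (simp add: X_def l12_def l13_def)
qed

end

section \<open>Finite dimensional full comodules\<close>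

locale fdc = wmbf H + frame "sp V" I g f for H :: "('k::field, 'a::ring) wmb" and V :: "('k, 'v::ab_group_add, 'a) comod"
  and I :: "'i set" and g :: "'i \<Rightarrow> 'v" and f :: "'i \<Rightarrow> 'v \<Rightarrow> 'k" +
 assumes fullV: "full_comodule H V"
begin
abbreviation X where "X \<equiv> sp V"
lemma comV: "comodule H V" using fullV by (simp add: full_comodule_def)
lemma lin_lam: "lin (X \<otimes> alg H) (X \<otimes> alg H) (lam V)" and lin_rho: "lin (X \<otimes> alg H) (X \<otimes> alg H) (rho V)"
 using comV by (simp_all add: comodule_def Let_def)
lemma lin_lr2[lins]: "lin W (X \<otimes> alg H) h ==> lin W (X \<otimes> alg H) (\<lambda>w. lam V (h w))" "lin W (X \<otimes> alg H) h ==> lin W (X \<otimes> alg H) (\<lambda>w. rho V (h w))"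
 by (rule lin_comp[OF lin_lam], assumption) (rule lin_comp[OF lin_rho], assumption)
lemma XAc[simp]: "x \<in> carr X ==> pure X A x a \<in> carr (X \<otimes> alg H)" by (simp add: pure_carr)
lemma lr_carr[simp]: "t \<in> carr (X \<otimes> alg H) ==> lam V t \<in> carr (X \<otimes> alg H)" "t \<in> carr (X \<otimes> alg H) ==> rho V t \<in> carr (X \<otimes> alg H)"
 using lin_carr[OF lin_lam] lin_carr[OF lin_rho] by blast+

definition "sl \<phi> t = tsum X A t (\<lambda>v a. asc H (\<phi> v) a)"
lemma lin_slI[lins]: assumes "lin X scalars \<phi>" "lin W (X \<otimes> alg H) h" shows "lin W A (\<lambda>w. sl \<phi> (h w))"
 unfolding sl_def by (intro lins assms vX)
lemma sl_pure2: assumes "lin X scalars \<phi>" "v \<in> carr X" shows "sl \<phi> (pure X A v a) = asc H (\<phi> v) a"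
 unfolding sl_def by (rule tsum_pure[OF vX vspace_A]) (intro lins assms carr_A)+
lemma XA_exp: assumes t: "t \<in> carr (X \<otimes> alg H)" shows "t = (\<Sum>i\<in>I. pure X A (g i) (sl (f i) t))"
proof (rule lin_tens_eq[OF vX _ _ t, where Z="X \<otimes> alg H"])
 show "lin (X \<otimes> alg H) (X \<otimes> alg H) (\<lambda>t. t)" by (intro lins)
 show "lin (X \<otimes> alg H) (X \<otimes> alg H) (\<lambda>t. \<Sum>i\<in>I. pure X A (g i) (sl (f i) t))" by (intro lins fl gc)
 fix v and a :: 'a assume v: "v \<in> carr X"
 have "pure X A v a = (\<Sum>i\<in>I. scal (X \<otimes> alg H) (f i v) (pure X A (g i) a))"
  by (rule exp_lin[of "X \<otimes> alg H" "\<lambda>v. pure X A v a", OF _ v]) (intro lins)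
 also have "\<dots> = (\<Sum>i\<in>I. pure X A (g i) (asc H (f i v) a))"
  using lin_scal[of A "X \<otimes> alg H" "\<lambda>a. pure X A (g _) a"] by (simp add: lins)
 also have "\<dots> = (\<Sum>i\<in>I. pure X A (g i) (sl (f i) (pure X A v a)))" by (simp only: sl_pure2[OF fl v])
 finally show "pure X A v a = (\<Sum>i\<in>I. pure X A (g i) (sl (f i) (pure X A v a)))" .
qed

text \<open>The coefficient multiplier of a functional and a vector.\<close>
definition "mc \<phi> v = ((\<lambda>a. sl \<phi> (lam V (pure X A v a))), (\<lambda>a. sl \<phi> (rho V (pure X A v a))))"
lemma mc_s: "mc \<phi> v \<rhd> a = sl \<phi> (lam V (pure X A v a))" "a \<lhd> mc \<phi> v = sl \<phi> (rho V (pure X A v a))" by (simp_all add: mc_def)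
lemma mc_cong: assumes "\<And>v. v \<in> carr X ==> \<phi> v = \<psi> v" shows "mc \<phi> v = mc \<psi> v"
proof -
 have "sl \<phi> t = sl \<psi> t" for t unfolding sl_def by (rule tsum_cong[OF vX]) (simp add: assms)
 then show ?thesis by (simp add: mc_def)
qed
lemma lam_exp: "v \<in> carr X ==> lam V (pure X A v a) = (\<Sum>i\<in>I. pure X A (g i) (mc (f i) v \<rhd> a))"
 and rho_exp: "v \<in> carr X ==> rho V (pure X A v a) = (\<Sum>i\<in>I. pure X A (g i) (a \<lhd> mc (f i) v))"
 by (simp_all add: mc_s flip: XA_exp)
lemma mc_MM[simp, lins]: assumes p: "lin X scalars \<phi>" and v: "v \<in> carr X" shows "mc \<phi> v \<in> MM"
proof (rule MMI)
 show "lin A A (fst (mc \<phi> v))" "lin A A (snd (mc \<phi> v))" unfolding mc_def fst_conv snd_conv by (intro lins p v)+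
 fix a b
 have c: "tmap X A X A id (\<lambda>y. a * y) (lam V (pure X A v b)) = tmap X A X A id (\<lambda>y. y * b) (rho V (pure X A v a))"
  using comV v by (simp add: comodule_def Let_def)
 have s: "sl \<phi> (tmap X A X A id h t) = h (sl \<phi> t)" if h: "lin A A h" and t: "t \<in> carr (X \<otimes> alg H)" for h t
 proof -
  note lh = lin_comp[OF h]
  show ?thesis
   by (rule lin_tens_eq[OF vX _ _ t, where Z=A]) (intro lh lin_slI p lin_tmap lin_idc h lin_id | simp add: tmap_pure[OF lin_idc h] tmap_pure[OF lin_id h] sl_pure2[OF p] lin_scal[OF h, simplified])+
 qed
 show "a * (mc \<phi> v \<rhd> b) = (a \<lhd> mc \<phi> v) * b"
  using arg_cong[OF c, of "sl \<phi>"] v by (simp add: mc_s s lins)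
qed
lemma lin_mc[lins]: assumes "lin X scalars \<phi>" "lin W X h" shows "lin W M (\<lambda>w. mc \<phi> (h w))"
 by (rule lin_toM) (use lin_carr[OF assms(2)] in \<open>auto simp: mc_s assms(1) intro!: lins assms\<close>)
lemma sl_exp: assumes p: "lin X scalars \<phi>" and t: "t \<in> carr (X \<otimes> alg H)" shows "sl \<phi> t = (\<Sum>i\<in>I. asc H (\<phi> (g i)) (sl (f i) t))"
proof -
 have "sl \<phi> t = sl \<phi> (\<Sum>i\<in>I. pure X A (g i) (sl (f i) t))" using XA_exp[OF t] by simp
 also have "\<dots> = (\<Sum>i\<in>I. sl \<phi> (pure X A (g i) (sl (f i) t)))" by (rule lin_sum[OF vspace_tprod lin_slI[OF p lin_id]]) simp
 finally show ?thesis by (simp add: sl_pure2 p)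
qed
lemma mc_exp: assumes p: "lin X scalars \<phi>" and v: "v \<in> carr X"
 shows "mc \<phi> v \<rhd> a = (\<Sum>i\<in>I. asc H (\<phi> (g i)) (mc (f i) v \<rhd> a))" "a \<lhd> mc \<phi> v = (\<Sum>i\<in>I. asc H (\<phi> (g i)) (a \<lhd> mc (f i) v))"
 unfolding mc_s by (rule sl_exp[OF p]; simp add: v)+

text \<open>Multiplication by \<open>X = \<Sum>i. mc \<phi> (g i) \<otimes> mc (f i) v\<close>.\<close>
definition "XL \<phi> v t = XX I (\<lambda>i. mc \<phi> (g i)) (\<lambda>i. mc (f i) v) t"
definition "XR \<phi> v t = XXr I (\<lambda>i. mc \<phi> (g i)) (\<lambda>i. mc (f i) v) t"
lemma XL_c[simp]: "XL \<phi> v t \<in> carr AA" "XR \<phi> v t \<in> carr AA" by (simp_all add: XL_def XR_def)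
lemma lin_XL[lins]: "lin X scalars \<phi> ==> v \<in> carr X ==> lin W AA h ==> lin W AA (\<lambda>w. XL \<phi> v (h w))"
 "lin X scalars \<phi> ==> v \<in> carr X ==> lin W AA h ==> lin W AA (\<lambda>w. XR \<phi> v (h w))"
 unfolding XL_def XR_def by (intro lins fl gc; assumption)+
lemma lin_XLv: "lin X scalars \<phi> ==> lin W X h ==> lin W AA (\<lambda>w. XL \<phi> (h w) t)"
 unfolding XL_def XX_def by (intro lins fl gc; assumption)
lemma XL_pure: assumes "lin X scalars \<phi>" "v \<in> carr X"
 shows "XL \<phi> v (x \<odot> y) = (\<Sum>i\<in>I. (mc \<phi> (g i) \<rhd> x) \<odot> (mc (f i) v \<rhd> y))" "XR \<phi> v (x \<odot> y) = (\<Sum>i\<in>I. (x \<lhd> mc \<phi> (g i)) \<odot> (y \<lhd> mc (f i) v))"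
 unfolding XL_def XR_def by (rule XX_pure; simp add: assms fl)+
lemma XL_r: assumes p: "lin X scalars \<phi>" "v \<in> carr X" and t: "t \<in> carr AA" shows "XL \<phi> v (r1 t d) = r1 (XL \<phi> v t) d" "XL \<phi> v (r2 t d) = r2 (XL \<phi> v t) d"
 by (rule AA_eq[OF _ _ t, where Z=AA], (intro lins p)+, simp add: XL_pure p, subst lin_sum[OF vspace_tprod], rule lin_lr[OF lin_id], simp, simp add: MM_l p fl)+
lemma XL_adj: assumes p: "lin X scalars \<phi>" "v \<in> carr X" and t: "t \<in> carr AA" and u: "u \<in> carr AA" shows "t \<cdot> XL \<phi> v u = XR \<phi> v t \<cdot> u"
proof (rule AA_eq[OF _ _ t, where Z=AA], (intro lins p)+)
 fix a b show "a \<odot> b \<cdot> XL \<phi> v u = XR \<phi> v (a \<odot> b) \<cdot> u"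
 proof (rule AA_eq[OF _ _ u, where Z=AA], (intro lins p)+)
  fix x y
  have "a \<odot> b \<cdot> XL \<phi> v (x \<odot> y) = (\<Sum>i\<in>I. a \<odot> b \<cdot> (mc \<phi> (g i) \<rhd> x) \<odot> (mc (f i) v \<rhd> y))"
   unfolding XL_pure[OF p] by (rule lin_sum[OF vspace_tprod lin_mm(2)[OF lin_id]]) simp
  also have "\<dots> = (\<Sum>i\<in>I. (a \<lhd> mc \<phi> (g i)) \<odot> (b \<lhd> mc (f i) v) \<cdot> x \<odot> y)" by (simp add: MM_bal p fl)
  also have "\<dots> = XR \<phi> v (a \<odot> b) \<cdot> x \<odot> y"
   unfolding XL_pure[OF p] by (rule lin_sum[OF vspace_tprod lin_mm(1)[OF lin_id], symmetric]) simp
  finally show "a \<odot> b \<cdot> XL \<phi> v (x \<odot> y) = XR \<phi> v (a \<odot> b) \<cdot> x \<odot> y" .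
 qed
qed

text \<open>The two comodule axioms, evaluated with \<open>\<phi>\<close> on the leg in \<open>V\<close>.\<close>
lemma comod_ev:
 assumes p: "lin X scalars \<phi>" and v: "v \<in> carr X"
 shows XL_E1_pure: "XL \<phi> v (e1 a b) = XL \<phi> v (a \<odot> b)" and XL_T1: "XL \<phi> v (t1 a b) = t1 (mc \<phi> v \<rhd> a) b"
proof -
 let ?s = "pure (X \<otimes> alg H) A (pure X A v a) b"
 have sc: "?s \<in> carr ((X \<otimes> alg H) \<otimes> alg H)" by (simp add: pure_carr v)
 let ?g0 = "\<lambda>w x y. asc H (\<phi> w) x \<odot> y"
 let ?g1 = "\<lambda>w x y. (mc \<phi> w \<rhd> x) \<odot> y"
 have g0: "tril X A A AA ?g0" by (intro lins p)
 have g1: "tril X A A AA ?g1" by (intro lins p)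
 have g2: "tril X A A AA (\<lambda>w x y. XL \<phi> w (x \<odot> y))"
  by (intro trilI lin_XLv[OF p] lin_XL p lins)
 note l12 = lin_leg12[OF lin_lam, where Z="alg H"] and l13 = lin_leg13[OF vX vspace_A vspace_A lin_lam]
 have l23: "lin ((X \<otimes> alg H) \<otimes> alg H) ((X \<otimes> alg H) \<otimes> alg H) (leg23 X A A A A F)" if "lin AA AA F" for F
  by (rule lin_leg23[OF vX vspace_A vspace_A that])
 have e01: "(\<lambda>x y u. tsum X A (lam V (pure X A x y)) (\<lambda>p q. ?g0 p q u)) = (\<lambda>x y u. ?g1 x y u)"
 proof (rule ext, rule ext, rule ext)
  fix x y u
  show "tsum X A (lam V (pure X A x y)) (\<lambda>p q. ?g0 p q u) = ?g1 x y u"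
   unfolding mc_s sl_def by (rule tsum_push[OF vX vspace_A, of AA "\<lambda>t. t \<odot> u", symmetric]) (intro lins carr_A)+
 qed
 have s12: "tsum3 X A A (leg12 X A A (lam V) t) ?g0 = tsum3 X A A t ?g1" if "t \<in> carr ((X \<otimes> alg H) \<otimes> alg H)" for t
  using tsum3_leg12[OF vX vspace_tprod lin_lam g0 that] by (simp add: e01)
 have s1213: "tsum3 X A A (leg12 X A A (lam V) (leg13 X A A (lam V) t)) ?g0 = tsum3 X A A t (\<lambda>w x y. XL \<phi> w (x \<odot> y))" if t: "t \<in> carr ((X \<otimes> alg H) \<otimes> alg H)" for t
 proof -
  have "tsum3 X A A (leg12 X A A (lam V) (leg13 X A A (lam V) t)) ?g0 = tsum3 X A A t (\<lambda>w x y. tsum X A (lam V (pure X A w y)) (\<lambda>p q. ?g1 p x q))"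
   by (simp add: s12 lin_carr[OF l13] t tsum3_leg13[OF vX vspace_A vspace_tprod vspace_A lin_lam g1])
  also have "\<dots> = tsum3 X A A t (\<lambda>w x y. XL \<phi> w (x \<odot> y))"
   unfolding tsum3_def
  proof (intro tsum_cong vspace_tprod vX)
   fix u z w x assume w: "w \<in> carr X"
   have b: "bilin X A AA (\<lambda>p q. ?g1 p x q)" by (intro lins p carr_A)
   show "tsum X A (lam V (pure X A w z)) (\<lambda>p q. ?g1 p x q) = XL \<phi> w (x \<odot> z)"
    unfolding lam_exp[OF w] by (subst tsum_sumpure[OF vX vspace_tprod b]) (simp_all add: XL_pure p w)
  qed
  finally show ?thesis .
 qed
 have c1: "leg12 X A A (lam V) (leg13 X A A (lam V) (leg23 X A A A A (E1 H) ?s)) = leg12 X A A (lam V) (leg13 X A A (lam V) ?s)"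
  and c2: "leg12 X A A (lam V) (leg13 X A A (lam V) (leg23 X A A A A (T1 H) ?s)) = leg23 X A A A A (T1 H) (leg12 X A A (lam V) ?s)"
  using comV sc by (simp_all add: comodule_def Let_def)
 have s23: "tsum3 X A A (leg23 X A A A A F ?s) (\<lambda>w x y. XL \<phi> w (x \<odot> y)) = XL \<phi> v (F (a \<odot> b))" if F: "lin AA AA F" for F
 proof -
  have t: "tril X A A AA (\<lambda>x y u. ts (F (y \<odot> u)) (\<lambda>p q. XL \<phi> x (p \<odot> q)))"
   by (intro lins lin_comp[OF F] trilD[OF g2] carr_A vX; assumption)
  have "tsum3 X A A (leg23 X A A A A F ?s) (\<lambda>w x y. XL \<phi> w (x \<odot> y)) = ts (F (a \<odot> b)) (\<lambda>p q. XL \<phi> v (p \<odot> q))"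
   by (simp add: tsum3_leg23[OF vX vspace_A vspace_tprod vspace_A F g2 sc] tsum3_pure2[OF vX vspace_tprod t] v)
  also have "\<dots> = XL \<phi> v (F (a \<odot> b))" by (rule ts_lin[where Z=AA and f="\<lambda>t. XL \<phi> v t", symmetric]) (intro lins p v lin_carr[OF F pc])+
  finally show ?thesis .
 qed
 show "XL \<phi> v (e1 a b) = XL \<phi> v (a \<odot> b)"
  using arg_cong[OF c1, of "\<lambda>t. tsum3 X A A t ?g0"]
  by (simp add: s1213 sc lin_carr[OF l23] lin_F s23 tsum3_pure2[OF vX vspace_tprod g2] v)
 have g3: "tril X A A AA (\<lambda>x y u. ts (t1 y u) (\<lambda>p q. ?g0 x p q))" by (intro lins p)
 have t3: "tril X A A AA (\<lambda>x y u. tsum X A (lam V (pure X A x y)) (\<lambda>x y. ts (t1 y u) (\<lambda>p q. ?g0 x p q)))" by (intro lins p carr_A)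
 have "tsum3 X A A (leg23 X A A A A (T1 H) (leg12 X A A (lam V) ?s)) ?g0 = tsum X A (lam V (pure X A v a)) (\<lambda>w c. ts (t1 c b) (\<lambda>p q. asc H (\<phi> w) p \<odot> q))"
  by (simp add: tsum3_leg23[OF vX vspace_A vspace_tprod vspace_A lin_F(3) g0] lin_carr[OF l12] sc
    tsum3_leg12[OF vX vspace_tprod lin_lam g3] tsum3_pure2[OF vX vspace_tprod t3] v)
 also have "\<dots> = tsum X A (lam V (pure X A v a)) (\<lambda>w c. t1 (asc H (\<phi> w) c) b)"
 proof (intro tsum_cong vX)
  fix w c
  have "t1 (asc H k c) b = ts (t1 c b) (\<lambda>p q. asc H k p \<odot> q)" for k
  proof -
   have "t1 (asc H k c) b = scal AA k (t1 c b)" by (rule lin_scal[of A AA "\<lambda>p. t1 p b", simplified]) (intro lins)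
   also have "\<dots> = scal AA k (ts (t1 c b) (\<lambda>g h. g \<odot> h))" by (simp add: ts_self)
   also have "\<dots> = ts (t1 c b) (\<lambda>g h. scal AA k (g \<odot> h))" by (rule ts_pushAA[where Z'=AA]) (intro lins | simp)+
   also have "\<dots> = ts (t1 c b) (\<lambda>g h. asc H k g \<odot> h)"
    using lin_scal[of A AA "\<lambda>y. y \<odot> _" _ k] by (simp add: lins)
   finally show ?thesis .
  qed
  then show "ts (t1 c b) (\<lambda>p q. asc H (\<phi> w) p \<odot> q) = t1 (asc H (\<phi> w) c) b" by simp
 qed
 also have "\<dots> = t1 (mc \<phi> v \<rhd> a) b"
  unfolding mc_s sl_def by (rule tsum_push[OF vX vspace_A, of AA "\<lambda>c. t1 c b", symmetric]) (intro lins carr_A)+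
 finally have "tsum3 X A A (leg23 X A A A A (T1 H) (leg12 X A A (lam V) ?s)) ?g0 = t1 (mc \<phi> v \<rhd> a) b" .
 then show "XL \<phi> v (t1 a b) = t1 (mc \<phi> v \<rhd> a) b"
  using arg_cong[OF c2, of "\<lambda>t. tsum3 X A A t ?g0"]
  by (simp add: s1213 sc lin_carr[OF l23] lin_F s23)
qed

end

lemma scal_0l: "vspace X ==> scal X 0 x = 0"
proof -
 assume X: "vspace X"
 interpret vector_space "scal X" by (rule vspace_vs[OF X])
 show ?thesis by (rule scale_zero_left)
qed
lemma (in wmba) er_sum: assumes "\<And>i. i \<in> K ==> t i \<in> carr AA" shows "er (\<Sum>i\<in>K. t i) = (\<Sum>i\<in>K. er (t i))" "el (\<Sum>i\<in>K. t i) = (\<Sum>i\<in>K. el (t i))"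
 by (rule lin_sum[where X=AA and Y=A], (intro lins)+, rule assms, assumption)+
lemma (in wmba) MM_0: "m \<in> MM ==> m \<rhd> 0 = 0" using lin_0[OF vspace_A, of A "fst m"] by (simp add: MM_iff)
lemma (in wmba) asc_0l: "asc H 0 y = 0"
proof -
 interpret vector_space "asc H" by (rule vs_A)
 show ?thesis by (rule scale_zero_left)
qed
context fdc begin

lemma XL_E1: assumes p: "lin X scalars \<phi>" "v \<in> carr X" and t: "t \<in> carr AA" shows "XL \<phi> v (E1 H t) = XL \<phi> v t"
 by (rule AA_eq[OF _ _ t, where Z=AA], (intro lins p)+) (rule XL_E1_pure[OF p])
lemma XL_DL: assumes p: "lin X scalars \<phi>" "v \<in> carr X" and t: "t \<in> carr AA" shows "DL (mc \<phi> v \<rhd> a) t = XL \<phi> v (DL a t)"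
 by (rule AA_eq[OF _ _ t, where Z=AA], (intro lins p)+) (simp add: DL_pure XL_r p XL_T1)
lemma E1_XL: assumes p: "lin X scalars \<phi>" "v \<in> carr X" and t: "t \<in> carr AA" shows "E1 H (XL \<phi> v t) = XL \<phi> v t"
proof -
 have "E1 H (XL \<phi> v (E1 H t)) = XL \<phi> v (E1 H t)"
  by (rule E1_ext[where Z=AA, OF _ _ _ t], (intro lins p)+) (simp add: E1_DL p flip: XL_DL)
 then show ?thesis by (simp add: XL_E1 p t)
qed
lemma DL_XL: assumes p: "lin X scalars \<phi>" "v \<in> carr X" and t: "t \<in> carr AA" shows "DL a (XL \<phi> v t) = DL (a \<lhd> mc \<phi> v) t"
proof -
 have "DL a (XL \<phi> v (E1 H t)) = DL (a \<lhd> mc \<phi> v) (E1 H t)"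
  by (rule E1_ext[where Z=AA, OF _ _ _ t], (intro lins p)+) (simp add: p MM_bal flip: XL_DL DL_DL)
 then show ?thesis by (simp add: XL_E1 p t DL_E1)
qed
lemma XR_DR: assumes p: "lin X scalars \<phi>" "v \<in> carr X" and t: "t \<in> carr AA" shows "XR \<phi> v (DR a t) = DR (a \<lhd> mc \<phi> v) t"
 by (rule nondeg_mm(2)) (simp_all add: p t DL_XL flip: XL_adj DL_adj)
lemma XR_E2: assumes p: "lin X scalars \<phi>" "v \<in> carr X" and t: "t \<in> carr AA" shows "XR \<phi> v (E2 H t) = XR \<phi> v t"
 by (rule nondeg_mm(2)) (simp_all add: p t E1_XL flip: XL_adj E_balanced)
lemma XR_l: assumes p: "lin X scalars \<phi>" "v \<in> carr X" and t: "t \<in> carr AA" shows "XR \<phi> v (l1 d t) = l1 d (XR \<phi> v t)" "XR \<phi> v (l2 d t) = l2 d (XR \<phi> v t)"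
 by (rule nondeg_mm(2); simp add: p t mm_leg flip: XL_adj)+

text \<open>Counit laws for a coefficient: the counit on one leg of \<open>X\<close> gives back \<open>mc \<phi> v\<close>, up to the counital map that
\<open>E\<close> contributes.\<close>
lemma er_XL: assumes p: "lin X scalars \<phi>" "v \<in> carr X" shows "er (XL \<phi> v (a \<odot> c)) = mc \<phi> v \<rhd> (Rb c \<rhd> a)"
proof -
 have "er (XL \<phi> v (E1 H (a \<odot> c))) = mc \<phi> v \<rhd> er (E1 H (a \<odot> c))"
 proof (rule E1_ext[where Z=A and f="\<lambda>t. er (XL \<phi> v t)" and g="\<lambda>t. mc \<phi> v \<rhd> er t"], (intro lins p mc_MM)+)
  fix d w u
  show "er (XL \<phi> v (DL d (w \<odot> u))) = mc \<phi> v \<rhd> er (DL d (w \<odot> u))"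
   by (simp add: DL_pure XL_r p XL_T1 el_lr MM_l flip: Rb_r) (simp add: MM_comm p)
 qed simp
 then show ?thesis by (simp add: XL_E1 p Rb_l)
qed
lemma el_XL: assumes p: "lin X scalars \<phi>" "v \<in> carr X" shows "el (XL \<phi> v (a \<odot> c)) = mc \<phi> v \<rhd> (L a \<rhd> c)"
proof -
 have "el (XL \<phi> v (E1 H (a \<odot> c))) = mc \<phi> v \<rhd> el (E1 H (a \<odot> c))"
 proof (rule E1_ext[where Z=A and f="\<lambda>t. el (XL \<phi> v t)" and g="\<lambda>t. mc \<phi> v \<rhd> el t"], (intro lins p mc_MM)+)
  fix d w u
  have "XL \<phi> v (DL d (w \<odot> u)) = r2 (t4 w (mc \<phi> v \<rhd> d)) u"
   by (simp add: p flip: XL_DL DL_pure4)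
  then show "el (XL \<phi> v (DL d (w \<odot> u))) = mc \<phi> v \<rhd> el (DL d (w \<odot> u))"
   by (simp add: DL_pure4 el_lr MM_l p flip: L_r) (simp add: MM_comm p)
 qed simp
 then show ?thesis by (simp add: XL_E1 p L_l)
qed
lemma er_XR: assumes p: "lin X scalars \<phi>" "v \<in> carr X" shows "er (XR \<phi> v (a \<odot> c)) = (a \<lhd> Rr c) \<lhd> mc \<phi> v"
proof -
 have "er (XR \<phi> v (E2 H (a \<odot> c))) = er (E2 H (a \<odot> c)) \<lhd> mc \<phi> v"
 proof (rule E2_ext[where Z=A and f="\<lambda>t. er (XR \<phi> v t)" and g="\<lambda>t. er t \<lhd> mc \<phi> v"], (intro lins p mc_MM)+)
  fix d w u
  have "XR \<phi> v (DR d (w \<odot> u)) = l1 w (t3 (d \<lhd> mc \<phi> v) u)"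
   by (simp add: XR_DR p flip: DR_pure3)
  then show "er (XR \<phi> v (DR d (w \<odot> u))) = er (DR d (w \<odot> u)) \<lhd> mc \<phi> v"
   by (simp add: DR_pure3 el_lr MM_r p flip: Rr_l) (simp add: MM_comm p)
 qed simp
 then show ?thesis by (simp add: XR_E2 p Rr_r)
qed

section \<open>The actions of the base algebra\<close>

text \<open>The actions of \<open>Rb c\<close> and \<open>Rr c\<close>, as functions of \<open>c\<close>. That they depend only on the element of \<open>R\<close> is a consequence of
\<open>mc_inj\<close>.\<close>
definition "actv v c = (\<Sum>i\<in>I. scal X (eps H (mc (f i) v \<rhd> c)) (g i))"
definition "actl c v = (\<Sum>i\<in>I. scal X (eps H (c \<lhd> mc (f i) v)) (g i))"
lemma act_c[simp]: "actv v c \<in> carr X" "actl c v \<in> carr X" by (simp_all add: actv_def actl_def sumX)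
lemma phi_act: assumes p: "lin X scalars \<phi>" and v: "v \<in> carr X"
 shows "\<phi> (actv v c) = eps H (mc \<phi> v \<rhd> c)" "\<phi> (actl c v) = eps H (c \<lhd> mc \<phi> v)"
 unfolding actv_def actl_def mc_exp[OF p v]
 by (simp_all add: lin_sum[OF vX p] lin_sum[OF vspace_A lin_eps] vspace_scal lin_scal[OF p] lin_scal[OF lin_eps, simplified] mult.commute)
lemma mc_sum: assumes p: "lin X scalars \<phi>" shows "mc \<phi> (\<Sum>i\<in>I. scal X (c i) (g i)) \<rhd> a = (\<Sum>i\<in>I. asc H (c i) (mc \<phi> (g i) \<rhd> a))"
  "a \<lhd> mc \<phi> (\<Sum>i\<in>I. scal X (c i) (g i)) = (\<Sum>i\<in>I. asc H (c i) (a \<lhd> mc \<phi> (g i)))"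
proof -
 have l: "lin X A (\<lambda>v. mc \<phi> v \<rhd> a)" "lin X A (\<lambda>v. a \<lhd> mc \<phi> v)" by (intro lins p)+
 show "mc \<phi> (\<Sum>i\<in>I. scal X (c i) (g i)) \<rhd> a = (\<Sum>i\<in>I. asc H (c i) (mc \<phi> (g i) \<rhd> a))"
  "a \<lhd> mc \<phi> (\<Sum>i\<in>I. scal X (c i) (g i)) = (\<Sum>i\<in>I. asc H (c i) (a \<lhd> mc \<phi> (g i)))"
  using lin_sum[OF vX l(1), of I "\<lambda>i. scal X (c i) (g i)"] lin_sum[OF vX l(2), of I "\<lambda>i. scal X (c i) (g i)"]
   lin_scal[OF l(1)] lin_scal[OF l(2)] by (simp_all add: vspace_scal)
qed
lemma mc_actv: assumes p: "lin X scalars \<phi>" and v: "v \<in> carr X" shows "mc \<phi> (actv v c) = mc \<phi> v \<star> Rb c"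
proof (rule MM_eq)
 fix a
 have "mc \<phi> (actv v c) \<rhd> a = er (XL \<phi> v (a \<odot> c))"
  unfolding XL_pure[OF p v] actv_def mc_sum[OF p] by (subst er_sum) (simp_all add: er_pure)
 then show "mc \<phi> (actv v c) \<rhd> a = (mc \<phi> v \<star> Rb c) \<rhd> a" by (simp add: er_XL p v)
qed (simp_all add: p v)
lemma mc_actl: assumes p: "lin X scalars \<phi>" and v: "v \<in> carr X" shows "mc \<phi> (actl c v) = Rr c \<star> mc \<phi> v"
proof (rule MM_eqr)
 fix a
 have "a \<lhd> mc \<phi> (actl c v) = er (XR \<phi> v (a \<odot> c))"
  unfolding XL_pure[OF p v] actl_def mc_sum[OF p] by (subst er_sum) (simp_all add: er_pure)
 then show "a \<lhd> mc \<phi> (actl c v) = a \<lhd> (Rr c \<star> mc \<phi> v)" by (simp add: er_XR p v)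
qed (simp_all add: p v)

lemma slice_lam: assumes w: "lin A scalars \<omega>" and v: "v \<in> carr X" shows "slice_right X (alg H) \<omega> (lam V (pure X A v a)) = (\<Sum>i\<in>I. scal X (\<omega> (mc (f i) v \<rhd> a)) (g i))"
 "slice_right X (alg H) \<omega> (rho V (pure X A v a)) = (\<Sum>i\<in>I. scal X (\<omega> (a \<lhd> mc (f i) v)) (g i))"
proof -
 have b: "bilin X A X (\<lambda>x y. scal X (\<omega> y) x)" using w by (intro lins)
 show "slice_right X (alg H) \<omega> (lam V (pure X A v a)) = (\<Sum>i\<in>I. scal X (\<omega> (mc (f i) v \<rhd> a)) (g i))"
  "slice_right X (alg H) \<omega> (rho V (pure X A v a)) = (\<Sum>i\<in>I. scal X (\<omega> (a \<lhd> mc (f i) v)) (g i))"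
  unfolding lam_exp[OF v] rho_exp[OF v] slice_right_def
  by (subst lin_sum[OF vspace_tprod lift_lin[OF vX b]]; simp add: lift_pure[OF vX b])+
qed
lemma phi_slice: assumes p: "lin X scalars \<phi>" and w: "lin A scalars \<omega>" and v: "v \<in> carr X"
 shows "\<phi> (slice_right X (alg H) \<omega> (lam V (pure X A v a))) = \<omega> (mc \<phi> v \<rhd> a)"
 unfolding slice_lam[OF w v] mc_exp[OF p v]
 by (simp add: lin_sum[OF vX p] lin_sum[OF vspace_A w] vspace_scal lin_scal[OF p] lin_scal[OF w, simplified] mult.commute)

text \<open>Fullness: a functional whose coefficients all vanish is zero.\<close>
lemma full0: assumes p: "lin X scalars \<psi>" and z: "\<And>w a. w \<in> carr X ==> mc \<psi> w \<rhd> a = 0" and v: "v \<in> carr X" shows "\<psi> v = 0"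
proof (rule lin_span_eq[OF vX p, where g="\<lambda>_. 0"])
 show "lin X scalars (\<lambda>_. 0)" by (simp add: lin_def)
 let ?P = "{slice_right X (alg H) \<omega> (lam V (pure X (alg H) v a)) | v a \<omega>. v \<in> carr X \<and> lin (alg H) scalars \<omega>}"
 show "v \<in> module.span (scal X) ?P" using fullV v by (simp add: full_comodule_def)
 show "?P \<subseteq> carr X" by (auto simp: slice_lam sumX)
 show "\<psi> x = 0" if "x \<in> ?P" for x
  using that by (auto simp: phi_slice[OF p] z lin_0[OF vspace_A])
qed
text \<open>The functional \<open>\<epsilon>(mc \<phi> v _)\<close> factors through \<open>Rb\<close>. Indeed, as a functional of \<open>v\<close> it has coefficient
\<open>mc \<phi> w (L u _)\<close>, and \<open>L u = 0\<close> when \<open>Rb u = 0\<close>. So \<open>transfer_r\<close> applies to this functional.\<close>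
lemma eps_mc_0: assumes u: "Rb u = 0" and p: "lin X scalars \<phi>" and v: "v \<in> carr X" shows "eps H (mc \<phi> v \<rhd> u) = 0"
proof (rule full0[where \<psi>="\<lambda>v. eps H (mc \<phi> v \<rhd> u)", OF _ _ v])
 show l: "lin X scalars (\<lambda>v. eps H (mc \<phi> v \<rhd> u))" by (intro lins p)
 have e: "eps H (a * u) = 0" for a using eps_Rb[of u a] u lin_0[OF vspace_A lin_eps] by simp
 \<comment> \<open>the first leg of \<open>E\<close> lies in the base algebra, and \<open>\<epsilon>(r u) = 0\<close> for \<open>r\<close> in the base algebra\<close>
 have Lu: "L u \<rhd> c = 0" for c
 proof (rule idemE[where Z=A and f="\<lambda>c. L u \<rhd> c" and g="\<lambda>_. 0"], (intro lins)+)
  show "lin A A (\<lambda>_. 0)" by (simp add: lin_def)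
  fix a b
  have "L u \<rhd> (a * b) = ts (t1 a b) (\<lambda>r y. asc H (eps H (Rb r \<rhd> u)) y)"
   unfolding L_l E1_Rb by (subst el_ts) (simp_all add: el_pure)
  also have "\<dots> = 0"
  proof (rule ts_zero)
   fix r y
   obtain d where "Rb r = Rr d" by (rule R_E(2)[OF R_Rb])
   then have "eps H (Rb r \<rhd> u) = 0" by (simp add: eps_Rr e)
   then show "asc H (eps H (Rb r \<rhd> u)) y = 0" by (simp add: asc_0l)
  qed
  finally show "L u \<rhd> (a * b) = 0" .
 qed
 fix w a assume w: "w \<in> carr X"
 show "mc (\<lambda>v. eps H (mc \<phi> v \<rhd> u)) w \<rhd> a = 0"
 proof -
  have "mc (\<lambda>v. eps H (mc \<phi> v \<rhd> u)) w \<rhd> a = el (XL \<phi> w (u \<odot> a))"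
   unfolding mc_exp(1)[OF l w] XL_pure[OF p w] by (subst er_sum) (simp_all add: el_pure)
  then show ?thesis by (simp add: el_XL p w Lu MM_0)
 qed
qed

lemma lin_actv[lins]: "lin W A h ==> v \<in> carr X ==> lin W X (\<lambda>w. actv v (h w))" "lin W X k ==> lin W X (\<lambda>w. actv (k w) c)"
 "lin W A h ==> v \<in> carr X ==> lin W X (\<lambda>w. actl (h w) v)" "lin W X k ==> lin W X (\<lambda>w. actl c (k w))"
 unfolding actv_def actl_def by (intro lins fl gc mc_MM; assumption)+

lemma span_act: "carr X = module.span (scal X) {actv w (p * c) | w p c. w \<in> carr X}" (is "_ = module.span _ ?P")
proof
 interpret vector_space "scal X" by (rule vspace_vs[OF vX])
 show "span ?P \<subseteq> carr X" by (rule span_minimal) (use vX in \<open>auto simp: vspace_def\<close>)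
 show "carr X \<subseteq> span ?P"
 proof
  fix v assume v: "v \<in> carr X"
  show "v \<in> span ?P"
  proof (rule functional_sep[OF vspace_vs[OF vX] subspace_span])
   fix \<theta> assume "Vector_Spaces.linear (scal X) (*) \<theta>" and z: "\<And>w. w \<in> span ?P ==> \<theta> w = 0"
   then have p: "lin X scalars \<theta>" by (intro linear_lin)
   have z0: "eps H (mc \<theta> w \<rhd> c) = 0" if w: "w \<in> carr X" for w c
   proof (rule idemE[where Z=scalars and f="\<lambda>c. eps H (mc \<theta> w \<rhd> c)" and g="\<lambda>_. 0"], (intro lins mc_MM p w)+)
    show "lin A scalars (\<lambda>_. 0)" by (simp add: lin_def)
    fix a b show "eps H (mc \<theta> w \<rhd> (a * b)) = 0"
     unfolding phi_act(1)[OF p w, symmetric] by (rule z, rule span_base) (use w in blast)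
   qed
   show "\<theta> v = 0"
   proof (rule full0[OF p _ v])
    fix w a assume w: "w \<in> carr X"
    have 0: "mc \<theta> w \<rhd> (L u \<rhd> b) = 0" for u b
    proof -
     have "el (XL \<theta> w (u \<odot> b)) = 0"
      unfolding XL_pure[OF p w] by (subst er_sum) (simp_all add: el_pure z0 asc_0l)
     then show ?thesis by (simp add: el_XL p w)
    qed
    show "mc \<theta> w \<rhd> a = 0"
    proof (rule idemE[where Z=A and f="\<lambda>c. mc \<theta> w \<rhd> c" and g="\<lambda>_. 0"], (intro lins mc_MM p w)+)
     show "lin A A (\<lambda>_. 0)" by (simp add: lin_def)
     fix a b have "mc \<theta> w \<rhd> (a * b) = ts (t1 a b) (\<lambda>p z. mc \<theta> w \<rhd> (L p \<rhd> z))"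
      unfolding L_t1[symmetric] by (rule ts_pushA[where f="\<lambda>t. mc \<theta> w \<rhd> t" and Z'=A]) (intro lins mc_MM p w)
     then show "mc \<theta> w \<rhd> (a * b) = 0" by (simp add: 0 ts_zero)
    qed
   qed
  qed
 qed
qed

abbreviation "ch \<phi> v \<equiv> (\<lambda>y. eps H (mc \<phi> v \<rhd> y))"
lemma lin_ch: "lin X scalars \<phi> ==> v \<in> carr X ==> lin A scalars (ch \<phi> v)" by (intro lins mc_MM)

section \<open>Vectors are determined by their coefficients\<close>

text \<open>Fullness says that the vectors \<open>w r\<close> with \<open>r = Rb (p c)\<close> span. For such a vector let \<open>n i\<close> be the slice of
\<open>\<Delta>(p)(c \<otimes> 1)\<close> by \<open>\<epsilon>(mc (f i) w _)\<close> on the right leg. By \<open>base_split\<close> and the transfer principle, \<open>Rb (n i)\<close> is obtained from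
\<open>(1 \<otimes> r)\<Delta>(d)(e \<otimes> 1)\<close> by the same functional, and there \<open>r\<close> turns the coefficients of \<open>w\<close> into those of \<open>w r\<close>.\<close>
lemma coord_expansion: assumes v: "v \<in> carr X"
 shows "\<exists>n. (\<forall>i d e. Rb (n i) \<rhd> (d * e) = slr (ch (f i) v) (t4 e d)) \<and> v = (\<Sum>i\<in>I. actv (g i) (n i))"
proof -
 interpret vector_space "scal X" by (rule vspace_vs[OF vX])
 let ?P = "{actv w (p * c) | w p c. w \<in> carr X}"
 have lact: "lin A X (\<lambda>n. actv (g i) n)" for i by (intro lins gc)
 have s: "slr (ch (f i) (scal X k x + y)) t = asc H k (slr (ch (f i) x) t) + slr (ch (f i) y) t" if "x \<in> carr X" "y \<in> carr X" for i k x y t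
 proof -
  have l: "lin X A (\<lambda>v. slr (ch (f i) v) t)" unfolding slr_def by (intro lins fl)
  show ?thesis using lin_add[OF l vspace_scal[OF vX that(1)] that(2)] lin_scal[OF l that(1)] by simp
 qed
 have "v \<in> span ?P" using v equalityD1[OF span_act] by blast
 then have "v \<in> carr X \<and> (\<exists>n. (\<forall>i d e. Rb (n i) \<rhd> (d * e) = slr (ch (f i) v) (t4 e d)) \<and> v = (\<Sum>i\<in>I. actv (g i) (n i)))"
 proof (induction rule: span_induct_alt)
  case base
  have "mc (f i) 0 \<rhd> y = 0" for i y by (rule lin_0[OF vX, where f="\<lambda>v. mc (f i) v \<rhd> y" and Y=A]) (intro lins fl)
  then have "slr (ch (f i) 0) t = 0" for i t by (simp add: slr_def lin_0[OF vspace_A lin_eps] asc_0l ts_zero)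
  moreover have "Rb 0 \<rhd> x = 0" for x by (rule lin_0[OF vspace_A, where f="\<lambda>v. Rb v \<rhd> x" and Y=A]) (intro lins)
  ultimately show ?case using lin_0[OF vspace_A lact] vspace_0[OF vX] by (intro conjI exI[of _ "\<lambda>_. 0"]) simp_all
 next
  case (step k x y)
  then obtain w p c where w: "w \<in> carr X" and x: "x = actv w (p * c)" by blast
  from step(2) obtain n where yc: "y \<in> carr X" and n: "\<And>i d e. Rb (n i) \<rhd> (d * e) = slr (ch (f i) y) (t4 e d)" and y: "y = (\<Sum>i\<in>I. actv (g i) (n i))" by blast
  define m where "m i = slr (ch (f i) w) (t4 c p)" for i
  have m: "Rb (m i) \<rhd> (d * e) = slr (ch (f i) x) (t4 e d)" for i d e
  proof -
   let ?r = "Rb (p * c)"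
   let ?c = "ch (f i) w"
   have lc: "lin A scalars ?c" by (rule lin_ch[OF fl w])
   have rM: "?r \<in> MM" by simp
   let ?t1 = "o2 ?r (t4 e d)" and ?t2 = "ts (t4 c p) (\<lambda>g h. (Rb g \<rhd> (d * e)) \<odot> h)"
   have "slr ?c (?t1 - ?t2) = 0"
   proof (rule transfer_r[OF _ lc])
    show "?t1 - ?t2 \<in> carr AA" by (rule vspace_diff[OF vspace_tprod]) simp_all
    fix x
    have la: "lin A scalars (\<lambda>y. eps H (x * y))" by (intro lins)
    have e: "slr (\<lambda>y. eps H (x * y)) t = er (l2 x t)" if t: "t \<in> carr AA" for t
     by (rule AA_eq[OF _ _ t, where Z=A], (intro lins la)+) (simp add: sl_pure[OF la] er_pure)
    show "slr (\<lambda>y. eps H (x * y)) (?t1 - ?t2) = 0"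
     by (subst lin_diff[OF vspace_tprod lin_sl(1)[OF la lin_id]]) (simp_all add: e base_split[OF refl])
   next
    fix y assume "\<And>x. eps H (x * y) = 0"
    then have "eps H (x * y) = eps H (x * 0)" for x by (simp add: lin_0[OF vspace_A lin_eps])
    then have "Rb y = Rb 0" by (rule Rb_eqI)
    then have "Rb y = 0" using lin_0[OF vspace_A lin_Rb[OF lin_id]] by simp
    then show "?c y = 0" by (rule eps_mc_0[OF _ fl w])
   qed
   then have "slr ?c ?t1 = slr ?c ?t2"
    by (subst (asm) lin_diff[OF vspace_tprod lin_sl(1)[OF lc lin_id]]) simp_all
   also have "slr ?c ?t1 = slr (ch (f i) x) (t4 e d)"
    unfolding x slr_def mc_actv[OF fl w] mp_s by (rule ts_o(2)[where Z=A]) (intro lins fl w mc_MM rM)+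
   also have "slr ?c ?t2 = Rb (m i) \<rhd> (d * e)"
   proof -
    have "slr ?c ?t2 = ts (t4 c p) (\<lambda>g h. asc H (?c h) (Rb g \<rhd> (d * e)))"
     by (subst ts_pushAA[of A "\<lambda>t. slr ?c t"]) (intro lins lc | simp add: sl_pure[OF lc])+
    also have "\<dots> = ts (t4 c p) (\<lambda>g h. Rb (asc H (?c h) g) \<rhd> (d * e))"
     using lin_scal[of A A "\<lambda>p. Rb p \<rhd> (d * e)"] by (simp add: lins)
    also have "\<dots> = Rb (m i) \<rhd> (d * e)" unfolding m_def slr_def
     by (rule ts_pushA[symmetric, of A "\<lambda>w. Rb w \<rhd> (d * e)"]) (intro lins)
    finally show ?thesis .
   qed
   finally show ?thesis ..
  qed
  have xs: "x = (\<Sum>i\<in>I. actv (g i) (m i))"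
  proof (rule eqX)
   show "x \<in> carr X" by (simp add: x)
   show "(\<Sum>i\<in>I. actv (g i) (m i)) \<in> carr X" by (intro vspace_sum vX) simp
   fix j assume "j \<in> I"
   have "f j (\<Sum>i\<in>I. actv (g i) (m i)) = (\<Sum>i\<in>I. eps H (mc (f j) (g i) \<rhd> m i))"
    by (simp add: lin_sum[OF vX fl] phi_act fl)
   also have "\<dots> = ts (t4 c p) (\<lambda>a b. \<Sum>i\<in>I. eps H (mc (f i) w \<rhd> b) * eps H (mc (f j) (g i) \<rhd> a))"
   proof -
    have "eps H (mc (f j) (g i) \<rhd> m i) = ts (t4 c p) (\<lambda>a b. eps H (mc (f i) w \<rhd> b) * eps H (mc (f j) (g i) \<rhd> a))" for i
     unfolding m_def slr_def by (subst ts_pushA[of scalars "ch (f j) (g i)"])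
      (intro lin_ch fl gc | simp add: lin_scal[OF lin_ch[OF fl gc], simplified])+
    then show ?thesis by (simp add: tsum_sum)
   qed
   also have "\<dots> = ts (t4 c p) (\<lambda>a b. eps H (mc (f j) w \<rhd> (Rb b \<rhd> a)))"
   proof -
    have "(\<Sum>i\<in>I. eps H (mc (f i) w \<rhd> b) * eps H (mc (f j) (g i) \<rhd> a)) = eps H (mc (f j) w \<rhd> (Rb b \<rhd> a))" for a b
    proof -
     have "(\<Sum>i\<in>I. eps H (mc (f i) w \<rhd> b) * eps H (mc (f j) (g i) \<rhd> a)) = eps H (er (XL (f j) w (a \<odot> b)))"
      unfolding XL_pure[OF fl w] by (simp add: er_sum er_pure lin_sum[OF vspace_A lin_eps] lin_scal[OF lin_eps, simplified])
     then show ?thesis by (simp add: er_XL fl w)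
    qed
    then show ?thesis by simp
   qed
   also have "\<dots> = eps H (mc (f j) w \<rhd> (p * c))"
    unfolding Rb_t4[symmetric] by (rule ts_pushA[symmetric, OF lin_ch[OF fl w]])
   also have "\<dots> = f j x" by (simp add: x phi_act fl w)
   finally show "f j x = f j (\<Sum>i\<in>I. actv (g i) (m i))" ..
  qed
  have xc: "x \<in> carr X" by (simp add: x)
  define q where "q i = asc H k (m i) + n i" for i
  have "Rb (q i) \<rhd> (d * e) = slr (ch (f i) (scal X k x + y)) (t4 e d)" for i d e
   using lin_add[of A A "\<lambda>p. Rb p \<rhd> (d * e)"] lin_scal[of A A "\<lambda>p. Rb p \<rhd> (d * e)"]
   by (simp add: lins q_def m n s xc yc)
  moreover have "(\<Sum>i\<in>I. actv (g i) (q i)) = scal X k x + y"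
  proof -
   have "(\<Sum>i\<in>I. actv (g i) (q i)) = (\<Sum>i\<in>I. scal X k (actv (g i) (m i)) + actv (g i) (n i))"
    by (simp add: q_def lin_add[OF lact] lin_scal[OF lact, simplified])
   then show ?thesis by (subst xs, subst y) (simp add: sum.distrib scale_sum_right)
  qed
  ultimately show ?case using xc yc by (metis vspace_add[OF vX] vspace_scal[OF vX])
 qed
 then show ?thesis by blast
qed

text \<open>If all coefficients of \<open>v\<close> vanish, then so do all \<open>Rb (n i)\<close> in the expansion of \<open>v\<close>.\<close>
lemma mc_inj0: assumes v: "v \<in> carr X" and z: "\<And>i a. i \<in> I ==> mc (f i) v \<rhd> a = 0" shows "v = 0"
proof -
 obtain n where n: "\<And>i d e. Rb (n i) \<rhd> (d * e) = slr (ch (f i) v) (t4 e d)" and v': "v = (\<Sum>i\<in>I. actv (g i) (n i))" using coord_expansion[OF v] by blast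
 have "actv (g i) (n i) = 0" if i: "i \<in> I" for i
 proof -
  have 0: "Rb (n i) \<rhd> (d * e) = 0" for d e by (simp add: n z i slr_def lin_0[OF vspace_A lin_eps] asc_0l ts_zero)
  have "Rb (n i) = 0"
  proof (rule MM_eq)
   show "0 \<in> MM" by (rule vspace_0[OF vspace_M])
   fix x have "Rb (n i) \<rhd> x = 0"
    by (rule idemE[where Z=A and f="\<lambda>c. Rb (n i) \<rhd> c" and g="\<lambda>c. 0"], (intro lins)+) (auto simp: 0 lin_def)
   then show "Rb (n i) \<rhd> x = 0 \<rhd> x" by simp
  qed simp
  then show ?thesis unfolding actv_def by (simp add: eps_mc_0[OF _ fl gc] scal_0l)
 qed
 then show ?thesis using v' by simp
qed
lemma mc_inj: assumes v: "v \<in> carr X" "w \<in> carr X" and z: "\<And>i a. i \<in> I ==> mc (f i) v \<rhd> a = mc (f i) w \<rhd> a" shows "v = w"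
proof -
 have "v - w = 0"
 proof (rule mc_inj0)
  show "v - w \<in> carr X" by (rule vspace_diff[OF vX v])
  fix i a assume "i \<in> I"
  then show "mc (f i) (v - w) \<rhd> a = 0"
   using lin_diff[OF vX, of A "\<lambda>v. mc (f i) v \<rhd> a" v w] z v by (simp add: lins fl)
 qed
 then show ?thesis by simp
qed

lemma ract_Rb: assumes v: "v \<in> carr X" shows "ract H V v (Rb c) = actv v c"
proof -
 let ?d = "SOME a. Rb a = Rb c"
 have d: "Rb ?d = Rb c" by (rule someI) (rule refl)
 have "ract H V v (Rb c) = actv v ?d" unfolding ract_def slice_lam[OF lin_eps v] actv_def ..
 also have "\<dots> = actv v c" by (rule mc_inj) (simp_all add: mc_actv fl v d)
 finally show ?thesis .
qed
lemma lact_Rr: assumes v: "v \<in> carr X" shows "lact H V (Rr c) v = actl c v"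
proof -
 \<comment> \<open>the action is defined through a chosen preimage \<open>?d\<close>; by \<open>mc_inj\<close> every preimage gives the same vector\<close>
 let ?d = "SOME a. Rr a = Rr c"
 have d: "Rr ?d = Rr c" by (rule someI) (rule refl)
 have "lact H V (Rr c) v = actl ?d v" unfolding lact_def slice_lam[OF lin_eps v] actl_def ..
 also have "\<dots> = actl c v" by (rule mc_inj) (simp_all add: mc_actl fl v d)
 finally show ?thesis .
qed
lemma act_carr[simp]: "v \<in> carr X ==> r \<in> carr R ==> ract H V v r \<in> carr X" "v \<in> carr X ==> r \<in> carr R ==> lact H V r v \<in> carr X"
 by (erule R_E(1), simp add: ract_Rb) (erule R_E(2), simp add: lact_Rr)
lemma mc_act[simp]: "lin X scalars \<phi> ==> v \<in> carr X ==> r \<in> carr R ==> mc \<phi> (ract H V v r) = mc \<phi> v \<star> r"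
 "lin X scalars \<phi> ==> v \<in> carr X ==> r \<in> carr R ==> mc \<phi> (lact H V r v) = r \<star> mc \<phi> v"
 by (erule R_E(1), simp add: ract_Rb mc_actv) (erule R_E(2), simp add: lact_Rr mc_actl)
lemma phi_ract: "lin X scalars \<phi> ==> v \<in> carr X ==> \<phi> (ract H V v (Rb c)) = eps H (mc \<phi> v \<rhd> c)"
 "lin X scalars \<phi> ==> v \<in> carr X ==> \<phi> (lact H V (Rr c) v) = eps H (c \<lhd> mc \<phi> v)"
 by (simp_all add: ract_Rb lact_Rr phi_act)
text \<open>Linearity of a map into \<open>V\<close> may be tested on coefficients.\<close>
lemma lin_ractI: assumes l: "\<And>i a. lin W A (\<lambda>w. mc (f i) (F w) \<rhd> a)" and c: "\<And>w. w \<in> carr W ==> F w \<in> carr X" and W: "vspace W"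
 shows "lin W X F"
 unfolding lin_def
proof (intro conjI ballI allI)
 fix x y k assume x: "x \<in> carr W"
 show "F x \<in> carr X" by (rule c[OF x])
 show "F (scal W k x) = scal X k (F x)"
  by (rule mc_inj) (simp_all add: c x W vspace_scal lin_scal[OF l] lin_scal[of X A "\<lambda>v. mc (f _) v \<rhd> _"] lins fl)
next
 fix x y assume x: "x \<in> carr W" "y \<in> carr W"
 show "F (x + y) = F x + F y"
  by (rule mc_inj) (simp_all add: c x W vspace_add lin_add[OF l] lin_add[of X A "\<lambda>v. mc (f _) v \<rhd> _"] lins fl)
qed
lemma lin_act[lins]: "lin W X h ==> r \<in> carr R ==> vspace W ==> lin W X (\<lambda>w. ract H V (h w) r)"
 "lin W X h ==> r \<in> carr R ==> vspace W ==> lin W X (\<lambda>w. lact H V r (h w))"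
proof -
 show "lin W X (\<lambda>w. ract H V (h w) r)" if h: "lin W X h" and r: "r \<in> carr R" and W: "vspace W"
 proof (rule lin_ractI[OF _ _ W])
  show "lin W A (\<lambda>w. mc (f i) (ract H V (h w) r) \<rhd> a)" for i a
   by (rule lin_cong[of W "\<lambda>w. mc (f i) (h w) \<rhd> (r \<rhd> a)"]) (simp_all add: lin_carr[OF h] fl r W lins h)
 qed (simp add: lin_carr[OF h] r)
 show "lin W X (\<lambda>w. lact H V r (h w))" if h: "lin W X h" and r: "r \<in> carr R" and W: "vspace W"
 proof (rule lin_ractI[OF _ _ W])
  show "lin W A (\<lambda>w. mc (f i) (lact H V r (h w)) \<rhd> a)" for i a
   by (rule lin_cong[of W "\<lambda>w. r \<rhd> (mc (f i) (h w) \<rhd> a)"]) (simp_all add: lin_carr[OF h] fl r R_MM W lins h)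
 qed (simp add: lin_carr[OF h] r)
qed
lemma lin_act2[lins]: "lin W R k ==> v \<in> carr X ==> vspace W ==> lin W X (\<lambda>w. ract H V v (k w))"
 "lin W R k ==> v \<in> carr X ==> vspace W ==> lin W X (\<lambda>w. lact H V (k w) v)"
proof -
 show "lin W X (\<lambda>w. ract H V v (k w))" if h: "lin W R k" and v: "v \<in> carr X" and W: "vspace W"
 proof (rule lin_ractI[OF _ _ W])
  show "lin W A (\<lambda>w. mc (f i) (ract H V v (k w)) \<rhd> a)" for i a
   by (rule lin_cong[of W "\<lambda>w. mc (f i) v \<rhd> (k w \<rhd> a)"]) (simp_all add: lin_carr[OF h] fl v W lins h)
 qed (simp add: lin_carr[OF h] v)
 show "lin W X (\<lambda>w. lact H V (k w) v)" if h: "lin W R k" and v: "v \<in> carr X" and W: "vspace W"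
 proof (rule lin_ractI[OF _ _ W])
  show "lin W A (\<lambda>w. mc (f i) (lact H V (k w) v) \<rhd> a)" for i a
   by (rule lin_cong[of W "\<lambda>w. k w \<rhd> (mc (f i) v \<rhd> a)"]) (simp_all add: lin_carr[OF h] fl v W lins h)
 qed (simp add: lin_carr[OF h] v)
qed
end

lemma (in wmba) M_sum[simp]: "(\<Sum>i\<in>K. m i) \<rhd> x = (\<Sum>i\<in>K. m i \<rhd> (x::'a))" "x \<lhd> (\<Sum>i\<in>K. m i) = (\<Sum>i\<in>K. x \<lhd> m i)"
 by (induction K rule: infinite_finite_induct) simp_all
lemma (in wmba) lin_mp[lins]: "lin W M h ==> m \<in> MM ==> lin W M (\<lambda>w. m \<star> h w)" "lin W M h ==> m \<in> MM ==> lin W M (\<lambda>w. h w \<star> m)"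
 by (rule lin_toM; simp add: lin_carr; intro lins; assumption)+
lemma (in wmba) lin_mrI: "m \<in> MM ==> lin A A (\<lambda>x. x \<lhd> m)" by (intro lins)
lemma (in wmba) mr_sum: "m \<in> MM ==> (\<Sum>i\<in>K. y i) \<lhd> m = (\<Sum>i\<in>K. y i \<lhd> m)"
 by (rule lin_sum[OF vspace_A lin_mrI]) simp_all
lemma (in wmba) mr_scal: "m \<in> MM ==> asc H c x \<lhd> m = asc H c (x \<lhd> m)"
 using lin_scal[OF lin_mrI, of m x c] by simp
lemma (in wmba) ml_sum: "m \<in> MM ==> m \<rhd> (\<Sum>i\<in>K. y i) = (\<Sum>i\<in>K. m \<rhd> y i)"
 by (rule lin_sum[OF vspace_A]) (auto intro!: lins)
lemma (in wmba) Rr_t2: "ts (t2 a b) (\<lambda>p q. p \<lhd> Rr q) = a * b"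
proof -
 have "ts (t2 a b) (\<lambda>p q. p \<lhd> Rr q) = er (E2 H (t2 a b))"
  unfolding Rr_r by (rule ts_lin[symmetric, where f="\<lambda>t. er (E2 H t)" and Z=A]) (intro lins | simp)+
 then show ?thesis by (simp add: E2_t2 counit_T)
qed

lemma (in wmbf) Rb_0: assumes "\<And>x. eps H (x * y) = 0" shows "Rb y = 0"
proof -
 have "eps H (x * y) = eps H (x * 0)" for x by (simp add: assms lin_0[OF vspace_A lin_eps])
 then have "Rb y = Rb 0" by (rule Rb_eqI)
 then show ?thesis using lin_0[OF vspace_A lin_Rb[OF lin_id]] by simp
qed
text \<open>The products \<open>a S b\<close> span, so left multiplications by \<open>S \<otimes> S\<close> are jointly injective.\<close>
lemma (in antip) S2_cancel: assumes t: "t \<in> carr AA" and u: "u \<in> carr AA" and e: "\<And>a b. S2 (a \<odot> b) t = S2 (a \<odot> b) u" shows "t = u"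
proof (rule nondeg_mm(1)[OF t u])
 fix a c
 show "a \<odot> c \<cdot> t = a \<odot> c \<cdot> u"
 proof (rule S_extr[where Z=AA and f="\<lambda>a. a \<odot> c \<cdot> t" and g="\<lambda>a. a \<odot> c \<cdot> u"], (intro lins)+)
  fix a b
  show "(a \<lhd> S b) \<odot> c \<cdot> t = (a \<lhd> S b) \<odot> c \<cdot> u"
  proof (rule S_extr[where Z=AA and f="\<lambda>c. (a \<lhd> S b) \<odot> c \<cdot> t" and g="\<lambda>c. (a \<lhd> S b) \<odot> c \<cdot> u"], (intro lins)+)
   fix c d
   have "(a \<lhd> S b) \<odot> (c \<lhd> S d) \<cdot> t = a \<odot> c \<cdot> S2 (d \<odot> b) t" if t: "t \<in> carr AA" for t
    by (rule AA_eq[OF _ _ t, where Z=AA], (intro lins)+) (simp add: S2_pure MM_bal)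
   then show "(a \<lhd> S b) \<odot> (c \<lhd> S d) \<cdot> t = (a \<lhd> S b) \<odot> (c \<lhd> S d) \<cdot> u" by (simp add: t u e)
  qed
 qed
qed

section \<open>Evaluation and coevaluation multipliers\<close>

locale dfd = fdc H V I g f + antip H S G R1
 for H :: "('k::field, 'a::ring) wmb" and V :: "('k, 'v::ab_group_add, 'a) comod" and I :: "'i set" and g f S G R1
begin

lemma mcM: assumes p: "lin X scalars \<phi>" and v: "v \<in> carr X" shows "mc \<phi> v = (\<Sum>i\<in>I. scal M (\<phi> (g i)) (mc (f i) v))"
 by (rule mult_eqI) (simp_all add: mc_exp[OF p v])

definition "evm \<phi> v = (\<Sum>i\<in>I. Sb (mc \<phi> (g i)) \<star> mc (f i) v)"
definition "Nm \<phi> v = (\<Sum>i\<in>I. mc \<phi> (g i) \<star> Sb (mc (f i) v))"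
lemma evN_MM[simp, lins]: "lin X scalars \<phi> ==> v \<in> carr X ==> evm \<phi> v \<in> MM" "lin X scalars \<phi> ==> v \<in> carr X ==> Nm \<phi> v \<in> MM"
 unfolding evm_def Nm_def by (rule vspace_sum[OF vspace_M]; simp add: fl)+
lemma lin_evm[lins]: "lin X scalars \<phi> ==> lin W X h ==> lin W M (\<lambda>w. evm \<phi> (h w))"
 unfolding evm_def by (intro lins fl gc mc_MM; assumption?)
lemma evm_l: "evm \<phi> v \<rhd> x = (\<Sum>i\<in>I. Sb (mc \<phi> (g i)) \<rhd> (mc (f i) v \<rhd> x))" by (simp add: evm_def)
lemma Nm_l: "Nm \<phi> v \<rhd> x = (\<Sum>i\<in>I. mc \<phi> (g i) \<rhd> (Sb (mc (f i) v) \<rhd> x))" by (simp add: Nm_def)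

text \<open>\<open>Rr\<close> is \<open>S(p\<^sub>1) p\<^sub>2\<close>; for \<open>p = mc \<phi> v x\<close> the comultiplication brings in \<open>X\<close>, and \<open>T\<^sub>1 R1 = E\<close> is absorbed by \<open>X\<close>.\<close>
lemma evm_R1: assumes p: "lin X scalars \<phi>" and v: "v \<in> carr X"
 shows "ts (R1 (a \<odot> b)) (\<lambda>x y. Rr (mc \<phi> v \<rhd> x) \<rhd> y) = S a \<rhd> (evm \<phi> v \<rhd> b)"
proof -
 have "ts (R1 (a \<odot> b)) (\<lambda>x y. Rr (mc \<phi> v \<rhd> x) \<rhd> y) = ts (R1 (a \<odot> b)) (\<lambda>x y. ts (XL \<phi> v (t1 x y)) (\<lambda>p q. S p \<rhd> q))"
  by (simp add: XL_T1 p v antipode_left)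
 also have "\<dots> = ts (XL \<phi> v (T1 H (R1 (a \<odot> b)))) (\<lambda>p q. S p \<rhd> q)"
  by (rule ts_lin[symmetric, where f="\<lambda>t. ts (XL \<phi> v (T1 H t)) (\<lambda>p q. S p \<rhd> q)" and Z=A]) (intro lins p v | simp)+
 also have "\<dots> = ts (XL \<phi> v (a \<odot> b)) (\<lambda>p q. S p \<rhd> q)" by (simp add: T1R1 XL_E1 p v)
 also have "\<dots> = (\<Sum>i\<in>I. ts ((mc \<phi> (g i) \<rhd> a) \<odot> (mc (f i) v \<rhd> b)) (\<lambda>p q. S p \<rhd> q))"
  unfolding XL_pure[OF p v] by (rule lin_sum[where X=AA and Y=A]) (intro lins | simp)+
 also have "\<dots> = (\<Sum>i\<in>I. S a \<rhd> (Sb (mc \<phi> (g i)) \<rhd> (mc (f i) v \<rhd> b)))"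
  by (intro sum.cong refl) (subst ts_pureA, (intro lins)+, simp add: S_act p)
 also have "\<dots> = S a \<rhd> (evm \<phi> v \<rhd> b)"
  unfolding evm_l by (rule lin_sum[where X=A and Y=A, symmetric]) (intro lins | simp)+
 finally show ?thesis .
qed
lemma Rr_mult_R1: "ts (R1 (a \<odot> b)) (\<lambda>x y. Rr (x' * x) \<rhd> y) = S a \<rhd> (Rr x' \<rhd> b)"
proof -
 have "ts (R1 (a \<odot> b)) (\<lambda>x y. Rr (x' * x) \<rhd> y) = ts (R1 (a \<odot> b)) (\<lambda>x y. ts (DL x' (t1 x y)) (\<lambda>p q. S p \<rhd> q))"
  by (simp add: antipode_left flip: t1_DL)
 also have "\<dots> = ts (DL x' (T1 H (R1 (a \<odot> b)))) (\<lambda>p q. S p \<rhd> q)"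
  by (rule ts_lin[symmetric, where f="\<lambda>t. ts (DL x' (T1 H t)) (\<lambda>p q. S p \<rhd> q)" and Z=A]) (intro lins | simp)+
 also have "\<dots> = ts (r1 (t1 x' b) a) (\<lambda>p q. S p \<rhd> q)" by (simp add: T1R1 DL_E1 DL_pure)
 also have "\<dots> = ts (t1 x' b) (\<lambda>p q. S a \<rhd> (S p \<rhd> q))"
  by (subst ts_lrA, (intro lins)+) (rule tsum_cong[OF vspace_A], simp add: S_mult)
 also have "\<dots> = S a \<rhd> (Rr x' \<rhd> b)" by (simp add: antipode_left flip: ts_ml)
 finally show ?thesis .
qed

text \<open>In the counterpart for \<open>\<epsilon>(x _)\<close> the matrix product \<open>evm \<phi> v\<close> is replaced by \<open>Rr x\<close>; this is \<open>Rr_mult_R1\<close>.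
Transfer to \<open>\<epsilon>(mc \<phi> v _)\<close>, then \<open>evm_R1\<close> and cancellation of \<open>S a\<close>.\<close>
lemma evm_slice: assumes p: "lin X scalars \<phi>" and v: "v \<in> carr X"
 shows "evm \<phi> v \<rhd> (b * c) = slr (ch \<phi> v) (t4 c b)"
proof -
 have lc: "lin A scalars (ch \<phi> v)" by (rule lin_ch[OF p v])
 have key: "(S a \<rhd> (evm \<phi> v \<rhd> b)) * c = S a \<rhd> slr (ch \<phi> v) (t4 c b)" for a
 proof -
  let ?t1 = "ts (R1 (a \<odot> b)) (\<lambda>x y. l2 x (t4 c y))" and ?t2 = "o1 (S a) (t4 c b)"
  have s2: "slr \<omega> ?t2 = S a \<rhd> slr \<omega> (t4 c b)" if "lin A scalars \<omega>" for \<omega>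
   unfolding slr_def by (subst ts_o(1)[where Z=A], (intro lins lin_comp[OF that])+)
    (simp add: ts_ml lin_scal[of A A "\<lambda>x. S a \<rhd> x", simplified] lins)
  have s1: "slr \<omega> ?t1 = ts (R1 (a \<odot> b)) (\<lambda>x y. slr (\<lambda>t. \<omega> (x * t)) (t4 c y))" if w: "lin A scalars \<omega>" for \<omega>
  proof -
   have "slr \<omega> ?t1 = ts (R1 (a \<odot> b)) (\<lambda>x y. slr \<omega> (l2 x (t4 c y)))"
    by (rule ts_pushAA[where f="\<lambda>t. slr \<omega> t" and Z'=A]) (intro lins w | simp)+
   moreover have "slr \<omega> (l2 x (t4 c y)) = slr (\<lambda>t. \<omega> (x * t)) (t4 c y)" for x y
    unfolding slr_def by (rule ts_lrA) (intro lins lin_comp[OF w])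
   ultimately show ?thesis by simp
  qed
  have rr: "slr (\<lambda>y. eps H (x * y)) (t4 c y) = (Rr x \<rhd> y) * c" for x y by (simp add: slr_def Rr_l_t4)
  \<comment> \<open>for \<open>\<epsilon>(x _)\<close> in place of \<open>ch \<phi> v\<close> both slices are \<open>S a (Rr x b) c\<close>\<close>
  have "slr (ch \<phi> v) (?t1 - ?t2) = 0"
  proof (rule transfer_r[OF _ lc])
   show "?t1 - ?t2 \<in> carr AA" by (rule vspace_diff[OF vspace_tprod]) (intro ts_carrAA | simp)+
   fix x
   have la: "lin A scalars (\<lambda>y. eps H (x * y))" by (intro lins)
   have "slr (\<lambda>y. eps H (x * y)) ?t1 = ts (R1 (a \<odot> b)) (\<lambda>z y. (Rr (x * z) \<rhd> y) * c)"
    by (simp add: s1[OF la] rr flip: mult.assoc)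
   also have "\<dots> = slr (\<lambda>y. eps H (x * y)) ?t2"
    by (simp add: s2[OF la] rr Rr_mult_R1 MM_l flip: ts_mul)
   finally show "slr (\<lambda>y. eps H (x * y)) (?t1 - ?t2) = 0"
    by (subst lin_diff[OF vspace_tprod lin_sl(1)[OF la lin_id]]) (intro ts_carrAA | simp)+
  next
   fix y assume "\<And>x. eps H (x * y) = 0"
   then have "Rb y = 0" by (rule Rb_0)
   then show "ch \<phi> v y = 0" by (rule eps_mc_0[OF _ p v])
  qed
  then have "slr (ch \<phi> v) ?t1 = slr (ch \<phi> v) ?t2"
   by (subst (asm) lin_diff[OF vspace_tprod lin_sl(1)[OF lc lin_id]]) (intro ts_carrAA | simp)+
  then have "ts (R1 (a \<odot> b)) (\<lambda>x y. (Rr (mc \<phi> v \<rhd> x) \<rhd> y) * c) = S a \<rhd> slr (ch \<phi> v) (t4 c b)"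
   by (simp add: s1[OF lc] s2[OF lc] MM_l p v rr)
  then show ?thesis by (simp add: evm_R1 p v flip: ts_mul)
 qed
 show ?thesis by (rule S_cancel) (simp add: MM_l p v flip: key)
qed

text \<open>By \<open>coord_expansion\<close> the same slices are the \<open>Rb (n i)\<close>.\<close>
lemma evm_base[simp]: assumes p: "lin X scalars \<phi>" and v: "v \<in> carr X" shows "evm \<phi> v \<in> carr R"
proof -
 obtain n where n: "\<And>i d e. Rb (n i) \<rhd> (d * e) = slr (ch (f i) v) (t4 e d)" using coord_expansion[OF v] by blast
 have "evm (f i) v = Rb (n i)" for i
 proof (rule MM_eq)
  fix x show "evm (f i) v \<rhd> x = Rb (n i) \<rhd> x"
   by (rule idemE[where Z=A and f="\<lambda>x. evm (f i) v \<rhd> x" and g="\<lambda>x. Rb (n i) \<rhd> x"]) (intro lins evN_MM fl v | simp add: evm_slice fl v n)+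
 qed (simp_all add: fl v)
 then have e: "evm (f i) v \<in> carr R" for i by simp
 have "evm \<phi> v = (\<Sum>i\<in>I. scal M (\<phi> (g i)) (evm (f i) v))"
 proof (rule mult_eqI)
  have l: "lin A A (\<lambda>x. Sb m \<rhd> x)" if "m \<in> MM" for m using that by (intro lins)
  have "Sb (mc \<phi> w) = (\<Sum>i\<in>I. scal M (\<phi> (g i)) (Sb (mc (f i) w)))" if w: "w \<in> carr X" for w
   by (subst mcM[OF p w], subst lin_sum[OF vspace_M lin_Sb[OF lin_id vspace_M]])
     (simp_all add: fl w vspace_scal lin_scal[OF lin_Sb[OF lin_id vspace_M]])
  then have s: "Sb (mc \<phi> w) \<rhd> y = (\<Sum>i\<in>I. asc H (\<phi> (g i)) (Sb (mc (f i) w) \<rhd> y))" 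
    "y \<lhd> Sb (mc \<phi> w) = (\<Sum>i\<in>I. asc H (\<phi> (g i)) (y \<lhd> Sb (mc (f i) w)))" if w: "w \<in> carr X" for w y
   using w by simp_all
  fix x
  interpret AV: vector_space "asc H" by (rule vs_A)
  show "evm \<phi> v \<rhd> x = (\<Sum>i\<in>I. scal M (\<phi> (g i)) (evm (f i) v)) \<rhd> x"
   by (simp add: evm_l s AV.scale_sum_right) (rule sum.swap)
  show "x \<lhd> evm \<phi> v = x \<lhd> (\<Sum>i\<in>I. scal M (\<phi> (g i)) (evm (f i) v))"
   unfolding evm_def by (simp add: s AV.scale_sum_right mr_sum mr_scal fl v) (rule sum.swap)
 qed
 moreover have "(\<Sum>i\<in>I. scal R (\<phi> (g i)) (evm (f i) v)) \<in> carr R" by (intro vspace_sum vR vspace_scal e)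
 ultimately show ?thesis by (simp add: scal_R)
qed

text \<open>From \<open>a\<^sub>1 S(a\<^sub>2) = L a\<close> at \<open>a mc \<phi> v\<close>, in which \<open>\<Delta>(a mc \<phi> v) = \<Delta>(a) X\<close>, one finds \<open>a\<^sub>1 Nm S(a\<^sub>2)\<close>. The factor
\<open>S(a\<^sub>2)\<close> is then removed with the other antipode axiom.\<close>
lemma Nm_slice: assumes p: "lin X scalars \<phi>" and v: "v \<in> carr X"
 shows "a * (Nm \<phi> v \<rhd> b) = sll (\<lambda>y. eps H (y \<lhd> mc \<phi> v)) (t1 a b)"
proof -
 let ?m = "mc \<phi> v" and ?N = "Nm \<phi> v"
 have m: "?m \<in> MM" by (simp add: p v)
 have LS: "x \<lhd> L (a \<lhd> ?m) = ts (t2 x a) (\<lambda>s t. (s \<lhd> ?N) \<lhd> S t)" for x a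
 proof -
  have t2m: "t2 x (a \<lhd> ?m) = XR \<phi> v (t2 x a)"
   by (rule nondegAA(2)) (simp_all add: DR_pure[symmetric] XR_DR[symmetric] XR_l[symmetric] p v)
  have "x \<lhd> L (a \<lhd> ?m) = ts (XR \<phi> v (t2 x a)) (\<lambda>s t. s \<lhd> S t)" by (simp add: antipode_right t2m)
  also have "\<dots> = ts (t2 x a) (\<lambda>s t. ts (XR \<phi> v (s \<odot> t)) (\<lambda>s t. s \<lhd> S t))"
   by (rule ts_lin[where f="\<lambda>u. ts (XR \<phi> v u) (\<lambda>s t. s \<lhd> S t)" and Z=A]) (intro lins p v | simp)+
  also have "\<dots> = ts (t2 x a) (\<lambda>s t. (s \<lhd> ?N) \<lhd> S t)"
  proof -
   have "ts (XR \<phi> v (s \<odot> t)) (\<lambda>s t. s \<lhd> S t) = (s \<lhd> ?N) \<lhd> S t" for s t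
   proof -
    have "ts (XR \<phi> v (s \<odot> t)) (\<lambda>s t. s \<lhd> S t) = (\<Sum>i\<in>I. ts ((s \<lhd> mc \<phi> (g i)) \<odot> (t \<lhd> mc (f i) v)) (\<lambda>s t. s \<lhd> S t))"
     unfolding XL_pure[OF p v] by (rule lin_sum[where X=AA and Y=A]) (intro lins | simp)+
    also have "\<dots> = (\<Sum>i\<in>I. ((s \<lhd> mc \<phi> (g i)) \<lhd> Sb (mc (f i) v)) \<lhd> S t)"
     by (intro sum.cong refl) (subst ts_pureA, (intro lins)+, simp add: S_act fl v)
    also have "\<dots> = (s \<lhd> ?N) \<lhd> S t"
     unfolding Nm_def by (simp add: mr_sum)
    finally show ?thesis .
   qed
   then show ?thesis by simp
  qed
  finally show ?thesis .
 qed
 have el: "L (x \<lhd> ?m) \<rhd> y = sll (\<lambda>y. eps H (y \<lhd> ?m)) (e1 x y)" for x y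
 proof (rule idemE[where Z=A and f="\<lambda>y. L (x \<lhd> ?m) \<rhd> y" and g="\<lambda>y. sll (\<lambda>y. eps H (y \<lhd> ?m)) (e1 x y)"])
  fix q p'
  have le: "lin A scalars (\<lambda>y. eps H (y \<lhd> ?m))" by (intro lins m)
  have "L (x \<lhd> ?m) \<rhd> (q * p') = ts (t1 q p') (\<lambda>r z. asc H (eps H (Rb r \<rhd> (x \<lhd> ?m))) z)"
   unfolding L_l E1_Rb by (subst el_ts) (simp_all add: el_pure)
  also have "\<dots> = sll (\<lambda>y. eps H (y \<lhd> ?m)) (e1 x (q * p'))"
   unfolding E1_Rb by (subst ts_pushAA[where f="sll (\<lambda>y. eps H (y \<lhd> ?m))" and Z'=A]) (intro lins m | simp add: sl_pure[OF le] MM_comm m)+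
  finally show "L (x \<lhd> ?m) \<rhd> (q * p') = sll (\<lambda>y. eps H (y \<lhd> ?m)) (e1 x (q * p'))" .
 qed (intro lins m)+
 have tr: "tri A (\<lambda>s t z. (s \<lhd> ?N) * (S t \<rhd> z))" by (intro lins evN_MM p v)
 have NS: "(x \<lhd> ?N) * (S d \<rhd> y) = ts (XR \<phi> v (x \<odot> d)) (\<lambda>s t. s * (S t \<rhd> y))" for x d y
 proof -
  have "ts (XR \<phi> v (x \<odot> d)) (\<lambda>s t. s * (S t \<rhd> y)) = (\<Sum>i\<in>I. ts ((x \<lhd> mc \<phi> (g i)) \<odot> (d \<lhd> mc (f i) v)) (\<lambda>s t. s * (S t \<rhd> y)))"
   unfolding XL_pure[OF p v] by (rule lin_sum[where X=AA and Y=A]) (intro lins | simp)+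
  also have "\<dots> = (\<Sum>i\<in>I. ((x \<lhd> mc \<phi> (g i)) \<lhd> Sb (mc (f i) v)) * (S d \<rhd> y))"
   by (intro sum.cong refl) (subst ts_pureA, (intro lins)+, simp add: S_act fl v flip: MM_bal)
  finally show ?thesis by (simp add: Nm_def sum_distrib_right)
 qed
 have Rt: "((q * a) \<lhd> ?N) * y = ts (t2 q a) (\<lambda>s t. (s \<lhd> ?N) * (Rr t \<rhd> y))" for q y
 proof (rule S_ext[where Z=A and f="\<lambda>y. ((q * a) \<lhd> ?N) * y" and g="\<lambda>y. ts (t2 q a) (\<lambda>s t. (s \<lhd> ?N) * (Rr t \<rhd> y))"], (intro lins)+)
  fix d y
  have "((q * a) \<lhd> ?N) * (S d \<rhd> y) = ts (XR \<phi> v (e2 (q * a) d)) (\<lambda>s t. s * (S t \<rhd> y))" by (simp add: NS XR_E2 p v)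
  also have "\<dots> = ts (t2 q a) (\<lambda>s t. ts (XR \<phi> v (s \<odot> (d \<lhd> Lb t))) (\<lambda>s t. s * (S t \<rhd> y)))"
   unfolding E2_Lb by (rule ts_pushAA[where f="\<lambda>u. ts (XR \<phi> v u) (\<lambda>s t. s * (S t \<rhd> y))" and Z'=A]) (intro lins p v | simp)+
  also have "\<dots> = ts (t2 q a) (\<lambda>s t. (s \<lhd> ?N) * (Rr t \<rhd> (S d \<rhd> y)))" by (simp add: S_Lbr flip: NS)
  finally show "((q * a) \<lhd> ?N) * (S d \<rhd> y) = ts (t2 q a) (\<lambda>s t. (s \<lhd> ?N) * (Rr t \<rhd> (S d \<rhd> y)))" .
 qed
 have 1: "a * (?N \<rhd> b) = ts (t1 a b) (\<lambda>x y. L (x \<lhd> ?m) \<rhd> y)"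
 proof (rule nondegA_eq(2))
  fix q
  have "q * (a * (?N \<rhd> b)) = ((q * a) \<lhd> ?N) * b" by (simp add: MM_bal MM_r p v mult.assoc)
  also have "\<dots> = ts (t2 q a) (\<lambda>s t. ts (t1 t b) (\<lambda>t z. (s \<lhd> ?N) * (S t \<rhd> z)))"
   by (simp add: Rt antipode_left flip: ts_mul)
  also have "\<dots> = ts (t1 a b) (\<lambda>x z. ts (t2 q x) (\<lambda>s t. (s \<lhd> ?N) * (S t \<rhd> z)))"
   by (rule T1_T2_commute[where Z=A and g="\<lambda>s t z. (s \<lhd> ?N) * (S t \<rhd> z)", symmetric]) (intro vspace_A tr)+
  also have "\<dots> = q * ts (t1 a b) (\<lambda>x y. L (x \<lhd> ?m) \<rhd> y)"
   by (simp add: ts_mul(2) MM_bal LS flip: ts_mul(1))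
  finally show "q * (a * (?N \<rhd> b)) = q * ts (t1 a b) (\<lambda>x y. L (x \<lhd> ?m) \<rhd> y)" .
 qed
 also have "\<dots> = sll (\<lambda>y. eps H (y \<lhd> ?m)) (E1 H (t1 a b))"
  unfolding el by (rule ts_lin[where f="\<lambda>t. sll (\<lambda>y. eps H (y \<lhd> ?m)) (E1 H t)" and Z=A, symmetric]) (intro lins m | simp)+
 finally show ?thesis by (simp add: E1_t1)
qed

text \<open>The axiom relating \<open>\<epsilon>\<close>, \<open>E\<close> and \<open>\<Delta>\<close> says that \<open>(1 \<otimes> a)E(1 \<otimes> b)\<close> and \<open>\<Delta>(a)(1 \<otimes> b)\<close> agree when their first legs are tested
with \<open>\<epsilon>(_ x)\<close>. By transfer they agree when tested with \<open>\<epsilon>(_ mc \<phi> v)\<close>, which is the action of \<open>R\<close> followed by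
\<open>\<phi>\<close>.\<close>
lemma Nm_E: assumes p: "lin X scalars \<phi>" and v: "v \<in> carr X" and t: "repE b t"
 shows "Nm \<phi> v \<rhd> b = tsum R A t (\<lambda>r z. asc H (\<phi> (lact H V r v)) z)"
proof (rule nondegA_eq(2))
 fix a
 let ?c = "\<lambda>y. eps H (y \<lhd> mc \<phi> v)"
 have lc: "lin A scalars ?c" by (intro lins mc_MM p v)
 have tc: "t \<in> carr (R \<otimes> alg H)" using t by (simp add: repE_def)
 from RA_rep[OF tc] obtain t' where t': "t' \<in> carr AA" "t = ts t' (\<lambda>y z. pure R A (Rr y) z)" by blast
 note lphi = lin_comp[OF p]
 have st: "tsum R A t b' = ts t' (\<lambda>y z. b' (Rr y) z)" if "vspace Z" "bilin R A Z b'" for b' and Z :: "('k,'z::ab_group_add) space"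
  unfolding t'(2) by (subst tsum_tsum[where Z=Z]) (auto simp: that pure_carr tsum_pure[OF vR that])
 have 1: "tsum R A t (\<lambda>r z. asc H (\<phi> (lact H V r v)) z) = sll ?c t'"
 proof -
  have b: "bilin R A A (\<lambda>r z. asc H (\<phi> (lact H V r v)) z)" by (intro lins lphi vR v)
  show ?thesis unfolding st[OF vspace_A b] by (simp add: sll_def phi_ract p v)
 qed
 have "sll ?c (t1 a b - l2 a t') = 0"
 proof (rule transfer_l[OF _ lc])
  show "t1 a b - l2 a t' \<in> carr AA" by (rule vspace_diff[OF vspace_tprod]) (simp_all add: t')
  fix x
  have la: "lin A scalars (\<lambda>y. eps H (y * x))" by (intro lins)
  have e: "sll (\<lambda>y. eps H (y * x)) t = el (r1 t x)" if t: "t \<in> carr AA" for t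
   by (rule AA_eq[OF _ _ t, where Z=A], (intro lins la)+) (simp add: sl_pure[OF la] el_pure)
  have "e1 x b = ts t' (\<lambda>y z. (Rr y \<rhd> x) \<odot> z)"
  proof -
   have b: "bilin R A AA (\<lambda>r z. (r \<rhd> x) \<odot> z)" by (intro lins R_MM | simp)+
   have "e1 x b = tsum R A t (\<lambda>r z. (r \<rhd> x) \<odot> z)" using t by (simp add: repE_def)
   also note st[OF vspace_tprod b]
   finally show ?thesis .
  qed
  then have "el (e1 x b) = sll (\<lambda>y. eps H (y * x)) t'"
   by (simp add: el_ts el_pure eps_Rr sll_def)
  then have "sll (\<lambda>y. eps H (y * x)) (t1 a b) = sll (\<lambda>y. eps H (y * x)) (l2 a t')"
   by (simp add: slr_lr la t') (simp add: e el_lr flip: counit_E)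
  then show "sll (\<lambda>y. eps H (y * x)) (t1 a b - l2 a t') = 0"
   by (subst lin_diff[OF vspace_tprod lin_sl(2)[OF la lin_id]]) (simp_all add: t')
 next
  fix y assume z: "\<And>x. eps H (y * x) = 0"
  then have "eps H (y * x) = eps H (0 * x)" for x by (simp add: lin_0[OF vspace_A lin_eps])
  then have "Rr y = Rr 0" by (rule Rr_eqI)
  then have "?c y = ?c 0" using phi_ract(2)[OF p v] by metis
  then show "?c y = 0" by (simp add: lin_0[OF vspace_A lc])
 qed
 then have "sll ?c (t1 a b) = sll ?c (l2 a t')"
  by (subst (asm) lin_diff[OF vspace_tprod lin_sl(2)[OF lc lin_id]]) (simp_all add: t')
 then show "a * (Nm \<phi> v \<rhd> b) = a * tsum R A t (\<lambda>r z. asc H (\<phi> (lact H V r v)) z)"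
  unfolding 1 by (simp add: Nm_slice p v slr_lr lc t'(1))
qed

text \<open>Reassociating gives \<open>\<Sum>i. Nm \<phi> (g i) mc (f i) v\<close>. By \<open>Nm_slice\<close> this is the counit applied to the first leg of
\<open>\<Delta>(a) X\<close>, where \<open>X\<close> turns \<open>\<Delta>(a)\<close> into \<open>\<Delta>(a mc \<phi> v)\<close>.\<close>
lemma triangle_mc: assumes p: "lin X scalars \<phi>" and v: "v \<in> carr X" shows "(\<Sum>k\<in>I. mc \<phi> (g k) \<rhd> (evm (f k) v \<rhd> b)) = mc \<phi> v \<rhd> b"
proof (rule nondegA_eq(2))
 fix a
 let ?t = "\<lambda>i. t1 a (mc (f i) v \<rhd> b)"
 have "(\<Sum>k\<in>I. mc \<phi> (g k) \<rhd> (evm (f k) v \<rhd> b)) = (\<Sum>i\<in>I. Nm \<phi> (g i) \<rhd> (mc (f i) v \<rhd> b))"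
  unfolding evm_l Nm_l by (simp add: ml_sum p) (rule sum.swap)
 then have "a * (\<Sum>k\<in>I. mc \<phi> (g k) \<rhd> (evm (f k) v \<rhd> b)) = (\<Sum>i\<in>I. sll (\<lambda>y. eps H (y \<lhd> mc \<phi> (g i))) (?t i))"
  by (simp add: sum_distrib_left Nm_slice p)
 also have "\<dots> = (\<Sum>i\<in>I. el (ts (?t i) (\<lambda>y z. (y \<lhd> mc \<phi> (g i)) \<odot> z)))"
  by (simp add: el_ts el_pure sll_def)
 also have "\<dots> = el (\<Sum>i\<in>I. ts (?t i) (\<lambda>y z. (y \<lhd> mc \<phi> (g i)) \<odot> z))"
  by (subst er_sum) (auto intro: ts_carrAA)
 also have "(\<Sum>i\<in>I. ts (?t i) (\<lambda>y z. (y \<lhd> mc \<phi> (g i)) \<odot> z)) = t1 (a \<lhd> mc \<phi> v) b"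
 proof (rule nondegAA(3))
  show "(\<Sum>i\<in>I. ts (?t i) (\<lambda>y z. (y \<lhd> mc \<phi> (g i)) \<odot> z)) \<in> carr AA" by (intro vspace_sum vspace_tprod ts_carrAA) simp
  fix d
  have "r1 (\<Sum>i\<in>I. ts (?t i) (\<lambda>y z. (y \<lhd> mc \<phi> (g i)) \<odot> z)) d = (\<Sum>i\<in>I. r1 (ts (?t i) (\<lambda>y z. (y \<lhd> mc \<phi> (g i)) \<odot> z)) d)"
   by (rule lin_sum[where X=AA and Y=AA, OF vspace_tprod]) (intro lins ts_carrAA | simp)+
  also have "\<dots> = (\<Sum>i\<in>I. r1 (?t i) (mc \<phi> (g i) \<rhd> d))"
  proof (rule sum.cong[OF refl])
   fix i
   have "r1 (ts (?t i) (\<lambda>y z. (y \<lhd> mc \<phi> (g i)) \<odot> z)) d = ts (?t i) (\<lambda>y z. ((y \<lhd> mc \<phi> (g i)) * d) \<odot> z)"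
    by (subst ts_pushAA[where f="\<lambda>t. r1 t d" and Z'=AA]) (intro lins | simp)+
   also have "\<dots> = ts (?t i) (\<lambda>y z. r1 (y \<odot> z) (mc \<phi> (g i) \<rhd> d))" by (simp add: MM_bal p)
   also have "\<dots> = r1 (?t i) (mc \<phi> (g i) \<rhd> d)"
    by (rule ts_lin[where f="\<lambda>t. r1 t (mc \<phi> (g i) \<rhd> d)" and Z=AA, symmetric]) (intro lins | simp)+
   finally show "r1 (ts (?t i) (\<lambda>y z. (y \<lhd> mc \<phi> (g i)) \<odot> z)) d = r1 (?t i) (mc \<phi> (g i) \<rhd> d)" .
  qed
  also have "\<dots> = (\<Sum>i\<in>I. DL a ((mc \<phi> (g i) \<rhd> d) \<odot> (mc (f i) v \<rhd> b)))" by (simp add: DL_pure)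
  also have "\<dots> = DL a (XL \<phi> v (d \<odot> b))"
   unfolding XL_pure[OF p v] by (rule lin_sum[where X=AA and Y=AA, OF vspace_tprod, symmetric]) (intro lins | simp)+
  also have "\<dots> = r1 (t1 (a \<lhd> mc \<phi> v) b) d" by (simp add: DL_XL p v DL_pure)
  finally show "r1 (\<Sum>i\<in>I. ts (?t i) (\<lambda>y z. (y \<lhd> mc \<phi> (g i)) \<odot> z)) d = r1 (t1 (a \<lhd> mc \<phi> v) b) d" .
 qed simp
 finally show "a * (\<Sum>k\<in>I. mc \<phi> (g k) \<rhd> (evm (f k) v \<rhd> b)) = a * (mc \<phi> v \<rhd> b)" by (simp add: counit_T MM_bal p v)
qed

lemma triangle_Sb: assumes p: "lin X scalars \<phi>" and v: "v \<in> carr X" shows "(\<Sum>k\<in>I. evm \<phi> (g k) \<rhd> (Sb (mc (f k) v) \<rhd> b)) = Sb (mc \<phi> v) \<rhd> b"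
proof -
 have "(\<Sum>k\<in>I. evm \<phi> (g k) \<rhd> (Sb (mc (f k) v) \<rhd> b)) = (\<Sum>i\<in>I. Sb (mc \<phi> (g i)) \<rhd> (Nm (f i) v \<rhd> b))"
  unfolding evm_l Nm_l by (simp add: ml_sum p fl v) (rule sum.swap)
 also have "\<dots> = Sb (mc \<phi> v) \<rhd> b"
 proof (rule idemE[where Z=A and f="\<lambda>b. \<Sum>i\<in>I. Sb (mc \<phi> (g i)) \<rhd> (Nm (f i) v \<rhd> b)" and g="\<lambda>b. Sb (mc \<phi> v) \<rhd> b"])
  fix x y
  note lphi = lin_comp[OF fl]
  have 1: "Nm (f i) v \<rhd> (x * y) = ts (t1 x y) (\<lambda>y z. asc H (f i (lact H V (Rb y) v)) z)" for i
   unfolding Nm_E[OF fl v repE_pq]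
   by (subst tsum_tsum[where Z=A], auto simp: pure_carr intro!: lins lin_f v) (subst tsum_pure[where Z=A], (auto intro!: lins lin_f v)[3], simp_all)
  have "(\<Sum>i\<in>I. Sb (mc \<phi> (g i)) \<rhd> (Nm (f i) v \<rhd> (x * y))) = ts (t1 x y) (\<lambda>y z. \<Sum>i\<in>I. asc H (f i (lact H V (Rb y) v)) (Sb (mc \<phi> (g i)) \<rhd> z))"
   using lin_scal[of A A "\<lambda>x. Sb (mc \<phi> (g _)) \<rhd> x"] by (simp add: 1 ts_ml p tsum_sum lins)
  also have "\<dots> = ts (t1 x y) (\<lambda>y z. Sb (mc \<phi> v) \<rhd> (L y \<rhd> z))"
  proof (intro tsum_cong vspace_A)
   fix y z :: 'a
   have "(\<Sum>i\<in>I. asc H (f i (lact H V (Rb y) v)) (Sb (mc \<phi> (g i)) \<rhd> z)) = Sb (mc \<phi> (lact H V (Rb y) v)) \<rhd> z"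
    using exp_lin[of A "\<lambda>v. Sb (mc \<phi> v) \<rhd> z" "lact H V (Rb y) v"] by (simp add: lins p v)
   then show "(\<Sum>i\<in>I. asc H (f i (lact H V (Rb y) v)) (Sb (mc \<phi> (g i)) \<rhd> z)) = Sb (mc \<phi> v) \<rhd> (L y \<rhd> z)"
    by (simp add: p v Sb_mp Sb_Rb)
  qed
  also have "\<dots> = Sb (mc \<phi> v) \<rhd> (x * y)" by (simp add: p v L_t1 flip: ts_ml)
  finally show "(\<Sum>i\<in>I. Sb (mc \<phi> (g i)) \<rhd> (Nm (f i) v \<rhd> (x * y))) = Sb (mc \<phi> v) \<rhd> (x * y)" .
 qed (intro lins mc_MM Sb_MM evN_MM fl p v gc; simp)+
 finally show ?thesis .
qed

text \<open>The coaction of the unit comodule on \<open>evm \<phi> v\<close> is the product coaction of the dual and \<open>V\<close>, evaluated. By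
\<open>evm_slice\<close> the first legs on the right are slices of \<open>\<Delta>(b)(c \<otimes> 1)\<close>; the functional used acts on the second leg as \<open>L\<close>,
because \<open>Sb (Rb t) = L t\<close>. So the right side becomes \<open>E\<close>, whose second leg consists of values of \<open>L\<close>.\<close>
lemma E1_evm: assumes p: "lin X scalars \<phi>" and v: "v \<in> carr X"
 shows "e1 x (evm \<phi> v \<rhd> a) = (\<Sum>j\<in>I. \<Sum>i\<in>I. (evm (f j) (g i) \<rhd> x) \<odot> (Sb (mc \<phi> (g j)) \<rhd> (mc (f i) v \<rhd> a)))"
proof (rule idemE[where Z=AA and f="\<lambda>x. e1 x (evm \<phi> v \<rhd> a)" and g="\<lambda>x. \<Sum>j\<in>I. \<Sum>i\<in>I. (evm (f j) (g i) \<rhd> x) \<odot> (Sb (mc \<phi> (g j)) \<rhd> (mc (f i) v \<rhd> a))"])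
 fix b c
 let ?k = "\<lambda>j i. Sb (mc \<phi> (g j)) \<rhd> (mc (f i) v \<rhd> a)"
 have 1: "(evm (f j) (g i) \<rhd> (b * c)) \<odot> ?k j i = ts (t4 c b) (\<lambda>s t. s \<odot> asc H (eps H (mc (f j) (g i) \<rhd> t)) (?k j i))" for j i
  by (simp add: evm_slice fl slr_def ts_tpL asc_tp)
 have "(\<Sum>j\<in>I. \<Sum>i\<in>I. (evm (f j) (g i) \<rhd> (b * c)) \<odot> ?k j i)
   = ts (t4 c b) (\<lambda>s t. \<Sum>j\<in>I. \<Sum>i\<in>I. s \<odot> asc H (eps H (mc (f j) (g i) \<rhd> t)) (?k j i))"
  by (simp add: 1 tsum_sum)
 also have "\<dots> = ts (t4 c b) (\<lambda>s t. s \<odot> (L t \<rhd> (evm \<phi> v \<rhd> a)))"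
 proof (intro tsum_cong vspace_A)
  fix s t :: 'a
  have ts: "s \<odot> (\<Sum>i\<in>I. y i) = (\<Sum>i\<in>I. s \<odot> y i)" for y :: "'i \<Rightarrow> 'a"
   by (rule lin_sum[OF vspace_A]) (auto intro!: lins)
  have "(\<Sum>j\<in>I. asc H (eps H (mc (f j) (g i) \<rhd> t)) (Sb (mc \<phi> (g j)) \<rhd> z)) = L t \<rhd> (Sb (mc \<phi> (g i)) \<rhd> z)" for i z
  proof -
   have "(\<Sum>j\<in>I. asc H (f j (actv (g i) t)) (Sb (mc \<phi> (g j)) \<rhd> z)) = Sb (mc \<phi> (actv (g i) t)) \<rhd> z"
    using exp_lin[of A "\<lambda>v. Sb (mc \<phi> v) \<rhd> z" "actv (g i) t"] by (simp add: lins p)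
   then show ?thesis by (simp add: phi_act fl mc_actv p Sb_mp Sb_Rb)
  qed
  then have "(\<Sum>i\<in>I. \<Sum>j\<in>I. asc H (eps H (mc (f j) (g i) \<rhd> t)) (?k j i)) = L t \<rhd> (evm \<phi> v \<rhd> a)"
   by (simp add: evm_l ml_sum)
  then have "(\<Sum>j\<in>I. \<Sum>i\<in>I. asc H (eps H (mc (f j) (g i) \<rhd> t)) (?k j i)) = L t \<rhd> (evm \<phi> v \<rhd> a)"
   by (subst sum.swap)
  then show "(\<Sum>j\<in>I. \<Sum>i\<in>I. s \<odot> asc H (eps H (mc (f j) (g i) \<rhd> t)) (?k j i)) = s \<odot> (L t \<rhd> (evm \<phi> v \<rhd> a))"
   by (simp flip: ts)
 qed
 finally show "e1 (b * c) (evm \<phi> v \<rhd> a) = (\<Sum>j\<in>I. \<Sum>i\<in>I. (evm (f j) (g i) \<rhd> (b * c)) \<odot> ?k j i)" by (simp add: E1_L)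
qed (intro lins evN_MM fl p gc; assumption?)+
end

context antip begin
lemma eps_S: "eps H (S b \<rhd> a) = eps H (Rb a \<rhd> b)"
proof -
 have "eps H (S b \<rhd> a) = ts (R1 (b \<odot> a)) (\<lambda>p q. eps H (Rr p \<rhd> q))" unfolding Rr_R1[symmetric] by (rule ts_pushA[OF lin_eps])
 also have "\<dots> = eps H (ts (R1 (b \<odot> a)) (\<lambda>p q. p * q))" unfolding eps_Rr by (rule ts_pushA[OF lin_eps, symmetric])
 also have "\<dots> = eps H (Rb a \<rhd> b)" by (simp add: mult_R1 L_l Rb_l eps_el_er)
 finally show ?thesis .
qed
lemma Rr_Lb: "Rr (Lb u \<rhd> p) = Rr (u * p)"
proof (rule Rr_eqI)
 fix y
 have "eps H ((Lb u \<rhd> p) * y) = eps H (el (t2 u (p * y)))" by (simp add: MM_l[symmetric]) (simp add: Lb_l)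
 also have "\<dots> = eps H (er (t2 u (p * y)))" by (simp only: eps_el_er)
 finally show "eps H ((Lb u \<rhd> p) * y) = eps H (u * p * y)" by (simp add: counit_T mult.assoc)
qed
text \<open>The behaviour of the counital maps under the antipode, \<open>\<epsilon>(S(b) a) = \<epsilon>(Rb(a) b)\<close> being the case of the counit.\<close>
lemma Rb_S: "Rb (S b \<rhd> a) = Rr (Rb a \<rhd> b)"
proof (rule MM_eq)
 fix x
 obtain a' where a': "Rb a = Rr a'" by (rule R_E(2)[OF R_Rb])
 have R2: "Rr (Rr a' \<rhd> b) = Rr (a' * b)" for b
  by (rule Rr_eqI) (simp add: MM_l[symmetric] eps_Rr mult.assoc)
 show "Rb (S b \<rhd> a) \<rhd> x = Rr (Rb a \<rhd> b) \<rhd> x"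
 proof (rule idemE[where Z=A and f="\<lambda>b. Rb (S b \<rhd> a) \<rhd> x" and g="\<lambda>b. Rr (Rb a \<rhd> b) \<rhd> x"], (intro lins R_MM R_Rb)+)
  fix q p
  have "Rb (S (q * p) \<rhd> a) \<rhd> x = ts (t2 q p) (\<lambda>s t. asc H (eps H (a' * s)) (Rr t \<rhd> x))"
   unfolding Rb_l E1_S by (subst ts_pushAA[where f=er and Z'=A]) (intro lins | simp add: er_pure eps_S a' eps_Rr)+
  also have "\<dots> = Rr (ts (t2 q p) (\<lambda>s t. asc H (eps H (a' * s)) t)) \<rhd> x"
   using lin_scal[of A A "\<lambda>t. Rr t \<rhd> x"] by (subst ts_pushA[of A "\<lambda>t. Rr t \<rhd> x"]) (simp_all add: lins)
  also have "ts (t2 q p) (\<lambda>s t. asc H (eps H (a' * s)) t) = Lb (a' * q) \<rhd> p"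
   unfolding Lb_l t2L el_def by (subst ts_lrA) (intro lins | simp)+
  finally show "Rb (S (q * p) \<rhd> a) \<rhd> x = Rr (Rb a \<rhd> (q * p)) \<rhd> x" by (simp add: a' R2 Rr_Lb mult.assoc)
 qed
qed simp_all
text \<open>For \<open>c = S(b) a\<close> the element \<open>c' = Rb(a) b\<close> works, and the condition is linear in \<open>c\<close> and \<open>c'\<close>. In this way the right action of
\<open>R\<close> on the dual becomes the transpose of its left action on \<open>V\<close>.\<close>
lemma eps_Sb: "\<exists>c'. Rr c' = Rb c \<and> (\<forall>m\<in>MM. eps H (Sb m \<rhd> c) = eps H (c' \<lhd> m))"
proof -
 interpret vector_space "asc H" by (rule vs_A)
 have "c \<in> span {S b \<rhd> a | a b. True}" by (subst SA_span) (rule UNIV_I)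
 then show ?thesis
 proof (induction rule: span_induct_alt)
  case base
  have "Rr 0 = 0" "Rb 0 = 0" using lin_0[OF vspace_A lin_Rb[OF lin_id]] lin_0[OF vspace_A lin_Rr[OF lin_id]] by simp_all
  then show ?case by (intro exI[of _ 0]) (simp add: MM_0 lin_0[OF vspace_A lin_mrI])
 next
  case (step k x y)
  then obtain a b where x: "x = S b \<rhd> a" by blast
  from step obtain y' where y: "Rr y' = Rb y" "\<And>m. m \<in> MM ==> eps H (Sb m \<rhd> y) = eps H (y' \<lhd> m)" by blast
  have "Rr (asc H k (Rb a \<rhd> b) + y') = Rb (asc H k x + y)"
   using lin_add[OF lin_Rb[OF lin_id], of "asc H k x" y] lin_scal[OF lin_Rb[OF lin_id], of x k]
    lin_add[OF lin_Rr[OF lin_id], of "asc H k (Rb a \<rhd> b)" y'] lin_scal[OF lin_Rr[OF lin_id], of "Rb a \<rhd> b" k]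
   by (simp add: y x Rb_S)
  moreover have "eps H (Sb m \<rhd> (asc H k x + y)) = eps H ((asc H k (Rb a \<rhd> b) + y') \<lhd> m)" if m: "m \<in> MM" for m
  proof -
   have l: "lin A scalars (\<lambda>c. eps H (Sb m \<rhd> c))" and l': "lin A scalars (\<lambda>c. eps H (c \<lhd> m))" by (intro lins m Sb_MM)+
   show ?thesis using lin_add[OF l, of "asc H k x" y] lin_scal[OF l, of x k]
     lin_add[OF l', of "asc H k (Rb a \<rhd> b)" y'] lin_scal[OF l', of "Rb a \<rhd> b" k]
    by (simp add: y m x Sb_l eps_S MM_comm)
  qed
  ultimately show ?case by blast
 qed
qed
end

lemma fun_sum_apply: "(\<Sum>i\<in>K. F i) x = (\<Sum>i\<in>K. (F i x :: 'b::comm_monoid_add))"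
 by (induction K rule: infinite_finite_induct) simp_all

lemma (in frame) tens_exp:
 assumes Y: "vspace Y" and t: "t \<in> carr (X \<otimes> Y)" shows "t = (\<Sum>i\<in>I. pure X Y (g i) (tsum X Y t (\<lambda>v a. scal Y (f i v) a)))"
proof (rule lin_tens_eq[OF vX _ _ t, where Z="X \<otimes> Y"])
 have b: "bilin X Y Y (\<lambda>v a. scal Y (f i v) a)" for i by (intro lins lin_f Y; assumption?)
 show "lin (X \<otimes> Y) (X \<otimes> Y) (\<lambda>t. t)" by (intro lins)
 show "lin (X \<otimes> Y) (X \<otimes> Y) (\<lambda>t. \<Sum>i\<in>I. pure X Y (g i) (tsum X Y t (\<lambda>v a. scal Y (f i v) a)))"
  by (intro lin_sumI vspace_tprod lin_pure2 gc lin_tsum_op vX Y b)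
 fix v a assume v: "v \<in> carr X" and a: "a \<in> carr Y"
 have "pure X Y v a = (\<Sum>i\<in>I. scal (X \<otimes> Y) (f i v) (pure X Y (g i) a))"
  by (rule exp_lin[of "X \<otimes> Y" "\<lambda>v. pure X Y v a", OF _ v]) (intro lins a)
 also have "\<dots> = (\<Sum>i\<in>I. pure X Y (g i) (scal Y (f i v) a))"
  using lin_scal[of Y "X \<otimes> Y" "\<lambda>a. pure X Y (g _) a" a] by (simp add: lins a)
 also have "\<dots> = (\<Sum>i\<in>I. pure X Y (g i) (tsum X Y (pure X Y v a) (\<lambda>v a. scal Y (f i v) a)))"
  by (simp only: tsum_pure[OF vX Y b v a])
 finally show "pure X Y v a = (\<Sum>i\<in>I. pure X Y (g i) (tsum X Y (pure X Y v a) (\<lambda>v a. scal Y (f i v) a)))" .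
qed

section \<open>The dual comodule\<close>

lemma carr_dual: "\<phi> \<in> carr (dual X) \<longleftrightarrow> lin X scalars \<phi> \<and> (\<forall>x. x \<notin> carr X \<longrightarrow> \<phi> x = 0)" by (simp add: dual_def)
lemma scal_dual: "scal (dual X) = fscal" by (simp add: dual_def)
lemma vspace_dual[simp, lins]: assumes "vspace X" shows "vspace (dual X)"
proof -
 interpret F: vector_space "fscal :: 'a \<Rightarrow> ('b \<Rightarrow> 'a) \<Rightarrow> _" by (rule vector_space_fscal)
 have "F.subspace (carr (dual X))"
  by (rule F.subspaceI) (auto simp: carr_dual lin_def fscal_def algebra_simps)
 then show ?thesis by (simp add: vspace_def scal_dual vector_space_fscal)
qed
lemma lin_dual_ev: "lin (dual X) scalars (\<lambda>\<phi>. \<phi> v)" by (auto simp: lin_def scal_dual fscal_def)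

context frame begin
definition "fd i = (\<lambda>v. if v \<in> carr X then f i v else 0)"
lemma fd_c[simp, lins]: "fd i \<in> carr (dual X)"
 using fl[of i] vX by (auto simp: carr_dual fd_def lin_def vspace_add vspace_scal)
lemma fd_v: "v \<in> carr X ==> fd i v = f i v" by (simp add: fd_def)
lemma dual_frame: "frame (dual X) I fd (\<lambda>i \<phi>. \<phi> (g i))"
proof
 show "vspace (dual X)" by simp
 show "finite I" by (rule fin)
 show "lin (dual X) scalars (\<lambda>\<phi>. \<phi> (g i))" for i by (rule lin_dual_ev)
 fix \<phi> assume p: "\<phi> \<in> carr (dual X)"
 show "\<phi> = (\<Sum>i\<in>I. scal (dual X) (\<phi> (g i)) (fd i))"
 proof (rule ext)
  fix v
  have "\<phi> v = (\<Sum>i\<in>I. \<phi> (g i) * fd i v)"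
  proof (cases "v \<in> carr X")
   case True
   then show ?thesis using exp_lin[of scalars \<phi> v] p by (simp add: carr_dual fd_v mult.commute)
  next
   case False then show ?thesis using p by (simp add: carr_dual fd_def)
  qed
  then show "\<phi> v = (\<Sum>i\<in>I. scal (dual X) (\<phi> (g i)) (fd i)) v" by (simp add: scal_dual fun_sum_apply fscal_def)
 qed
qed simp
end

context dfd begin
abbreviation D where "D \<equiv> dual (sp V)"
lemma dual_lin: "\<phi> \<in> carr D ==> lin X scalars \<phi>" by (simp add: carr_dual)
lemma lin_mcphi: assumes v: "v \<in> carr X" shows "lin D M (\<lambda>\<phi>. mc \<phi> v)"
proof (rule lin_cong[of D "\<lambda>\<phi>. \<Sum>i\<in>I. scal M (\<phi> (g i)) (mc (f i) v)"])
 show "(\<Sum>i\<in>I. scal M (\<phi> (g i)) (mc (f i) v)) = mc \<phi> v" if "\<phi> \<in> carr D" for \<phi> using mcM[OF dual_lin[OF that] v] ..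
 show "lin D M (\<lambda>\<phi>. \<Sum>i\<in>I. scal M (\<phi> (g i)) (mc (f i) v))"
  by (intro lin_sumI vspace_M lin_scal2 lin_dual_ev mc_MM fl v)
qed simp
lemma lin_mcphiI[lins]: "lin W D h ==> v \<in> carr X ==> lin W M (\<lambda>w. mc (h w) v)" by (rule lin_comp[OF lin_mcphi])

lemma dual_eval_eq: assumes t: "t \<in> carr (D \<otimes> alg H)" shows "dual_eval H X t v = tsum D A t (\<lambda>\<phi> a. asc H (\<phi> v) a)"
proof -
 have b: "bilin D A A (\<lambda>\<phi> a. asc H (\<phi> v) a)" by (intro bilinI lin_asc1 lin_asc2 lin_dual_ev lin_id)
 show ?thesis unfolding dual_eval_def
  by (rule lin_tens_eq[OF vspace_dual[OF vX] lift_lin[OF vspace_A b] lin_tsum_op[OF vspace_dual[OF vX] vspace_A b] t])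
   (simp add: lift_pure[OF vspace_A b] tsum_pure[OF vspace_dual[OF vX] vspace_A b])
qed
lemma dual_exp: assumes t: "t \<in> carr (D \<otimes> alg H)" shows "t = (\<Sum>i\<in>I. pure D A (fd i) (dual_eval H X t (g i)))"
 using frame.tens_exp[OF dual_frame vspace_A t] by (simp add: dual_eval_eq[OF t])
lemma dual_eval_sum: "dual_eval H X (\<Sum>i\<in>I. pure D A (fd i) (y i)) v = (\<Sum>i\<in>I. asc H (fd i v) (y i))"
proof -
 have b: "bilin D A A (\<lambda>\<phi> a. asc H (\<phi> v) a)" by (intro bilinI lin_asc1 lin_asc2 lin_dual_ev lin_id)
 show ?thesis unfolding dual_eval_def
  by (subst lin_sum[OF vspace_tprod lift_lin[OF vspace_A b]]) (auto intro!: sum.cong simp: pure_carr lift_pure[OF vspace_A b])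
qed

lemma S_mc: assumes p: "\<phi> \<in> carr D" and v: "v \<in> carr X"
 shows "phi_S H X \<phi> S (rho V (pure X A v b)) \<rhd> a = S (b \<lhd> mc \<phi> v) \<rhd> a" "a \<lhd> phi_S H X \<phi> S (lam V (pure X A v b)) = a \<lhd> S (mc \<phi> v \<rhd> b)"
proof -
 have p': "lin X scalars \<phi>" by (rule dual_lin[OF p])
 note c = lin_comp[OF p']
 have b: "bilin X A M (\<lambda>v a. scal M (\<phi> v) (S a))" by (intro lins c S_MM)
 have s: "phi_S H X \<phi> S (\<Sum>i\<in>I. pure X A (g i) (y i)) = (\<Sum>i\<in>I. scal M (\<phi> (g i)) (S (y i)))" for y
  unfolding phi_S_def by (subst lin_sum[OF vspace_tprod lift_lin[OF vspace_M b]]) (auto intro!: sum.cong simp: lift_pure[OF vspace_M b])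
 have l: "lin A A (\<lambda>b. S b \<rhd> a)" "lin A A (\<lambda>b. a \<lhd> S b)" by (intro lins)+
 show "phi_S H X \<phi> S (rho V (pure X A v b)) \<rhd> a = S (b \<lhd> mc \<phi> v) \<rhd> a"
  unfolding rho_exp[OF v] s mc_exp[OF p' v] by (simp add: lin_sum[OF vspace_A l(1)] lin_scal[OF l(1), simplified])
 show "a \<lhd> phi_S H X \<phi> S (lam V (pure X A v b)) = a \<lhd> S (mc \<phi> v \<rhd> b)"
  unfolding lam_exp[OF v] s mc_exp[OF p' v] by (simp add: lin_sum[OF vspace_A l(2)] lin_scal[OF l(2), simplified])
qed

text \<open>The defining conditions prescribe the maps on \<open>\<phi> \<otimes> S(b) a\<close> and \<open>\<phi> \<otimes> a S(b)\<close>. As these elements span, they mean that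
the maps have the matrix \<open>Sb (mc \<phi> (g k))\<close>.\<close>
lemma dual_structure_iff: "(dual_structure H S V lamS rhoS) = (lin (D \<otimes> alg H) (D \<otimes> alg H) lamS \<and> lin (D \<otimes> alg H) (D \<otimes> alg H) rhoS \<and>
  (\<forall>\<phi>\<in>carr D. \<forall>b. lamS (pure D A \<phi> b) = (\<Sum>k\<in>I. pure D A (fd k) (Sb (mc \<phi> (g k)) \<rhd> b)) \<and> rhoS (pure D A \<phi> b) = (\<Sum>k\<in>I. pure D A (fd k) (b \<lhd> Sb (mc \<phi> (g k))))))"
 (is "?l = ?r")
proof
 assume ds: ?l
 then have l: "lin (D \<otimes> alg H) (D \<otimes> alg H) lamS" and r: "lin (D \<otimes> alg H) (D \<otimes> alg H) rhoS" by (simp_all add: dual_structure_def Let_def)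
 have "lamS (pure D A \<phi> b) = (\<Sum>k\<in>I. pure D A (fd k) (Sb (mc \<phi> (g k)) \<rhd> b)) \<and> rhoS (pure D A \<phi> b) = (\<Sum>k\<in>I. pure D A (fd k) (b \<lhd> Sb (mc \<phi> (g k))))" if p: "\<phi> \<in> carr D" for \<phi> b
 proof
  have c: "pure D A \<phi> b \<in> carr (D \<otimes> alg H)" for b by (simp add: pure_carr p)
  show "lamS (pure D A \<phi> b) = (\<Sum>k\<in>I. pure D A (fd k) (Sb (mc \<phi> (g k)) \<rhd> b))"
  proof (rule S_ext[where Z="D \<otimes> alg H" and f="\<lambda>b. lamS (pure D A \<phi> b)" and g="\<lambda>b. \<Sum>k\<in>I. pure D A (fd k) (Sb (mc \<phi> (g k)) \<rhd> b)"])
   fix b a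
   have "dual_eval H X (lamS (pure D A \<phi> (S b \<rhd> a))) (g k) = Sb (mc \<phi> (g k)) \<rhd> (S b \<rhd> a)" for k
    using ds p by (simp add: dual_structure_def Let_def S_mc Sb_l dual_lin)
   then show "lamS (pure D A \<phi> (S b \<rhd> a)) = (\<Sum>k\<in>I. pure D A (fd k) (Sb (mc \<phi> (g k)) \<rhd> (S b \<rhd> a)))"
    by (subst dual_exp[OF lin_carr[OF l c]]) simp
  qed (intro lins lin_comp[OF l] dual_lin p)+
  show "rhoS (pure D A \<phi> b) = (\<Sum>k\<in>I. pure D A (fd k) (b \<lhd> Sb (mc \<phi> (g k))))"
  proof (rule S_extr[where Z="D \<otimes> alg H" and f="\<lambda>b. rhoS (pure D A \<phi> b)" and g="\<lambda>b. \<Sum>k\<in>I. pure D A (fd k) (b \<lhd> Sb (mc \<phi> (g k)))"])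
   fix a b
   have "dual_eval H X (rhoS (pure D A \<phi> (a \<lhd> S b))) (g k) = (a \<lhd> S b) \<lhd> Sb (mc \<phi> (g k))" for k
    using ds p by (simp add: dual_structure_def Let_def S_mc Sb_r dual_lin)
   then show "rhoS (pure D A \<phi> (a \<lhd> S b)) = (\<Sum>k\<in>I. pure D A (fd k) ((a \<lhd> S b) \<lhd> Sb (mc \<phi> (g k))))"
    by (subst dual_exp[OF lin_carr[OF r c]]) simp
  qed (intro lins lin_comp[OF r] dual_lin p)+
 qed
 then show ?r using l r by blast
next
 assume r: ?r
 have s: "(\<Sum>k\<in>I. asc H (f k v) (F (g k))) = F v" if "lin X A F" "v \<in> carr X" for F v using exp_lin[OF that] by simp
 show ?l unfolding dual_structure_def Let_def
 proof (intro conjI ballI allI)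
  fix \<phi> a b v assume p: "\<phi> \<in> carr D" and v: "v \<in> carr X"
  have l: "lin X A (\<lambda>v. Sb (mc \<phi> v) \<rhd> a)" "lin X A (\<lambda>v. a \<lhd> Sb (mc \<phi> v))" for a by (intro lins dual_lin[OF p])+
  show "dual_eval H X (lamS (pure D A \<phi> (S b \<rhd> a))) v = phi_S H X \<phi> S (rho V (pure X A v b)) \<rhd> a"
   using r p v s[OF l(1)[of "S b \<rhd> a"] v] by (simp add: dual_eval_sum S_mc fd_v Sb_l dual_lin)
  show "dual_eval H X (rhoS (pure D A \<phi> (a \<lhd> S b))) v = a \<lhd> phi_S H X \<phi> S (lam V (pure X A v b))"
   using r p v s[OF l(2)[of "a \<lhd> S b"] v] by (simp add: dual_eval_sum S_mc fd_v Sb_r dual_lin)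
 qed (use r in blast)+
qed

lemma dual_structure_exists: "\<exists>lamS rhoS. dual_structure H S V lamS rhoS"
proof -
 have b: "bilin D A (D \<otimes> alg H) (\<lambda>\<phi> b. \<Sum>k\<in>I. pure D A (fd k) (Sb (mc \<phi> (g k)) \<rhd> b))"
   "bilin D A (D \<otimes> alg H) (\<lambda>\<phi> b. \<Sum>k\<in>I. pure D A (fd k) (b \<lhd> Sb (mc \<phi> (g k))))"
  by (intro lins dual_lin vX; assumption?)+
 show ?thesis unfolding dual_structure_iff
  by (rule exI, rule exI, intro conjI ballI allI, rule lift_lin[OF vspace_tprod b(1)], rule lift_lin[OF vspace_tprod b(2)],
    rule lift_pure[OF vspace_tprod b(1)], simp_all add: lift_pure[OF vspace_tprod b(2)])
qed

abbreviation "XD \<phi> v \<equiv> XX I (\<lambda>i. Sb (mc (f i) v)) (\<lambda>i. Sb (mc \<phi> (g i)))"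
text \<open>\<open>XD\<close> is \<open>S \<otimes> S\<close> with a flip of the matrix \<open>X\<close>; the flip is compensated by the exchange of vectors and functionals.\<close>
lemma XD_S2: assumes p: "lin X scalars \<phi>" and v: "v \<in> carr X" and t: "t \<in> carr AA" and z: "z \<in> carr AA"
 shows "XD \<phi> v (S2 t z) = S2 (XR \<phi> v t) z"
  "S2 t (XD \<phi> v z) = S2 (XL \<phi> v t) z"
proof -
 have lX[lins]: "lin W AA (\<lambda>w. XD \<phi> v (h w))" if "lin W AA h" for h and W :: "('k,'w::ab_group_add) space"
  using that by (intro lins) (simp_all add: p fl v)
 have Xp: "XD \<phi> v (x \<odot> y) = (\<Sum>i\<in>I. (Sb (mc (f i) v) \<rhd> x) \<odot> (Sb (mc \<phi> (g i)) \<rhd> y))" for x y by (rule XX_pure) (simp_all add: p fl v)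
 have s2: "S2 (\<Sum>i\<in>I. y i) z = (\<Sum>i\<in>I. S2 (y i) z)" "S2 t (\<Sum>i\<in>I. y i) = (\<Sum>i\<in>I. S2 t (y i))" if "\<And>i. i \<in> I ==> y i \<in> carr AA" for y z t
  using that by (intro lin_sum[where X=AA and Y=AA] lins; assumption)+
 have b: "XD \<phi> v (S2 (a \<odot> b) (x \<odot> y)) = S2 (XR \<phi> v (a \<odot> b)) (x \<odot> y)" "S2 (a \<odot> b) (XD \<phi> v (x \<odot> y)) = S2 (XL \<phi> v (a \<odot> b)) (x \<odot> y)" for a b x y
  by (simp_all add: S2_pure Xp XL_pure p v s2 fl S_act)
 show "XD \<phi> v (S2 t z) = S2 (XR \<phi> v t) z"
 proof (rule AA_eq[OF _ _ t, where Z=AA], (intro lins p v)+)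
  fix a b' show "XD \<phi> v (S2 (a \<odot> b') z) = S2 (XR \<phi> v (a \<odot> b')) z"
   by (rule AA_eq[OF _ _ z, where Z=AA], (intro lins p v)+) (rule b(1))
 qed
 show "S2 t (XD \<phi> v z) = S2 (XL \<phi> v t) z"
 proof (rule AA_eq[OF _ _ t, where Z=AA], (intro lins p v)+)
  fix a b' show "S2 (a \<odot> b') (XD \<phi> v z) = S2 (XL \<phi> v (a \<odot> b')) z"
   by (rule AA_eq[OF _ _ z, where Z=AA], (intro lins p v)+) (rule b(2))
 qed
qed

lemma XD_E1: assumes p: "lin X scalars \<phi>" and v: "v \<in> carr X" and t: "t \<in> carr AA"
 shows "XD \<phi> v (E1 H t) = XD \<phi> v t"
proof (rule S2_ext[OF vAA _ _ _ t, where f="\<lambda>t. XD \<phi> v (E1 H t)" and g="\<lambda>t. XD \<phi> v t"])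
 show "lin AA AA (\<lambda>t. XD \<phi> v (E1 H t))" "lin AA AA (XD \<phi> v)" by (intro lins; simp add: p fl v)+
 fix c d x y
 show "XD \<phi> v (E1 H (S2 (c \<odot> d) (x \<odot> y))) = XD \<phi> v (S2 (c \<odot> d) (x \<odot> y))" by (simp add: E1_S2 XD_S2 p v XR_E2)
qed
lemma XD_DL: assumes p: "lin X scalars \<phi>" and v: "v \<in> carr X" and t: "t \<in> carr AA"
 shows "DL (Sb (mc \<phi> v) \<rhd> a) t = XD \<phi> v (DL a t)"
proof (rule S_ext[where Z=AA and f="\<lambda>a. DL (Sb (mc \<phi> v) \<rhd> a) t" and g="\<lambda>a. XD \<phi> v (DL a t)"])
 show "lin A AA (\<lambda>a. DL (Sb (mc \<phi> v) \<rhd> a) t)" "lin A AA (\<lambda>a. XD \<phi> v (DL a t))" by (intro lins; simp add: p fl v)+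
 fix d b
 show "DL (Sb (mc \<phi> v) \<rhd> (S d \<rhd> b)) t = XD \<phi> v (DL (S d \<rhd> b) t)"
 proof (rule S2_cancel)
  fix w u
  have AC': "S2 s (DL (S d \<rhd> b) t) = S2 (DL d s) (DL b t)" if s: "s \<in> carr AA" for s
   by (rule AA_eq[OF _ _ s, where Z=AA], (intro lins)+) (rule S2_DL[OF t])
  have "S2 (w \<odot> u) (DL (Sb (mc \<phi> v) \<rhd> (S d \<rhd> b)) t) = S2 (DL (d \<lhd> mc \<phi> v) (w \<odot> u)) (DL b t)"
   by (simp add: Sb_l p v S2_DL t)
  also have "\<dots> = S2 (w \<odot> u) (XD \<phi> v (DL (S d \<rhd> b) t))" by (simp add: XD_S2 p v AC' DL_XL)
  finally show "S2 (w \<odot> u) (DL (Sb (mc \<phi> v) \<rhd> (S d \<rhd> b)) t) = S2 (w \<odot> u) (XD \<phi> v (DL (S d \<rhd> b) t))" .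
 qed simp_all
qed

lemma mc_fd: "mc (fd i) v = mc (f i) v" by (rule mc_cong) (simp add: fd_v)

abbreviation "dc lamS rhoS \<equiv> \<lparr>sp = D, lam = lamS, rho = rhoS\<rparr>"
lemma dual_comodule: assumes ds: "dual_structure H S V lamS rhoS" shows "comodule H (dc lamS rhoS)"
proof (rule comodI[where V="dc lamS rhoS" and pt="\<lambda>x. x" and P="carr D" and K=I and gg=fd and m="\<lambda>k \<phi>. Sb (mc \<phi> (g k))"])
 interpret F: vector_space "fscal :: 'k \<Rightarrow> ('v \<Rightarrow> 'k) \<Rightarrow> _" by (rule vector_space_fscal)
 have "F.subspace (carr D)" using vspace_dual[OF vX] by (simp add: vspace_def scal_dual)
 then show "module.span (scal (sp (dc lamS rhoS))) ((\<lambda>x. x) ` carr D) = carr (sp (dc lamS rhoS))" by (simp add: scal_dual F.span_eq_iff)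
 fix k \<phi> t a assume p: "\<phi> \<in> carr D" and t: "t \<in> carr AA"
 show "XX I (\<lambda>i. Sb (mc (fd i) (g k))) (\<lambda>i. Sb (mc \<phi> (g i))) (E1 H t) = XX I (\<lambda>i. Sb (mc (fd i) (g k))) (\<lambda>i. Sb (mc \<phi> (g i))) t"
  by (simp add: mc_fd XD_E1 dual_lin p t)
 show "DL (Sb (mc \<phi> (g k)) \<rhd> a) t = XX I (\<lambda>i. Sb (mc (fd i) (g k))) (\<lambda>i. Sb (mc \<phi> (g i))) (DL a t)"
  by (simp add: mc_fd XD_DL dual_lin p t)
qed (use ds in \<open>auto simp: dual_structure_iff dual_lin\<close>)

text \<open>A functional on the dual that kills all slices is evaluation at some \<open>v0\<close> with \<open>Sb (mc \<psi> v0) = 0\<close> for all \<open>\<psi>\<close>. Then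
\<open>Nm \<psi> v0 = 0\<close>, so that by \<open>Nm_slice\<close> and right fullness \<open>\<epsilon>(y mc \<psi> v0) = 0\<close> for all \<open>y\<close>. By \<open>Rr_t2\<close> every
\<open>a mc \<psi> v0\<close> vanishes, and hence \<open>v0 = 0\<close>.\<close>
lemma dual_full: assumes ds: "dual_structure H S V lamS rhoS" shows "full_comodule H (dc lamS rhoS)"
 unfolding full_comodule_def
proof (intro conjI dual_comodule[OF ds])
 interpret F: vector_space "fscal :: 'k \<Rightarrow> ('v \<Rightarrow> 'k) \<Rightarrow> _" by (rule vector_space_fscal)
 have ll: "lamS (pure D A \<phi> b) = (\<Sum>k\<in>I. pure D A (fd k) (Sb (mc \<phi> (g k)) \<rhd> b))" if "\<phi> \<in> carr D" for \<phi> b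
  using ds that by (simp add: dual_structure_iff)
 have sl: "slice_right D (alg H) \<omega> (lamS (pure D A \<phi> a)) = (\<Sum>k\<in>I. fscal (\<omega> (Sb (mc \<phi> (g k)) \<rhd> a)) (fd k))"
  if w: "lin A scalars \<omega>" and p: "\<phi> \<in> carr D" for \<omega> \<phi> a
 proof -
  have b: "bilin D A D (\<lambda>x y. scal D (\<omega> y) x)" using w by (intro lins vX)
  note b = b[unfolded scal_dual]
  show ?thesis unfolding ll[OF p] slice_right_def scal_dual
   by (subst lin_sum[OF vspace_tprod lift_lin[OF vspace_dual[OF vX] b]]) (auto intro!: sum.cong simp: pure_carr lift_pure[OF vspace_dual[OF vX] b])
 qed
 let ?P = "{slice_right D (alg H) \<omega> (lamS (pure D (alg H) v a)) | v a \<omega>. v \<in> carr D \<and> lin (alg H) scalars \<omega>}"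
 have "F.span ?P = carr D"
 proof
  have sub: "F.subspace (carr D)" using vspace_dual[OF vX] by (simp add: vspace_def scal_dual)
  have "(\<Sum>k\<in>I. fscal (c k) (fd k)) \<in> carr D" for c
   by (rule F.subspace_sum[OF sub], rule F.subspace_scale[OF sub]) simp
  then have "?P \<subseteq> carr D" by (auto simp: sl)
  then show "F.span ?P \<subseteq> carr D" by (rule F.span_minimal[OF _ sub])
  show "carr D \<subseteq> F.span ?P"
  proof
   fix \<phi> assume p: "\<phi> \<in> carr D"
   show "\<phi> \<in> F.span ?P"
   proof (rule functional_sep[OF vector_space_fscal F.subspace_span])
    fix \<theta> :: "('v \<Rightarrow> 'k) \<Rightarrow> 'k"
    assume "Vector_Spaces.linear fscal (*) \<theta>" and z: "\<And>w. w \<in> F.span ?P ==> \<theta> w = 0"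
    then have lt: "lin D scalars \<theta>" using linear_lin[of D \<theta>] by (simp add: scal_dual)
    \<comment> \<open>\<open>\<theta>\<close> is evaluation at \<open>v0\<close>\<close>
    define v0 where "v0 = (\<Sum>i\<in>I. scal X (\<theta> (fd i)) (g i))"
    have v0: "v0 \<in> carr X" unfolding v0_def by (rule sumX)
    have th: "(\<Sum>k\<in>I. c k * \<theta> (fd k)) = \<theta> (\<Sum>k\<in>I. fscal (c k) (fd k))" for c
     using lin_sum[OF vspace_dual[OF vX] lt, of I "\<lambda>k. fscal (c k) (fd k)"] lin_scal[OF lt fd_c] vspace_scal[OF vspace_dual[OF vX] fd_c]
     by (simp add: scal_dual)
    have S0: "Sb (mc \<psi> v0) \<rhd> a = 0" if q: "\<psi> \<in> carr D" for \<psi> a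
    proof (rule vspace_functionals[OF vspace_A])
     fix \<omega> assume w: "lin A scalars \<omega>"
     note lw = lin_comp[OF w]
     have l: "lin X scalars (\<lambda>v. \<omega> (Sb (mc \<psi> v) \<rhd> a))" by (intro lins lw dual_lin[OF q])
     have "\<omega> (Sb (mc \<psi> v0) \<rhd> a) = (\<Sum>k\<in>I. \<omega> (Sb (mc \<psi> (g k)) \<rhd> a) * \<theta> (fd k))"
      unfolding v0_def by (simp add: lin_sum[OF vX l] vspace_scal lin_scal[OF l] mult.commute)
     also have "\<dots> = \<theta> (slice_right D (alg H) \<omega> (lamS (pure D A \<psi> a)))" by (simp add: sl[OF w q] th)
     also have "\<dots> = 0" by (rule z, rule F.span_base) (use w q in blast)
     finally show "\<omega> (Sb (mc \<psi> v0) \<rhd> a) = 0" .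
    qed
    have "mc (f j) v0 \<rhd> a = 0" for j a
    proof -
     have "sll (\<lambda>y. eps H (y \<lhd> mc \<psi> v0)) (t1 a b) = 0" if q: "lin X scalars \<psi>" for \<psi> a b
     proof -
      have "Nm \<psi> v0 \<rhd> b = 0" using S0[OF fd_c] by (simp add: Nm_l mc_fd MM_0 q)
      then show ?thesis using Nm_slice[OF q v0, of a b] by simp
     qed
     then have e: "eps H (y \<lhd> mc \<psi> v0) = 0" if q: "lin X scalars \<psi>" for \<psi> y
      using q by (intro rfullD[where \<psi>="\<lambda>y. eps H (y \<lhd> mc \<psi> v0)"] lins mc_MM v0) simp_all
     have er0: "(x \<lhd> Rr c) \<lhd> mc (f j) v0 = 0" for x c
     proof -
      have "er (XR (f j) v0 (x \<odot> c)) = 0" unfolding XL_pure[OF fl v0] by (subst er_sum) (simp_all add: er_pure e fl asc_0l)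
      then show ?thesis by (simp add: er_XR fl v0)
     qed
     have 0: "x \<lhd> mc (f j) v0 = 0" for x
     proof (rule idemE[where Z=A and f="\<lambda>x. x \<lhd> mc (f j) v0" and g="\<lambda>_. 0"], (intro lins mc_MM fl v0)+)
      show "lin A A (\<lambda>_. 0)" by (simp add: lin_def)
      fix p q have "(p * q) \<lhd> mc (f j) v0 = ts (t2 p q) (\<lambda>p q. (p \<lhd> Rr q) \<lhd> mc (f j) v0)"
       by (simp add: Rr_t2 fl v0 flip: ts_mr)
      then show "(p * q) \<lhd> mc (f j) v0 = 0" by (simp add: er0 ts_zero)
     qed
     show ?thesis by (rule nondegA_eq(2)) (simp add: MM_bal fl v0 0)
    qed
    then have "v0 = 0" by (intro mc_inj0[OF v0]) simp
    moreover have "\<theta> \<phi> = \<phi> v0"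
    proof -
     have pl: "lin X scalars \<phi>" by (rule dual_lin[OF p])
     have "\<theta> \<phi> = \<theta> (\<Sum>i\<in>I. fscal (\<phi> (g i)) (fd i))" using frame.exp[OF dual_frame p] by (simp add: scal_dual)
     also have "\<dots> = \<phi> v0" unfolding v0_def
      by (simp add: lin_sum[OF vX pl] vspace_scal lin_scal[OF pl] mult.commute flip: th)
     finally show ?thesis .
    qed
    ultimately show "\<theta> \<phi> = 0" using lin_0[OF vX dual_lin[OF p]] by simp
   qed
  qed
 qed
 then show "module.span (scal (sp (dc lamS rhoS))) {slice_right (sp (dc lamS rhoS)) (alg H) \<omega> (lam (dc lamS rhoS) (pure (sp (dc lamS rhoS)) (alg H) v a)) | v a \<omega>. v \<in> carr (sp (dc lamS rhoS)) \<and> lin (alg H) scalars \<omega>} = carr (sp (dc lamS rhoS))"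
  by (simp add: scal_dual)
qed

lemma dual_fdc: assumes ds: "dual_structure H S V lamS rhoS" shows "fdc H (dc lamS rhoS) I fd (\<lambda>i \<phi>. \<phi> (g i))"
 unfolding fdc_def fdc_axioms_def using dual_full[OF ds] dual_frame by (simp add: wmbf_axioms)
end

section \<open>Balanced tensor products\<close>

lemma vspace_rtens[simp, lins]: "vspace (rtens H V W)" by (simp add: rtens_def vspace_tspace)
lemma scal_rtens: "scal (rtens H V W) = fscal" by (simp add: rtens_def tspace_def)
lemma rpure_carr[simp, lins]:
 fixes H :: "('k::field, 'a::ring) wmb" and V :: "('k, 'v::ab_group_add, 'a) comod" and W :: "('k, 'w::ab_group_add, 'a) comod"
 assumes "v \<in> carr (sp V)" "w \<in> carr (sp W)" shows "rpure H V W v w \<in> carr (rtens H V W)"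
proof -
 interpret F: vector_space "fscal :: 'k \<Rightarrow> (('v \<Rightarrow> 'w \<Rightarrow> 'k) \<Rightarrow> 'k) \<Rightarrow> _" by (rule vector_space_fscal)
 show ?thesis using assms by (auto simp: rtens_def tspace_def rpure_def intro!: F.span_base)
qed
lemma bilin_rpure:
 fixes H :: "('k::field, 'a::ring) wmb" and V :: "('k, 'v::ab_group_add, 'a) comod" and W :: "('k, 'w::ab_group_add, 'a) comod"
 shows "bilin (sp V) (sp W) (rtens H V W) (rpure H V W)"
proof -
 have b: "bilin (sp V) (sp W) scalars b" if "b \<in> rforms H V W" for b using that by (simp add: rforms_def forms_def)
 note l = bilinD(1)[OF b] bilinD(2)[OF b]
 have "rpure H V W x (y + z) = rpure H V W x y + rpure H V W x z" "rpure H V W x (scal (sp W) c y) = fscal c (rpure H V W x y)"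
  if "x \<in> carr (sp V)" "y \<in> carr (sp W)" "z \<in> carr (sp W)" for x y z c
  using lin_add[OF l(1)] lin_scal[OF l(1)] that by (auto simp: rpure_def ptensor_def fun_eq_iff fscal_def)
 moreover have "rpure H V W (x + y) z = rpure H V W x z + rpure H V W y z" "rpure H V W (scal (sp V) c x) z = fscal c (rpure H V W x z)"
  if "x \<in> carr (sp V)" "y \<in> carr (sp V)" "z \<in> carr (sp W)" for x y z c
  using lin_add[OF l(2)] lin_scal[OF l(2)] that by (auto simp: rpure_def ptensor_def fun_eq_iff fscal_def)
 ultimately show ?thesis unfolding bilin_def lin_def by (simp add: scal_rtens)
qed
lemma lin_rpure[lins]: "lin Z (sp V) k ==> w \<in> carr (sp W) ==> lin Z (rtens H V W) (\<lambda>z. rpure H V W (k z) w)"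
 "lin Z (sp W) l ==> v \<in> carr (sp V) ==> lin Z (rtens H V W) (\<lambda>z. rpure H V W v (l z))"
 by (rule lin_comp[OF bilinD(2)[OF bilin_rpure]]; assumption) (rule lin_comp[OF bilinD(1)[OF bilin_rpure]]; assumption)
lemma rpure_bal: "v \<in> carr (sp V) ==> r \<in> carr (base H) ==> w \<in> carr (sp W) ==> rpure H V W (ract H V v r) w = rpure H V W v (lact H W r w)"
 by (auto simp: rpure_def ptensor_def fun_eq_iff rforms_def)

text \<open>Bilinear and balanced over the base algebra.\<close>
definition "rbal H V W Z b \<longleftrightarrow> bilin (sp V) (sp W) Z b \<and>
 (\<forall>v\<in>carr (sp V). \<forall>r\<in>carr (base H). \<forall>w\<in>carr (sp W). b (ract H V v r) w = b v (lact H W r w))"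
lemma rlift_exists:
 assumes Z: "vspace Z" and b: "rbal H V W Z b"
 shows rlift_lin: "lin (rtens H V W) Z (rlift H V W Z b)"
  and rlift_pure: "v \<in> carr (sp V) ==> w \<in> carr (sp W) ==> rlift H V W Z b (rpure H V W v w) = b v w"
proof -
 have "\<exists>f. lin (tspace (rforms H V W) (sp V) (sp W)) Z f \<and>
       (\<forall>x\<in>carr (sp V). \<forall>y\<in>carr (sp W). f (ptensor (rforms H V W) x y) = b x y)"
 proof (rule tensor_universal[OF Z])
  show "b x y \<in> carr Z" if "x \<in> carr (sp V)" "y \<in> carr (sp W)" for x y
   using b that by (auto simp: rbal_def bilin_def lin_def)
  show "(\<lambda>x y. \<omega> (b x y)) \<in> rforms H V W" if "lin Z scalars \<omega>" for \<omega>
   using b that by (auto simp: rbal_def rforms_def forms_def bilin_def lin_def)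
 qed
 from someI_ex[OF this]
 show "lin (rtens H V W) Z (rlift H V W Z b)"
  and "v \<in> carr (sp V) ==> w \<in> carr (sp W) ==> rlift H V W Z b (rpure H V W v w) = b v w"
  by (auto simp: rtens_def rlift_def tlift_def rpure_def)
qed
lemma rtens_eq:
 fixes Z :: "('k::field,'z::ab_group_add) space"
 assumes "vspace Z" "lin (rtens H V W) Z f" "lin (rtens H V W) Z g"
  and "\<And>v w. v \<in> carr (sp V) ==> w \<in> carr (sp W) ==> f (rpure H V W v w) = g (rpure H V W v w)" and "t \<in> carr (rtens H V W)"
 shows "f t = g t"
 by (rule tensor_unique[OF assms(1) assms(2)[unfolded rtens_def] assms(3)[unfolded rtens_def] assms(4)[unfolded rpure_def] assms(5)[unfolded rtens_def]])
lemma bilin_rlift: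
 fixes Z :: "('k::field,'z::ab_group_add) space"
 assumes Z: "vspace Z" and Y: "vspace Y" and b: "\<And>w. w \<in> carr Y ==> rbal H U V Z (\<lambda>u v. b u v w)"
  and l: "\<And>u v. u \<in> carr (sp U) ==> v \<in> carr (sp V) ==> lin Y Z (\<lambda>w. b u v w)"
 shows "bilin (rtens H U V) Y Z (\<lambda>t w. rlift H U V Z (\<lambda>u v. b u v w) t)"
proof (rule bilinI)
 fix t assume t: "t \<in> carr (rtens H U V)"
 let ?L = "\<lambda>w. rlift H U V Z (\<lambda>u v. b u v w)"
 have L: "lin (rtens H U V) Z (?L w)" if "w \<in> carr Y" for w by (rule rlift_lin[OF Z b[OF that]])
 have P: "?L w (rpure H U V u v) = b u v w" if "w \<in> carr Y" "u \<in> carr (sp U)" "v \<in> carr (sp V)" for u v w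
  by (rule rlift_pure[OF Z b]) (rule that)+
 show "lin Y Z (\<lambda>w. ?L w t)" unfolding lin_def
 proof (intro conjI ballI allI)
  fix w w' assume w: "w \<in> carr Y" "w' \<in> carr Y"
  have ww: "w + w' \<in> carr Y" by (rule vspace_add[OF Y w])
  show "?L (w + w') t = ?L w t + ?L w' t"
   by (rule rtens_eq[OF Z L[OF ww] lin_addI[OF Z L[OF w(1)] L[OF w(2)]] _ t])
    (simp add: P w ww lin_add[OF l])
 next
  fix c w assume w: "w \<in> carr Y"
  have ww: "scal Y c w \<in> carr Y" by (rule vspace_scal[OF Y w])
  show "?L w t \<in> carr Z" by (rule lin_carr[OF L[OF w] t])
  show "?L (scal Y c w) t = scal Z c (?L w t)"
   by (rule rtens_eq[OF Z L[OF ww] lin_scalI[OF Z L[OF w]] _ t]) (simp add: P w ww lin_scal[OF l])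
 qed
next
 fix w assume "w \<in> carr Y" then show "lin (rtens H U V) Z (\<lambda>t. rlift H U V Z (\<lambda>u v. b u v w) t)"
  using rlift_lin[OF Z b] by blast
qed

lemma slice_right_exists:
 fixes X :: "('k::field,'v::ab_group_add) space" and Y :: "('k,'w::ab_group_add) space"
 assumes X: "vspace X" and w: "lin Y scalars \<omega>"
 shows slice_lin: "lin (X \<otimes> Y) X (slice_right X Y \<omega>)"
  and slice_pure: "x \<in> carr X ==> y \<in> carr Y ==> slice_right X Y \<omega> (pure X Y x y) = scal X (\<omega> y) x"
proof -
 have b: "bilin X Y X (\<lambda>x y. scal X (\<omega> y) x)" by (intro lins X w lin_scal2)
 show "lin (X \<otimes> Y) X (slice_right X Y \<omega>)" and "x \<in> carr X ==> y \<in> carr Y ==> slice_right X Y \<omega> (pure X Y x y) = scal X (\<omega> y) x"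
  unfolding slice_right_def by (rule lift_lin[OF X b]) (rule lift_pure[OF X b])
qed

context wmbf begin

lemma lin_ract_comod: assumes "vspace (sp V)" "lin (sp V \<otimes> alg H) (sp V \<otimes> alg H) (lam V)" shows "lin (sp V) (sp V) (\<lambda>v. ract H V v r)"
 unfolding ract_def by (rule lin_comp[OF slice_lin[OF assms(1) lin_eps] lin_comp[OF assms(2)]]) (intro lins carr_A)
lemma lin_lact_comod: assumes "vspace (sp V)" "lin (sp V \<otimes> alg H) (sp V \<otimes> alg H) (rho V)" shows "lin (sp V) (sp V) (\<lambda>v. lact H V r v)"
 unfolding lact_def by (rule lin_comp[OF slice_lin[OF assms(1) lin_eps] lin_comp[OF assms(2)]]) (intro lins carr_A)

text \<open>Nondegeneracy of \<open>A\<close>, used for the second structure map of a product: the adjointness relation determines it from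
the first one.\<close>
lemma second_cancel:
 fixes Z :: "('k,'z::ab_group_add) space"
 assumes Z: "vspace Z" and s: "s \<in> carr (Z \<otimes> alg H)" and t: "t \<in> carr (Z \<otimes> alg H)"
  and e: "\<And>b. tmap Z A Z A id (\<lambda>y. y * b) s = tmap Z A Z A id (\<lambda>y. y * b) t"
 shows "s = t"
proof -
 have lm: "lin A A (\<lambda>y. y * b)" for b by (intro lins)
 have "s - t = 0"
 proof (rule nondeg_right'[OF Z vspace_diff[OF vspace_tprod s t]])
  fix b
  have "tmap Z A Z A id (\<lambda>y. y * b) (s - t) = 0"
   using lin_diff[OF vspace_tprod lin_tmap[OF lin_idc lm] s t] e by simp
  then show "tsum Z A (s - t) (\<lambda>x y. pure Z A x (y * b)) = 0"
   by (simp add: tmap_tsum[OF Z lin_idc lm vspace_diff[OF vspace_tprod s t]])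
 qed
 then show ?thesis by simp
qed

section \<open>The unit comodule\<close>

lemma lin_amap[lins]: "lin W AA k ==> lin A A p ==> lin A A q ==> lin W AA (\<lambda>w. amap H p q (k w))"
 unfolding amap_def by (rule lin_comp[OF lin_tmap])
lemma amap_pure: "lin A A p ==> lin A A q ==> amap H p q (x \<odot> y) = p x \<odot> q y"
 unfolding amap_def by (simp add: tmap_pure)
lemma amap_r2: assumes t: "t \<in> carr AA" shows "amap H id (\<lambda>y. y * b) t = r2 t b" "amap H id (\<lambda>y. b * y) t = l2 b t"
 by (rule AA_eq[OF _ _ t, where Z=AA], (intro lins lin_idc)+, simp add: amap_pure lins lin_idc)+
lemma rm_lin: "r \<in> carr R ==> lin A A (\<lambda>x. r \<rhd> x)" "r \<in> carr R ==> lin A A (\<lambda>x. x \<lhd> r)" "lin A A (\<lambda>y. b * y)" "lin A A (\<lambda>y. y * b)"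
 by (intro lins R_MM; assumption)+
lemma bil_RA: "bilin R A AA (\<lambda>r a. ts u (\<lambda>x y. (r \<rhd> x) \<odot> (a * y)))" "bilin R A AA (\<lambda>r a. ts u (\<lambda>x y. (x \<lhd> r) \<odot> (y * a)))"
 "bilin R A AA (\<lambda>r a. (r \<rhd> x) \<odot> a)" "bilin R A AA (\<lambda>r a. (x \<lhd> r) \<odot> a)"
 by (intro lins R_MM; assumption?)+
lemma RA_eq: assumes t: "t \<in> carr (R \<otimes> alg H)" and u: "u \<in> carr AA"
 shows "RA_left H t u = tsum R A t (\<lambda>r a. ts u (\<lambda>x y. (r \<rhd> x) \<odot> (a * y)))" "RA_right H u t = tsum R A t (\<lambda>r a. ts u (\<lambda>x y. (x \<lhd> r) \<odot> (y * a)))"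
proof -
 have e: "amap H (\<lambda>x. r \<rhd> x) (\<lambda>y. a * y) u = ts u (\<lambda>x y. (r \<rhd> x) \<odot> (a * y))" "amap H (\<lambda>x. x \<lhd> r) (\<lambda>y. y * a) u = ts u (\<lambda>x y. (x \<lhd> r) \<odot> (y * a))" if r: "r \<in> carr R" for r a
  unfolding amap_def by (rule tmap_tsum[OF vspace_A rm_lin(1)[OF r] rm_lin(3) u], rule tmap_tsum[OF vspace_A rm_lin(2)[OF r] rm_lin(4) u])
 have c: "bilin R A AA (\<lambda>r a. amap H (\<lambda>x. r \<rhd> x) (\<lambda>y. a * y) u)" "bilin R A AA (\<lambda>r a. amap H (\<lambda>x. x \<lhd> r) (\<lambda>y. y * a) u)"
  by (rule bilin_cong[OF _ vR vspace_A bil_RA(1)], simp add: e, rule bilin_cong[OF _ vR vspace_A bil_RA(2)], simp add: e)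
 note lt = lin_tsum_op[OF vR vspace_tprod bil_RA(1)] lin_tsum_op[OF vR vspace_tprod bil_RA(2)]
 show "RA_left H t u = tsum R A t (\<lambda>r a. ts u (\<lambda>x y. (r \<rhd> x) \<odot> (a * y)))"
  unfolding RA_left_def algsq_eq
  by (rule lin_tens_eq[OF vR lift_lin[OF vspace_tprod c(1)] lt(1) t])
   (simp add: lift_pure[OF vspace_tprod c(1)] e tsum_pure[OF vR vspace_tprod bil_RA(1)])
 show "RA_right H u t = tsum R A t (\<lambda>r a. ts u (\<lambda>x y. (x \<lhd> r) \<odot> (y * a)))"
  unfolding RA_right_def algsq_eq
  by (rule lin_tens_eq[OF vR lift_lin[OF vspace_tprod c(2)] lt(2) t])
   (simp add: lift_pure[OF vspace_tprod c(2)] e tsum_pure[OF vR vspace_tprod bil_RA(2)])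
qed
abbreviation "lt t x \<equiv> tsum R A t (\<lambda>r a. (r \<rhd> x) \<odot> a)"
abbreviation "rt t x \<equiv> tsum R A t (\<lambda>r a. (x \<lhd> r) \<odot> a)"
lemma lrt_c[simp]: "lt t x \<in> carr AA" "rt t x \<in> carr AA" by (rule tsum_carr[OF vR vspace_tprod]; simp)+
lemma RA_pure: assumes t: "t \<in> carr (R \<otimes> alg H)" shows "RA_left H t (x \<odot> y) = r2 (lt t x) y" "RA_right H (x \<odot> y) t = l2 y (rt t x)"
proof -
 note l = lin_tsum_op[OF vR vspace_tprod bil_RA(3)] lin_tsum_op[OF vR vspace_tprod bil_RA(4)]
 have p: "ts (x \<odot> y) (\<lambda>x y. (r \<rhd> x) \<odot> (a * y)) = (r \<rhd> x) \<odot> (a * y)" "ts (x \<odot> y) (\<lambda>x y. (x \<lhd> r) \<odot> (y * a)) = (x \<lhd> r) \<odot> (y * a)" if "r \<in> carr R" for r a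
  by (rule ts_pureAA; intro lins R_MM that)+
 show "RA_left H t (x \<odot> y) = r2 (lt t x) y"
  unfolding RA_eq[OF t pc] by (rule lin_tens_eq[OF vR lin_tsum_op[OF vR vspace_tprod bil_RA(1)] _ t], intro lins l)
   (simp add: p tsum_pure[OF vR vspace_tprod bil_RA(1)] tsum_pure[OF vR vspace_tprod bil_RA(3)])
 show "RA_right H (x \<odot> y) t = l2 y (rt t x)"
  unfolding RA_eq[OF t pc] by (rule lin_tens_eq[OF vR lin_tsum_op[OF vR vspace_tprod bil_RA(2)] _ t], intro lins l)
   (simp add: p tsum_pure[OF vR vspace_tprod bil_RA(2)] tsum_pure[OF vR vspace_tprod bil_RA(4)])
qed
lemma RA_lin: assumes t: "t \<in> carr (R \<otimes> alg H)" shows "lin AA AA (RA_left H t)" "lin AA AA (\<lambda>u. RA_right H u t)"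
proof -
 have c: "lin AA AA (\<lambda>u. tsum R A t (\<lambda>r a. ts u (\<lambda>x y. (r \<rhd> x) \<odot> (a * y))))" "lin AA AA (\<lambda>u. tsum R A t (\<lambda>r a. ts u (\<lambda>x y. (x \<lhd> r) \<odot> (y * a))))"
  by (intro lin_tsum_c vR vspace_tprod lins R_MM; assumption?)+
 show "lin AA AA (RA_left H t)" by (rule lin_cong[OF _ vspace_tprod c(1)]) (simp add: RA_eq t)
 show "lin AA AA (\<lambda>u. RA_right H u t)" by (rule lin_cong[OF _ vspace_tprod c(2)]) (simp add: RA_eq t)
qed
lemma lrt_adj: assumes t: "t \<in> carr (R \<otimes> alg H)" shows "(x \<odot> y) \<cdot> r2 (lt t p) q = l2 y (rt t x) \<cdot> (p \<odot> q)"
 by (rule lin_tens_eq[OF vR _ _ t, where Z=AA], (intro lins lin_tsum_op vR vspace_tprod bil_RA)+)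
  (simp add: tsum_pure[OF vR vspace_tprod bil_RA(3)] tsum_pure[OF vR vspace_tprod bil_RA(4)] MM_bal R_MM mult.assoc)

definition "repE' b t \<longleftrightarrow> t \<in> carr (R \<otimes> alg H) \<and> (\<forall>x. e2 x b = rt t x)"
lemma e_r2: "r2 (e1 x b) y = e1 x (b * y)" "l2 y (e2 x b) = e2 x (y * b)"
 by (simp_all add: E1_r[symmetric] E2_l[symmetric])
lemma is_E_times_iff: "is_E_times H b t \<longleftrightarrow> repE b t"
proof
 assume r: "repE b t"
 then have t: "t \<in> carr (R \<otimes> alg H)" and l: "\<And>x. e1 x b = lt t x" by (simp_all add: repE_def)
 have "RA_left H t u = E1 H (amap H id (\<lambda>y. b * y) u) \<and> RA_right H u t = amap H id (\<lambda>y. y * b) (E2 H u)" if u: "u \<in> carr AA" for u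
 proof
  show "RA_left H t u = E1 H (amap H id (\<lambda>y. b * y) u)"
   by (rule AA_eq[OF RA_lin(1)[OF t] _ u], (intro lins lin_idc)+) (simp add: RA_pure t amap_pure lins lin_idc e_r2 flip: l)
  have "l2 y (rt t x) = r2 (e2 x y) b" for x y
  proof (rule nondeg_mm(2))
   fix p q
   have "l2 y (rt t x) \<cdot> p \<odot> q = (x \<odot> y) \<cdot> e1 p (b * q)" by (simp only: lrt_adj[OF t, symmetric] l[symmetric] e_r2)
   also have "\<dots> = e2 x y \<cdot> (p \<odot> (b * q))" by (rule E_balanced) simp_all
   also have "\<dots> = r2 (e2 x y) b \<cdot> p \<odot> q" by (simp add: mm_lr lr_comm)
   finally show "l2 y (rt t x) \<cdot> p \<odot> q = r2 (e2 x y) b \<cdot> p \<odot> q" .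
  qed simp_all
  moreover have "amap H id (\<lambda>y. y * b) (e2 x y) = r2 (e2 x y) b" for x y by (rule amap_r2) simp
  ultimately show "RA_right H u t = amap H id (\<lambda>y. y * b) (E2 H u)"
   by (intro AA_eq[OF RA_lin(2)[OF t] _ u]) ((intro lins lin_idc)+, simp only: RA_pure[OF t])
 qed
 then show "is_E_times H b t" using t by (simp add: is_E_times_def algsq_eq)
next
 assume e: "is_E_times H b t"
 then have t: "t \<in> carr (R \<otimes> alg H)" by (simp add: is_E_times_def)
 have "e1 x b = lt t x" for x
 proof (rule nondegAA(4))
  fix d have "RA_left H t (x \<odot> d) = E1 H (amap H id (\<lambda>y. b * y) (x \<odot> d))" using e by (simp add: is_E_times_def algsq_eq)
  then show "r2 (e1 x b) d = r2 (lt t x) d" by (simp add: RA_pure t amap_pure lins lin_idc e_r2)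
 qed simp_all
 then show "repE b t" by (simp add: repE_def t)
qed
lemma is_times_E_iff: "is_times_E H b t \<longleftrightarrow> repE' b t"
proof
 assume r: "repE' b t"
 then have t: "t \<in> carr (R \<otimes> alg H)" and l: "\<And>x. e2 x b = rt t x" by (simp_all add: repE'_def)
 have "RA_left H t u = amap H id (\<lambda>y. b * y) (E1 H u) \<and> RA_right H u t = E2 H (amap H id (\<lambda>y. y * b) u)" if u: "u \<in> carr AA" for u
 proof
  show "RA_right H u t = E2 H (amap H id (\<lambda>y. y * b) u)"
   by (rule AA_eq[OF RA_lin(2)[OF t] _ u], (intro lins lin_idc)+) (simp add: RA_pure t amap_pure lins lin_idc e_r2 flip: l)
  have "r2 (lt t x) y = l2 b (e1 x y)" for x y
  proof (rule nondeg_mm(1))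
   fix p q
   have "p \<odot> q \<cdot> r2 (lt t x) y = e2 p (q * b) \<cdot> (x \<odot> y)" by (simp only: lrt_adj[OF t] l[symmetric] e_r2)
   also have "\<dots> = p \<odot> (q * b) \<cdot> e1 x y" by (rule E_balanced[symmetric]) simp_all
   also have "\<dots> = p \<odot> q \<cdot> l2 b (e1 x y)" by (simp add: mm_lr lr_comm)
   finally show "p \<odot> q \<cdot> r2 (lt t x) y = p \<odot> q \<cdot> l2 b (e1 x y)" .
  qed simp_all
  moreover have "amap H id (\<lambda>y. b * y) (e1 x y) = l2 b (e1 x y)" for x y by (rule amap_r2) simp
  ultimately show "RA_left H t u = amap H id (\<lambda>y. b * y) (E1 H u)"
   by (intro AA_eq[OF RA_lin(1)[OF t] _ u]) ((intro lins lin_idc)+, simp only: RA_pure[OF t])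
 qed
 then show "is_times_E H b t" using t by (simp add: is_times_E_def algsq_eq)
next
 assume e: "is_times_E H b t"
 then have t: "t \<in> carr (R \<otimes> alg H)" by (simp add: is_times_E_def)
 have "e2 x b = rt t x" for x
 proof (rule nondegAA(2))
  fix d have "RA_right H (x \<odot> d) t = E2 H (amap H id (\<lambda>y. y * b) (x \<odot> d))" using e by (simp add: is_times_E_def algsq_eq)
  then show "l2 d (e2 x b) = l2 d (rt t x)" by (simp add: RA_pure t amap_pure lins lin_idc e_r2)
 qed simp_all
 then show "repE' b t" by (simp add: repE'_def t)
qed

lemma lin_lrt: "lin (R \<otimes> alg H) AA (\<lambda>t. lt t x)" "lin (R \<otimes> alg H) AA (\<lambda>t. rt t x)"
 by (rule lin_tsum_op[OF vR vspace_tprod bil_RA(3)], rule lin_tsum_op[OF vR vspace_tprod bil_RA(4)])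
text \<open>\<open>R \<otimes> A\<close> is represented faithfully on \<open>A\<close>: slices by functionals of \<open>A\<close> are elements of \<open>R\<close>, and these are multipliers.\<close>
lemma RA_faithful0: assumes t: "t \<in> carr (R \<otimes> alg H)" and e: "(\<forall>x. lt t x = 0) \<or> (\<forall>x. rt t x = 0)" shows "t = 0"
proof (rule tens_sep_right[OF vR vspace_A t])
 fix \<phi> assume p: "lin A scalars \<phi>"
 let ?r = "\<lambda>t. tsum R A t (\<lambda>x y. scal R (\<phi> y) x)"
 note lp = lin_comp[OF p]
 have b: "bilin R A R (\<lambda>x y. scal R (\<phi> y) x)" by (intro lins lp vR)
 have l: "lin (R \<otimes> alg H) R ?r" by (rule lin_tsum_op[OF vR vR b])
 have r: "?r t \<in> carr R" by (rule lin_carr[OF l t])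
 have 1: "?r t \<rhd> x = slr \<phi> (lt t x)" "x \<lhd> ?r t = slr \<phi> (rt t x)" for x
  by (rule lin_tens_eq[OF vR lin_Ract(1)[OF l] lin_sl(1)[OF p lin_lrt(1)] t], simp only: tsum_pure[OF vR vR b] tsum_pure[OF vR vspace_tprod bil_RA(3)], simp add: sl_pure[OF p] scal_R)
   (rule lin_tens_eq[OF vR lin_Ract(2)[OF l] lin_sl(1)[OF p lin_lrt(2)] t], simp only: tsum_pure[OF vR vR b] tsum_pure[OF vR vspace_tprod bil_RA(4)], simp add: sl_pure[OF p] scal_R)
 have 0: "slr \<phi> 0 = 0" by (rule lin_0[OF vspace_tprod lin_sl(1)[OF p lin_id]])
 have m0: "0 \<in> MM" by (rule vspace_0[OF vspace_M])
 from e show "?r t = 0"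
 proof
  assume "\<forall>x. lt t x = 0" then show ?thesis by (intro MM_eq[OF R_MM[OF r] m0]) (simp add: 1 0)
 next
  assume "\<forall>x. rt t x = 0" then show ?thesis by (intro MM_eqr[OF R_MM[OF r] m0]) (simp add: 1 0)
 qed
qed
lemma repE_unique: "repE b t ==> repE b u ==> t = u" and repE'_unique: "repE' b t ==> repE' b u ==> t = u"
proof -
 assume a: "repE b t" "repE b u"
 then have c: "t \<in> carr (R \<otimes> alg H)" "u \<in> carr (R \<otimes> alg H)" by (simp_all add: repE_def)
 have "lt (t - u) x = 0" for x using a lin_diff[OF vspace_tprod lin_lrt(1) c, of x] by (simp add: repE_def)
 then have "t - u = 0" by (intro RA_faithful0 vspace_diff[OF vspace_tprod] c) simp
 then show "t = u" by simp
next
 assume a: "repE' b t" "repE' b u"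
 then have c: "t \<in> carr (R \<otimes> alg H)" "u \<in> carr (R \<otimes> alg H)" by (simp_all add: repE'_def)
 have "rt (t - u) x = 0" for x using a lin_diff[OF vspace_tprod lin_lrt(2) c, of x] by (simp add: repE'_def)
 then have "t - u = 0" by (intro RA_faithful0 vspace_diff[OF vspace_tprod] c) simp
 then show "t = u" by simp
qed
lemma repE'_qp: "repE' (q * p) (ts (t3 p q) (\<lambda>y z. pure R A (Rr y) z))"
proof -
 have c: "ts (t3 p q) (\<lambda>y z. pure R A (Rr y) z) \<in> carr (R \<otimes> A)" by (rule ts_carr[OF vspace_tprod]) (simp add: pure_carr)
 have "rt (ts (t3 p q) (\<lambda>y z. pure R A (Rr y) z)) x = ts (t3 p q) (\<lambda>y z. (x \<lhd> Rr y) \<odot> z)" for x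
  by (subst tsum_tsum[where Z=AA]) (intro lins R_MM bil_RA | simp add: pure_carr tsum_pure[OF vR vspace_tprod bil_RA(4)] lins R_MM)+
 then show ?thesis using c by (simp add: repE'_def E2_Rr)
qed
lemma repE'_add: "repE' b t ==> repE' c u ==> repE' (b + c) (t + u)"
 using lin_add[of A AA "\<lambda>y. _ \<odot> y" b c] by (simp add: repE'_def vspace_add[OF vspace_tprod] lin_add[OF lin_lrt(2)] lins lin_add[OF lin_F(2)])
lemma repE'_ex: "\<exists>t. repE' b t"
proof -
 obtain s where s: "b = ts s (\<lambda>x y. x * y)" by (rule idem)
 let ?t = "\<lambda>q p. ts (t3 p q) (\<lambda>y z. pure R A (Rr y) z)"
 have c: "?t q p \<in> carr (R \<otimes> A)" for q p using repE'_qp by (simp add: repE'_def)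
 have "e2 x b = ts s (\<lambda>q p. e2 x (q * p))" for x
  unfolding s by (rule ts_pushA[where f="\<lambda>y. e2 x y" and Z'=AA]) (intro lins)
 moreover have "rt (ts s ?t) x = ts s (\<lambda>q p. rt (?t q p) x)" for x
  by (rule ts_push[OF vspace_tprod lin_lrt(2) c])
 ultimately have "repE' b (ts s ?t)"
  using repE'_qp ts_carr[OF vspace_tprod c] by (simp add: repE'_def)
 then show ?thesis by blast
qed
text \<open>The elements \<open>E(1 \<otimes> b)\<close> and \<open>(1 \<otimes> b)E\<close> of \<open>R \<otimes> A\<close>.\<close>
definition "rE b = (THE t. is_E_times H b t)"
definition "rE' b = (THE t. is_times_E H b t)"
lemma rE: "repE b (rE b)" unfolding rE_def is_E_times_iff using repE_ex[of b] repE_unique by (metis theI)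
lemma rE': "repE' b (rE' b)" unfolding rE'_def is_times_E_iff using repE'_ex[of b] repE'_unique by (metis theI)
lemma rE_eqI: "repE b t ==> rE b = t" using rE repE_unique by blast
lemma rE_c[simp]: "rE b \<in> carr (R \<otimes> alg H)" "rE' b \<in> carr (R \<otimes> alg H)" using rE[of b] rE'[of b] by (simp_all add: repE_def repE'_def)
lemma lin_rE: "lin A (R \<otimes> alg H) rE" "lin A (R \<otimes> alg H) rE'"
proof -
 have l: "lin A AA (\<lambda>b. e1 x b)" "lin A AA (\<lambda>b. e2 x b)" for x by (intro lins)+
 have s: "repE (asc H c b) (scal (R \<otimes> alg H) c (rE b))" "repE' (asc H c b) (scal (R \<otimes> alg H) c (rE' b))" for c b
  using rE[of b] rE'[of b] lin_scal[OF l(1), of b _ c] lin_scal[OF l(2), of b _ c] lin_scal[OF lin_lrt(1)] lin_scal[OF lin_lrt(2)]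
  by (auto simp: repE_def repE'_def vspace_scal[OF vspace_tprod])
 show "lin A (R \<otimes> alg H) rE" "lin A (R \<otimes> alg H) rE'" unfolding lin_def
  using repE_unique[OF rE repE_add[OF rE rE]] repE'_unique[OF rE' repE'_add[OF rE' rE']] repE_unique[OF rE s(1)] repE'_unique[OF rE' s(2)] by auto
qed

abbreviation "U \<equiv> unit_comod H"
lemma sp_U[simp]: "sp U = R" by (simp add: unit_comod_def Let_def)
lemma lam_U: "lin (R \<otimes> alg H) (R \<otimes> alg H) (lam U)" "r \<in> carr R ==> lam U (pure R A r a) = rE (r \<rhd> a)"
 and rho_U: "lin (R \<otimes> alg H) (R \<otimes> alg H) (rho U)" "r \<in> carr R ==> rho U (pure R A r a) = rE' (a \<lhd> r)"
proof -
 note l = lin_comp[OF lin_rE(1)] lin_comp[OF lin_rE(2)]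
 have b: "bilin R A (R \<otimes> alg H) (\<lambda>r a. rE (r \<rhd> a))" "bilin R A (R \<otimes> alg H) (\<lambda>r a. rE' (a \<lhd> r))" by (intro bilinI l rm_lin lin_Ract lin_id; assumption)+
 have u: "lam U = lift R A (R \<otimes> alg H) (\<lambda>r a. rE (r \<rhd> a))" "rho U = lift R A (R \<otimes> alg H) (\<lambda>r a. rE' (a \<lhd> r))"
  by (simp_all add: unit_comod_def Let_def rE_def rE'_def)
 show "lin (R \<otimes> alg H) (R \<otimes> alg H) (lam U)" "r \<in> carr R ==> lam U (pure R A r a) = rE (r \<rhd> a)"
  "lin (R \<otimes> alg H) (R \<otimes> alg H) (rho U)" "r \<in> carr R ==> rho U (pure R A r a) = rE' (a \<lhd> r)"
  unfolding u by (simp_all add: lift_lin[OF vspace_tprod b(1)] lift_lin[OF vspace_tprod b(2)] lift_pure[OF vspace_tprod b(1)] lift_pure[OF vspace_tprod b(2)])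
qed
lemma slice_rE: "slice_right R (alg H) (eps H) (rE b) = Rb b" "slice_right R (alg H) (eps H) (rE' b) = Rr b"
proof -
 note sl = slice_lin[OF vR lin_eps] and sp = slice_pure[OF vR lin_eps]
 have c: "slice_right R (alg H) (eps H) t \<in> carr R" if "t \<in> carr (R \<otimes> alg H)" for t by (rule lin_carr[OF sl that])
 have 1: "slice_right R (alg H) (eps H) t \<rhd> x = er (lt t x)" "x \<lhd> slice_right R (alg H) (eps H) t = er (rt t x)" if t: "t \<in> carr (R \<otimes> alg H)" for t x
  by (rule lin_tens_eq[OF vR lin_Ract(1)[OF sl] lin_comp[OF _ lin_lrt(1)] t], intro lins, simp only: sp tsum_pure[OF vR vspace_tprod bil_RA(3)], simp add: er_pure scal_R)
   (rule lin_tens_eq[OF vR lin_Ract(2)[OF sl] lin_comp[OF _ lin_lrt(2)] t], intro lins, simp only: sp tsum_pure[OF vR vspace_tprod bil_RA(4)], simp add: er_pure scal_R)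
 have e: "lt (rE b) x = e1 x b" "rt (rE' b) x = e2 x b" for x using rE[of b] rE'[of b] by (simp_all add: repE_def repE'_def)
 show "slice_right R (alg H) (eps H) (rE b) = Rb b" by (rule MM_eq[OF R_MM[OF c]]) (simp_all add: 1 e Rb_l)
 show "slice_right R (alg H) (eps H) (rE' b) = Rr b" by (rule MM_eqr[OF R_MM[OF c]]) (simp_all add: 1 e Rr_r)
qed
lemma act_U[simp]: assumes s: "s \<in> carr R" and r: "r \<in> carr R" shows "ract H U s r = s \<star> r" "lact H U r s = r \<star> s"
proof -
 have x: "\<exists>a. Rb a = r" using r by (auto simp: R_carr)
 have x': "\<exists>a. Rr a = r" using r unfolding R_carr range_eq by auto
 have e: "Rb (SOME a. Rb a = r) = r" "Rr (SOME a. Rr a = r) = r" by (rule someI_ex[OF x], rule someI_ex[OF x'])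
 show "ract H U s r = s \<star> r" by (simp add: ract_def lam_U s slice_rE Rb_R e)
 show "lact H U r s = r \<star> s" by (simp add: lact_def rho_U s slice_rE Rr_R e)
qed
end

context fdc begin
lemma E2_XR: assumes p: "lin X scalars \<phi>" "v \<in> carr X" and t: "t \<in> carr AA" shows "E2 H (XR \<phi> v t) = XR \<phi> v t"
 by (rule nondeg_mm(2)) (simp_all add: p t XL_E1 flip: XL_adj E_balanced)
text \<open>Compare coefficients: both sides come from applying the counit to a leg of \<open>E X\<close>, which is \<open>X\<close>.\<close>
lemma sum_act: assumes v: "v \<in> carr X"
 shows sum_lact: "(\<Sum>i\<in>I. lact H V (Rb (mc (f i) v \<rhd> a)) (g i)) = ract H V v (Rb a)"
  and sum_ract: "(\<Sum>i\<in>I. ract H V (g i) (Rr (a \<lhd> mc (f i) v))) = lact H V (Rr a) v"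
proof -
 have l: "lin X A (\<lambda>v. mc (f k) v \<rhd> x)" "lin X A (\<lambda>v. x \<lhd> mc (f k) v)" for k x by (intro lins fl)+
 show "(\<Sum>i\<in>I. lact H V (Rb (mc (f i) v \<rhd> a)) (g i)) = ract H V v (Rb a)"
 proof (rule mc_inj)
  fix k x
  have "mc (f k) (\<Sum>i\<in>I. lact H V (Rb (mc (f i) v \<rhd> a)) (g i)) \<rhd> x = (\<Sum>i\<in>I. er (E1 H ((mc (f k) (g i) \<rhd> x) \<odot> (mc (f i) v \<rhd> a))))"
   by (simp add: lin_sum[OF vX l(1)] fl Rb_l)
  also have "\<dots> = er (E1 H (XL (f k) v (x \<odot> a)))"
   unfolding XL_pure[OF fl v] by (rule lin_sum[where X=AA and Y=A and f="\<lambda>t. er (E1 H t)", symmetric]) (intro lins | simp)+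
  finally show "mc (f k) (\<Sum>i\<in>I. lact H V (Rb (mc (f i) v \<rhd> a)) (g i)) \<rhd> x = mc (f k) (ract H V v (Rb a)) \<rhd> x"
   by (simp add: E1_XL fl v er_XL)
 qed (intro vspace_sum vX act_carr R_Rb gc v)+
 show "(\<Sum>i\<in>I. ract H V (g i) (Rr (a \<lhd> mc (f i) v))) = lact H V (Rr a) v" (is "?s = _")
 proof (rule mc_inj)
  show c: "?s \<in> carr X" by (intro vspace_sum vX act_carr R_Rr gc v)
  show c': "lact H V (Rr a) v \<in> carr X" by (simp add: v)
  fix k x
  have "mc (f k) ?s = mc (f k) (lact H V (Rr a) v)"
  proof (rule MM_eqr)
   fix x
   have "x \<lhd> mc (f k) ?s = (\<Sum>i\<in>I. er (E2 H ((x \<lhd> mc (f k) (g i)) \<odot> (a \<lhd> mc (f i) v))))"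
    by (simp add: lin_sum[OF vX l(2)] fl Rr_r)
   also have "\<dots> = er (E2 H (XR (f k) v (x \<odot> a)))"
    unfolding XL_pure[OF fl v] by (rule lin_sum[where X=AA and Y=A and f="\<lambda>t. er (E2 H t)", symmetric]) (intro lins | simp)+
   finally show "x \<lhd> mc (f k) ?s = x \<lhd> mc (f k) (lact H V (Rr a) v)"
    by (simp add: E2_XR fl v er_XR)
  qed (simp_all add: fl c c')
  then show "mc (f k) ?s \<rhd> x = mc (f k) (lact H V (Rr a) v) \<rhd> x" by simp
 qed
qed
end

section \<open>The product of two comodules\<close>

locale fdc2 = wmbf H + V: fdc H V I g f + W: fdc H W J h e
 for H :: "('k::field, 'a::ring) wmb" and V :: "('k, 'v::ab_group_add, 'a) comod" and W :: "('k, 'w::ab_group_add, 'a) comod"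
  and I :: "'i set" and g f and J :: "'j set" and h e
begin
abbreviation "RT \<equiv> rtens H V W"
abbreviation "rp \<equiv> rpure H V W"
abbreviation "P \<equiv> rprod H V W"
text \<open>The matrix of the product comodule is the product of the two matrices.\<close>
definition "cf k q = V.mc (f (fst k)) (fst q) \<star> W.mc (e (snd k)) (snd q)"
definition "gk k = (g (fst k), h (snd k))"
definition "pt q = rp (fst q) (snd q)"
abbreviation "Q \<equiv> carr (sp V) \<times> carr (sp W)"
lemma gk_Q[simp]: "gk k \<in> Q" by (simp add: gk_def)
lemma pt_c[simp, lins]: "q \<in> Q ==> pt q \<in> carr RT" by (auto simp: pt_def)
lemma cf_MM[simp]: "q \<in> Q ==> cf k q \<in> MM" by (auto simp: cf_def V.fl W.fl)
lemma lin_cf: "lin Z (sp V) a ==> w \<in> carr (sp W) ==> lin Z M (\<lambda>z. cf k (a z, w))" "v \<in> carr (sp V) ==> lin Z (sp W) b ==> lin Z M (\<lambda>z. cf k (v, b z))"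
 unfolding cf_def fst_conv snd_conv by (intro lins V.fl W.fl; assumption)+

lemma XX_cf: assumes q: "q \<in> Q" and t: "t \<in> carr AA"
 shows "XX (I \<times> J) (\<lambda>i. cf l (gk i)) (\<lambda>i. cf i q) t = V.XL (f (fst l)) (fst q) (W.XL (e (snd l)) (snd q) t)"
proof (rule AA_eq[OF _ _ t, where Z=AA])
 have q': "fst q \<in> carr (sp V)" "snd q \<in> carr (sp W)" using q by auto
 show "lin AA AA (XX (I \<times> J) (\<lambda>i. cf l (gk i)) (\<lambda>i. cf i q))" by (rule lin_XX(1)[OF lin_id]) (simp_all add: q)
 show "lin AA AA (\<lambda>t. V.XL (f (fst l)) (fst q) (W.XL (e (snd l)) (snd q) t))" by (intro lins V.fl W.fl q')
 fix x y
 let ?F = "\<lambda>i j. (V.mc (f (fst l)) (g i) \<rhd> (W.mc (e (snd l)) (h j) \<rhd> x)) \<odot> (V.mc (f i) (fst q) \<rhd> (W.mc (e j) (snd q) \<rhd> y))"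
 have "XX (I \<times> J) (\<lambda>i. cf l (gk i)) (\<lambda>i. cf i q) (x \<odot> y) = (\<Sum>i\<in>I \<times> J. (cf l (gk i) \<rhd> x) \<odot> (cf i q \<rhd> y))"
  by (rule XX_pure) (simp_all add: q)
 also have "\<dots> = (\<Sum>i\<in>I. \<Sum>j\<in>J. ?F i j)" by (simp add: cf_def gk_def sum.cartesian_product split_def)
 also have "\<dots> = (\<Sum>j\<in>J. \<Sum>i\<in>I. ?F i j)" by (rule sum.swap)
 also have "\<dots> = (\<Sum>j\<in>J. V.XL (f (fst l)) (fst q) ((W.mc (e (snd l)) (h j) \<rhd> x) \<odot> (W.mc (e j) (snd q) \<rhd> y)))"
  by (simp add: V.XL_pure V.fl q')
 also have "\<dots> = V.XL (f (fst l)) (fst q) (W.XL (e (snd l)) (snd q) (x \<odot> y))"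
  unfolding W.XL_pure[OF W.fl q'(2)] by (rule lin_sum[where X=AA and Y=AA, symmetric]) (intro lins V.fl q' | simp)+
 finally show "XX (I \<times> J) (\<lambda>i. cf l (gk i)) (\<lambda>i. cf i q) (x \<odot> y) = V.XL (f (fst l)) (fst q) (W.XL (e (snd l)) (snd q) (x \<odot> y))" .
qed

lemma rproj: "lin (sp V \<otimes> sp W) RT (rproj H V W)" "v \<in> carr (sp V) ==> w \<in> carr (sp W) ==> rproj H V W (pure (sp V) (sp W) v w) = rp v w"
 unfolding rproj_def by (rule lift_lin[OF vspace_rtens bilin_rpure], rule lift_pure[OF vspace_rtens bilin_rpure])
abbreviation "TV \<equiv> tens_comod H V W"
lemma sp_TV[simp]: "sp TV = sp V \<otimes> sp W" by (simp add: tens_comod_def Let_def)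
lemma lin_TV: "lin ((sp V \<otimes> sp W) \<otimes> alg H) ((sp V \<otimes> sp W) \<otimes> alg H) (lam TV)"
 by (simp add: tens_comod_def Let_def comp_def lin_comp[OF lin_leg13[OF V.vX vspace_A W.vX V.lin_lam] lin_leg23[OF V.vX vspace_A W.vX W.lin_lam]])
lemma lam_TV: assumes v: "v \<in> carr (sp V)" and w: "w \<in> carr (sp W)"
 shows "lam TV (pure (sp V \<otimes> sp W) A (pure (sp V) (sp W) v w) a) = (\<Sum>k\<in>I \<times> J. pure (sp V \<otimes> sp W) A (pure (sp V) (sp W) (g (fst k)) (h (snd k))) (cf k (v, w) \<rhd> a))"
proof -
 let ?p = "\<lambda>v w a. pure (sp V \<otimes> sp W) A (pure (sp V) (sp W) v w) a"
 have pc: "?p v w a \<in> carr ((sp V \<otimes> sp W) \<otimes> alg H)" if "v \<in> carr (sp V)" "w \<in> carr (sp W)" for v w a using that by (simp add: pure_carr)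
 have b1: "bilin (sp W) A ((sp V \<otimes> sp W) \<otimes> alg H) (\<lambda>y z. ?p v y z)" by (intro lins pure_carr v; assumption?)
 have b2: "bilin (sp V) A ((sp V \<otimes> sp W) \<otimes> alg H) (\<lambda>y z. ?p y (h j) z)" for j by (intro lins pure_carr W.gc; assumption?)
 have 1: "leg23 (sp V) (sp W) A (sp W) A (lam W) (?p v w a) = (\<Sum>j\<in>J. ?p v (h j) (W.mc (e j) w \<rhd> a))"
  unfolding leg23_pure[OF V.vX vspace_A W.vX W.lin_lam v w carr_A] W.lam_exp[OF w]
  by (rule tsum_sumpure[OF W.vX vspace_tprod b1]) simp_all
 have 2: "leg13 (sp V) (sp W) A (lam V) (?p v (h j) b) = (\<Sum>i\<in>I. ?p (g i) (h j) (V.mc (f i) v \<rhd> b))" for j b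
  unfolding leg13_pure[OF V.vX vspace_A W.vX V.lin_lam v W.gc carr_A] V.lam_exp[OF v]
  by (rule tsum_sumpure[OF V.vX vspace_tprod b2]) simp_all
 have "lam TV (?p v w a) = leg13 (sp V) (sp W) A (lam V) (\<Sum>j\<in>J. ?p v (h j) (W.mc (e j) w \<rhd> a))"
  by (simp add: tens_comod_def Let_def 1)
 also have "\<dots> = (\<Sum>j\<in>J. \<Sum>i\<in>I. ?p (g i) (h j) (V.mc (f i) v \<rhd> (W.mc (e j) w \<rhd> a)))"
  by (subst lin_sum[OF vspace_tprod lin_leg13[OF V.vX vspace_A W.vX V.lin_lam]]) (simp_all add: 2 pc v)
 also have "\<dots> = (\<Sum>i\<in>I. \<Sum>j\<in>J. ?p (g i) (h j) (V.mc (f i) v \<rhd> (W.mc (e j) w \<rhd> a)))" by (rule sum.swap)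
 finally show ?thesis by (simp add: cf_def sum.cartesian_product split_def)
qed

definition "PL q a = (\<Sum>k\<in>I \<times> J. pure RT A (pt (gk k)) (cf k q \<rhd> a))"
definition "PR q a = (\<Sum>k\<in>I \<times> J. pure RT A (pt (gk k)) (a \<lhd> cf k q))"
lemma PLR_c[simp]: "PL q a \<in> carr (RT \<otimes> alg H)" "PR q a \<in> carr (RT \<otimes> alg H)"
 unfolding PL_def PR_def by (intro vspace_sum vspace_tprod pure_carr pt_c gk_Q carr_A)+
text \<open>Multipliers compose associatively, so that an element of \<open>R\<close> acts between the two coefficients; therefore the matrix
descends to the balanced tensor product.\<close>
lemma cf_bal: assumes "v \<in> carr (sp V)" "r \<in> carr R" "w \<in> carr (sp W)" shows "cf k (ract H V v r, w) = cf k (v, lact H W r w)"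
 using assms by (simp add: cf_def V.fl W.fl mp_assoc)
lemma rbal_PLR: "rbal H V W (RT \<otimes> alg H) (\<lambda>v w. PL (v, w) a)" "rbal H V W (RT \<otimes> alg H) (\<lambda>v w. PR (v, w) a)"
 unfolding rbal_def PL_def PR_def
 by (intro conjI bilinI lin_sumI vspace_tprod lin_pure2 pt_c gk_Q lin_Mact lin_cf lin_id; assumption?; simp add: cf_bal)+
lemma lin_PLR: "q \<in> Q ==> lin A (RT \<otimes> alg H) (\<lambda>a. PL q a)" "q \<in> Q ==> lin A (RT \<otimes> alg H) (\<lambda>a. PR q a)"
 unfolding PL_def PR_def by (intro lin_sumI vspace_tprod lin_pure2 pt_c gk_Q lin_ml lin_mr lin_id cf_MM; assumption)+

lemma span_pt: "module.span (scal RT) (pt ` Q) = carr RT"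
proof -
 have "pt ` Q = {ptensor (rforms H V W) x y | x y. x \<in> carr (sp V) \<and> y \<in> carr (sp W)}"
  by (auto simp: pt_def rpure_def image_def)
 then show ?thesis by (simp add: rtens_def tspace_def)
qed

text \<open>By \<open>comodI\<close> with the images of pure tensors. For the product matrix, \<open>X\<close> is the composite of those of the factors.\<close>
lemma rprod_ex: "\<exists>P. sp P = RT \<and> comodule H P \<and> comod_mor H TV P (rproj H V W)"
proof -
 let ?L = "\<lambda>t a. rlift H V W (RT \<otimes> alg H) (\<lambda>v w. PL (v, w) a) t" and ?R = "\<lambda>t a. rlift H V W (RT \<otimes> alg H) (\<lambda>v w. PR (v, w) a) t"
 have bl: "bilin RT A (RT \<otimes> alg H) ?L" "bilin RT A (RT \<otimes> alg H) ?R"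
  by (rule bilin_rlift[OF vspace_tprod vspace_A rbal_PLR(1)], rule lin_PLR(1), simp, rule bilin_rlift[OF vspace_tprod vspace_A rbal_PLR(2)], rule lin_PLR(2), simp)
 define P0 where "P0 = \<lparr>sp = RT, lam = lift RT A (RT \<otimes> alg H) ?L, rho = lift RT A (RT \<otimes> alg H) ?R\<rparr>"
 have s: "sp P0 = RT" by (simp add: P0_def)
 have ll: "lin (RT \<otimes> alg H) (RT \<otimes> alg H) (lam P0)" "lin (RT \<otimes> alg H) (RT \<otimes> alg H) (rho P0)"
  by (simp_all add: P0_def lift_lin[OF vspace_tprod bl(1)] lift_lin[OF vspace_tprod bl(2)])
 have lp: "lam P0 (pure RT A (pt q) a) = PL q a" "rho P0 (pure RT A (pt q) a) = PR q a" if q: "q \<in> Q" for q a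
 proof -
  have q': "fst q \<in> carr (sp V)" "snd q \<in> carr (sp W)" using q by auto
  show "lam P0 (pure RT A (pt q) a) = PL q a" "rho P0 (pure RT A (pt q) a) = PR q a"
   by (simp_all add: P0_def lift_pure[OF vspace_tprod bl(1)] lift_pure[OF vspace_tprod bl(2)] q)
    (simp_all add: pt_def q' rlift_pure[OF vspace_tprod rbal_PLR(1)] rlift_pure[OF vspace_tprod rbal_PLR(2)])
 qed
 have "comodule H P0"
 proof (rule comodI[where V=P0 and pt=pt and P=Q and K="I \<times> J" and gg=gk and m=cf])
  show "module.span (scal (sp P0)) (pt ` Q) = carr (sp P0)" by (simp only: s span_pt)
  fix k q a t assume q: "q \<in> Q" and t: "t \<in> carr AA"
  have q': "fst q \<in> carr (sp V)" "snd q \<in> carr (sp W)" using q by auto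
  show "XX (I \<times> J) (\<lambda>i. cf k (gk i)) (\<lambda>i. cf i q) (E1 H t) = XX (I \<times> J) (\<lambda>i. cf k (gk i)) (\<lambda>i. cf i q) t"
   by (simp add: XX_cf q t W.XL_E1 W.fl q')
  show "DL (cf k q \<rhd> a) t = XX (I \<times> J) (\<lambda>i. cf k (gk i)) (\<lambda>i. cf i q) (DL a t)"
   by (simp add: XX_cf q t) (simp add: W.XL_DL V.XL_DL V.fl W.fl q' t cf_def)
 qed (use ll lp in \<open>simp_all only: s vspace_rtens PL_def PR_def cf_MM gk_Q\<close>, auto)
 moreover have "comod_mor H TV P0 (rproj H V W)"
 proof -
  let ?f = "tmap (sp V \<otimes> sp W) A RT A (rproj H V W) id"
  have lf: "lin ((sp V \<otimes> sp W) \<otimes> alg H) (RT \<otimes> alg H) ?f" by (rule lin_tmap[OF rproj(1) lin_idc])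
  have "lam P0 (?f t) = ?f (lam TV t)" if t: "t \<in> carr ((sp V \<otimes> sp W) \<otimes> alg H)" for t
  proof (rule lin_tens3_eq[OF V.vX lin_comp[OF ll(1) lf] lin_comp[OF lf lin_TV] t])
   fix v w a assume v: "v \<in> carr (sp V)" and w: "w \<in> carr (sp W)"
   have pf: "?f (pure (sp V \<otimes> sp W) A (pure (sp V) (sp W) v w) a) = pure RT A (pt (v, w)) a" if "v \<in> carr (sp V)" "w \<in> carr (sp W)" for v w a
    using that by (simp add: tmap_pure[OF rproj(1) lin_idc] pure_carr rproj(2) pt_def)
   show "lam P0 (?f (pure (sp V \<otimes> sp W) A (pure (sp V) (sp W) v w) a)) = ?f (lam TV (pure (sp V \<otimes> sp W) A (pure (sp V) (sp W) v w) a))"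
    by (simp only: pf v w lam_TV, subst lin_sum[OF vspace_tprod lf]) (simp_all add: pf pure_carr lp v w PL_def, simp add: gk_def)
  qed
  then show ?thesis by (simp add: comod_mor_def Let_def s rproj(1))
 qed
 ultimately show ?thesis using s by blast
qed
lemma P_spec: "sp P = RT \<and> comodule H P \<and> comod_mor H TV P (rproj H V W)" unfolding rprod_def by (rule someI_ex[OF rprod_ex])
lemma sp_P[simp]: "sp P = RT" and com_P: "comodule H P" using P_spec by auto
lemma lin_P: "lin (RT \<otimes> alg H) (RT \<otimes> alg H) (lam P)" "lin (RT \<otimes> alg H) (RT \<otimes> alg H) (rho P)" using com_P by (simp_all add: comodule_def Let_def)
text \<open>The projection from \<open>V \<otimes> W\<close> is a surjective morphism and so determines \<open>\<lambda>\<close>; \<open>\<rho>\<close> follows by nondegeneracy.\<close>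
lemma lam_P: assumes q: "q \<in> Q" shows "lam P (pure RT A (pt q) a) = PL q a"
proof -
 let ?f = "tmap (sp V \<otimes> sp W) A RT A (rproj H V W) id"
 have q': "fst q \<in> carr (sp V)" "snd q \<in> carr (sp W)" using q by auto
 have lf: "lin ((sp V \<otimes> sp W) \<otimes> alg H) (RT \<otimes> alg H) ?f" by (rule lin_tmap[OF rproj(1) lin_idc])
 have pf: "?f (pure (sp V \<otimes> sp W) A (pure (sp V) (sp W) v w) a) = pure RT A (pt (v, w)) a" if "v \<in> carr (sp V)" "w \<in> carr (sp W)" for v w a
  using that by (simp add: tmap_pure[OF rproj(1) lin_idc] pure_carr rproj(2) pt_def)
 let ?t = "pure (sp V \<otimes> sp W) A (pure (sp V) (sp W) (fst q) (snd q)) a"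
 have tc: "?t \<in> carr ((sp V \<otimes> sp W) \<otimes> alg H)" by (simp add: pure_carr q')
 \<comment> \<open>the projection is a morphism of comodules and is onto the pure tensors\<close>
 have "lam P (pure RT A (pt q) a) = lam P (?f ?t)" by (simp add: pf[OF q'])
 also have "\<dots> = ?f (lam TV ?t)" using P_spec tc unfolding comod_mor_def Let_def by simp
 also have "\<dots> = PL q a"
  by (simp only: lam_TV[OF q'], subst lin_sum[OF vspace_tprod lf]) (simp_all add: pf pure_carr PL_def, simp add: gk_def)
 finally show ?thesis .
qed
lemma rho_P: assumes q: "q \<in> Q" shows "rho P (pure RT A (pt q) a) = PR q a"
proof (rule second_cancel[OF vspace_rtens])
 have pc: "pure RT A (pt q) a \<in> carr (RT \<otimes> alg H)" for a by (simp add: pure_carr q)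
 show "rho P (pure RT A (pt q) a) \<in> carr (RT \<otimes> alg H)" by (rule lin_carr[OF lin_P(2) pc])
 show "PR q a \<in> carr (RT \<otimes> alg H)" by simp
 fix b
 have la: "lin A A (\<lambda>y. a * y)" "lin A A (\<lambda>y. y * b)" by (intro lins)+
 have "tmap RT A RT A id (\<lambda>y. y * b) (rho P (pure RT A (pt q) a)) = tmap RT A RT A id (\<lambda>y. a * y) (PL q b)"
  using com_P pt_c[OF q] unfolding comodule_def Let_def sp_P lam_P[OF q, symmetric] by simp
 also have "\<dots> = (\<Sum>k\<in>I \<times> J. pure RT A (pt (gk k)) (a * (cf k q \<rhd> b)))" unfolding PL_def
  by (subst lin_sum[OF vspace_tprod lin_tmap[OF lin_idc la(1)]]) (simp_all add: pure_carr tmap_pure[OF lin_idc la(1)])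
 also have "\<dots> = tmap RT A RT A id (\<lambda>y. y * b) (PR q a)" unfolding PR_def
  by (subst lin_sum[OF vspace_tprod lin_tmap[OF lin_idc la(2)]]) (simp_all add: pure_carr tmap_pure[OF lin_idc la(2)] MM_bal q)
 finally show "tmap RT A RT A id (\<lambda>y. y * b) (rho P (pure RT A (pt q) a)) = tmap RT A RT A id (\<lambda>y. y * b) (PR q a)" .
qed

lemma lin_P_act: "lin RT RT (\<lambda>t. ract H P t r)" "lin RT RT (\<lambda>t. lact H P r t)"
 using lin_ract_comod[of P r] lin_lact_comod[of P r] lin_P by simp_all
lemma slice_P: "slice_right RT (alg H) (eps H) (PL q a) = (\<Sum>i\<in>I. \<Sum>j\<in>J. scal RT (eps H (V.mc (f i) (fst q) \<rhd> (W.mc (e j) (snd q) \<rhd> a))) (rp (g i) (h j)))"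
 "slice_right RT (alg H) (eps H) (PR q a) = (\<Sum>i\<in>I. \<Sum>j\<in>J. scal RT (eps H ((a \<lhd> V.mc (f i) (fst q)) \<lhd> W.mc (e j) (snd q))) (rp (g i) (h j)))"
 unfolding PL_def PR_def
 by (subst lin_sum[OF vspace_tprod slice_lin[OF vspace_rtens lin_eps]], simp_all add: pure_carr slice_pure[OF vspace_rtens lin_eps],
   simp add: cf_def gk_def pt_def sum.cartesian_product split_def)+
text \<open>The module structure of the product is the outer one; this is \<open>sum_lact\<close> and \<open>sum_ract\<close> for the factors.\<close>
lemma P_act: assumes v: "v \<in> carr (sp V)" and w: "w \<in> carr (sp W)" and r: "r \<in> carr R"
 shows "ract H P (rp v w) r = rp v (ract H W w r)" "lact H P r (rp v w) = rp (lact H V r v) w"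
proof -
 have q: "(v, w) \<in> Q" using v w by simp
 have vw: "rp v w = pt (v, w)" by (simp add: pt_def)
 have x: "\<exists>a. Rb a = r" using r by (auto simp: R_carr)
 have x': "\<exists>a. Rr a = r" using r unfolding R_carr range_eq by auto
 define a where "a = (SOME a. Rb a = r)"
 define a' where "a' = (SOME a. Rr a = r)"
 have a: "Rb a = r" "Rr a' = r" unfolding a_def a'_def by (rule someI_ex[OF x], rule someI_ex[OF x'])
 have s1: "(\<Sum>i\<in>I. scal RT (c i) (rp (g i) y)) = rp (\<Sum>i\<in>I. scal (sp V) (c i) (g i)) y" if "y \<in> carr (sp W)" for c y
 proof -
  have l: "lin (sp V) RT (\<lambda>x. rp x y)" using that by (intro lins)
  show ?thesis by (simp add: lin_sum[OF V.vX l] vspace_scal lin_scal[OF l])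
 qed
 have s2: "(\<Sum>j\<in>J. scal RT (c j) (rp y (h j))) = rp y (\<Sum>j\<in>J. scal (sp W) (c j) (h j))" if "y \<in> carr (sp V)" for c y
 proof -
  have l: "lin (sp W) RT (\<lambda>x. rp y x)" using that by (intro lins)
  show ?thesis by (simp add: lin_sum[OF W.vX l] vspace_scal lin_scal[OF l])
 qed
 have l1: "lin (sp W) RT (\<lambda>x. rp v x)" by (intro lins v)
 have l2: "lin (sp V) RT (\<lambda>x. rp x w)" by (intro lins w)
 have "ract H P (rp v w) r = (\<Sum>i\<in>I. \<Sum>j\<in>J. scal RT (eps H (V.mc (f i) v \<rhd> (W.mc (e j) w \<rhd> a))) (rp (g i) (h j)))"
  unfolding ract_def sp_P a_def[symmetric] vw lam_P[OF q] slice_P by simp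
 also have "\<dots> = (\<Sum>j\<in>J. \<Sum>i\<in>I. scal RT (eps H (V.mc (f i) v \<rhd> (W.mc (e j) w \<rhd> a))) (rp (g i) (h j)))" by (rule sum.swap)
 also have "\<dots> = (\<Sum>j\<in>J. rp (ract H V v (Rb (W.mc (e j) w \<rhd> a))) (h j))" by (simp add: s1 V.ract_Rb v V.actv_def)
 also have "\<dots> = (\<Sum>j\<in>J. rp v (lact H W (Rb (W.mc (e j) w \<rhd> a)) (h j)))" by (simp add: rpure_bal v)
 also have "\<dots> = rp v (ract H W w r)"
  by (simp add: W.sum_lact[OF w, symmetric] lin_sum[OF W.vX l1] flip: a(1))
 finally show "ract H P (rp v w) r = rp v (ract H W w r)" .
 have "lact H P r (rp v w) = (\<Sum>i\<in>I. \<Sum>j\<in>J. scal RT (eps H ((a' \<lhd> V.mc (f i) v) \<lhd> W.mc (e j) w)) (rp (g i) (h j)))"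
  unfolding lact_def sp_P a'_def[symmetric] vw rho_P[OF q] slice_P by simp
 also have "\<dots> = (\<Sum>i\<in>I. rp (g i) (lact H W (Rr (a' \<lhd> V.mc (f i) v)) w))" by (simp add: s2 W.lact_Rr w W.actl_def)
 also have "\<dots> = (\<Sum>i\<in>I. rp (ract H V (g i) (Rr (a' \<lhd> V.mc (f i) v))) w)" by (simp add: rpure_bal w)
 also have "\<dots> = rp (lact H V r v) w"
  by (simp add: V.sum_ract[OF v, symmetric] lin_sum[OF V.vX l2] flip: a(2))
 finally show "lact H P r (rp v w) = rp (lact H V r v) w" .
qed
end

context fdc begin
lemma act_act: assumes v: "v \<in> carr X" and r: "r \<in> carr R" "s \<in> carr R"
 shows "ract H V (ract H V v r) s = ract H V v (r \<star> s)" "lact H V r (lact H V s v) = lact H V (r \<star> s) v"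
 by (rule mc_inj; simp add: v r fl)+
end

context wmbf begin

section \<open>Associators and unitors\<close>

text \<open>Stated with the module laws as hypotheses, so that it applies to triple products made from \<open>V\<close> and its dual.\<close>
lemma rassoc_exists:
 fixes K :: "('k, 'u::ab_group_add, 'a) comod" and L :: "('k, 'v::ab_group_add, 'a) comod" and N :: "('k, 'w::ab_group_add, 'a) comod"
 assumes vN: "vspace (sp N)" and vK: "vspace (sp K)"
  and s1: "sp (rprod H K L) = rtens H K L" and s2: "sp (rprod H L N) = rtens H L N"
  and l1: "\<And>r. lin (rtens H K L) (rtens H K L) (\<lambda>t. ract H (rprod H K L) t r)" and l2: "\<And>r. lin (rtens H L N) (rtens H L N) (\<lambda>t. lact H (rprod H L N) r t)"
  and c: "\<And>u r. u \<in> carr (sp K) ==> r \<in> carr R ==> ract H K u r \<in> carr (sp K)" "\<And>v r. v \<in> carr (sp L) ==> r \<in> carr R ==> ract H L v r \<in> carr (sp L)"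
    "\<And>v r. v \<in> carr (sp L) ==> r \<in> carr R ==> lact H L r v \<in> carr (sp L)" "\<And>w r. w \<in> carr (sp N) ==> r \<in> carr R ==> lact H N r w \<in> carr (sp N)"
  and p1: "\<And>u v r. u \<in> carr (sp K) ==> v \<in> carr (sp L) ==> r \<in> carr R ==> ract H (rprod H K L) (rpure H K L u v) r = rpure H K L u (ract H L v r)"
  and p2: "\<And>v w r. v \<in> carr (sp L) ==> w \<in> carr (sp N) ==> r \<in> carr R ==> lact H (rprod H L N) r (rpure H L N v w) = rpure H L N (lact H L r v) w"
 shows rassoc_lin: "lin (rtens H (rprod H K L) N) (rtens H K (rprod H L N)) (rassoc H K L N)"
  and rassoc_pure: "u \<in> carr (sp K) ==> v \<in> carr (sp L) ==> w \<in> carr (sp N) ==>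
    rassoc H K L N (rpure H (rprod H K L) N (rpure H K L u v) w) = rpure H K (rprod H L N) u (rpure H L N v w)"
  and rassoc_inv_lin: "lin (rtens H K (rprod H L N)) (rtens H (rprod H K L) N) (rassoc_inv H K L N)"
  and rassoc_inv_pure: "u \<in> carr (sp K) ==> v \<in> carr (sp L) ==> w \<in> carr (sp N) ==>
    rassoc_inv H K L N (rpure H K (rprod H L N) u (rpure H L N v w)) = rpure H (rprod H K L) N (rpure H K L u v) w"
proof -
 let ?Z = "rtens H K (rprod H L N)" and ?b = "\<lambda>u v w. rpure H K (rprod H L N) u (rpure H L N v w)"
 let ?Y = "rtens H (rprod H K L) N" and ?d = "\<lambda>u v w. rpure H (rprod H K L) N (rpure H K L u v) w"
 have pc: "rpure H K L u v \<in> carr (sp (rprod H K L))" if "u \<in> carr (sp K)" "v \<in> carr (sp L)" for u v using that by (simp add: s1)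
 have qc: "rpure H L N u v \<in> carr (sp (rprod H L N))" if "u \<in> carr (sp L)" "v \<in> carr (sp N)" for u v using that by (simp add: s2)
 have lb: "lin W (sp (rprod H L N)) (\<lambda>z. rpure H L N (k z) w)" if "lin W (sp L) k" "w \<in> carr (sp N)" for W :: "('k,'z::ab_group_add) space" and k w
  using that unfolding s2 by (intro lins)
 have lb': "lin W (sp (rprod H L N)) (\<lambda>z. rpure H L N v (k z))" if "lin W (sp N) k" "v \<in> carr (sp L)" for W :: "('k,'z::ab_group_add) space" and k v
  using that unfolding s2 by (intro lins)
 have ld: "lin W (sp (rprod H K L)) (\<lambda>z. rpure H K L (k z) w)" if "lin W (sp K) k" "w \<in> carr (sp L)" for W :: "('k,'z::ab_group_add) space" and k w
  using that unfolding s1 by (intro lins)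
 have ld': "lin W (sp (rprod H K L)) (\<lambda>z. rpure H K L v (k z))" if "lin W (sp L) k" "v \<in> carr (sp K)" for W :: "('k,'z::ab_group_add) space" and k v
  using that unfolding s1 by (intro lins)
 have ib: "rbal H K L ?Z (\<lambda>u v. ?b u v w)" if w: "w \<in> carr (sp N)" for w
  unfolding rbal_def by (intro conjI bilinI lin_rpure lb qc lin_id ballI w; assumption?) (simp add: rpure_bal qc w flip: p2)
 have id: "rbal H L N ?Y (\<lambda>v w. ?d u v w)" if u: "u \<in> carr (sp K)" for u
  unfolding rbal_def by (intro conjI bilinI lin_rpure ld' pc lin_id ballI u; assumption?) (simp add: rpure_bal pc u flip: p1)
 let ?B = "\<lambda>t w. rlift H K L ?Z (\<lambda>u v. ?b u v w) t" and ?D = "\<lambda>u t. rlift H L N ?Y (\<lambda>v w. ?d u v w) t"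
 note Bp = rlift_pure[OF vspace_rtens ib] and Dp = rlift_pure[OF vspace_rtens id]
 note Bl = rlift_lin[OF vspace_rtens ib] and Dl = rlift_lin[OF vspace_rtens id]
 have bB: "bilin (rtens H K L) (sp N) ?Z ?B"
  by (rule bilin_rlift[OF vspace_rtens vN ib], assumption) (intro lin_rpure lb' lin_id; assumption)
 have bD: "bilin (rtens H L N) (sp K) ?Y (\<lambda>t u. ?D u t)"
  by (rule bilin_rlift[OF vspace_rtens vK id], assumption) (intro lin_rpure ld pc lin_id; assumption)
 have oB: "rbal H (rprod H K L) N ?Z ?B" unfolding rbal_def s1
 proof (intro conjI bB ballI)
  fix t r w assume t: "t \<in> carr (rtens H K L)" and r: "r \<in> carr R" and w: "w \<in> carr (sp N)"
  show "?B (ract H (rprod H K L) t r) w = ?B t (lact H N r w)"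
   by (rule rtens_eq[OF vspace_rtens lin_comp[OF Bl[OF w] l1] Bl[OF c(4)[OF w r]] _ t]) (simp add: p1 r w Bp c rpure_bal)
 qed
 have oD: "rbal H K (rprod H L N) ?Y ?D" unfolding rbal_def s2
 proof (intro conjI ballI)
  show "bilin (sp K) (rtens H L N) ?Y ?D" by (rule bilinI[OF bilinD(2)[OF bD] bilinD(1)[OF bD]])
  fix u r t assume t: "t \<in> carr (rtens H L N)" and r: "r \<in> carr R" and u: "u \<in> carr (sp K)"
  show "?D (ract H K u r) t = ?D u (lact H (rprod H L N) r t)"
   by (rule rtens_eq[OF vspace_rtens Dl[OF c(1)[OF u r]] lin_comp[OF Dl[OF u] l2] _ t]) (simp add: p2 r u Dp c rpure_bal)
 qed
 show "lin ?Y ?Z (rassoc H K L N)" unfolding rassoc_def by (rule rlift_lin[OF vspace_rtens oB])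
 show "lin ?Z ?Y (rassoc_inv H K L N)" unfolding rassoc_inv_def by (rule rlift_lin[OF vspace_rtens oD])
 assume uvw: "u \<in> carr (sp K)" "v \<in> carr (sp L)" "w \<in> carr (sp N)"
 show "rassoc H K L N (rpure H (rprod H K L) N (rpure H K L u v) w) = ?b u v w"
  unfolding rassoc_def using uvw by (simp add: rlift_pure[OF vspace_rtens oB] pc Bp)
 show "rassoc_inv H K L N (rpure H K (rprod H L N) u (rpure H L N v w)) = ?d u v w"
  unfolding rassoc_inv_def using uvw by (simp add: rlift_pure[OF vspace_rtens oD] qc Dp)
qed

lemma rmap_exists:
 fixes K :: "('k, 'u::ab_group_add, 'a) comod" and L :: "('k, 'v::ab_group_add, 'a) comod"
  and K' :: "('k, 'u2::ab_group_add, 'a) comod" and L' :: "('k, 'v2::ab_group_add, 'a) comod"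
 assumes f: "lin (sp K) (sp K') f" and g: "lin (sp L) (sp L') g"
  and fr: "\<And>v r. v \<in> carr (sp K) ==> r \<in> carr R ==> f (ract H K v r) = ract H K' (f v) r"
  and gr: "\<And>v r. v \<in> carr (sp L) ==> r \<in> carr R ==> g (lact H L r v) = lact H L' r (g v)"
 shows rmap_lin: "lin (rtens H K L) (rtens H K' L') (rmap H K L K' L' f g)"
  and rmap_pure: "v \<in> carr (sp K) ==> w \<in> carr (sp L) ==> rmap H K L K' L' f g (rpure H K L v w) = rpure H K' L' (f v) (g w)"
proof -
 note c = lin_carr[OF f] lin_carr[OF g]
 have b: "rbal H K L (rtens H K' L') (\<lambda>v w. rpure H K' L' (f v) (g w))"
  unfolding rbal_def by (intro conjI bilinI lin_rpure c f g ballI; assumption?) (simp add: fr gr rpure_bal c)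
 show "lin (rtens H K L) (rtens H K' L') (rmap H K L K' L' f g)"
  "v \<in> carr (sp K) ==> w \<in> carr (sp L) ==> rmap H K L K' L' f g (rpure H K L v w) = rpure H K' L' (f v) (g w)"
  unfolding rmap_def by (rule rlift_lin[OF vspace_rtens b], rule rlift_pure[OF vspace_rtens b])
qed
end

context fdc begin
lemma unitors: shows lunitor_lin: "lin (rtens H U V) X (lunitor H V)" and lunitor_pure: "r \<in> carr R ==> v \<in> carr X ==> lunitor H V (rpure H U V r v) = lact H V r v"
 and runitor_lin: "lin (rtens H V U) X (runitor H V)" and runitor_pure: "r \<in> carr R ==> v \<in> carr X ==> runitor H V (rpure H V U v r) = ract H V v r"
proof -
 have b: "rbal H U V X (\<lambda>r v. lact H V r v)" "rbal H V U X (\<lambda>v r. ract H V v r)"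
  unfolding rbal_def sp_U by (intro conjI bilinI lin_act lin_act2 lin_id vX vR ballI; assumption?; simp add: act_act)+
 show "lin (rtens H U V) X (lunitor H V)" "r \<in> carr R ==> v \<in> carr X ==> lunitor H V (rpure H U V r v) = lact H V r v"
  "lin (rtens H V U) X (runitor H V)" "r \<in> carr R ==> v \<in> carr X ==> runitor H V (rpure H V U v r) = ract H V v r"
  unfolding lunitor_def runitor_def
  by (rule rlift_lin[OF vX b(1)], simp add: rlift_pure[OF vX b(1)], rule rlift_lin[OF vX b(2)], simp add: rlift_pure[OF vX b(2)])
qed
end

lemma (in fdc2) RTA_eq:
 fixes Z :: "('k,'z::ab_group_add) space"
 assumes Z: "vspace Z" and F: "lin (RT \<otimes> alg H) Z F" and G: "lin (RT \<otimes> alg H) Z G"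
  and e: "\<And>v w a. v \<in> carr (sp V) ==> w \<in> carr (sp W) ==> F (pure RT A (rp v w) a) = G (pure RT A (rp v w) a)" and t: "t \<in> carr (RT \<otimes> alg H)"
 shows "F t = G t"
proof (rule lin_tens_eq[OF vspace_rtens F G t])
 fix x a assume x: "x \<in> carr RT"
 show "F (pure RT A x a) = G (pure RT A x a)"
  by (rule rtens_eq[OF Z lin_comp[OF F] lin_comp[OF G] _ x]) (intro lins carr_A | simp add: e)+
qed

section \<open>Duality\<close>

locale dualpair = dfd H V I g f S G R1
 for H :: "('k::field, 'a::ring) wmb" and V :: "('k, 'v::ab_group_add, 'a) comod" and I :: "'i set" and g f S G R1 +
 fixes lamS rhoS assumes ds: "dual_structure H S V lamS rhoS"
begin
abbreviation "W \<equiv> \<lparr>sp = dual (sp V), lam = lamS, rho = rhoS\<rparr>"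
abbreviation "fe \<equiv> (\<lambda>i \<phi>. \<phi> (g i))"
end
sublocale dualpair \<subseteq> W: fdc H W I fd fe by (rule dual_fdc[OF ds])
sublocale dualpair \<subseteq> VW: fdc2 H V W I g f I fd fe by unfold_locales
sublocale dualpair \<subseteq> WV: fdc2 H W V I fd fe I g f by unfold_locales

context dualpair begin
lemma Wmc: assumes p: "\<phi> \<in> carr D" shows "W.mc (fe k) \<phi> = Sb (mc \<phi> (g k))"
proof (rule MM_eq)
 have l: "lin X A (\<lambda>v. Sb (mc \<phi> v) \<rhd> b)" for b by (intro lins dual_lin[OF p])
 fix b
 have "W.mc (fe k) \<phi> \<rhd> b = W.sl (fe k) (\<Sum>j\<in>I. pure D A (fd j) (Sb (mc \<phi> (g j)) \<rhd> b))"
  using ds p by (simp add: W.mc_s dual_structure_iff)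
 also have "\<dots> = (\<Sum>j\<in>I. asc H (f j (g k)) (Sb (mc \<phi> (g j)) \<rhd> b))"
 proof -
  have l': "lin (D \<otimes> alg H) A (\<lambda>t. W.sl (fe k) t)" using W.lin_slI[OF W.fl lin_id, of k] by simp
  have "W.sl (fe k) (pure D A (fd j) y) = asc H (f j (g k)) y" for j y using W.sl_pure2[OF W.fl, of "fd j" k y] by (simp add: fd_v)
  then show ?thesis by (subst lin_sum[OF vspace_tprod l']) (simp_all add: pure_carr)
 qed
 also have "\<dots> = Sb (mc \<phi> (g k)) \<rhd> b" using exp_lin[OF l[of b] gc[of k]] by simp
 finally show "W.mc (fe k) \<phi> \<rhd> b = Sb (mc \<phi> (g k)) \<rhd> b" .
qed (simp_all add: p dual_lin, use W.mc_MM[OF W.fl] p in simp)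
lemma D_act: assumes p: "\<phi> \<in> carr D" and r: "r \<in> carr R" shows "ract H W \<phi> r \<in> carr D" "lact H W r \<phi> \<in> carr D"
 using W.act_carr[of \<phi> r] p r by simp_all
lemma Sb_act: assumes p: "\<phi> \<in> carr D" and r: "r \<in> carr R"
 shows "Sb (mc (ract H W \<phi> r) (g k)) = Sb (mc \<phi> (g k)) \<star> r" "Sb (mc (lact H W r \<phi>) (g k)) = r \<star> Sb (mc \<phi> (g k))"
 using W.mc_act[OF W.fl, of \<phi> r k] p r by (simp_all add: Wmc D_act)
text \<open>The action on the dual is defined by the counit of \<open>Sb (mc \<phi> v) c\<close>; \<open>eps_Sb\<close> converts it into \<open>\<epsilon>(c' mc \<phi> v)\<close>.\<close>
lemma W_ract: assumes p: "\<phi> \<in> carr D" and r: "r \<in> carr R" and v: "v \<in> carr X" shows "ract H W \<phi> r v = \<phi> (lact H V r v)"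
proof -
 obtain c where c: "r = Rb c" by (rule R_E(1)[OF r])
 have p': "lin X scalars \<phi>" by (rule dual_lin[OF p])
 have l: "lin X scalars (\<lambda>v. eps H (Sb (mc \<phi> v) \<rhd> c))" by (intro lins p')
 obtain c' where c': "Rr c' = Rb c" "\<And>m. m \<in> MM ==> eps H (Sb m \<rhd> c) = eps H (c' \<lhd> m)" using eps_Sb by blast
 have "ract H W \<phi> r = (\<Sum>i\<in>I. fscal (eps H (Sb (mc \<phi> (g i)) \<rhd> c)) (fd i))"
  using W.ract_Rb[of \<phi> c] p by (simp add: c W.actv_def Wmc scal_dual)
 then have "ract H W \<phi> r v = (\<Sum>i\<in>I. eps H (Sb (mc \<phi> (g i)) \<rhd> c) * f i v)" by (simp add: fun_sum_apply fscal_def fd_v v)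
 also have "\<dots> = eps H (Sb (mc \<phi> v) \<rhd> c)" using exp_lin[OF l v] by (simp add: mult.commute)
 also have "\<dots> = \<phi> (lact H V (Rr c') v)" by (simp add: c' phi_ract p' v del: c'(1))
 finally show ?thesis by (simp add: c c'(1))
qed

lemma evm_fd: "evm (fd k) v = evm (f k) v" by (simp add: evm_def mc_fd)
lemma evm_act: assumes p: "\<phi> \<in> carr D" and r: "r \<in> carr R" and v: "v \<in> carr X"
 shows evm_bal: "evm (ract H W \<phi> r) v = evm \<phi> (lact H V r v)" and evm_r: "evm \<phi> (ract H V v r) = evm \<phi> v \<star> r" and evm_lact: "evm (lact H W r \<phi>) v = r \<star> evm \<phi> v"
proof -
 have p': "lin X scalars \<phi>" "lin X scalars (ract H W \<phi> r)" "lin X scalars (lact H W r \<phi>)" using p D_act[OF p r] by (simp_all add: dual_lin)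
 note m = R_MM[OF r]
 show "evm (ract H W \<phi> r) v = evm \<phi> (lact H V r v)" by (simp add: evm_def Sb_act p r v fl mp_assoc)
 show "evm \<phi> (ract H V v r) = evm \<phi> v \<star> r" by (rule MM_eq) (simp_all add: p' v r m, simp add: evm_l fl v r)
 show "evm (lact H W r \<phi>) v = r \<star> evm \<phi> v" by (rule MM_eq) (simp_all add: p' v m, simp add: evm_l Sb_act p r v m ml_sum fl)
qed

definition "ev = rlift H W V R evm"
lemma ev: "lin WV.RT R ev" "\<phi> \<in> carr D ==> v \<in> carr X ==> ev (WV.rp \<phi> v) = evm \<phi> v"
proof -
 have "lin D M (\<lambda>\<phi>. evm \<phi> v)" if v: "v \<in> carr X" for v
  unfolding evm_def using v by (intro lin_sumI vspace_M lin_mp lin_Sb lin_mcphiI lin_id mc_MM fl gc vspace_dual vX)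
 then have b: "rbal H W V R evm" unfolding rbal_def
  by (auto simp: evm_bal dual_lin intro!: bilinI lin_toR lin_evm lin_id)
 show "lin WV.RT R ev" "\<phi> \<in> carr D ==> v \<in> carr X ==> ev (WV.rp \<phi> v) = evm \<phi> v"
  unfolding ev_def by (rule rlift_lin[OF vR b], simp add: rlift_pure[OF vR b])
qed
lemma ev_act: assumes t: "t \<in> carr WV.RT" and r: "r \<in> carr R" shows "ev (ract H WV.P t r) = ev t \<star> r" "ev (lact H WV.P r t) = r \<star> ev t"
proof -
 have c: "ev (ract H WV.P t r) \<in> carr R" "ev (lact H WV.P r t) \<in> carr R" "ev t \<in> carr R" if "t \<in> carr WV.RT" for t
  by (rule lin_carr[OF ev(1)], rule lin_carr[OF WV.lin_P_act(1) that], rule lin_carr[OF ev(1)], rule lin_carr[OF WV.lin_P_act(2) that], rule lin_carr[OF ev(1) that])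
 have l: "lin WV.RT A (\<lambda>t. ev (ract H WV.P t r) \<rhd> x)" "lin WV.RT A (\<lambda>t. ev (lact H WV.P r t) \<rhd> x)" "lin WV.RT A (\<lambda>t. ev t \<rhd> x)" for x
  by (intro lin_Ract lin_comp[OF ev(1)] WV.lin_P_act lin_id)+
 show "ev (ract H WV.P t r) = ev t \<star> r"
 proof (rule MM_eq)
  fix x show "ev (ract H WV.P t r) \<rhd> x = (ev t \<star> r) \<rhd> x" unfolding mp_s
   by (rule rtens_eq[OF vspace_A l(1) l(3) _ t]) (simp add: WV.P_act r ev evm_r)
 qed (simp_all add: c t r R_MM)
 show "ev (lact H WV.P r t) = r \<star> ev t"
 proof (rule MM_eq)
  fix x show "ev (lact H WV.P r t) \<rhd> x = (r \<star> ev t) \<rhd> x" unfolding mp_s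
   by (rule rtens_eq[OF vspace_A l(2) lin_ml[OF l(3) R_MM[OF r]] _ t]) (simp add: WV.P_act r ev evm_lact D_act)
 qed (simp_all add: c t r R_MM)
qed
text \<open>\<open>E1_evm\<close> says that the image of the product coaction represents \<open>E(1 \<otimes> evm \<phi> v a)\<close>, and such a representing element of
\<open>R \<otimes> A\<close> is unique.\<close>
lemma ev_mor: "comod_mor H WV.P U ev"
proof -
 let ?f = "tmap WV.RT A R A ev id"
 have lf: "lin (WV.RT \<otimes> alg H) (R \<otimes> alg H) ?f" by (rule lin_tmap[OF ev(1) lin_idc])
 have "lam U (?f t) = ?f (lam WV.P t)" if t: "t \<in> carr (WV.RT \<otimes> alg H)" for t
 proof (rule WV.RTA_eq[OF vspace_tprod lin_comp[OF lam_U(1) lf] lin_comp[OF lf WV.lin_P(1)] _ t])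
  fix \<phi> v a assume "\<phi> \<in> carr (sp W)" and v: "v \<in> carr X"
  then have p: "\<phi> \<in> carr D" by simp
  let ?y = "\<lambda>k. Sb (mc \<phi> (g (fst k))) \<rhd> (mc (f (snd k)) v \<rhd> a)" and ?r = "\<lambda>k. evm (f (fst k)) (g (snd k))"
  have "?f (lam WV.P (pure WV.RT A (WV.rp \<phi> v) a)) = (\<Sum>k\<in>I \<times> I. pure R A (?r k) (?y k))"
   using WV.lam_P[of "(\<phi>, v)" a] p v
   by (simp add: WV.pt_def WV.PL_def WV.gk_def WV.cf_def Wmc lin_sum[OF vspace_tprod lf] pure_carr tmap_pure[OF ev(1) lin_idc] ev evm_fd)
  also have "\<dots> = rE (evm \<phi> v \<rhd> a)"
  proof (rule rE_eqI[symmetric])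
   have "lt (\<Sum>k\<in>I \<times> I. pure R A (?r k) (?y k)) x = e1 x (evm \<phi> v \<rhd> a)" for x
    by (subst tsum_sumpure[OF vR vspace_tprod bil_RA(3)]) (simp_all add: fl E1_evm dual_lin p v sum.cartesian_product split_def)
   then show "repE (evm \<phi> v \<rhd> a) (\<Sum>k\<in>I \<times> I. pure R A (?r k) (?y k))"
    unfolding repE_def by (auto intro!: vspace_sum vspace_tprod pure_carr simp: fl)
  qed
  also have "\<dots> = lam U (?f (pure WV.RT A (WV.rp \<phi> v) a))"
   using p v by (simp add: tmap_pure[OF ev(1) lin_idc] ev lam_U dual_lin)
  finally show "lam U (?f (pure WV.RT A (WV.rp \<phi> v) a)) = ?f (lam WV.P (pure WV.RT A (WV.rp \<phi> v) a))" ..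
 qed
 then show ?thesis by (simp add: comod_mor_def Let_def ev(1))
qed

definition "coev r = (\<Sum>k\<in>I. VW.rp (g k) (ract H W (fd k) r))"
lemma lin_coev: "lin R VW.RT coev"
proof -
 have "lin R (sp W) (\<lambda>r. ract H W (fd k) r)" for k by (rule W.lin_act2(1)[OF lin_id _ vR]) simp
 then show ?thesis unfolding coev_def by (intro lin_sumI vspace_rtens lin_rpure(2) gc)
qed
text \<open>Moving \<open>R\<close> to the other factor of the canonical element, as for a transposed map.\<close>
lemma coev_alt: assumes r: "r \<in> carr R" shows "coev r = (\<Sum>i\<in>I. VW.rp (lact H V r (g i)) (fd i))"
proof -
 have rp1: "VW.rp x (\<Sum>i\<in>I. fscal (c i) (fd i)) = (\<Sum>i\<in>I. fscal (c i) (VW.rp x (fd i)))" if "x \<in> carr X" for x c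
 proof -
  have l: "lin D VW.RT (\<lambda>y. VW.rp x y)" using lin_rpure(2)[OF lin_id that, of W] by simp
  show ?thesis using lin_sum[OF vspace_dual[OF vX] l, of I "\<lambda>i. fscal (c i) (fd i)"] vspace_scal[OF vspace_dual[OF vX] fd_c] lin_scal[OF l fd_c]
   by (simp add: scal_dual scal_rtens)
 qed
 have fdr: "ract H W (fd k) r = (\<Sum>i\<in>I. fscal (f k (lact H V r (g i))) (fd i))" for k
  using frame.exp[OF dual_frame D_act(1)[OF fd_c r], of k] by (simp add: scal_dual W_ract r fd_v)
 have "coev r = (\<Sum>k\<in>I. \<Sum>i\<in>I. fscal (f k (lact H V r (g i))) (VW.rp (g k) (fd i)))"
  by (simp add: coev_def fdr rp1)
 also have "\<dots> = (\<Sum>i\<in>I. \<Sum>k\<in>I. fscal (f k (lact H V r (g i))) (VW.rp (g k) (fd i)))" by (rule sum.swap)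
 also have "\<dots> = (\<Sum>i\<in>I. VW.rp (lact H V r (g i)) (fd i))"
 proof (rule sum.cong[OF refl])
  fix i
  have l: "lin X VW.RT (\<lambda>y. VW.rp y (fd i))" using lin_rpure(1)[OF lin_id, of "fd i" W V] by simp
  show "(\<Sum>k\<in>I. fscal (f k (lact H V r (g i))) (VW.rp (g k) (fd i))) = VW.rp (lact H V r (g i)) (fd i)"
   using exp_lin[OF l, of "lact H V r (g i)"] r by (simp add: scal_rtens)
 qed
 finally show ?thesis .
qed
lemma coev_act: assumes r: "r \<in> carr R" and s: "s \<in> carr R" shows "coev (s \<star> r) = ract H VW.P (coev s) r" "coev (s \<star> r) = lact H VW.P s (coev r)"
proof -
 have "ract H VW.P (coev s) r = (\<Sum>k\<in>I. ract H VW.P (VW.rp (g k) (ract H W (fd k) s)) r)"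
  unfolding coev_def by (rule lin_sum[OF vspace_rtens VW.lin_P_act(1)]) (simp add: D_act s)
 then show "coev (s \<star> r) = ract H VW.P (coev s) r"
  using W.act_act(1)[OF _ s r] by (simp add: VW.P_act D_act r s coev_def)
 have "lact H VW.P s (coev r) = (\<Sum>k\<in>I. lact H VW.P s (VW.rp (lact H V r (g k)) (fd k)))"
  unfolding coev_alt[OF r] by (rule lin_sum[OF vspace_rtens VW.lin_P_act(2)]) (simp add: r)
 then show "coev (s \<star> r) = lact H VW.P s (coev r)"
  by (simp add: VW.P_act r s coev_alt act_act)
qed
text \<open>The coaction on \<open>coev r\<close> has coefficients \<open>Nm (f j) (g i)\<close>, and \<open>Nm_E\<close> rewrites them by \<open>E\<close>.\<close>
lemma coev_mor: "comod_mor H U VW.P coev"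
proof -
 let ?f = "tmap R A VW.RT A coev id"
 have lf: "lin (R \<otimes> alg H) (VW.RT \<otimes> alg H) ?f" by (rule lin_tmap[OF lin_coev lin_idc])
 let ?p = "\<lambda>l. VW.rp (g (fst l)) (fd (snd l))"
 have pc: "?p l \<in> carr VW.RT" for l by simp
 have Nb: "bilin R A A (\<lambda>r z. asc H (f i (lact H V r (g j))) z)" for i j by (intro lins lin_f gc vR)
 have key: "?f t = (\<Sum>l\<in>I \<times> I. pure VW.RT A (?p l) (tsum R A t (\<lambda>r z. asc H (f (fst l) (lact H V r (g (snd l)))) z)))" if t: "t \<in> carr (R \<otimes> alg H)" for t
 proof (rule lin_tens_eq[OF vR lf _ t])
  show "lin (R \<otimes> alg H) (VW.RT \<otimes> alg H) (\<lambda>t. \<Sum>l\<in>I \<times> I. pure VW.RT A (?p l) (tsum R A t (\<lambda>r z. asc H (f (fst l) (lact H V r (g (snd l)))) z)))"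
   by (intro lin_sumI vspace_tprod lin_pure2 pc lin_tsum_op[OF vR vspace_A Nb])
  fix s and z :: 'a assume s: "s \<in> carr R"
  have l1: "lin VW.RT (VW.RT \<otimes> alg H) (\<lambda>x. pure VW.RT A x z)" by (intro lins carr_A)
  have ls: "pure VW.RT A x (asc H c z) = scal (VW.RT \<otimes> alg H) c (pure VW.RT A x z)" if "x \<in> carr VW.RT" for x c
   using lin_scal[OF lin_pure2[OF lin_id that, of A], of z c] by simp
  have "(\<Sum>l\<in>I \<times> I. pure VW.RT A (?p l) (tsum R A (pure R A s z) (\<lambda>r z. asc H (f (fst l) (lact H V r (g (snd l)))) z)))
    = (\<Sum>l\<in>I \<times> I. pure VW.RT A (?p l) (asc H (f (fst l) (lact H V s (g (snd l)))) z))"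
   by (simp only: tsum_pure[OF vR vspace_A Nb s carr_A])
  also have "\<dots> = (\<Sum>l\<in>I \<times> I. scal (VW.RT \<otimes> alg H) (f (fst l) (lact H V s (g (snd l)))) (pure VW.RT A (?p l) z))"
   by (simp only: ls[OF pc])
  also have "\<dots> = (\<Sum>k\<in>I. \<Sum>i\<in>I. scal (VW.RT \<otimes> alg H) (f k (lact H V s (g i))) (pure VW.RT A (VW.rp (g k) (fd i)) z))"
   by (simp add: sum.cartesian_product split_def)
  also have "\<dots> = (\<Sum>i\<in>I. \<Sum>k\<in>I. scal (VW.RT \<otimes> alg H) (f k (lact H V s (g i))) (pure VW.RT A (VW.rp (g k) (fd i)) z))" by (rule sum.swap)
  also have "\<dots> = (\<Sum>i\<in>I. pure VW.RT A (VW.rp (lact H V s (g i)) (fd i)) z)"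
  proof (rule sum.cong[OF refl])
   fix i
   have "lin X VW.RT (\<lambda>y. VW.rp y (fd i))" using lin_rpure(1)[OF lin_id, of "fd i" W V] by simp
   then have l: "lin X (VW.RT \<otimes> alg H) (\<lambda>y. pure VW.RT A (VW.rp y (fd i)) z)" by (rule lin_comp[OF l1])
   show "(\<Sum>k\<in>I. scal (VW.RT \<otimes> alg H) (f k (lact H V s (g i))) (pure VW.RT A (VW.rp (g k) (fd i)) z)) = pure VW.RT A (VW.rp (lact H V s (g i)) (fd i)) z"
    using exp_lin[OF l, of "lact H V s (g i)"] s by simp
  qed
  also have "\<dots> = pure VW.RT A (coev s) z"
   unfolding coev_alt[OF s] by (rule lin_sum[OF vspace_rtens l1, symmetric]) (simp add: s)
  also have "\<dots> = ?f (pure R A s z)" by (simp add: tmap_pure[OF lin_coev lin_idc] s)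
  finally show "?f (pure R A s z) = (\<Sum>l\<in>I \<times> I. pure VW.RT A (?p l) (tsum R A (pure R A s z) (\<lambda>r z. asc H (f (fst l) (lact H V r (g (snd l)))) z)))" ..
 qed
 have "lam VW.P (?f t) = ?f (lam U t)" if t: "t \<in> carr (R \<otimes> alg H)" for t
 proof (rule lin_tens_eq[OF vR lin_comp[OF VW.lin_P(1) lf] lin_comp[OF lf lam_U(1)] t])
  fix r and a :: 'a assume r: "r \<in> carr R"
  have q: "(g k, ract H W (fd k) r) \<in> VW.Q" for k by (simp add: D_act r)
  have cf: "VW.cf l (g k, ract H W (fd k) r) = mc (f (fst l)) (g k) \<star> Sb (mc (f k) (g (snd l))) \<star> r" for l k
   by (simp add: VW.cf_def Wmc D_act r Sb_act mc_fd mp_assoc)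
  have l1: "lin VW.RT (VW.RT \<otimes> alg H) (\<lambda>x. pure VW.RT A x a)" by (intro lins carr_A)
  have "lam VW.P (?f (pure R A r a)) = lam VW.P (pure VW.RT A (\<Sum>k\<in>I. VW.pt (g k, ract H W (fd k) r)) a)"
   by (simp add: tmap_pure[OF lin_coev lin_idc] r coev_def VW.pt_def)
  also have "\<dots> = (\<Sum>k\<in>I. VW.PL (g k, ract H W (fd k) r) a)"
   by (subst lin_sum[OF vspace_rtens lin_comp[OF VW.lin_P(1) l1]]) (simp_all only: VW.pt_c[OF q] VW.lam_P[OF q])
  also have "\<dots> = (\<Sum>k\<in>I. \<Sum>l\<in>I \<times> I. pure VW.RT A (?p l) (mc (f (fst l)) (g k) \<rhd> (Sb (mc (f k) (g (snd l))) \<rhd> (r \<rhd> a))))"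
   by (simp add: VW.PL_def cf VW.pt_def VW.gk_def)
  also have "\<dots> = (\<Sum>l\<in>I \<times> I. \<Sum>k\<in>I. pure VW.RT A (?p l) (mc (f (fst l)) (g k) \<rhd> (Sb (mc (f k) (g (snd l))) \<rhd> (r \<rhd> a))))" by (rule sum.swap)
  also have "\<dots> = (\<Sum>l\<in>I \<times> I. pure VW.RT A (?p l) (Nm (f (fst l)) (g (snd l)) \<rhd> (r \<rhd> a)))"
  proof (rule sum.cong[OF refl])
   fix l
   have l2: "lin A (VW.RT \<otimes> alg H) (\<lambda>x. pure VW.RT A (?p l) x)" by (rule lin_pure2[OF lin_id pc])
   show "(\<Sum>k\<in>I. pure VW.RT A (?p l) (mc (f (fst l)) (g k) \<rhd> (Sb (mc (f k) (g (snd l))) \<rhd> (r \<rhd> a)))) = pure VW.RT A (?p l) (Nm (f (fst l)) (g (snd l)) \<rhd> (r \<rhd> a))"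
    unfolding Nm_l by (rule lin_sum[OF vspace_A l2, symmetric]) simp
  qed
  also have "\<dots> = ?f (rE (r \<rhd> a))" by (simp only: key[OF rE_c(1)] Nm_E[OF fl gc rE])
  also have "\<dots> = ?f (lam U (pure R A r a))" by (simp add: lam_U r)
  finally show "lam VW.P (?f (pure R A r a)) = ?f (lam U (pure R A r a))" .
 qed
 then show ?thesis by (simp add: comod_mor_def Let_def lin_coev)
qed

text \<open>By balancedness the composite sends \<open>r \<otimes> v\<close> to \<open>\<Sum>k. g k evm (f k) (r v)\<close>; its coefficients are those of \<open>r v\<close> by
\<open>triangle_mc\<close>.\<close>
lemma triangle1: assumes t: "t \<in> carr (rtens H U V)"
 shows "runitor H V (rmap H V WV.P V U id ev (rassoc H V W V (rmap H U V VW.P V coev id t))) = lunitor H V t"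
proof -
 have m1: "lin (rtens H U V) (rtens H VW.P V) (rmap H U V VW.P V coev id)"
  "r \<in> carr R ==> v \<in> carr X ==> rmap H U V VW.P V coev id (rpure H U V r v) = rpure H VW.P V (coev r) v" for r v
  using rmap_exists[of U VW.P coev V V id] by (simp_all add: lin_coev lin_idc coev_act(1))
 have m2: "lin (rtens H V WV.P) (rtens H V U) (rmap H V WV.P V U id ev)"
  "v \<in> carr X ==> u \<in> carr WV.RT ==> rmap H V WV.P V U id ev (rpure H V WV.P v u) = rpure H V U v (ev u)" for v u
  using rmap_exists[of V V id WV.P U ev] by (simp_all add: ev(1) lin_idc ev_act lin_carr[OF ev(1)])
 note as = rassoc_exists[of V V W]
 have a: "lin (rtens H VW.P V) (rtens H V WV.P) (rassoc H V W V)"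
  "u \<in> carr X ==> \<phi> \<in> carr D ==> w \<in> carr X ==> rassoc H V W V (rpure H VW.P V (VW.rp u \<phi>) w) = rpure H V WV.P u (WV.rp \<phi> w)" for u \<phi> w
  using rassoc_exists(1,2)[of V V W] by (simp_all add: VW.lin_P_act WV.lin_P_act VW.P_act WV.P_act D_act)
 show ?thesis
 proof (rule rtens_eq[OF vX lin_comp[OF runitor_lin lin_comp[OF m2(1) lin_comp[OF a(1) m1(1)]]] lunitor_lin _ t])
  fix r v assume "r \<in> carr (sp U)" and v: "v \<in> carr X"
  then have r: "r \<in> carr R" by simp
  have l: "lin VW.RT (rtens H VW.P V) (\<lambda>x. rpure H VW.P V x v)" using lin_rpure(1)[OF lin_id, of v V VW.P] v by simp
  have lF: "lin VW.RT X (\<lambda>x. runitor H V (rmap H V WV.P V U id ev (rassoc H V W V (rpure H VW.P V x v))))"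
   by (rule lin_comp[OF runitor_lin lin_comp[OF m2(1) lin_comp[OF a(1) l]]])
  have "runitor H V (rmap H V WV.P V U id ev (rassoc H V W V (rmap H U V VW.P V coev id (rpure H U V r v))))
   = (\<Sum>k\<in>I. runitor H V (rmap H V WV.P V U id ev (rassoc H V W V (rpure H VW.P V (VW.rp (g k) (ract H W (fd k) r)) v))))"
   unfolding m1(2)[OF r v] coev_def by (rule lin_sum[OF vspace_rtens lF]) (simp add: D_act r)
  also have "\<dots> = (\<Sum>k\<in>I. ract H V (g k) (evm (fd k) (lact H V r v)))"
   by (simp add: a(2) m2(2) D_act r v ev runitor_pure evm_bal dual_lin)
  also have "\<dots> = lact H V r v"
  proof (rule mc_inj)
   have c: "evm (fd k) (lact H V r v) \<in> carr R" for k by (simp add: evm_fd fl v r)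
   show "(\<Sum>k\<in>I. ract H V (g k) (evm (fd k) (lact H V r v))) \<in> carr X" by (intro vspace_sum vX act_carr gc c)
   show "lact H V r v \<in> carr X" by (simp add: v r)
   fix i b
   have l: "lin X A (\<lambda>v. mc (f i) v \<rhd> b)" by (intro lins fl)
   show "mc (f i) (\<Sum>k\<in>I. ract H V (g k) (evm (fd k) (lact H V r v))) \<rhd> b = mc (f i) (lact H V r v) \<rhd> b"
    by (simp add: lin_sum[OF vX l] c fl del: mc_act(2)) (simp only: evm_fd triangle_mc[OF fl act_carr(2)[OF v r]])
  qed
  finally show "runitor H V (rmap H V WV.P V U id ev (rassoc H V W V (rmap H U V VW.P V coev id (rpure H U V r v)))) = lunitor H V (rpure H U V r v)"
   by (simp add: lunitor_pure r v)
 qed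
qed

text \<open>The same on the dual, with \<open>triangle_Sb\<close>.\<close>
lemma triangle2: assumes t: "t \<in> carr (rtens H W U)"
 shows "lunitor H W (rmap H WV.P W U W ev id (rassoc_inv H W V W (rmap H W U W VW.P id coev t))) = runitor H W t"
proof -
 have m1: "lin (rtens H W U) (rtens H W VW.P) (rmap H W U W VW.P id coev)"
  "r \<in> carr R ==> v \<in> carr D ==> rmap H W U W VW.P id coev (rpure H W U v r) = rpure H W VW.P v (coev r)" for r v
  using rmap_exists[of W W id U VW.P coev] by (simp_all add: lin_coev lin_idc coev_act(2))
 have m2: "lin (rtens H WV.P W) (rtens H U W) (rmap H WV.P W U W ev id)"
  "v \<in> carr D ==> u \<in> carr WV.RT ==> rmap H WV.P W U W ev id (rpure H WV.P W u v) = rpure H U W (ev u) v" for v u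
  using rmap_exists[of WV.P U ev W W id] by (simp_all add: ev(1) lin_idc ev_act lin_carr[OF ev(1)])
 have a: "lin (rtens H W VW.P) (rtens H WV.P W) (rassoc_inv H W V W)"
  "u \<in> carr D ==> v \<in> carr X ==> w \<in> carr D ==> rassoc_inv H W V W (rpure H W VW.P u (VW.rp v w)) = rpure H WV.P W (WV.rp u v) w" for u v w
  using rassoc_exists(3,4)[of W W V] by (simp_all add: VW.lin_P_act WV.lin_P_act VW.P_act WV.P_act D_act)
 show ?thesis
 proof (rule rtens_eq[OF W.vX lin_comp[OF W.lunitor_lin lin_comp[OF m2(1) lin_comp[OF a(1) m1(1)]]] W.runitor_lin _ t])
  fix \<phi> r assume "r \<in> carr (sp U)" and "\<phi> \<in> carr (sp W)"
  then have r: "r \<in> carr R" and p: "\<phi> \<in> carr D" by simp_all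
  have p': "lin X scalars \<phi>" by (rule dual_lin[OF p])
  have l: "lin VW.RT (rtens H W VW.P) (\<lambda>x. rpure H W VW.P \<phi> x)" using lin_rpure(2)[OF lin_id, of \<phi> W VW.P] p by simp
  have lF: "lin VW.RT (sp W) (\<lambda>x. lunitor H W (rmap H WV.P W U W ev id (rassoc_inv H W V W (rpure H W VW.P \<phi> x))))"
   by (rule lin_comp[OF W.lunitor_lin lin_comp[OF m2(1) lin_comp[OF a(1) l]]])
  have "lunitor H W (rmap H WV.P W U W ev id (rassoc_inv H W V W (rmap H W U W VW.P id coev (rpure H W U \<phi> r))))
   = (\<Sum>k\<in>I. lunitor H W (rmap H WV.P W U W ev id (rassoc_inv H W V W (rpure H W VW.P \<phi> (VW.rp (g k) (ract H W (fd k) r))))))"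
   unfolding m1(2)[OF r p] coev_def by (rule lin_sum[OF vspace_rtens lF]) (simp add: D_act r)
  also have "\<dots> = (\<Sum>k\<in>I. lact H W (evm \<phi> (g k)) (ract H W (fd k) r))"
   using W.lunitor_pure by (simp add: a(2) m2(2) D_act r p ev p')
  also have "\<dots> = ract H W \<phi> r"
  proof (rule W.mc_inj)
   have c: "lact H W (evm \<phi> (g k)) (ract H W (fd k) r) \<in> carr D" for k by (simp add: D_act r p')
   show "(\<Sum>k\<in>I. lact H W (evm \<phi> (g k)) (ract H W (fd k) r)) \<in> carr (sp W)" using c by (intro vspace_sum W.vX) simp
   show "ract H W \<phi> r \<in> carr (sp W)" by (simp add: D_act r p)
   fix j b
   have l: "lin D A (\<lambda>\<phi>. W.mc (fe j) \<phi> \<rhd> b)" using lin_Mact(1)[OF W.lin_mc[OF W.fl lin_id], of j b] by simp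
   show "W.mc (fe j) (\<Sum>k\<in>I. lact H W (evm \<phi> (g k)) (ract H W (fd k) r)) \<rhd> b = W.mc (fe j) (ract H W \<phi> r) \<rhd> b"
    by (simp add: lin_sum[OF vspace_dual[OF vX] l] c Wmc D_act r p p' Sb_act mc_fd triangle_Sb)
  qed
  finally show "lunitor H W (rmap H WV.P W U W ev id (rassoc_inv H W V W (rmap H W U W VW.P id coev (rpure H W U \<phi> r)))) = runitor H W (rpure H W U \<phi> r)"
   using W.runitor_pure[OF r, of \<phi>] p by simp
 qed
qed

lemma dual_is_dual: "is_dual H V W"
 unfolding is_dual_def Let_def using ev_mor coev_mor triangle1 triangle2 by blast
end

theorem theorem6p7:
  fixes H :: "('k::field, 'a::ring) wmb"
    and S :: "'a \<Rightarrow> 'a mult"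
    and V :: "('k, 'v::ab_group_add, 'a) comod"
  assumes "regular_wmb H"
    and "left_full H" and "right_full H"
    and "antipode H S"
    and "full_comodule H V"
    and "finite_dim (sp V)"
  shows "(\<exists>lamS rhoS. dual_structure H S V lamS rhoS) \<and>
    (\<forall>lamS rhoS. dual_structure H S V lamS rhoS \<longrightarrow>
       full_comodule H \<lparr>sp = dual (sp V), lam = lamS, rho = rhoS\<rparr> \<and>
       is_dual H V \<lparr>sp = dual (sp V), lam = lamS, rho = rhoS\<rparr>)"
proof -
 obtain G1 R1 where R1: "is_G1 H G1" "lin (algsq H) (algsq H) R1"
   "\<And>t. t \<in> carr (algsq H) ==> R1 (T1 H t) = G1 t \<and> T1 H (R1 t) = E1 H t \<and> R1 (T1 H (R1 t)) = R1 t"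
   "lin (alg H) (multipliers H) S" "\<And>a b. S a \<rhd> b = eps_left H (R1 (ap H a b))"
  using assms(4) unfolding antipode_def by blast
 have vX: "vspace (sp V)" using assms(5) by (simp add: full_comodule_def comodule_def Let_def)
 obtain I :: "'v set" and g f where fr: "frame (sp V) I g f" using fd_frame[OF vX assms(6)] by blast
 have w: "wmbf H" unfolding wmbf_def wmba_def wmbf_axioms_def using assms by blast
 have d: "dfd H V I g f S G1 R1"
  unfolding dfd_def fdc_def fdc_axioms_def antip_def antip_axioms_def using w fr assms(5) R1[unfolded algsq_def] by blast
 have p: "dualpair H V I g f S G1 R1 lamS rhoS" if "dual_structure H S V lamS rhoS" for lamS rhoS
  unfolding dualpair_def dualpair_axioms_def using d that by blast
 show ?thesis using dfd.dual_structure_exists[OF d] dfd.dual_full[OF d] dualpair.dual_is_dual[OF p] by blast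
qed

end
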